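(* Let $\mathbf{k}$ be a commutative ring, let $\mathcal{A}$ be a base category over $\mathbf{k}$, and let $\mathcal{C}$ be a stratified linear category over $\mathcal{A}$. Then the following conditions (1) and (2) are equivalent. (1) $\mathcal{C}$ is perfect. (2) The pair $(\mathcal{C}^+,\mathcal{C}^-)$ gives a Morita equivalence between $\mathcal{A}$ and $\mathcal{C}$, i.e. $\mathcal{C}^+\otimes_{\mathcal{A}}\mathcal{C}^-\cong\mathcal{C}$ as $\mathcal{C}$-bimodules and $\mathcal{C}^-\otimes_{\mathcal{C}}\mathcal{C}^+\cong\mathcal{A}$ as $\mathcal{A}$-bimodules. If, moreover, $\mathcal{C}=(\mathcal{C},b',d')$ is a quasi-cellular category over $\mathcal{A}$, then (1) and (2) imply: (3) The functor $L:\mathcal{C}\to\mathcal{C}_{b'}$ is an isomorphism of linear categories. If, in addition, the quasi-cellular category $(\mathcal{C},b',d')$ admits an action, then (3) is equivalent to (1) and (2).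
   Context: All categories and functors are $\mathbf{k}$-linear. **Base category.** A base category is a linear category $\mathcal{A}$ whose object set carries a partial order $\le$ satisfying the descending chain condition, with $\mathcal{A}(x,y)=0$ for $x\ne y$. Put $\mathcal{A}_x=\mathcal{A}(x,x)$. An $\mathcal{A}$-bimodule $M$ is a family of $(\mathcal{A}_y,\mathcal{A}_x)$-bimodules $M(x,y)$, $x,y\in\mathrm{Ob}(\mathcal{A})$; morphisms are families of bimodule maps. The category $\mathcal{A}\text{-bim}$ is monoidal with $(M\otimes_{\mathcal{A}}N)(x,y)=\bigoplus_z M(z,y)\otimes_{\mathcal{A}_z}N(x,z)$ and unit $\mathcal{A}$; it is treated as strict. **Stratified linear category over $\mathcal{A}$.** A linear category $\mathcal{C}$ with $\mathrm{Ob}(\mathcal{C})=\mathrm{Ob}(\mathcal{A})$, a linear functor $i:\mathcal{A}\to\mathcal{C}$ that is the identity on objects, and wide linear subcategories $\mathcal{C}^+,\mathcal{C}^-$ such that: $\mathcal{C}^+(x,y)=0$ unless $x\le y$ and $\mathcal{C}^-(x,y)=0$ unless $x\ge y$; $\mathcal{C}^+(x,x)=\mathcal{C}^-(x,x)$ for all $x$; $i$ maps $\mathcal{A}_x$ isomorphically onto $\mathcal{C}^{\pm}(x,x)$ (and we identify them); and for all $x,z$ composition induces an isomorphism $\bigoplus_y\mathcal{C}^+(y,z)\otimes_{\mathcal{A}_y}\mathcal{C}^-(x,y)\to\mathcal{C}(x,z)$. Thus we identify $\mathcal{C}=\mathcal{C}^+\otimes_{\mathcal{A}}\mathcal{C}^-$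 as $\mathcal{A}$-bimodules. Write $\mu^\pm:\mathcal{C}^\pm\otimes_{\mathcal{A}}\mathcal{C}^\pm\to\mathcal{C}^\pm$ for composition, $\eta^\pm:\mathcal{A}\to\mathcal{C}^\pm$ for the inclusions, and $\varepsilon^\pm:\mathcal{C}^\pm\to\mathcal{A}$ for the maps that are the identity on $\mathcal{C}^\pm(x,x)=\mathcal{A}_x$ and $0$ on $\mathcal{C}^\pm(x,y)$, $x\neq y$. **Perfectness.** The twist $\tau:\mathcal{C}^-\otimes_{\mathcal{A}}\mathcal{C}^+\to\mathcal{C}^+\otimes_{\mathcal{A}}\mathcal{C}^-$ sends $g\otimes f$ to the element corresponding to the composite $gf\in\mathcal{C}$. The pairing is $b=(\varepsilon^+\otimes\varepsilon^-)\tau:\mathcal{C}^-\otimes_{\mathcal{A}}\mathcal{C}^+\to\mathcal{A}$. A pairing $\beta:\mathcal{C}^-\otimes_{\mathcal{A}}\mathcal{C}^+\to\mathcal{A}$ in $\mathcal{A}\text{-bim}$ is perfect if there is a (necessarily unique) copairing $\gamma:\mathcal{A}\to\mathcal{C}^+\otimes_{\mathcal{A}}\mathcal{C}^-$ in $\mathcal{A}\text{-bim}$ with $(\beta\otimes\mathrm{id}_{\mathcal{C}^-})(\mathrm{id}_{\mathcal{C}^-}\otimes\gamma)=\mathrm{id}_{\mathcal{C}^-}$ and $(\mathrm{id}_{\mathcal{C}^+}\otimes\beta)(\gamma\otimes\mathrm{id}_{\mathcal{C}^+})=\mathrm{id}_{\mathcal{C}^+}$. $\mathcal{C}$ is perfect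 if $b$ is perfect. **Module structures in (2).** $\mathcal{C}^+$ is a left $\mathcal{C}$-module: $g\in\mathcal{C}(y,z)$ acts on $f\in\mathcal{C}^+(x,y)$ by $(\mathrm{id}_{\mathcal{C}^+}\otimes\varepsilon^-)(gf)\in\mathcal{C}^+(x,z)$. $\mathcal{C}^-$ is a right $\mathcal{C}$-module: $f\in\mathcal{C}^-(y,z)$ acted on by $g\in\mathcal{C}(x,y)$ is $(\varepsilon^+\otimes\mathrm{id}_{\mathcal{C}^-})(fg)\in\mathcal{C}^-(x,z)$. These make $\mathcal{C}^+\otimes_{\mathcal{A}}\mathcal{C}^-$ a $\mathcal{C}$-bimodule (left action on $\mathcal{C}^+$, right action on $\mathcal{C}^-$), to be compared with the regular bimodule $\mathcal{C}$; $\mathcal{C}^-\otimes_{\mathcal{C}}\mathcal{C}^+$ is the quotient of $\mathcal{C}^-\otimes_{\mathcal{A}}\mathcal{C}^+$ by the relations $fg\otimes h=f\otimes gh$ for $g$ in $\mathcal{C}$ (using these actions). **Quasi-cellular category over $\mathcal{A}$.** A stratified linear category $\mathcal{C}$ over $\mathcal{A}$ with a perfect pairing $b':\mathcal{C}^-\otimes_{\mathcal{A}}\mathcal{C}^+\to\mathcal{A}$ in $\mathcal{A}\text{-bim}$, with copairing $d'$, satisfying $b'(\eta^-\otimes\mathrm{id}_{\mathcal{C}^+})=\varepsilon^+$ and $b'(\mathrm{id}_{\mathcal{C}^-}\otimes\eta^+)=\varepsilon^-$. The linear category $\mathcal{C}_{b'}$ has the same objects as $\mathcal{C}$, underlying $\mathcal{A}$-bimodule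 of morphisms $\mathcal{C}^+\otimes_{\mathcal{A}}\mathcal{C}^-$, composition $\mathrm{id}_{\mathcal{C}^+}\otimes b'\otimes\mathrm{id}_{\mathcal{C}^-}$, and identities given by $d'$ (the identity of $x$ is $d'(1_x)$). The linear functor $L:\mathcal{C}\to\mathcal{C}_{b'}$ is the identity on objects and on morphisms is $$L=(\mathrm{id}_{\mathcal{C}^+}\otimes\varepsilon^+\otimes\mu^-)(\mathrm{id}_{\mathcal{C}^+}\otimes\tau\otimes\mathrm{id}_{\mathcal{C}^-})(d'\otimes\mathrm{id}_{\mathcal{C}^+}\otimes\mathrm{id}_{\mathcal{C}^-}).$$ **Action.** $(\mathcal{C},b',d')$ admits an action if there is a morphism $\partial:\mathcal{C}^-\otimes_{\mathcal{A}}\mathcal{C}^+\to\mathcal{C}^+$ in $\mathcal{A}\text{-bim}$ with $\partial(\mu^-\otimes\mathrm{id}_{\mathcal{C}^+})=\partial(\mathrm{id}_{\mathcal{C}^-}\otimes\partial)$, $\partial(\eta^-\otimes\mathrm{id}_{\mathcal{C}^+})=\mathrm{id}_{\mathcal{C}^+}$, $\partial(\mathrm{id}_{\mathcal{C}^-}\otimes\eta^+)=\eta^+\varepsilon^-$, and $b'=\varepsilon^+\partial$. *)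

theory Defs
  imports "HOL-Algebra.Free_Abelian_Groups" "HOL-Algebra.Module"
begin

section \<open>Linear categories and linear functors\<close>

definition linear_map ::
  "('k, 'z) ring_scheme \<Rightarrow> ('k, 'm) module \<Rightarrow> ('k, 'n) module \<Rightarrow> ('m \<Rightarrow> 'n) \<Rightarrow> bool" where
  "linear_map K M N f \<longleftrightarrow>
     f \<in> carrier M \<rightarrow> carrier N \<and>
     (\<forall>u\<in>carrier M. \<forall>v\<in>carrier M. f (u \<oplus>\<^bsub>M\<^esub> v) = f u \<oplus>\<^bsub>N\<^esub> f v) \<and>
     (\<forall>c\<in>carrier K. \<forall>u\<in>carrier M. f (c \<odot>\<^bsub>M\<^esub> u) = c \<odot>\<^bsub>N\<^esub> f u)"

text \<open>Morphisms of different hom-modules may share an element of the type \<^typ>\<open>'c\<close>, so composition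
  is indexed by objects: \<open>Comp C x y z g f\<close> is the composite of \<open>f : x \<rightarrow> y\<close> and \<open>g : y \<rightarrow> z\<close>.
  The type \<open>module\<close> extends \<open>ring\<close>; the fields \<open>mult\<close> and \<open>one\<close> of modules are never used.\<close>

record ('o, 'k, 'c) lincat =
  Ob :: "'o set"
  Hom :: "'o \<Rightarrow> 'o \<Rightarrow> ('k, 'c) module"
  Comp :: "'o \<Rightarrow> 'o \<Rightarrow> 'o \<Rightarrow> 'c \<Rightarrow> 'c \<Rightarrow> 'c"
  idn :: "'o \<Rightarrow> 'c"

locale linear_category =
  fixes K :: "('k, 'z) ring_scheme" and C :: "('o, 'k, 'c, 'w) lincat_scheme"
  assumes cring: "cring K"
    and Hom_module: "\<lbrakk>x \<in> Ob C; y \<in> Ob C\<rbrakk> \<Longrightarrow> module K (Hom C x y)"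
    and idn_closed: "x \<in> Ob C \<Longrightarrow> idn C x \<in> carrier (Hom C x x)"
    and Comp_linear_right:
      "\<lbrakk>x \<in> Ob C; y \<in> Ob C; z \<in> Ob C; g \<in> carrier (Hom C y z)\<rbrakk>
        \<Longrightarrow> linear_map K (Hom C x y) (Hom C x z) (\<lambda>f. Comp C x y z g f)"
    and Comp_linear_left:
      "\<lbrakk>x \<in> Ob C; y \<in> Ob C; z \<in> Ob C; f \<in> carrier (Hom C x y)\<rbrakk>
        \<Longrightarrow> linear_map K (Hom C y z) (Hom C x z) (\<lambda>g. Comp C x y z g f)"
    and Comp_assoc:
      "\<lbrakk>w \<in> Ob C; x \<in> Ob C; y \<in> Ob C; z \<in> Ob C;
        f \<in> carrier (Hom C w x); g \<in> carrier (Hom C x y); h \<in> carrier (Hom C y z)\<rbrakk>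
        \<Longrightarrow> Comp C w x z (Comp C x y z h g) f = Comp C w y z h (Comp C w x y g f)"
    and Comp_idn_left:
      "\<lbrakk>x \<in> Ob C; y \<in> Ob C; f \<in> carrier (Hom C x y)\<rbrakk> \<Longrightarrow> Comp C x y y (idn C y) f = f"
    and Comp_idn_right:
      "\<lbrakk>x \<in> Ob C; y \<in> Ob C; f \<in> carrier (Hom C x y)\<rbrakk> \<Longrightarrow> Comp C x x y f (idn C x) = f"

locale linear_functor = source: linear_category K C + target: linear_category K D
  for K :: "('k, 'z) ring_scheme" and C :: "('o, 'k, 'c, 'w) lincat_scheme"
    and D :: "('p, 'k, 'd, 'v) lincat_scheme" +
  fixes Fo :: "'o \<Rightarrow> 'p" and Fm :: "'o \<Rightarrow> 'o \<Rightarrow> 'c \<Rightarrow> 'd"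
  assumes Fo_closed: "x \<in> Ob C \<Longrightarrow> Fo x \<in> Ob D"
    and Fm_linear:
      "\<lbrakk>x \<in> Ob C; y \<in> Ob C\<rbrakk> \<Longrightarrow> linear_map K (Hom C x y) (Hom D (Fo x) (Fo y)) (Fm x y)"
    and Fm_Comp:
      "\<lbrakk>x \<in> Ob C; y \<in> Ob C; z \<in> Ob C; f \<in> carrier (Hom C x y); g \<in> carrier (Hom C y z)\<rbrakk>
        \<Longrightarrow> Fm x z (Comp C x y z g f) = Comp D (Fo x) (Fo y) (Fo z) (Fm y z g) (Fm x y f)"
    and Fm_idn: "x \<in> Ob C \<Longrightarrow> Fm x x (idn C x) = idn D (Fo x)"

definition linear_category_iso ::
  "('k, 'z) ring_scheme \<Rightarrow> ('o, 'k, 'c, 'w) lincat_scheme \<Rightarrow> ('p, 'k, 'd, 'v) lincat_scheme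
    \<Rightarrow> ('o \<Rightarrow> 'p) \<Rightarrow> ('o \<Rightarrow> 'o \<Rightarrow> 'c \<Rightarrow> 'd) \<Rightarrow> bool" where
  "linear_category_iso K C D Fo Fm \<longleftrightarrow>
     linear_functor K C D Fo Fm \<and>
     (\<exists>Go Gm. linear_functor K D C Go Gm \<and>
        (\<forall>x\<in>Ob C. Go (Fo x) = x) \<and> (\<forall>x\<in>Ob D. Fo (Go x) = x) \<and>
        (\<forall>x\<in>Ob C. \<forall>y\<in>Ob C. \<forall>f\<in>carrier (Hom C x y). Gm (Fo x) (Fo y) (Fm x y f) = f) \<and>
        (\<forall>x\<in>Ob D. \<forall>y\<in>Ob D. \<forall>f\<in>carrier (Hom D x y). Fm (Go x) (Go y) (Gm x y f) = f))"

definition wide_linear_subcategory ::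
  "('k, 'z) ring_scheme \<Rightarrow> ('o, 'k, 'c, 'w) lincat_scheme \<Rightarrow> ('o \<Rightarrow> 'o \<Rightarrow> 'c set) \<Rightarrow> bool" where
  "wide_linear_subcategory K C P \<longleftrightarrow>
     (\<forall>x\<in>Ob C. \<forall>y\<in>Ob C. submodule (P x y) K (Hom C x y)) \<and>
     (\<forall>x\<in>Ob C. idn C x \<in> P x x) \<and>
     (\<forall>x\<in>Ob C. \<forall>y\<in>Ob C. \<forall>z\<in>Ob C. \<forall>g\<in>P y z. \<forall>f\<in>P x y. Comp C x y z g f \<in> P x z)"


section \<open>Base categories and their bimodules\<close>

record ('o, 'k, 'a) basecat = "('o, 'k, 'a) lincat" +
  le :: "('o \<times> 'o) set"

locale base_category = linear_category K A
  for K :: "('k, 'z) ring_scheme" and A :: "('o, 'k, 'a) basecat" +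
  assumes le_order: "partial_order_on (Ob A) (le A)"
    and le_dcc: "wf (le A - Id)"
    and Hom_zero: "\<lbrakk>x \<in> Ob A; y \<in> Ob A; x \<noteq> y\<rbrakk> \<Longrightarrow> carrier (Hom A x y) = {\<zero>\<^bsub>Hom A x y\<^esub>}"

text \<open>\<open>lact M x y a m\<close> is defined for \<open>a\<close> in \<open>Hom A y y\<close>, and \<open>ract M x y m a\<close> for \<open>a\<close> in
  \<open>Hom A x x\<close>, where \<open>m\<close> is in \<open>bhom M x y\<close>.\<close>

record ('o, 'k, 'a, 'm) bimod =
  bhom :: "'o \<Rightarrow> 'o \<Rightarrow> ('k, 'm) module"
  lact :: "'o \<Rightarrow> 'o \<Rightarrow> 'a \<Rightarrow> 'm \<Rightarrow> 'm"
  ract :: "'o \<Rightarrow> 'o \<Rightarrow> 'm \<Rightarrow> 'a \<Rightarrow> 'm"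

locale bimodule =
  fixes K :: "('k, 'z) ring_scheme" and A :: "('o, 'k, 'a) basecat"
    and M :: "('o, 'k, 'a, 'm) bimod"
  assumes bhom_module: "\<lbrakk>x \<in> Ob A; y \<in> Ob A\<rbrakk> \<Longrightarrow> module K (bhom M x y)"
    and lact_linear:
      "\<lbrakk>x \<in> Ob A; y \<in> Ob A; a \<in> carrier (Hom A y y)\<rbrakk>
        \<Longrightarrow> linear_map K (bhom M x y) (bhom M x y) (\<lambda>m. lact M x y a m)"
    and lact_linear_scalar:
      "\<lbrakk>x \<in> Ob A; y \<in> Ob A; m \<in> carrier (bhom M x y)\<rbrakk>
        \<Longrightarrow> linear_map K (Hom A y y) (bhom M x y) (\<lambda>a. lact M x y a m)"
    and ract_linear:
      "\<lbrakk>x \<in> Ob A; y \<in> Ob A; a \<in> carrier (Hom A x x)\<rbrakk>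
        \<Longrightarrow> linear_map K (bhom M x y) (bhom M x y) (\<lambda>m. ract M x y m a)"
    and ract_linear_scalar:
      "\<lbrakk>x \<in> Ob A; y \<in> Ob A; m \<in> carrier (bhom M x y)\<rbrakk>
        \<Longrightarrow> linear_map K (Hom A x x) (bhom M x y) (\<lambda>a. ract M x y m a)"
    and lact_idn:
      "\<lbrakk>x \<in> Ob A; y \<in> Ob A; m \<in> carrier (bhom M x y)\<rbrakk> \<Longrightarrow> lact M x y (idn A y) m = m"
    and ract_idn:
      "\<lbrakk>x \<in> Ob A; y \<in> Ob A; m \<in> carrier (bhom M x y)\<rbrakk> \<Longrightarrow> ract M x y m (idn A x) = m"
    and lact_Comp:
      "\<lbrakk>x \<in> Ob A; y \<in> Ob A; m \<in> carrier (bhom M x y);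
        a \<in> carrier (Hom A y y); b \<in> carrier (Hom A y y)\<rbrakk>
        \<Longrightarrow> lact M x y (Comp A y y y a b) m = lact M x y a (lact M x y b m)"
    and ract_Comp:
      "\<lbrakk>x \<in> Ob A; y \<in> Ob A; m \<in> carrier (bhom M x y);
        a \<in> carrier (Hom A x x); b \<in> carrier (Hom A x x)\<rbrakk>
        \<Longrightarrow> ract M x y m (Comp A x x x a b) = ract M x y (ract M x y m a) b"
    and lact_ract:
      "\<lbrakk>x \<in> Ob A; y \<in> Ob A; m \<in> carrier (bhom M x y);
        a \<in> carrier (Hom A y y); b \<in> carrier (Hom A x x)\<rbrakk>
        \<Longrightarrow> ract M x y (lact M x y a m) b = lact M x y a (ract M x y m b)"

definition bimod_morphism ::
  "('k, 'z) ring_scheme \<Rightarrow> ('o, 'k, 'a) basecat \<Rightarrow> ('o, 'k, 'a, 'm) bimod \<Rightarrow> ('o, 'k, 'a, 'n) bimod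
    \<Rightarrow> ('o \<Rightarrow> 'o \<Rightarrow> 'm \<Rightarrow> 'n) \<Rightarrow> bool" where
  "bimod_morphism K A M N f \<longleftrightarrow>
     bimodule K A M \<and> bimodule K A N \<and>
     (\<forall>x\<in>Ob A. \<forall>y\<in>Ob A.
        linear_map K (bhom M x y) (bhom N x y) (f x y) \<and>
        (\<forall>m\<in>carrier (bhom M x y).
           (\<forall>a\<in>carrier (Hom A y y). f x y (lact M x y a m) = lact N x y a (f x y m)) \<and>
           (\<forall>a\<in>carrier (Hom A x x). f x y (ract M x y m a) = ract N x y (f x y m) a)))"

definition bimod_isomorphic ::
  "('k, 'z) ring_scheme \<Rightarrow> ('o, 'k, 'a) basecat \<Rightarrow> ('o, 'k, 'a, 'm) bimod \<Rightarrow> ('o, 'k, 'a, 'n) bimod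
    \<Rightarrow> bool" where
  "bimod_isomorphic K A M N \<longleftrightarrow>
     (\<exists>f. bimod_morphism K A M N f \<and>
        (\<forall>x\<in>Ob A. \<forall>y\<in>Ob A. bij_betw (f x y) (carrier (bhom M x y)) (carrier (bhom N x y))))"

definition bimod_eq ::
  "('o, 'k, 'a) basecat \<Rightarrow> ('o, 'k, 'a, 'm) bimod \<Rightarrow> ('o \<Rightarrow> 'o \<Rightarrow> 'm \<Rightarrow> 'n) \<Rightarrow> ('o \<Rightarrow> 'o \<Rightarrow> 'm \<Rightarrow> 'n)
    \<Rightarrow> bool" where
  "bimod_eq A M f g \<longleftrightarrow> (\<forall>x\<in>Ob A. \<forall>y\<in>Ob A. \<forall>m\<in>carrier (bhom M x y). f x y m = g x y m)"

definition bimod_id :: "'o \<Rightarrow> 'o \<Rightarrow> 'm \<Rightarrow> 'm" where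
  "bimod_id x y m = m"

definition bimod_comp ::
  "('o \<Rightarrow> 'o \<Rightarrow> 'n \<Rightarrow> 'p) \<Rightarrow> ('o \<Rightarrow> 'o \<Rightarrow> 'm \<Rightarrow> 'n) \<Rightarrow> 'o \<Rightarrow> 'o \<Rightarrow> 'm \<Rightarrow> 'p" (infixr \<open>\<bullet>\<close> 55) where
  "(g \<bullet> f) x y m = g x y (f x y m)"

definition regular_bimod :: "('o, 'k, 'a) basecat \<Rightarrow> ('o, 'k, 'a, 'a) bimod" where
  "regular_bimod A =
     \<lparr>bhom = Hom A, lact = (\<lambda>x y a m. Comp A x y y a m), ract = (\<lambda>x y m a. Comp A x x y m a)\<rparr>"


section \<open>Tensor products\<close>

definition module_of_group :: "'m monoid \<Rightarrow> ('k \<Rightarrow> 'm \<Rightarrow> 'm) \<Rightarrow> ('k, 'm) module" where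
  "module_of_group G s =
     \<lparr>carrier = carrier G, mult = undefined, one = undefined,
      zero = \<one>\<^bsub>G\<^esub>, add = (\<otimes>\<^bsub>G\<^esub>), smult = s\<rparr>"

subsection \<open>Tensor product of a right and a left module over a ring\<close>

text \<open>\<open>M \<otimes>\<^sub>R N\<close> is the free abelian group on pairs modulo the usual relations. Here \<open>R\<close> is the
  underlying set of a \<open>K\<close>-algebra acting \<open>K\<close>-linearly on \<open>M\<close> (by \<open>ra\<close>) and \<open>N\<close> (by \<open>la\<close>), so the
  relations force \<open>c m \<otimes> n = m \<otimes> c n\<close> for scalars \<open>c\<close> of \<open>K\<close> as well. The scalar \<open>c\<close> acts by
  \<open>m \<otimes> n \<mapsto> c m \<otimes> n\<close>; the union in the scalar multiplication is over representatives of one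
  coset, all giving the same coset.\<close>

definition tensor_rels ::
  "'a set \<Rightarrow> ('k, 'm) module \<Rightarrow> ('k, 'n) module \<Rightarrow> ('m \<Rightarrow> 'a \<Rightarrow> 'm) \<Rightarrow> ('a \<Rightarrow> 'n \<Rightarrow> 'n)
    \<Rightarrow> ('m \<times> 'n \<Rightarrow>\<^sub>0 int) set" where
  "tensor_rels R M N ra la =
     {frag_of (m \<oplus>\<^bsub>M\<^esub> m', n) - frag_of (m, n) - frag_of (m', n) | m m' n.
        m \<in> carrier M \<and> m' \<in> carrier M \<and> n \<in> carrier N} \<union>
     {frag_of (m, n \<oplus>\<^bsub>N\<^esub> n') - frag_of (m, n) - frag_of (m, n') | m n n'.
        m \<in> carrier M \<and> n \<in> carrier N \<and> n' \<in> carrier N} \<union>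
     {frag_of (ra m a, n) - frag_of (m, la a n) | m a n.
        m \<in> carrier M \<and> a \<in> R \<and> n \<in> carrier N}"

definition tensor_ker ::
  "'a set \<Rightarrow> ('k, 'm) module \<Rightarrow> ('k, 'n) module \<Rightarrow> ('m \<Rightarrow> 'a \<Rightarrow> 'm) \<Rightarrow> ('a \<Rightarrow> 'n \<Rightarrow> 'n)
    \<Rightarrow> ('m \<times> 'n \<Rightarrow>\<^sub>0 int) set" where
  "tensor_ker R M N ra la =
     generate (free_Abelian_group (carrier M \<times> carrier N)) (tensor_rels R M N ra la)"

definition tensor_class ::
  "'a set \<Rightarrow> ('k, 'm) module \<Rightarrow> ('k, 'n) module \<Rightarrow> ('m \<Rightarrow> 'a \<Rightarrow> 'm) \<Rightarrow> ('a \<Rightarrow> 'n \<Rightarrow> 'n)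
    \<Rightarrow> ('m \<times> 'n \<Rightarrow>\<^sub>0 int) \<Rightarrow> ('m \<times> 'n \<Rightarrow>\<^sub>0 int) set" where
  "tensor_class R M N ra la p =
     tensor_ker R M N ra la #>\<^bsub>free_Abelian_group (carrier M \<times> carrier N)\<^esub> p"

definition tensor ::
  "'a set \<Rightarrow> ('k, 'm) module \<Rightarrow> ('k, 'n) module \<Rightarrow> ('m \<Rightarrow> 'a \<Rightarrow> 'm) \<Rightarrow> ('a \<Rightarrow> 'n \<Rightarrow> 'n)
    \<Rightarrow> ('k, ('m \<times> 'n \<Rightarrow>\<^sub>0 int) set) module" where
  "tensor R M N ra la =
     module_of_group
       (free_Abelian_group (carrier M \<times> carrier N) Mod tensor_ker R M N ra la)
       (\<lambda>c t. \<Union>p\<in>t. tensor_class R M N ra la (frag_extend (\<lambda>(m, n). frag_of (c \<odot>\<^bsub>M\<^esub> m, n)) p))"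

text \<open>The additive map out of a tensor product induced by a balanced biadditive map \<open>\<phi>\<close> into \<open>T\<close>;
  for such \<open>\<phi>\<close>, the set passed to \<open>the_elem\<close> is a singleton.\<close>

definition tensor_lift ::
  "('k, 'u) module \<Rightarrow> ('m \<Rightarrow> 'n \<Rightarrow> 'u) \<Rightarrow> ('m \<times> 'n \<Rightarrow>\<^sub>0 int) set \<Rightarrow> 'u" where
  "tensor_lift T \<phi> t =
     the_elem ((\<lambda>p. \<Oplus>\<^bsub>T\<^esub>s\<in>Poly_Mapping.keys p. [Poly_Mapping.lookup p s] \<cdot>\<^bsub>T\<^esub> case_prod \<phi> s) ` t)"

subsection \<open>Direct sums\<close>

definition direct_sum :: "'i set \<Rightarrow> ('i \<Rightarrow> ('k, 'm) module) \<Rightarrow> ('k, 'i \<Rightarrow> 'm) module" where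
  "direct_sum I T =
     \<lparr>carrier = {t \<in> \<Pi>\<^sub>E i\<in>I. carrier (T i). finite {i \<in> I. t i \<noteq> \<zero>\<^bsub>T i\<^esub>}},
      mult = undefined, one = undefined,
      zero = (\<lambda>i\<in>I. \<zero>\<^bsub>T i\<^esub>),
      add = (\<lambda>s t. \<lambda>i\<in>I. s i \<oplus>\<^bsub>T i\<^esub> t i),
      smult = (\<lambda>c t. \<lambda>i\<in>I. c \<odot>\<^bsub>T i\<^esub> t i)\<rparr>"

subsection \<open>Tensor product of bimodules over a base category\<close>

type_synonym ('o, 'm, 'n) btensor = "'o \<Rightarrow> ('m \<times> 'n \<Rightarrow>\<^sub>0 int) set"

definition tensor_at ::
  "('o, 'k, 'a) basecat \<Rightarrow> ('o, 'k, 'a, 'm) bimod \<Rightarrow> ('o, 'k, 'a, 'n) bimod \<Rightarrow> 'o \<Rightarrow> 'o \<Rightarrow> 'o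
    \<Rightarrow> ('k, ('m \<times> 'n \<Rightarrow>\<^sub>0 int) set) module" where
  "tensor_at A M N x y z =
     tensor (carrier (Hom A z z)) (bhom M z y) (bhom N x z) (ract M z y) (lact N x z)"

definition tensor_hom ::
  "('o, 'k, 'a) basecat \<Rightarrow> ('o, 'k, 'a, 'm) bimod \<Rightarrow> ('o, 'k, 'a, 'n) bimod \<Rightarrow> 'o \<Rightarrow> 'o
    \<Rightarrow> ('k, ('o, 'm, 'n) btensor) module" where
  "tensor_hom A M N x y = direct_sum (Ob A) (tensor_at A M N x y)"

text \<open>\<open>pure A M N x y z m n\<close> is \<open>m \<otimes> n\<close> in the summand of \<open>(M \<otimes>\<^sub>A N)(x, y)\<close> with index \<open>z\<close>.\<close>

definition pure ::
  "('o, 'k, 'a) basecat \<Rightarrow> ('o, 'k, 'a, 'm) bimod \<Rightarrow> ('o, 'k, 'a, 'n) bimod \<Rightarrow> 'o \<Rightarrow> 'o \<Rightarrow> 'o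
    \<Rightarrow> 'm \<Rightarrow> 'n \<Rightarrow> ('o, 'm, 'n) btensor" where
  "pure A M N x y z m n =
     (\<lambda>w\<in>Ob A. if w = z
        then tensor_class (carrier (Hom A z z)) (bhom M z y) (bhom N x z) (ract M z y) (lact N x z)
               (frag_of (m, n))
        else \<zero>\<^bsub>tensor_at A M N x y w\<^esub>)"

text \<open>The map \<open>(M \<otimes>\<^sub>A N)(x, y) \<rightarrow> T\<close> determined by \<open>m \<otimes> n \<mapsto> \<phi> z m n\<close> on the summand \<open>z\<close>.\<close>

definition lift ::
  "('o, 'k, 'a) basecat \<Rightarrow> ('o, 'k, 'a, 'm) bimod \<Rightarrow> ('o, 'k, 'a, 'n) bimod \<Rightarrow> 'o \<Rightarrow> 'o
    \<Rightarrow> ('k, 'u) module \<Rightarrow> ('o \<Rightarrow> 'm \<Rightarrow> 'n \<Rightarrow> 'u) \<Rightarrow> ('o, 'm, 'n) btensor \<Rightarrow> 'u" where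
  "lift A M N x y T \<phi> t =
     (\<Oplus>\<^bsub>T\<^esub>z\<in>{z \<in> Ob A. t z \<noteq> \<zero>\<^bsub>tensor_at A M N x y z\<^esub>}. tensor_lift T (\<phi> z) (t z))"

definition tens ::
  "('o, 'k, 'a) basecat \<Rightarrow> ('o, 'k, 'a, 'm) bimod \<Rightarrow> ('o, 'k, 'a, 'n) bimod
    \<Rightarrow> ('o, 'k, 'a, ('o, 'm, 'n) btensor) bimod" where
  "tens A M N =
     \<lparr>bhom = tensor_hom A M N,
      lact = (\<lambda>x y a. lift A M N x y (tensor_hom A M N x y)
                (\<lambda>z m n. pure A M N x y z (lact M z y a m) n)),
      ract = (\<lambda>x y t a. lift A M N x y (tensor_hom A M N x y)
                (\<lambda>z m n. pure A M N x y z m (ract N x z n a)) t)\<rparr>"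

definition tens_map ::
  "('o, 'k, 'a) basecat \<Rightarrow> ('o, 'k, 'a, 'm) bimod \<Rightarrow> ('o, 'k, 'a, 'n) bimod
    \<Rightarrow> ('o, 'k, 'a, 'p) bimod \<Rightarrow> ('o, 'k, 'a, 'q) bimod
    \<Rightarrow> ('o \<Rightarrow> 'o \<Rightarrow> 'm \<Rightarrow> 'p) \<Rightarrow> ('o \<Rightarrow> 'o \<Rightarrow> 'n \<Rightarrow> 'q)
    \<Rightarrow> 'o \<Rightarrow> 'o \<Rightarrow> ('o, 'm, 'n) btensor \<Rightarrow> ('o, 'p, 'q) btensor" where
  "tens_map A M N P Q f g x y =
     lift A M N x y (tensor_hom A P Q x y) (\<lambda>z m n. pure A P Q x y z (f z y m) (g x z n))"

subsection \<open>Structural isomorphisms\<close>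

definition assoc ::
  "('o, 'k, 'a) basecat \<Rightarrow> ('o, 'k, 'a, 'm) bimod \<Rightarrow> ('o, 'k, 'a, 'n) bimod \<Rightarrow> ('o, 'k, 'a, 'p) bimod
    \<Rightarrow> 'o \<Rightarrow> 'o \<Rightarrow> ('o, ('o, 'm, 'n) btensor, 'p) btensor
    \<Rightarrow> ('o, 'm, ('o, 'n, 'p) btensor) btensor" where
  "assoc A M N P x y =
     lift A (tens A M N) P x y (tensor_hom A M (tens A N P) x y)
       (\<lambda>z t p. lift A M N z y (tensor_hom A M (tens A N P) x y)
          (\<lambda>w m n. pure A M (tens A N P) x y w m (pure A N P x w z n p)) t)"

definition assoc_inv ::
  "('o, 'k, 'a) basecat \<Rightarrow> ('o, 'k, 'a, 'm) bimod \<Rightarrow> ('o, 'k, 'a, 'n) bimod \<Rightarrow> ('o, 'k, 'a, 'p) bimod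
    \<Rightarrow> 'o \<Rightarrow> 'o \<Rightarrow> ('o, 'm, ('o, 'n, 'p) btensor) btensor
    \<Rightarrow> ('o, ('o, 'm, 'n) btensor, 'p) btensor" where
  "assoc_inv A M N P x y =
     lift A M (tens A N P) x y (tensor_hom A (tens A M N) P x y)
       (\<lambda>w m s. lift A N P x w (tensor_hom A (tens A M N) P x y)
          (\<lambda>z n p. pure A (tens A M N) P x y z (pure A M N z y w m n) p) s)"

text \<open>In the unitors, summands with \<open>z \<noteq> y\<close> (resp. \<open>z \<noteq> x\<close>) vanish.\<close>

definition lunit ::
  "('o, 'k, 'a) basecat \<Rightarrow> ('o, 'k, 'a, 'm) bimod \<Rightarrow> 'o \<Rightarrow> 'o \<Rightarrow> ('o, 'a, 'm) btensor \<Rightarrow> 'm" where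
  "lunit A M x y =
     lift A (regular_bimod A) M x y (bhom M x y)
       (\<lambda>z a m. if z = y then lact M x y a m else \<zero>\<^bsub>bhom M x y\<^esub>)"

definition runit ::
  "('o, 'k, 'a) basecat \<Rightarrow> ('o, 'k, 'a, 'm) bimod \<Rightarrow> 'o \<Rightarrow> 'o \<Rightarrow> ('o, 'm, 'a) btensor \<Rightarrow> 'm" where
  "runit A M x y =
     lift A M (regular_bimod A) x y (bhom M x y)
       (\<lambda>z m a. if z = x then ract M x y m a else \<zero>\<^bsub>bhom M x y\<^esub>)"

definition lunit_inv ::
  "('o, 'k, 'a) basecat \<Rightarrow> ('o, 'k, 'a, 'm) bimod \<Rightarrow> 'o \<Rightarrow> 'o \<Rightarrow> 'm \<Rightarrow> ('o, 'a, 'm) btensor" where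
  "lunit_inv A M x y m = pure A (regular_bimod A) M x y y (idn A y) m"

definition runit_inv ::
  "('o, 'k, 'a) basecat \<Rightarrow> ('o, 'k, 'a, 'm) bimod \<Rightarrow> 'o \<Rightarrow> 'o \<Rightarrow> 'm \<Rightarrow> ('o, 'm, 'a) btensor" where
  "runit_inv A M x y m = pure A M (regular_bimod A) x y x m (idn A x)"


section \<open>Stratified linear categories\<close>

record ('o, 'k, 'a, 'c) stratcat = "('o, 'k, 'c) lincat" +
  incl :: "'o \<Rightarrow> 'o \<Rightarrow> 'a \<Rightarrow> 'c"
  pos :: "'o \<Rightarrow> 'o \<Rightarrow> 'c set"
  neg :: "'o \<Rightarrow> 'o \<Rightarrow> 'c set"

definition subcat_bimod ::
  "('o, 'k, 'a, 'c) stratcat \<Rightarrow> ('o \<Rightarrow> 'o \<Rightarrow> 'c set) \<Rightarrow> ('o, 'k, 'a, 'c) bimod" where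
  "subcat_bimod C P =
     \<lparr>bhom = (\<lambda>x y. (Hom C x y)\<lparr>carrier := P x y\<rparr>),
      lact = (\<lambda>x y a f. Comp C x y y (incl C y y a) f),
      ract = (\<lambda>x y f a. Comp C x x y f (incl C x x a))\<rparr>"

abbreviation posb :: "('o, 'k, 'a, 'c) stratcat \<Rightarrow> ('o, 'k, 'a, 'c) bimod" where
  "posb C \<equiv> subcat_bimod C (pos C)"

abbreviation negb :: "('o, 'k, 'a, 'c) stratcat \<Rightarrow> ('o, 'k, 'a, 'c) bimod" where
  "negb C \<equiv> subcat_bimod C (neg C)"

definition comp_map ::
  "('o, 'k, 'a) basecat \<Rightarrow> ('o, 'k, 'a, 'c) stratcat \<Rightarrow> ('o \<Rightarrow> 'o \<Rightarrow> 'c set) \<Rightarrow> ('o \<Rightarrow> 'o \<Rightarrow> 'c set)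
    \<Rightarrow> 'o \<Rightarrow> 'o \<Rightarrow> ('o, 'c, 'c) btensor \<Rightarrow> 'c" where
  "comp_map A C P Q x y =
     lift A (subcat_bimod C P) (subcat_bimod C Q) x y (Hom C x y) (\<lambda>z g f. Comp C x z y g f)"

locale stratified_category = base: base_category K A + linear_category K C
  for K :: "('k, 'z) ring_scheme" and A :: "('o, 'k, 'a) basecat"
    and C :: "('o, 'k, 'a, 'c) stratcat" +
  assumes Ob_eq: "Ob C = Ob A"
    and incl_functor: "linear_functor K A C (\<lambda>x. x) (incl C)"
    and pos_subcategory: "wide_linear_subcategory K C (pos C)"
    and neg_subcategory: "wide_linear_subcategory K C (neg C)"
    and pos_zero:
      "\<lbrakk>x \<in> Ob A; y \<in> Ob A; (x, y) \<notin> le A\<rbrakk> \<Longrightarrow> pos C x y = {\<zero>\<^bsub>Hom C x y\<^esub>}"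
    and neg_zero:
      "\<lbrakk>x \<in> Ob A; y \<in> Ob A; (y, x) \<notin> le A\<rbrakk> \<Longrightarrow> neg C x y = {\<zero>\<^bsub>Hom C x y\<^esub>}"
    and pos_neg_diag: "x \<in> Ob A \<Longrightarrow> pos C x x = neg C x x"
    and incl_bij: "x \<in> Ob A \<Longrightarrow> bij_betw (incl C x x) (carrier (Hom A x x)) (pos C x x)"
    and comp_bij:
      "\<lbrakk>x \<in> Ob A; z \<in> Ob A\<rbrakk>
        \<Longrightarrow> bij_betw (comp_map A C (pos C) (neg C) x z)
              (carrier (tensor_hom A (posb C) (negb C) x z)) (carrier (Hom C x z))"

text \<open>\<open>decomp\<close> is the identification of \<open>C\<close> with \<open>C\<^sup>+ \<otimes>\<^sub>A C\<^sup>-\<close>.\<close>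

definition decomp ::
  "('o, 'k, 'a) basecat \<Rightarrow> ('o, 'k, 'a, 'c) stratcat \<Rightarrow> 'o \<Rightarrow> 'o \<Rightarrow> 'c \<Rightarrow> ('o, 'c, 'c) btensor" where
  "decomp A C x y =
     the_inv_into (carrier (tensor_hom A (posb C) (negb C) x y)) (comp_map A C (pos C) (neg C) x y)"

text \<open>The unit and counit are given by the same formulas on \<open>C\<^sup>+\<close> and on \<open>C\<^sup>-\<close>: the unit is
  \<open>incl C\<close>, the counit is \<open>counit A C\<close>.\<close>

definition counit ::
  "('o, 'k, 'a) basecat \<Rightarrow> ('o, 'k, 'a, 'c) stratcat \<Rightarrow> 'o \<Rightarrow> 'o \<Rightarrow> 'c \<Rightarrow> 'a" where
  "counit A C x y f =
     (if x = y then the_inv_into (carrier (Hom A x x)) (incl C x x) f else \<zero>\<^bsub>Hom A x y\<^esub>)"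

definition twist ::
  "('o, 'k, 'a) basecat \<Rightarrow> ('o, 'k, 'a, 'c) stratcat \<Rightarrow> 'o \<Rightarrow> 'o
    \<Rightarrow> ('o, 'c, 'c) btensor \<Rightarrow> ('o, 'c, 'c) btensor" where
  "twist A C = decomp A C \<bullet> comp_map A C (neg C) (pos C)"


section \<open>Perfectness\<close>

definition pairing ::
  "('o, 'k, 'a) basecat \<Rightarrow> ('o, 'k, 'a, 'c) stratcat \<Rightarrow> 'o \<Rightarrow> 'o \<Rightarrow> ('o, 'c, 'c) btensor \<Rightarrow> 'a" where
  "pairing A C =
     lunit A (regular_bimod A)
     \<bullet> tens_map A (posb C) (negb C) (regular_bimod A) (regular_bimod A) (counit A C) (counit A C)
     \<bullet> twist A C"

definition is_copairing ::
  "('k, 'z) ring_scheme \<Rightarrow> ('o, 'k, 'a) basecat \<Rightarrow> ('o, 'k, 'a, 'c) stratcat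
    \<Rightarrow> ('o \<Rightarrow> 'o \<Rightarrow> ('o, 'c, 'c) btensor \<Rightarrow> 'a) \<Rightarrow> ('o \<Rightarrow> 'o \<Rightarrow> 'a \<Rightarrow> ('o, 'c, 'c) btensor) \<Rightarrow> bool" where
  "is_copairing K A C \<beta> \<gamma> \<longleftrightarrow>
     (let P = posb C; N = negb C; U = regular_bimod A in
      bimod_morphism K A U (tens A P N) \<gamma> \<and>
      bimod_eq A N
        (lunit A N \<bullet> tens_map A (tens A N P) N U N \<beta> bimod_id \<bullet> assoc_inv A N P N
         \<bullet> tens_map A N U N (tens A P N) bimod_id \<gamma> \<bullet> runit_inv A N)
        bimod_id \<and>
      bimod_eq A P
        (runit A P \<bullet> tens_map A P (tens A N P) P U bimod_id \<beta> \<bullet> assoc A P N P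
         \<bullet> tens_map A U P (tens A P N) P \<gamma> bimod_id \<bullet> lunit_inv A P)
        bimod_id)"

definition perfect_pairing ::
  "('k, 'z) ring_scheme \<Rightarrow> ('o, 'k, 'a) basecat \<Rightarrow> ('o, 'k, 'a, 'c) stratcat
    \<Rightarrow> ('o \<Rightarrow> 'o \<Rightarrow> ('o, 'c, 'c) btensor \<Rightarrow> 'a) \<Rightarrow> bool" where
  "perfect_pairing K A C \<beta> \<longleftrightarrow>
     bimod_morphism K A (tens A (negb C) (posb C)) (regular_bimod A) \<beta> \<and>
     (\<exists>\<gamma>. is_copairing K A C \<beta> \<gamma>)"

definition perfect ::
  "('k, 'z) ring_scheme \<Rightarrow> ('o, 'k, 'a) basecat \<Rightarrow> ('o, 'k, 'a, 'c) stratcat \<Rightarrow> bool" where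
  "perfect K A C \<longleftrightarrow> perfect_pairing K A C (pairing A C)"


section \<open>Morita equivalence\<close>

text \<open>Bimodules over an arbitrary linear category \<open>C\<close>: \<open>clact M x y z g m\<close> is defined for
  \<open>g : y \<rightarrow> z\<close> and \<open>m\<close> in \<open>chom M x y\<close>, and \<open>cract M x y z m h\<close> for \<open>m\<close> in \<open>chom M y z\<close> and
  \<open>h : x \<rightarrow> y\<close>; both lie in \<open>chom M x z\<close>.\<close>

record ('o, 'k, 'c, 'm) cbimod =
  chom :: "'o \<Rightarrow> 'o \<Rightarrow> ('k, 'm) module"
  clact :: "'o \<Rightarrow> 'o \<Rightarrow> 'o \<Rightarrow> 'c \<Rightarrow> 'm \<Rightarrow> 'm"
  cract :: "'o \<Rightarrow> 'o \<Rightarrow> 'o \<Rightarrow> 'm \<Rightarrow> 'c \<Rightarrow> 'm"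

locale category_bimodule =
  fixes K :: "('k, 'z) ring_scheme" and C :: "('o, 'k, 'c, 'w) lincat_scheme"
    and M :: "('o, 'k, 'c, 'm) cbimod"
  assumes chom_module: "\<lbrakk>x \<in> Ob C; y \<in> Ob C\<rbrakk> \<Longrightarrow> module K (chom M x y)"
    and clact_linear:
      "\<lbrakk>x \<in> Ob C; y \<in> Ob C; z \<in> Ob C; g \<in> carrier (Hom C y z)\<rbrakk>
        \<Longrightarrow> linear_map K (chom M x y) (chom M x z) (\<lambda>m. clact M x y z g m)"
    and clact_linear_scalar:
      "\<lbrakk>x \<in> Ob C; y \<in> Ob C; z \<in> Ob C; m \<in> carrier (chom M x y)\<rbrakk>
        \<Longrightarrow> linear_map K (Hom C y z) (chom M x z) (\<lambda>g. clact M x y z g m)"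
    and cract_linear:
      "\<lbrakk>x \<in> Ob C; y \<in> Ob C; z \<in> Ob C; h \<in> carrier (Hom C x y)\<rbrakk>
        \<Longrightarrow> linear_map K (chom M y z) (chom M x z) (\<lambda>m. cract M x y z m h)"
    and cract_linear_scalar:
      "\<lbrakk>x \<in> Ob C; y \<in> Ob C; z \<in> Ob C; m \<in> carrier (chom M y z)\<rbrakk>
        \<Longrightarrow> linear_map K (Hom C x y) (chom M x z) (\<lambda>h. cract M x y z m h)"
    and clact_idn:
      "\<lbrakk>x \<in> Ob C; y \<in> Ob C; m \<in> carrier (chom M x y)\<rbrakk> \<Longrightarrow> clact M x y y (idn C y) m = m"
    and cract_idn:
      "\<lbrakk>x \<in> Ob C; y \<in> Ob C; m \<in> carrier (chom M x y)\<rbrakk> \<Longrightarrow> cract M x x y m (idn C x) = m"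
    and clact_Comp:
      "\<lbrakk>w \<in> Ob C; x \<in> Ob C; y \<in> Ob C; z \<in> Ob C; m \<in> carrier (chom M w x);
        g \<in> carrier (Hom C x y); h \<in> carrier (Hom C y z)\<rbrakk>
        \<Longrightarrow> clact M w x z (Comp C x y z h g) m = clact M w y z h (clact M w x y g m)"
    and cract_Comp:
      "\<lbrakk>w \<in> Ob C; x \<in> Ob C; y \<in> Ob C; z \<in> Ob C; m \<in> carrier (chom M y z);
        g \<in> carrier (Hom C x y); h \<in> carrier (Hom C w x)\<rbrakk>
        \<Longrightarrow> cract M w y z m (Comp C w x y g h) = cract M w x z (cract M x y z m g) h"
    and clact_cract:
      "\<lbrakk>w \<in> Ob C; x \<in> Ob C; y \<in> Ob C; z \<in> Ob C; m \<in> carrier (chom M x y);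
        g \<in> carrier (Hom C y z); h \<in> carrier (Hom C w x)\<rbrakk>
        \<Longrightarrow> cract M w x z (clact M x y z g m) h = clact M w y z g (cract M w x y m h)"

definition cbimod_isomorphic ::
  "('k, 'z) ring_scheme \<Rightarrow> ('o, 'k, 'c, 'w) lincat_scheme \<Rightarrow> ('o, 'k, 'c, 'm) cbimod
    \<Rightarrow> ('o, 'k, 'c, 'n) cbimod \<Rightarrow> bool" where
  "cbimod_isomorphic K C M N \<longleftrightarrow>
     category_bimodule K C M \<and> category_bimodule K C N \<and>
     (\<exists>f. (\<forall>x\<in>Ob C. \<forall>y\<in>Ob C.
             linear_map K (chom M x y) (chom N x y) (f x y) \<and>
             bij_betw (f x y) (carrier (chom M x y)) (carrier (chom N x y))) \<and>
          (\<forall>x\<in>Ob C. \<forall>y\<in>Ob C. \<forall>z\<in>Ob C. \<forall>m\<in>carrier (chom M x y). \<forall>g\<in>carrier (Hom C y z).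
             f x z (clact M x y z g m) = clact N x y z g (f x y m)) \<and>
          (\<forall>x\<in>Ob C. \<forall>y\<in>Ob C. \<forall>z\<in>Ob C. \<forall>m\<in>carrier (chom M y z). \<forall>h\<in>carrier (Hom C x y).
             f x z (cract M x y z m h) = cract N x y z (f y z m) h))"

definition regular_cbimod :: "('o, 'k, 'c, 'w) lincat_scheme \<Rightarrow> ('o, 'k, 'c, 'c) cbimod" where
  "regular_cbimod C = \<lparr>chom = Hom C, clact = Comp C, cract = Comp C\<rparr>"

definition pos_lact ::
  "('o, 'k, 'a) basecat \<Rightarrow> ('o, 'k, 'a, 'c) stratcat \<Rightarrow> 'o \<Rightarrow> 'o \<Rightarrow> 'o \<Rightarrow> 'c \<Rightarrow> 'c \<Rightarrow> 'c" where
  "pos_lact A C x y z g f =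
     (runit A (posb C)
      \<bullet> tens_map A (posb C) (negb C) (posb C) (regular_bimod A) bimod_id (counit A C)
      \<bullet> decomp A C) x z (Comp C x y z g f)"

definition neg_ract ::
  "('o, 'k, 'a) basecat \<Rightarrow> ('o, 'k, 'a, 'c) stratcat \<Rightarrow> 'o \<Rightarrow> 'o \<Rightarrow> 'o \<Rightarrow> 'c \<Rightarrow> 'c \<Rightarrow> 'c" where
  "neg_ract A C x y z f g =
     (lunit A (negb C)
      \<bullet> tens_map A (posb C) (negb C) (regular_bimod A) (negb C) (counit A C) bimod_id
      \<bullet> decomp A C) x z (Comp C x y z f g)"

definition pos_tens_neg ::
  "('o, 'k, 'a) basecat \<Rightarrow> ('o, 'k, 'a, 'c) stratcat \<Rightarrow> ('o, 'k, 'c, ('o, 'c, 'c) btensor) cbimod" where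
  "pos_tens_neg A C =
     (let P = posb C; N = negb C in
      \<lparr>chom = tensor_hom A P N,
       clact = (\<lambda>x y z g. lift A P N x y (tensor_hom A P N x z)
                  (\<lambda>w p n. pure A P N x z w (pos_lact A C w y z g p) n)),
       cract = (\<lambda>x y z t h. lift A P N y z (tensor_hom A P N x z)
                  (\<lambda>w p n. pure A P N x z w p (neg_ract A C x y w n h)) t)\<rparr>)"

text \<open>The quotient of a bimodule by a family \<open>H\<close> of additive subgroups that is stable under
  scalars and both actions; the unions are over representatives of one coset.\<close>

definition quotient_bimod ::
  "('o, 'k, 'a, 'm) bimod \<Rightarrow> ('o \<Rightarrow> 'o \<Rightarrow> 'm set) \<Rightarrow> ('o, 'k, 'a, 'm set) bimod" where
  "quotient_bimod M H =
     \<lparr>bhom = (\<lambda>x y. module_of_group (add_monoid (bhom M x y) Mod H x y)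
                (\<lambda>c q. \<Union>m\<in>q. H x y #>\<^bsub>add_monoid (bhom M x y)\<^esub> (c \<odot>\<^bsub>bhom M x y\<^esub> m))),
      lact = (\<lambda>x y a q. \<Union>m\<in>q. H x y #>\<^bsub>add_monoid (bhom M x y)\<^esub> lact M x y a m),
      ract = (\<lambda>x y q a. \<Union>m\<in>q. H x y #>\<^bsub>add_monoid (bhom M x y)\<^esub> ract M x y m a)\<rparr>"

text \<open>The set of relations is already stable under scalars and under both actions of \<open>A\<close>, so the
  additive subgroup it generates is a sub-bimodule.\<close>

definition neg_tens_pos_rels ::
  "('o, 'k, 'a) basecat \<Rightarrow> ('o, 'k, 'a, 'c) stratcat \<Rightarrow> 'o \<Rightarrow> 'o \<Rightarrow> ('o, 'c, 'c) btensor set" where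
  "neg_tens_pos_rels A C x y =
     {pure A (negb C) (posb C) x y u (neg_ract A C u v y f g) h
        \<ominus>\<^bsub>tensor_hom A (negb C) (posb C) x y\<^esub>
      pure A (negb C) (posb C) x y v f (pos_lact A C x u v g h) | u v f g h.
        u \<in> Ob C \<and> v \<in> Ob C \<and> f \<in> neg C v y \<and> g \<in> carrier (Hom C u v) \<and> h \<in> pos C x u}"

definition neg_tens_pos ::
  "('o, 'k, 'a) basecat \<Rightarrow> ('o, 'k, 'a, 'c) stratcat
    \<Rightarrow> ('o, 'k, 'a, ('o, 'c, 'c) btensor set) bimod" where
  "neg_tens_pos A C =
     quotient_bimod (tens A (negb C) (posb C))
       (\<lambda>x y. generate (add_monoid (tensor_hom A (negb C) (posb C) x y)) (neg_tens_pos_rels A C x y))"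

definition gives_morita_equivalence ::
  "('k, 'z) ring_scheme \<Rightarrow> ('o, 'k, 'a) basecat \<Rightarrow> ('o, 'k, 'a, 'c) stratcat \<Rightarrow> bool" where
  "gives_morita_equivalence K A C \<longleftrightarrow>
     cbimod_isomorphic K C (pos_tens_neg A C) (regular_cbimod C) \<and>
     bimod_isomorphic K A (neg_tens_pos A C) (regular_bimod A)"


section \<open>Quasi-cellular categories\<close>

locale quasi_cellular_category = stratified_category K A C
  for K :: "('k, 'z) ring_scheme" and A :: "('o, 'k, 'a) basecat"
    and C :: "('o, 'k, 'a, 'c) stratcat" +
  fixes b :: "'o \<Rightarrow> 'o \<Rightarrow> ('o, 'c, 'c) btensor \<Rightarrow> 'a"
    and d :: "'o \<Rightarrow> 'o \<Rightarrow> 'a \<Rightarrow> ('o, 'c, 'c) btensor"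
  assumes b_morphism:
      "bimod_morphism K A (tens A (negb C) (posb C)) (regular_bimod A) b"
    and d_copairing: "is_copairing K A C b d"
    and b_unit_left:
      "bimod_eq A (posb C)
         (b \<bullet> tens_map A (regular_bimod A) (posb C) (negb C) (posb C) (incl C) bimod_id
          \<bullet> lunit_inv A (posb C))
         (counit A C)"
    and b_unit_right:
      "bimod_eq A (negb C)
         (b \<bullet> tens_map A (negb C) (regular_bimod A) (negb C) (posb C) bimod_id (incl C)
          \<bullet> runit_inv A (negb C))
         (counit A C)"

text \<open>The maps \<open>id \<otimes> b \<otimes> id\<close> and \<open>L\<close> with the associativity and unit isomorphisms written out.\<close>

definition sandwich ::
  "('o, 'k, 'a) basecat \<Rightarrow> ('o, 'k, 'a, 'c) stratcat \<Rightarrow> ('o \<Rightarrow> 'o \<Rightarrow> ('o, 'c, 'c) btensor \<Rightarrow> 'a)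
    \<Rightarrow> 'o \<Rightarrow> 'o \<Rightarrow> ('o, ('o, 'c, 'c) btensor, ('o, 'c, 'c) btensor) btensor
    \<Rightarrow> ('o, 'c, 'c) btensor" where
  "sandwich A C b =
     (let P = posb C; N = negb C; U = regular_bimod A in
      tens_map A P (tens A U N) P N bimod_id (lunit A N)
      \<bullet> tens_map A P (tens A (tens A N P) N) P (tens A U N) bimod_id
          (tens_map A (tens A N P) N U N b bimod_id)
      \<bullet> tens_map A P (tens A N (tens A P N)) P (tens A (tens A N P) N) bimod_id (assoc_inv A N P N)
      \<bullet> assoc A P N (tens A P N))"

definition pairing_category ::
  "('o, 'k, 'a) basecat \<Rightarrow> ('o, 'k, 'a, 'c) stratcat \<Rightarrow> ('o \<Rightarrow> 'o \<Rightarrow> ('o, 'c, 'c) btensor \<Rightarrow> 'a)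
    \<Rightarrow> ('o \<Rightarrow> 'o \<Rightarrow> 'a \<Rightarrow> ('o, 'c, 'c) btensor) \<Rightarrow> ('o, 'k, ('o, 'c, 'c) btensor) lincat" where
  "pairing_category A C b d =
     (let P = posb C; N = negb C in
      \<lparr>Ob = Ob C,
       Hom = tensor_hom A P N,
       Comp = (\<lambda>x y z g f. sandwich A C b x z (pure A (tens A P N) (tens A P N) x z y g f)),
       idn = (\<lambda>x. d x x (idn A x))\<rparr>)"

definition L_map ::
  "('o, 'k, 'a) basecat \<Rightarrow> ('o, 'k, 'a, 'c) stratcat \<Rightarrow> ('o \<Rightarrow> 'o \<Rightarrow> 'a \<Rightarrow> ('o, 'c, 'c) btensor)
    \<Rightarrow> 'o \<Rightarrow> 'o \<Rightarrow> 'c \<Rightarrow> ('o, 'c, 'c) btensor" where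
  "L_map A C d =
     (let P = posb C; N = negb C; U = regular_bimod A; mu = comp_map A C (neg C) (neg C) in
      tens_map A P (tens A U N) P N bimod_id (lunit A N)
      \<bullet> tens_map A P (tens A P (tens A N N)) P (tens A U N) bimod_id
          (tens_map A P (tens A N N) U N (counit A C) mu)
      \<bullet> tens_map A P (tens A (tens A P N) N) P (tens A P (tens A N N)) bimod_id (assoc A P N N)
      \<bullet> tens_map A P (tens A (tens A N P) N) P (tens A (tens A P N) N) bimod_id
          (tens_map A (tens A N P) N (tens A P N) N (twist A C) bimod_id)
      \<bullet> tens_map A P (tens A N (tens A P N)) P (tens A (tens A N P) N) bimod_id (assoc_inv A N P N)
      \<bullet> assoc A P N (tens A P N)
      \<bullet> tens_map A U (tens A P N) (tens A P N) (tens A P N) d bimod_id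
      \<bullet> lunit_inv A (tens A P N)
      \<bullet> decomp A C)"

definition L_is_isomorphism ::
  "('k, 'z) ring_scheme \<Rightarrow> ('o, 'k, 'a) basecat \<Rightarrow> ('o, 'k, 'a, 'c) stratcat
    \<Rightarrow> ('o \<Rightarrow> 'o \<Rightarrow> ('o, 'c, 'c) btensor \<Rightarrow> 'a) \<Rightarrow> ('o \<Rightarrow> 'o \<Rightarrow> 'a \<Rightarrow> ('o, 'c, 'c) btensor) \<Rightarrow> bool" where
  "L_is_isomorphism K A C b d \<longleftrightarrow>
     linear_category_iso K C (pairing_category A C b d) (\<lambda>x. x) (L_map A C d)"

definition is_action ::
  "('k, 'z) ring_scheme \<Rightarrow> ('o, 'k, 'a) basecat \<Rightarrow> ('o, 'k, 'a, 'c) stratcat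
    \<Rightarrow> ('o \<Rightarrow> 'o \<Rightarrow> ('o, 'c, 'c) btensor \<Rightarrow> 'a) \<Rightarrow> ('o \<Rightarrow> 'o \<Rightarrow> ('o, 'c, 'c) btensor \<Rightarrow> 'c) \<Rightarrow> bool" where
  "is_action K A C b \<delta> \<longleftrightarrow>
     (let P = posb C; N = negb C; U = regular_bimod A; mu = comp_map A C (neg C) (neg C) in
      bimod_morphism K A (tens A N P) P \<delta> \<and>
      bimod_eq A (tens A (tens A N N) P)
        (\<delta> \<bullet> tens_map A (tens A N N) P N P mu bimod_id)
        (\<delta> \<bullet> tens_map A N (tens A N P) N P bimod_id \<delta> \<bullet> assoc A N N P) \<and>
      bimod_eq A P (\<delta> \<bullet> tens_map A U P N P (incl C) bimod_id \<bullet> lunit_inv A P) bimod_id \<and>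
      bimod_eq A N (\<delta> \<bullet> tens_map A N U N P bimod_id (incl C) \<bullet> runit_inv A N)
        (incl C \<bullet> counit A C) \<and>
      bimod_eq A (tens A N P) b (counit A C \<bullet> \<delta>))"

definition admits_action ::
  "('k, 'z) ring_scheme \<Rightarrow> ('o, 'k, 'a) basecat \<Rightarrow> ('o, 'k, 'a, 'c) stratcat
    \<Rightarrow> ('o \<Rightarrow> 'o \<Rightarrow> ('o, 'c, 'c) btensor \<Rightarrow> 'a) \<Rightarrow> bool" where
  "admits_action K A C b \<longleftrightarrow> (\<exists>\<delta>. is_action K A C b \<delta>)"

end

theory Submission
  imports Defs
begin

text \<open>Projecting \<open>C = C\<^sup>+ \<otimes> C\<^sup>-\<close> to its factors makes \<open>C\<^sup>+\<close> a left and \<open>C\<^sup>-\<close> a right \<open>C\<close>-module, and the pairing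
  \<open>\<beta>\<close> of \<open>C\<close> is balanced over \<open>C\<close>. Hence \<open>C\<^sup>- \<otimes>\<^sub>C C\<^sup>+ \<cong> A\<close> holds for every stratified category.
  If \<open>\<beta>\<close> is perfect, its copairing \<open>\<gamma>\<close> is central for \<open>C\<close>, so \<open>c \<mapsto> c \<gamma>\<close> is a map of bimodules
  \<open>C \<rightarrow> C\<^sup>+ \<otimes> C\<^sup>-\<close>; it is unipotent triangular for the order on objects, and therefore bijective by
  the descending chain condition. Conversely, an isomorphism of \<open>C\<close>-bimodules \<open>C \<rightarrow> C\<^sup>+ \<otimes> C\<^sup>-\<close> sends the
  identities to a copairing, up to a central unit of \<open>A\<close>. For another perfect pairing \<open>b\<close> with
  copairing \<open>d\<close>, the functor \<open>L\<close> is \<open>c \<mapsto> d c\<close>; it is the composite of \<open>c \<mapsto> c \<gamma>\<close> with the comparison of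
  \<open>\<beta>\<close> with \<open>b\<close>.\<close>

section \<open>Linear maps and quotient modules\<close>

text \<open>The monoidal category of bimodules is not strict here: each composite in the definitions
  carries associators, unitors and direct sums over objects. Each of them is evaluated once on pure
  tensors and replaced by a contraction: \<open>cL\<close> for (\<beta> \<otimes> id)(n \<otimes>
  t), \<open>cR\<close> for (id \<otimes> \<beta>)(t \<otimes> p), and \<open>sandw\<close> for id
  \<otimes> \<beta> \<otimes> id. The triangle identities then only concern the values of the
  copairing at identities. The link between the actions of C and the pairing is that the right
  projection of the product h t is the contraction of the right projection of h with t. It makes the
  pairing balanced, hence \<gamma> central, because \<gamma> recovers an element from its
  contractions; it shows that the top coefficient of \<gamma> is 1, which is the unipotence; and for
  an arbitrary isomorphism of bimodules it exhibits the top coefficient as the unit to be corrected.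
  The sandwich product is associative even when two different pairings occur in it, which is what
  allows \<beta> and b to be compared.\<close>

lemma linear_map_closed:
  "linear_map K M N f \<Longrightarrow> u \<in> carrier M \<Longrightarrow> f u \<in> carrier N"
  by (auto simp: linear_map_def)

lemma linear_map_add:
  "linear_map K M N f \<Longrightarrow> u \<in> carrier M \<Longrightarrow> v \<in> carrier M \<Longrightarrow> f (u \<oplus>\<^bsub>M\<^esub> v) = f u \<oplus>\<^bsub>N\<^esub> f v"
  by (auto simp: linear_map_def)

lemma linear_map_smult:
  "linear_map K M N f \<Longrightarrow> c \<in> carrier K \<Longrightarrow> u \<in> carrier M \<Longrightarrow> f (c \<odot>\<^bsub>M\<^esub> u) = c \<odot>\<^bsub>N\<^esub> f u"
  by (auto simp: linear_map_def)

lemma linear_mapI: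
  assumes "\<And>u. u \<in> carrier M \<Longrightarrow> f u \<in> carrier N"
    and "\<And>u v. u \<in> carrier M \<Longrightarrow> v \<in> carrier M \<Longrightarrow> f (u \<oplus>\<^bsub>M\<^esub> v) = f u \<oplus>\<^bsub>N\<^esub> f v"
    and "\<And>c u. c \<in> carrier K \<Longrightarrow> u \<in> carrier M \<Longrightarrow> f (c \<odot>\<^bsub>M\<^esub> u) = c \<odot>\<^bsub>N\<^esub> f u"
  shows "linear_map K M N f"
  using assms by (auto simp: linear_map_def)

lemma linear_map_ident: "linear_map K M M (\<lambda>u. u)"
  by (auto simp: linear_map_def)

lemma linear_map_compose:
  "linear_map K M N f \<Longrightarrow> linear_map K N L g \<Longrightarrow> linear_map K M L (\<lambda>u. g (f u))"
  by (auto simp: linear_map_def Pi_iff)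

text \<open>The module hypothesis keeps sums and multiples in the carrier, where \<open>f\<close>
  and \<open>g\<close> agree. This lets rewrite rules with membership premises act under the
  abstraction.\<close>

lemma linear_map_cong:
  "module K M \<Longrightarrow> (\<And>u. u \<in> carrier M \<Longrightarrow> f u = g u) \<Longrightarrow> linear_map K M N f \<longleftrightarrow> linear_map K M N g"
  by (auto simp: linear_map_def Pi_iff module_def abelian_group_def abelian_monoid.a_closed
      module.smult_closed)

lemma module_abelian_group: "module K M \<Longrightarrow> abelian_group M"
  by (simp add: module_def)

lemma linear_map_zero:
  assumes "module K M" "module K N" "linear_map K M N f"
  shows "f \<zero>\<^bsub>M\<^esub> = \<zero>\<^bsub>N\<^esub>"
proof -
  interpret M: module K M by fact
  interpret N: module K N by fact
  have "f \<zero>\<^bsub>M\<^esub> = f (\<zero>\<^bsub>K\<^esub> \<odot>\<^bsub>M\<^esub> \<zero>\<^bsub>M\<^esub>)"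
    by simp
  also have "\<dots> = \<zero>\<^bsub>K\<^esub> \<odot>\<^bsub>N\<^esub> f \<zero>\<^bsub>M\<^esub>"
    by (rule linear_map_smult [OF assms(3)]) auto
  finally show ?thesis
    using linear_map_closed [OF assms(3)] by simp
qed

lemma linear_map_minus:
  assumes "module K M" "module K N" "linear_map K M N f" "u \<in> carrier M"
  shows "f (\<ominus>\<^bsub>M\<^esub> u) = \<ominus>\<^bsub>N\<^esub> f u"
proof -
  interpret M: module K M by fact
  interpret N: module K N by fact
  have "f u \<oplus>\<^bsub>N\<^esub> f (\<ominus>\<^bsub>M\<^esub> u) = \<zero>\<^bsub>N\<^esub>"
    using assms linear_map_add [OF assms(3), of u "\<ominus>\<^bsub>M\<^esub> u"]
      linear_map_zero [OF assms(1-3)] by (simp add: M.r_neg)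
  then show ?thesis
    using assms N.minus_equality linear_map_closed [OF assms(3)]
    by (metis M.a_inv_closed N.a_comm)
qed

lemma linear_map_diff:
  assumes "module K M" "module K N" "linear_map K M N f" "u \<in> carrier M" "v \<in> carrier M"
  shows "f (u \<ominus>\<^bsub>M\<^esub> v) = f u \<ominus>\<^bsub>N\<^esub> f v"
proof -
  interpret M: module K M by fact
  show ?thesis
    using assms by (simp add: a_minus_def linear_map_add linear_map_minus [of K M N f])
qed

lemma linear_map_const_zero:
  assumes "module K N"
  shows "linear_map K M N (\<lambda>u. \<zero>\<^bsub>N\<^esub>)"
proof -
  interpret N: module K N by fact
  show ?thesis by (auto simp: linear_map_def)
qed

lemma linear_map_if:
  "(b \<Longrightarrow> linear_map K M N f) \<Longrightarrow> (\<not> b \<Longrightarrow> linear_map K M N g)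
    \<Longrightarrow> linear_map K M N (\<lambda>u. if b then f u else g u)"
  by (cases b) auto

lemma linear_map_sum:
  assumes "module K N" "linear_map K M N f" "linear_map K M N g"
  shows "linear_map K M N (\<lambda>u. f u \<oplus>\<^bsub>N\<^esub> g u)"
proof -
  interpret N: module K N by fact
  show ?thesis
    using assms(2,3)
    by (intro linear_mapI)
       (auto simp: linear_map_add linear_map_smult N.smult_r_distr N.a_ac linear_map_closed)
qed

lemma linear_map_inv_into:
  assumes "module K M" "linear_map K M N f" "bij_betw f (carrier M) (carrier N)"
  shows "linear_map K N M (the_inv_into (carrier M) f)"
proof -
  interpret M: module K M by fact
  let ?g = "the_inv_into (carrier M) f"
  have inj: "inj_on f (carrier M)" and im: "f ` carrier M = carrier N"
    using assms(3) by (auto simp: bij_betw_def)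
  have g: "?g v \<in> carrier M" "f (?g v) = v" if "v \<in> carrier N" for v
    using that inj im by (auto intro: the_inv_into_into f_the_inv_into_f)
  show ?thesis
  proof (rule linear_mapI)
    fix u v assume "u \<in> carrier N" "v \<in> carrier N"
    then have "f (?g u \<oplus>\<^bsub>M\<^esub> ?g v) = u \<oplus>\<^bsub>N\<^esub> v"
      using g linear_map_add [OF assms(2)] by simp
    then show "?g (u \<oplus>\<^bsub>N\<^esub> v) = ?g u \<oplus>\<^bsub>M\<^esub> ?g v"
      using g inj \<open>u \<in> carrier N\<close> \<open>v \<in> carrier N\<close>
      by (metis M.a_closed the_inv_into_f_f)
  next
    fix c u assume "c \<in> carrier K" "u \<in> carrier N"
    then have "f (c \<odot>\<^bsub>M\<^esub> ?g u) = c \<odot>\<^bsub>N\<^esub> u"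
      using g linear_map_smult [OF assms(2)] by simp
    then show "?g (c \<odot>\<^bsub>N\<^esub> u) = c \<odot>\<^bsub>M\<^esub> ?g u"
      using g inj \<open>c \<in> carrier K\<close> \<open>u \<in> carrier N\<close>
      by (metis M.smult_closed the_inv_into_f_f)
  qed (use g in auto)
qed

lemma coset_eq_iff:
  assumes "comm_group G" "subgroup H G" "u \<in> carrier G" "v \<in> carrier G"
  shows "H #>\<^bsub>G\<^esub> u = H #>\<^bsub>G\<^esub> v \<longleftrightarrow> u \<otimes>\<^bsub>G\<^esub> inv\<^bsub>G\<^esub> v \<in> H"
proof -
  interpret comm_group G by fact
  show ?thesis
    using assms by (metis group.rcos_self group.repr_independence is_group subgroup.rcos_module)
qed

text \<open>Since \<open>f\<close> carries \<open>H\<close> into \<open>H'\<close>, all cosets in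
  the union coincide. This is the well-definedness of every operation that is defined by a union
  over representatives.\<close>

lemma coset_UN:
  assumes "comm_group G" "comm_group G'" "subgroup H G" "subgroup H' G'" "f \<in> hom G G'"
    and H: "\<And>h. h \<in> H \<Longrightarrow> f h \<in> H'" and "u \<in> carrier G"
  shows "(\<Union>p\<in>H #>\<^bsub>G\<^esub> u. H' #>\<^bsub>G'\<^esub> f p) = H' #>\<^bsub>G'\<^esub> f u"
proof -
  interpret G: comm_group G by fact
  interpret G': comm_group G' by fact
  interpret f: group_hom G G' f by (unfold_locales) fact
  have eq: "H' #>\<^bsub>G'\<^esub> f p = H' #>\<^bsub>G'\<^esub> f u" if "p \<in> H #>\<^bsub>G\<^esub> u" for p
  proof -
    have p: "p \<in> carrier G"
      using that assms G.r_coset_subset_G subgroup.subset by blast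
    have "p \<otimes>\<^bsub>G\<^esub> inv\<^bsub>G\<^esub> u \<in> H"
      using that assms by (meson G.is_group subgroup.rcos_module_imp)
    from H [OF this] show ?thesis
      using p assms by (subst coset_eq_iff) auto
  qed
  moreover have "u \<in> H #>\<^bsub>G\<^esub> u"
    using assms by (simp add: G.rcos_self)
  ultimately show ?thesis by blast
qed

lemma module_of_group_simps [simp]:
  "carrier (module_of_group G s) = carrier G"
  "add (module_of_group G s) = (\<otimes>\<^bsub>G\<^esub>)"
  "zero (module_of_group G s) = \<one>\<^bsub>G\<^esub>"
  "smult (module_of_group G s) = s"
  by (auto simp: module_of_group_def)

text \<open>The module laws are required only modulo \<open>H\<close>. On a free abelian group the
  operation (m, n) \<mapsto> (c m, n) is additive in the element but not in the scalar c, and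
  becomes a module action only after division by the relations.\<close>

lemma module_of_quotient:
  assumes K: "cring K" and G: "comm_group G" and H: "subgroup H G"
    and S: "\<And>c. c \<in> carrier K \<Longrightarrow> S c \<in> hom G G"
    and SH: "\<And>c h. c \<in> carrier K \<Longrightarrow> h \<in> H \<Longrightarrow> S c h \<in> H"
    and S_add: "\<And>c d u. c \<in> carrier K \<Longrightarrow> d \<in> carrier K \<Longrightarrow> u \<in> carrier G
        \<Longrightarrow> H #>\<^bsub>G\<^esub> S (c \<oplus>\<^bsub>K\<^esub> d) u = H #>\<^bsub>G\<^esub> (S c u \<otimes>\<^bsub>G\<^esub> S d u)"
    and S_mult: "\<And>c d u. c \<in> carrier K \<Longrightarrow> d \<in> carrier K \<Longrightarrow> u \<in> carrier G
        \<Longrightarrow> H #>\<^bsub>G\<^esub> S (c \<otimes>\<^bsub>K\<^esub> d) u = H #>\<^bsub>G\<^esub> S c (S d u)"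
    and S_one: "\<And>u. u \<in> carrier G \<Longrightarrow> H #>\<^bsub>G\<^esub> S \<one>\<^bsub>K\<^esub> u = H #>\<^bsub>G\<^esub> u"
  shows "module K (module_of_group (G Mod H) (\<lambda>c q. \<Union>p\<in>q. H #>\<^bsub>G\<^esub> S c p))"
proof -
  interpret K: cring K by fact
  interpret G: comm_group G by fact
  interpret H: normal H G using G.subgroup_imp_normal H by blast
  let ?M = "module_of_group (G Mod H) (\<lambda>c q. \<Union>p\<in>q. H #>\<^bsub>G\<^esub> S c p)"
  have carr: "carrier ?M = (\<lambda>u. H #>\<^bsub>G\<^esub> u) ` carrier G"
    by (simp add: carrier_FactGroup)
  have add: "(H #>\<^bsub>G\<^esub> u) \<oplus>\<^bsub>?M\<^esub> (H #>\<^bsub>G\<^esub> v) = H #>\<^bsub>G\<^esub> (u \<otimes>\<^bsub>G\<^esub> v)" if "u \<in> carrier G" "v \<in> carrier G" for u v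
    using that by (simp add: H.rcos_sum)
  have sm: "c \<odot>\<^bsub>?M\<^esub> (H #>\<^bsub>G\<^esub> u) = H #>\<^bsub>G\<^esub> S c u" if "c \<in> carrier K" "u \<in> carrier G" for c u
    using coset_UN [OF G G H H S [OF that(1)] SH that(2)] that by simp
  have cg: "comm_group (G Mod H)"
    using G.abelian_FactGroup H by blast
  interpret Q: comm_group "G Mod H" by (fact cg)
  have "abelian_group ?M"
  proof (rule abelian_groupI)
    fix X assume "X \<in> carrier ?M"
    then show "\<exists>Y\<in>carrier ?M. Y \<oplus>\<^bsub>?M\<^esub> X = \<zero>\<^bsub>?M\<^esub>"
      using Q.l_inv_ex [of X] by (simp del: mult_FactGroup one_FactGroup)
  qed (auto simp del: mult_FactGroup one_FactGroup simp: Q.m_ac)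
  moreover have cl: "S c u \<in> carrier G" if "c \<in> carrier K" "u \<in> carrier G" for c u
    using S [OF that(1)] that(2) by (auto simp: hom_def)
  ultimately show ?thesis
  proof (intro moduleI [OF K])
    fix c d X assume c: "c \<in> carrier K" and d: "d \<in> carrier K" and "X \<in> carrier ?M"
    then obtain u where u: "u \<in> carrier G" and X: "X = H #>\<^bsub>G\<^esub> u" using carr by auto
    show "(c \<oplus>\<^bsub>K\<^esub> d) \<odot>\<^bsub>?M\<^esub> X = c \<odot>\<^bsub>?M\<^esub> X \<oplus>\<^bsub>?M\<^esub> d \<odot>\<^bsub>?M\<^esub> X"
      unfolding X using c d u by (simp only: sm add cl S_add K.add.m_closed)
    show "(c \<otimes>\<^bsub>K\<^esub> d) \<odot>\<^bsub>?M\<^esub> X = c \<odot>\<^bsub>?M\<^esub> (d \<odot>\<^bsub>?M\<^esub> X)"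
      unfolding X using c d u by (simp only: sm cl S_mult K.m_closed)
  next
    fix c X Y assume c: "c \<in> carrier K" and "X \<in> carrier ?M" "Y \<in> carrier ?M"
    then obtain u v where u: "u \<in> carrier G" "v \<in> carrier G" and X: "X = H #>\<^bsub>G\<^esub> u" "Y = H #>\<^bsub>G\<^esub> v"
      using carr by auto
    have "S c (u \<otimes>\<^bsub>G\<^esub> v) = S c u \<otimes>\<^bsub>G\<^esub> S c v"
      using S [OF c] u by (auto simp: hom_def)
    then show "c \<odot>\<^bsub>?M\<^esub> (X \<oplus>\<^bsub>?M\<^esub> Y) = c \<odot>\<^bsub>?M\<^esub> X \<oplus>\<^bsub>?M\<^esub> c \<odot>\<^bsub>?M\<^esub> Y"
      unfolding X using c u by (simp only: sm add cl G.m_closed)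
  next
    fix c X assume c: "c \<in> carrier K" and "X \<in> carrier ?M"
    then obtain u where u: "u \<in> carrier G" and X: "X = H #>\<^bsub>G\<^esub> u" using carr by auto
    show "c \<odot>\<^bsub>?M\<^esub> X \<in> carrier ?M"
      unfolding X sm [OF c u] carr using cl [OF c u] by blast
  next
    fix X assume "X \<in> carrier ?M"
    then obtain u where u: "u \<in> carrier G" and X: "X = H #>\<^bsub>G\<^esub> u" using carr by auto
    show "\<one>\<^bsub>K\<^esub> \<odot>\<^bsub>?M\<^esub> X = X"
      unfolding X using u by (simp only: sm K.one_closed S_one)
  qed
qed

section \<open>Tensor products over a ring\<close>

lemma (in abelian_group) int_smult_zero: "[(0::int)] \<cdot> x = \<zero>"
  by (simp add: add_pow_def)

text \<open>Combinations with different supports can be added termwise only over a common finite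
  index set; the extra terms have coefficient zero.\<close>

lemma (in abelian_group) lincomb_superset:
  fixes p :: "'s \<Rightarrow>\<^sub>0 int"
  assumes "finite F" "Poly_Mapping.keys p \<subseteq> F" "f \<in> F \<rightarrow> carrier G"
  shows "(\<Oplus>s\<in>Poly_Mapping.keys p. [Poly_Mapping.lookup p s] \<cdot> f s)
    = (\<Oplus>s\<in>F. [Poly_Mapping.lookup p s] \<cdot> f s)"
  using assms
  by (intro add.finprod_mono_neutral_cong_left)
     (auto simp: in_keys_iff int_smult_zero Pi_iff add.int_pow_closed)

lemma (in abelian_group) lincomb_hom:
  fixes f :: "'s \<Rightarrow> 'a"
  assumes "f \<in> S \<rightarrow> carrier G"
  shows "(\<lambda>p. \<Oplus>s\<in>Poly_Mapping.keys p. [Poly_Mapping.lookup p s] \<cdot> f s)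
    \<in> hom (free_Abelian_group S) (add_monoid G)"
proof (rule homI)
  fix p q assume p: "p \<in> carrier (free_Abelian_group S)" and q: "q \<in> carrier (free_Abelian_group S)"
  let ?F = "Poly_Mapping.keys p \<union> Poly_Mapping.keys q"
  have F: "finite ?F" "f \<in> ?F \<rightarrow> carrier G"
    using p q assms by auto
  have *: "(\<Oplus>s\<in>Poly_Mapping.keys r. [Poly_Mapping.lookup r s] \<cdot> f s)
    = (\<Oplus>s\<in>?F. [Poly_Mapping.lookup r s] \<cdot> f s)" if "Poly_Mapping.keys r \<subseteq> ?F" for r :: "'s \<Rightarrow>\<^sub>0 int"
    using F that by (intro lincomb_superset) auto
  have "(\<Oplus>s\<in>?F. [Poly_Mapping.lookup (p + q) s] \<cdot> f s) =
    (\<Oplus>s\<in>?F. [Poly_Mapping.lookup p s] \<cdot> f s \<oplus> [Poly_Mapping.lookup q s] \<cdot> f s)"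
    using F by (intro add.finprod_cong') (auto simp: lookup_add Pi_iff add.int_pow_mult add.int_pow_closed)
  also have "\<dots> = (\<Oplus>s\<in>?F. [Poly_Mapping.lookup p s] \<cdot> f s) \<oplus> (\<Oplus>s\<in>?F. [Poly_Mapping.lookup q s] \<cdot> f s)"
    using F by (intro finsum_addf) (auto simp: Pi_iff add.int_pow_closed)
  finally show "(\<Oplus>s\<in>Poly_Mapping.keys (p \<otimes>\<^bsub>free_Abelian_group S\<^esub> q).
      [Poly_Mapping.lookup (p \<otimes>\<^bsub>free_Abelian_group S\<^esub> q) s] \<cdot> f s) =
    (\<Oplus>s\<in>Poly_Mapping.keys p. [Poly_Mapping.lookup p s] \<cdot> f s) \<otimes>\<^bsub>add_monoid G\<^esub>
    (\<Oplus>s\<in>Poly_Mapping.keys q. [Poly_Mapping.lookup q s] \<cdot> f s)"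
    using keys_add [of p q] by (simp add: *)
qed (use assms in \<open>auto simp: Pi_iff add.int_pow_closed intro!: add.finprod_closed\<close>)

text \<open>Linearity over \<open>K\<close> is demanded in each variable, not just biadditivity, so
  that the induced map on the tensor product is linear and not only additive.\<close>

definition balanced ::
  "('k, 'z) ring_scheme \<Rightarrow> 'a set \<Rightarrow> ('k, 'm) module \<Rightarrow> ('k, 'n) module \<Rightarrow> ('m \<Rightarrow> 'a \<Rightarrow> 'm)
    \<Rightarrow> ('a \<Rightarrow> 'n \<Rightarrow> 'n) \<Rightarrow> ('k, 'u) module \<Rightarrow> ('m \<Rightarrow> 'n \<Rightarrow> 'u) \<Rightarrow> bool" where
  "balanced K R M N ra la T \<phi> \<longleftrightarrow>
     (\<forall>m\<in>carrier M. linear_map K N T (\<phi> m)) \<and>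
     (\<forall>n\<in>carrier N. linear_map K M T (\<lambda>m. \<phi> m n)) \<and>
     (\<forall>m\<in>carrier M. \<forall>a\<in>R. \<forall>n\<in>carrier N. \<phi> (ra m a) n = \<phi> m (la a n))"

lemmas frag_induct = free_Abelian_group_induct [consumes 1, case_names zero diff single]

text \<open>The condition \<open>scalars\<close> realises each scalar of \<open>K\<close> by one
  element of \<open>R\<close> acting on both factors. It is what lets scalars cross the tensor sign,
  although the relations only mention \<open>R\<close>.\<close>

locale tensor_factors =
  fixes K :: "('k, 'z) ring_scheme" and R :: "'a set" and M :: "('k, 'm) module"
    and N :: "('k, 'n) module" and ra :: "'m \<Rightarrow> 'a \<Rightarrow> 'm" and la :: "'a \<Rightarrow> 'n \<Rightarrow> 'n"
  assumes M: "module K M" and N: "module K N"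
    and ra: "a \<in> R \<Longrightarrow> linear_map K M M (\<lambda>m. ra m a)"
    and la: "a \<in> R \<Longrightarrow> linear_map K N N (la a)"
    and scalars: "c \<in> carrier K
      \<Longrightarrow> \<exists>a\<in>R. (\<forall>m\<in>carrier M. ra m a = c \<odot>\<^bsub>M\<^esub> m) \<and> (\<forall>n\<in>carrier N. la a n = c \<odot>\<^bsub>N\<^esub> n)"
begin

abbreviation "F \<equiv> free_Abelian_group (carrier M \<times> carrier N)"
abbreviation "J \<equiv> tensor_ker R M N ra la"
abbreviation "MN \<equiv> tensor R M N ra la"
abbreviation "cls \<equiv> tensor_class R M N ra la"
abbreviation "pr m n \<equiv> cls (frag_of (m, n))"
abbreviation "scale c \<equiv> frag_extend (\<lambda>(m, n). frag_of (c \<odot>\<^bsub>M\<^esub> m, n))"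

sublocale M: module K M by (rule M)
sublocale N: module K N by (rule N)
sublocale F: comm_group F by (rule abelian_free_Abelian_group)

lemma ra_closed [simp]: "m \<in> carrier M \<Longrightarrow> a \<in> R \<Longrightarrow> ra m a \<in> carrier M"
  using linear_map_closed [OF ra] by blast

lemma la_closed [simp]: "n \<in> carrier N \<Longrightarrow> a \<in> R \<Longrightarrow> la a n \<in> carrier N"
  using linear_map_closed [OF la] by blast

lemma diff_in_F: "u \<in> carrier F \<Longrightarrow> v \<in> carrier F \<Longrightarrow> u - v \<in> carrier F"
  using keys_diff [of u v] by auto

lemma rels_subset: "tensor_rels R M N ra la \<subseteq> carrier F"
  unfolding tensor_rels_def
  by (auto intro!: diff_in_F simp del: carrier_free_Abelian_group_iff)

lemma J_subgroup: "subgroup J F"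
  unfolding tensor_ker_def by (rule F.generate_is_subgroup [OF rels_subset])

lemma rels_J: "u \<in> tensor_rels R M N ra la \<Longrightarrow> u \<in> J"
  unfolding tensor_ker_def by (rule generate.incl)

lemma cls_eq_iff: "u \<in> carrier F \<Longrightarrow> v \<in> carrier F \<Longrightarrow> cls u = cls v \<longleftrightarrow> u - v \<in> J"
  unfolding tensor_class_def using coset_eq_iff [OF F.comm_group_axioms J_subgroup, of u v] by simp

text \<open>The preimage of \<open>L\<close> is a subgroup containing the relations, hence contains
  the subgroup they generate. Scaling uses this with \<open>L\<close> equal to \<open>J\<close>,
  induced maps use it with the trivial subgroup.\<close>

lemma hom_kills_J:
  assumes "group H" "f \<in> hom F H" "\<And>u. u \<in> tensor_rels R M N ra la \<Longrightarrow> f u \<in> L" "subgroup L H" "u \<in> J"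
  shows "f u \<in> L"
proof -
  interpret f: group_hom F H f
    using assms by (simp add: group_hom_def group_hom_axioms_def)
  interpret L: subgroup L H by fact
  have "\<one>\<^bsub>F\<^esub> \<in> {u \<in> carrier F. f u \<in> L}"
    using f.hom_one subgroup.one_closed [OF \<open>subgroup L H\<close>] by simp
  then have "subgroup {u \<in> carrier F. f u \<in> L} F"
    using F.m_closed F.inv_closed f.hom_mult f.hom_inv
    by (intro F.subgroupI) (auto simp del: carrier_free_Abelian_group_iff mult_free_Abelian_group
         inv_free_Abelian_group one_free_Abelian_group)
  from F.generate_subgroup_incl [OF _ this, of "tensor_rels R M N ra la"]
  show ?thesis
    using assms rels_subset unfolding tensor_ker_def by blast
qed

lemma scale_hom: "c \<in> carrier K \<Longrightarrow> scale c \<in> hom F F"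
proof (rule homI)
  fix u assume c: "c \<in> carrier K" and "u \<in> carrier F"
  then have "Poly_Mapping.keys u \<subseteq> carrier M \<times> carrier N" by simp
  then show "scale c u \<in> carrier F"
    using keys_frag_extend [of "\<lambda>(m, n). frag_of (c \<odot>\<^bsub>M\<^esub> m, n)" u] c by fastforce
qed (simp add: frag_extend_add)

lemma rels_add_left:
  "m \<in> carrier M \<Longrightarrow> m' \<in> carrier M \<Longrightarrow> n \<in> carrier N
    \<Longrightarrow> frag_of (m \<oplus>\<^bsub>M\<^esub> m', n) - frag_of (m, n) - frag_of (m', n) \<in> tensor_rels R M N ra la"
  by (auto simp: tensor_rels_def)

lemma rels_add_right:
  "m \<in> carrier M \<Longrightarrow> n \<in> carrier N \<Longrightarrow> n' \<in> carrier N
    \<Longrightarrow> frag_of (m, n \<oplus>\<^bsub>N\<^esub> n') - frag_of (m, n) - frag_of (m, n') \<in> tensor_rels R M N ra la"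
  by (auto simp: tensor_rels_def)

lemma rels_balanced:
  "m \<in> carrier M \<Longrightarrow> a \<in> R \<Longrightarrow> n \<in> carrier N
    \<Longrightarrow> frag_of (ra m a, n) - frag_of (m, la a n) \<in> tensor_rels R M N ra la"
  by (auto simp: tensor_rels_def)

lemma rels_cases [consumes 1, case_names add_left add_right balanced]:
  assumes "u \<in> tensor_rels R M N ra la"
  obtains m m' n where "m \<in> carrier M" "m' \<in> carrier M" "n \<in> carrier N"
      "u = frag_of (m \<oplus>\<^bsub>M\<^esub> m', n) - frag_of (m, n) - frag_of (m', n)"
  | m n n' where "m \<in> carrier M" "n \<in> carrier N" "n' \<in> carrier N"
      "u = frag_of (m, n \<oplus>\<^bsub>N\<^esub> n') - frag_of (m, n) - frag_of (m, n')"
  | m a n where "m \<in> carrier M" "a \<in> R" "n \<in> carrier N"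
      "u = frag_of (ra m a, n) - frag_of (m, la a n)"
  using assms unfolding tensor_rels_def
proof (elim UnE CollectE exE conjE, goal_cases)
  case (1 m m' n) then show ?case by (intro that(1))
next
  case (2 m n n') then show ?case by (intro that(2))
next
  case (3 m a n) then show ?case by (intro that(3))
qed

lemma scale_rels:
  assumes c: "c \<in> carrier K" and u: "u \<in> tensor_rels R M N ra la"
  shows "scale c u \<in> tensor_rels R M N ra la"
  using u
proof (cases rule: rels_cases)
  case (add_left m m' n)
  have "scale c u = frag_of (c \<odot>\<^bsub>M\<^esub> m \<oplus>\<^bsub>M\<^esub> c \<odot>\<^bsub>M\<^esub> m', n) - frag_of (c \<odot>\<^bsub>M\<^esub> m, n) - frag_of (c \<odot>\<^bsub>M\<^esub> m', n)"
    using add_left c by (simp add: frag_extend_diff M.smult_r_distr)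
  then show ?thesis using add_left c by (simp only: rels_add_left M.smult_closed)
next
  case (add_right m n n')
  have "scale c u = frag_of (c \<odot>\<^bsub>M\<^esub> m, n \<oplus>\<^bsub>N\<^esub> n') - frag_of (c \<odot>\<^bsub>M\<^esub> m, n) - frag_of (c \<odot>\<^bsub>M\<^esub> m, n')"
    using add_right c by (simp add: frag_extend_diff)
  then show ?thesis using add_right c by (simp only: rels_add_right M.smult_closed)
next
  case (balanced m a n)
  have "scale c u = frag_of (ra (c \<odot>\<^bsub>M\<^esub> m) a, n) - frag_of (c \<odot>\<^bsub>M\<^esub> m, la a n)"
    using balanced c linear_map_smult [OF ra] by (simp add: frag_extend_diff)
  then show ?thesis using balanced c by (simp only: rels_balanced M.smult_closed)
qed

lemma scale_J: "c \<in> carrier K \<Longrightarrow> u \<in> J \<Longrightarrow> scale c u \<in> J"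
  using hom_kills_J [OF _ scale_hom] scale_rels rels_J J_subgroup F.is_group by blast

lemma carrier_MN: "carrier MN = cls ` carrier F"
  by (simp add: tensor_def carrier_FactGroup tensor_class_def [abs_def])

lemma J_normal: "J \<lhd> F"
  using F.subgroup_imp_normal J_subgroup by blast

lemma cls_add: "u \<in> carrier F \<Longrightarrow> v \<in> carrier F \<Longrightarrow> cls u \<oplus>\<^bsub>MN\<^esub> cls v = cls (u + v)"
  using normal.rcos_sum [OF J_normal, of u v] by (simp add: tensor_def tensor_class_def)

lemma cls_smult: "c \<in> carrier K \<Longrightarrow> u \<in> carrier F \<Longrightarrow> c \<odot>\<^bsub>MN\<^esub> cls u = cls (scale c u)"
  using coset_UN [OF F.comm_group_axioms F.comm_group_axioms J_subgroup J_subgroup scale_hom scale_J]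
  by (simp add: tensor_def tensor_class_def)

lemma cls_zero: "\<zero>\<^bsub>MN\<^esub> = cls 0"
  using F.coset_mult_one [OF subgroup.subset [OF J_subgroup]]
  by (simp add: tensor_def tensor_class_def)

lemma frag_of_F: "m \<in> carrier M \<Longrightarrow> n \<in> carrier N \<Longrightarrow> frag_of (m, n) \<in> carrier F"
  by simp

lemma pr_add_left:
  assumes "m \<in> carrier M" "m' \<in> carrier M" "n \<in> carrier N"
  shows "pr (m \<oplus>\<^bsub>M\<^esub> m') n = pr m n \<oplus>\<^bsub>MN\<^esub> pr m' n"
proof -
  have "frag_of (m \<oplus>\<^bsub>M\<^esub> m', n) - frag_of (m, n) - frag_of (m', n) \<in> J"
    using assms by (intro rels_J rels_add_left rels_add_right rels_balanced)
  moreover have "frag_of (m, n) + frag_of (m', n) \<in> carrier F"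
    using F.m_closed [OF frag_of_F frag_of_F] assms by simp
  ultimately show ?thesis
    using assms by (simp add: cls_add cls_eq_iff diff_diff_eq)
qed

lemma pr_add_right:
  assumes "m \<in> carrier M" "n \<in> carrier N" "n' \<in> carrier N"
  shows "pr m (n \<oplus>\<^bsub>N\<^esub> n') = pr m n \<oplus>\<^bsub>MN\<^esub> pr m n'"
proof -
  have "frag_of (m, n \<oplus>\<^bsub>N\<^esub> n') - frag_of (m, n) - frag_of (m, n') \<in> J"
    using assms by (intro rels_J rels_add_left rels_add_right rels_balanced)
  moreover have "frag_of (m, n) + frag_of (m, n') \<in> carrier F"
    using F.m_closed [OF frag_of_F frag_of_F] assms by simp
  ultimately show ?thesis
    using assms by (simp add: cls_add cls_eq_iff diff_diff_eq)
qed

lemma pr_balanced: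
  assumes "m \<in> carrier M" "a \<in> R" "n \<in> carrier N"
  shows "pr (ra m a) n = pr m (la a n)"
proof -
  have "frag_of (ra m a, n) - frag_of (m, la a n) \<in> J"
    using assms by (intro rels_J rels_add_left rels_add_right rels_balanced)
  then show ?thesis
    using assms by (simp add: cls_eq_iff)
qed

lemma pr_smult: "c \<in> carrier K \<Longrightarrow> m \<in> carrier M \<Longrightarrow> n \<in> carrier N \<Longrightarrow> pr (c \<odot>\<^bsub>M\<^esub> m) n = c \<odot>\<^bsub>MN\<^esub> pr m n"
  by (simp add: cls_smult)

lemma pr_smult_right:
  assumes c: "c \<in> carrier K" and "m \<in> carrier M" "n \<in> carrier N"
  shows "pr m (c \<odot>\<^bsub>N\<^esub> n) = c \<odot>\<^bsub>MN\<^esub> pr m n"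
proof -
  obtain a where "a \<in> R" "ra m a = c \<odot>\<^bsub>M\<^esub> m" "la a n = c \<odot>\<^bsub>N\<^esub> n"
    using scalars [OF c] assms by blast
  with pr_balanced [of m a n] pr_smult [of c m n] assms show ?thesis by simp
qed

text \<open>The two sides differ in the free group itself: on a generator their difference is
  exactly one relation of additivity in the left variable.\<close>

lemma scale_add_J:
  assumes "c \<in> carrier K" "d \<in> carrier K" "u \<in> carrier F"
  shows "scale (c \<oplus>\<^bsub>K\<^esub> d) u - (scale c u + scale d u) \<in> J"
proof -
  have "Poly_Mapping.keys u \<subseteq> carrier M \<times> carrier N"
    using assms by simp
  then show ?thesis
  proof (induction u rule: frag_induct)
    case zero
    then show ?case using subgroup.one_closed [OF J_subgroup] by simp
  next
    case (diff u v)
    let ?e = "\<lambda>w. scale (c \<oplus>\<^bsub>K\<^esub> d) w - (scale c w + scale d w)"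
    have J: "x \<in> J \<Longrightarrow> y \<in> J \<Longrightarrow> x - y \<in> J" for x y
      using subgroup.m_closed [OF J_subgroup, of x "inv\<^bsub>F\<^esub> y"] subgroup.m_inv_closed [OF J_subgroup]
        subgroup.mem_carrier [OF J_subgroup] by simp
    have "?e (u - v) = ?e u - ?e v"
      by (simp add: frag_extend_diff)
    then show ?case using J diff by simp
  next
    case (single s)
    obtain m n where "s = (m, n)" "m \<in> carrier M" "n \<in> carrier N" using single by auto
    then have "scale (c \<oplus>\<^bsub>K\<^esub> d) (frag_of s) - (scale c (frag_of s) + scale d (frag_of s))
       = frag_of (c \<odot>\<^bsub>M\<^esub> m \<oplus>\<^bsub>M\<^esub> d \<odot>\<^bsub>M\<^esub> m, n) - frag_of (c \<odot>\<^bsub>M\<^esub> m, n) - frag_of (d \<odot>\<^bsub>M\<^esub> m, n)"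
      using assms by (simp add: M.smult_l_distr)
    also have "\<dots> \<in> tensor_rels R M N ra la"
      using assms \<open>m \<in> carrier M\<close> \<open>n \<in> carrier N\<close> by (intro rels_add_left M.smult_closed)
    finally show ?case by (rule rels_J)
  qed
qed

lemma scale_mult:
  assumes "c \<in> carrier K" "d \<in> carrier K" "u \<in> carrier F"
  shows "scale (c \<otimes>\<^bsub>K\<^esub> d) u = scale c (scale d u)"
proof -
  have "Poly_Mapping.keys u \<subseteq> carrier M \<times> carrier N"
    using assms by simp
  then show ?thesis
    by (induction u rule: frag_induct)
       (use assms in \<open>auto simp: frag_extend_diff M.smult_assoc1\<close>)
qed

lemma scale_one:
  assumes "u \<in> carrier F"
  shows "scale \<one>\<^bsub>K\<^esub> u = u"
proof -
  have "Poly_Mapping.keys u \<subseteq> carrier M \<times> carrier N"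
    using assms by simp
  then show ?thesis
    by (induction u rule: frag_induct) (auto simp: frag_extend_diff)
qed

lemma scale_closed: "c \<in> carrier K \<Longrightarrow> u \<in> carrier F \<Longrightarrow> scale c u \<in> carrier F"
  using scale_hom by (auto simp: hom_def Pi_iff)

lemma tensor_module: "module K MN"
  unfolding tensor_def tensor_class_def
proof (rule module_of_quotient)
  fix c d u assume cdu: "c \<in> carrier K" "d \<in> carrier K" "u \<in> carrier F"
  have "scale c u + scale d u \<in> carrier F"
    using F.m_closed [OF scale_closed scale_closed, of c u d u] cdu by simp
  then show "J #>\<^bsub>F\<^esub> scale (c \<oplus>\<^bsub>K\<^esub> d) u = J #>\<^bsub>F\<^esub> (scale c u \<otimes>\<^bsub>F\<^esub> scale d u)"
    using cls_eq_iff [of "scale (c \<oplus>\<^bsub>K\<^esub> d) u" "scale c u + scale d u"] scale_add_J [OF cdu] cdu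
    unfolding tensor_class_def by (simp add: scale_closed del: carrier_free_Abelian_group_iff)
qed (auto simp: M.cring_axioms F.comm_group_axioms J_subgroup scale_hom scale_J scale_mult scale_one
      simp del: carrier_free_Abelian_group_iff)

lemma cls_closed: "u \<in> carrier F \<Longrightarrow> cls u \<in> carrier MN"
  by (auto simp: carrier_MN simp del: carrier_free_Abelian_group_iff)

lemma pr_balanced_map: "balanced K R M N ra la MN pr"
  unfolding balanced_def
  by (auto intro!: linear_mapI cls_closed
      simp: pr_add_left pr_add_right pr_balanced pr_smult pr_smult_right)

lemma cls_diff:
  assumes "u \<in> carrier F" "v \<in> carrier F"
  shows "cls (u - v) = cls u \<ominus>\<^bsub>MN\<^esub> cls v"
proof -
  interpret MN: module K MN by (rule tensor_module)
  have "cls u = cls (u - v) \<oplus>\<^bsub>MN\<^esub> cls v"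
    using cls_add [of "u - v" v] diff_in_F assms by simp
  then show ?thesis
    using cls_closed [OF assms(1)] cls_closed [OF assms(2)] cls_closed [OF diff_in_F [OF assms]]
    by (simp add: a_minus_def MN.a_assoc MN.r_neg)
qed

text \<open>Sums suffice, without differences, because the negative of a pure tensor is again pure:
  the sign moves into the left factor.\<close>

lemma tensor_induct [consumes 1, case_names pr add]:
  assumes t: "t \<in> carrier MN"
    and pr: "\<And>m n. m \<in> carrier M \<Longrightarrow> n \<in> carrier N \<Longrightarrow> Q (pr m n)"
    and add: "\<And>s t. s \<in> carrier MN \<Longrightarrow> t \<in> carrier MN \<Longrightarrow> Q s \<Longrightarrow> Q t \<Longrightarrow> Q (s \<oplus>\<^bsub>MN\<^esub> t)"
  shows "Q t"
proof -
  interpret MN: module K MN by (rule tensor_module)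
  have lin: "linear_map K M MN (\<lambda>m. pr m n)" if "n \<in> carrier N" for n
    using pr_balanced_map that by (auto simp: balanced_def)
  obtain u where u: "u \<in> carrier F" and t: "t = cls u"
    using t carrier_MN by auto
  from u have "Poly_Mapping.keys u \<subseteq> carrier M \<times> carrier N" by simp
  \<comment> \<open>Induction on the free group produces differences, so the claim is carried for an
    element together with its negative.\<close>
  then have "Q (cls u) \<and> Q (\<ominus>\<^bsub>MN\<^esub> cls u)"
  proof (induction u rule: frag_induct)
    case zero
    have "pr \<zero>\<^bsub>M\<^esub> \<zero>\<^bsub>N\<^esub> = \<zero>\<^bsub>MN\<^esub>"
      using linear_map_zero [OF M tensor_module lin, of "\<zero>\<^bsub>N\<^esub>"] by simp
    moreover have "\<ominus>\<^bsub>MN\<^esub> \<zero>\<^bsub>MN\<^esub> = \<zero>\<^bsub>MN\<^esub>"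
      by (rule MN.minus_equality) simp_all
    ultimately show ?case
      using pr [of "\<zero>\<^bsub>M\<^esub>" "\<zero>\<^bsub>N\<^esub>"] by (simp only: M.zero_closed N.zero_closed flip: cls_zero)
  next
    case (diff u v)
    then have uv: "cls u \<in> carrier MN" "cls v \<in> carrier MN" by (auto intro: cls_closed)
    have "cls (u - v) = cls u \<oplus>\<^bsub>MN\<^esub> (\<ominus>\<^bsub>MN\<^esub> cls v)"
      using cls_diff [of u v] diff by (simp add: a_minus_def)
    moreover from this have "\<ominus>\<^bsub>MN\<^esub> cls (u - v) = cls v \<oplus>\<^bsub>MN\<^esub> (\<ominus>\<^bsub>MN\<^esub> cls u)"
      using uv by (simp add: MN.minus_add MN.a_comm)
    ultimately show ?case
      using diff uv add by simp
  next
    case (single s)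
    then obtain m n where s: "s = (m, n)" "m \<in> carrier M" "n \<in> carrier N" by auto
    then have "\<ominus>\<^bsub>MN\<^esub> pr m n = pr (\<ominus>\<^bsub>M\<^esub> m) n"
      using linear_map_minus [OF M tensor_module lin] by simp
    then show ?case
      using s pr [of m n] pr [of "\<ominus>\<^bsub>M\<^esub> m" n] by simp
  qed
  then show ?thesis using t by simp
qed

context
  fixes T :: "('k, 'u) module" and \<phi> :: "'m \<Rightarrow> 'n \<Rightarrow> 'u"
  assumes T: "module K T" and bal: "balanced K R M N ra la T \<phi>"
begin

interpretation T: module K T by (rule T)

abbreviation (input) "ev p \<equiv> \<Oplus>\<^bsub>T\<^esub>s\<in>Poly_Mapping.keys p. [Poly_Mapping.lookup p s] \<cdot>\<^bsub>T\<^esub> case_prod \<phi> s"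

lemma lift_fun_closed: "case_prod \<phi> \<in> carrier M \<times> carrier N \<rightarrow> carrier T"
  using bal by (auto simp: balanced_def intro: linear_map_closed)

lemma ev_hom: "ev \<in> hom F (add_monoid T)"
  by (rule T.lincomb_hom [OF lift_fun_closed])

lemma ev_frag_of:
  assumes "m \<in> carrier M" "n \<in> carrier N"
  shows "ev (frag_of (m, n)) = \<phi> m n"
proof -
  have "\<phi> m n \<in> carrier T"
    using lift_fun_closed assms by (auto simp: Pi_iff)
  then show ?thesis
    by (simp add: keys_frag_of T.add.int_pow_1)
qed

lemma ev_add: "u \<in> carrier F \<Longrightarrow> v \<in> carrier F \<Longrightarrow> ev (u + v) = ev u \<oplus>\<^bsub>T\<^esub> ev v"
  using hom_mult [OF ev_hom, of u v] by simp

lemma ev_closed: "u \<in> carrier F \<Longrightarrow> ev u \<in> carrier T"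
  using ev_hom by (auto simp: hom_def Pi_iff)

lemma ev_diff: "u \<in> carrier F \<Longrightarrow> v \<in> carrier F \<Longrightarrow> ev (u - v) = ev u \<ominus>\<^bsub>T\<^esub> ev v"
  using ev_add [of "u - v" v] diff_in_F [of u v] ev_closed [of v] ev_closed [of "u - v"]
  by (simp add: T.minus_eq T.a_assoc T.r_neg del: carrier_free_Abelian_group_iff)

lemma ev_rels:
  assumes "u \<in> tensor_rels R M N ra la"
  shows "ev u = \<zero>\<^bsub>T\<^esub>"
proof -
  have lin: "\<And>m. m \<in> carrier M \<Longrightarrow> linear_map K N T (\<phi> m)"
    "\<And>n. n \<in> carrier N \<Longrightarrow> linear_map K M T (\<lambda>m. \<phi> m n)"
    "\<And>m a n. m \<in> carrier M \<Longrightarrow> a \<in> R \<Longrightarrow> n \<in> carrier N \<Longrightarrow> \<phi> (ra m a) n = \<phi> m (la a n)"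
    using bal by (auto simp: balanced_def)
  have cl: "\<phi> m n \<in> carrier T" if "m \<in> carrier M" "n \<in> carrier N" for m n
    using linear_map_closed [OF lin(1)] that by blast
  have z: "x \<oplus>\<^bsub>T\<^esub> y \<ominus>\<^bsub>T\<^esub> x \<ominus>\<^bsub>T\<^esub> y = \<zero>\<^bsub>T\<^esub>" if "x \<in> carrier T" "y \<in> carrier T" for x y
    using that by (simp add: T.minus_eq T.a_comm [of x y] T.a_assoc T.r_neg)
  note d = ev_diff [OF diff_in_F [OF frag_of_F frag_of_F] frag_of_F] ev_diff [OF frag_of_F frag_of_F]
  show ?thesis
    using assms
  proof (cases rule: rels_cases)
    case (add_left m m' n)
    then show ?thesis
      using linear_map_add [OF lin(2)] z cl by (simp only: d ev_frag_of M.a_closed)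
  next
    case (add_right m n n')
    then show ?thesis
      using linear_map_add [OF lin(1)] z cl by (simp only: d ev_frag_of N.a_closed)
  next
    case (balanced m a n)
    then show ?thesis
      using lin(3) cl
      by (simp only: d ev_frag_of ra_closed la_closed) (simp add: T.r_neg T.minus_eq)
  qed
qed

lemma ev_J: "u \<in> J \<Longrightarrow> ev u = \<zero>\<^bsub>T\<^esub>"
  using hom_kills_J [OF T.a_group ev_hom, of "{\<zero>\<^bsub>T\<^esub>}" u] ev_rels
    group.triv_subgroup [OF T.a_group] by simp

text \<open>Evaluation kills \<open>J\<close> and is therefore constant on a coset, so its image is
  a singleton and \<open>the_elem\<close> returns the value at any representative.\<close>

lemma tensor_lift_cls:
  assumes "u \<in> carrier F"
  shows "tensor_lift T \<phi> (cls u) = ev u"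
proof -
  have "ev p = ev u" if "p \<in> cls u" for p
  proof -
    obtain j where j: "j \<in> J" and p: "p = j + u"
      using \<open>p \<in> cls u\<close> unfolding tensor_class_def r_coset_def by auto
    then have "ev p = ev j \<oplus>\<^bsub>T\<^esub> ev u"
      using assms subgroup.mem_carrier [OF J_subgroup j] by (simp only: ev_add)
    then show ?thesis
      using ev_J [OF j] ev_closed [OF assms] by simp
  qed
  moreover have "u \<in> cls u"
    unfolding tensor_class_def using F.rcos_self [OF assms J_subgroup] .
  ultimately have "ev ` cls u = {ev u}" by blast
  then show ?thesis
    unfolding tensor_lift_def by simp
qed

lemma tensor_lift_pr:
  "m \<in> carrier M \<Longrightarrow> n \<in> carrier N \<Longrightarrow> tensor_lift T \<phi> (pr m n) = \<phi> m n"
  by (simp only: tensor_lift_cls frag_of_F ev_frag_of)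

lemma tensor_lift_add:
  assumes "s \<in> carrier MN" "t \<in> carrier MN"
  shows "tensor_lift T \<phi> (s \<oplus>\<^bsub>MN\<^esub> t) = tensor_lift T \<phi> s \<oplus>\<^bsub>T\<^esub> tensor_lift T \<phi> t"
proof -
  obtain u v where uv: "u \<in> carrier F" "v \<in> carrier F" and s: "s = cls u" and t: "t = cls v"
    using assms carrier_MN by auto
  have "u + v \<in> carrier F"
    using F.m_closed [OF uv] by simp
  then show ?thesis
    unfolding s t using uv by (simp only: cls_add tensor_lift_cls ev_add)
qed

lemma tensor_lift_linear: "linear_map K MN T (tensor_lift T \<phi>)"
proof (rule linear_mapI)
  show cl: "tensor_lift T \<phi> t \<in> carrier T" if "t \<in> carrier MN" for t
  proof -
    from that obtain u where "u \<in> carrier F" "t = cls u" unfolding carrier_MN by (elim imageE)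
    then show ?thesis by (simp only: tensor_lift_cls ev_closed)
  qed
  interpret MN: module K MN by (rule tensor_module)
  fix c t assume c: "c \<in> carrier K" and t: "t \<in> carrier MN"
  show "tensor_lift T \<phi> (c \<odot>\<^bsub>MN\<^esub> t) = c \<odot>\<^bsub>T\<^esub> tensor_lift T \<phi> t"
    using t
  proof (induction t rule: tensor_induct)
    case (pr m n)
    then have "linear_map K M T (\<lambda>m. \<phi> m n)" using bal by (auto simp: balanced_def)
    then show ?case
      using pr c linear_map_smult [of K M T "\<lambda>m. \<phi> m n" c m]
      by (simp only: pr_smult [symmetric] tensor_lift_pr M.smult_closed)
  next
    case (add s t)
    then show ?case
      using c cl by (simp only: MN.smult_r_distr MN.smult_closed tensor_lift_add T.smult_r_distr)
  qed
qed (rule tensor_lift_add)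

end

end

section \<open>Direct sums\<close>

definition single_at :: "'i set \<Rightarrow> ('i \<Rightarrow> ('k, 'm) module) \<Rightarrow> 'i \<Rightarrow> 'm \<Rightarrow> 'i \<Rightarrow> 'm" where
  "single_at I T z u = (\<lambda>i\<in>I. if i = z then u else \<zero>\<^bsub>T i\<^esub>)"

lemma direct_sum_simps [simp]:
  "zero (direct_sum I T) = (\<lambda>i\<in>I. \<zero>\<^bsub>T i\<^esub>)"
  "add (direct_sum I T) = (\<lambda>s t. \<lambda>i\<in>I. s i \<oplus>\<^bsub>T i\<^esub> t i)"
  "smult (direct_sum I T) = (\<lambda>c t. \<lambda>i\<in>I. c \<odot>\<^bsub>T i\<^esub> t i)"
  by (simp_all add: direct_sum_def)

lemma direct_sum_carrier_iff:
  "t \<in> carrier (direct_sum I T) \<longleftrightarrow>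
    t \<in> extensional I \<and> (\<forall>i\<in>I. t i \<in> carrier (T i)) \<and> finite {i \<in> I. t i \<noteq> \<zero>\<^bsub>T i\<^esub>}"
  by (auto simp: direct_sum_def PiE_iff)

locale module_family =
  fixes K :: "('k, 'z) ring_scheme" and I :: "'i set" and T :: "'i \<Rightarrow> ('k, 'm) module"
  assumes family: "i \<in> I \<Longrightarrow> module K (T i)" and cring: "cring K"
begin

abbreviation "D \<equiv> direct_sum I T"

lemma family_simps:
  assumes "i \<in> I"
  shows "\<zero>\<^bsub>T i\<^esub> \<in> carrier (T i)"
    and "u \<in> carrier (T i) \<Longrightarrow> v \<in> carrier (T i) \<Longrightarrow> u \<oplus>\<^bsub>T i\<^esub> v \<in> carrier (T i)"
    and "u \<in> carrier (T i) \<Longrightarrow> \<ominus>\<^bsub>T i\<^esub> u \<in> carrier (T i)"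
    and "u \<in> carrier (T i) \<Longrightarrow> u \<oplus>\<^bsub>T i\<^esub> \<zero>\<^bsub>T i\<^esub> = u"
    and "u \<in> carrier (T i) \<Longrightarrow> \<zero>\<^bsub>T i\<^esub> \<oplus>\<^bsub>T i\<^esub> u = u"
    and "u \<in> carrier (T i) \<Longrightarrow> \<ominus>\<^bsub>T i\<^esub> u \<oplus>\<^bsub>T i\<^esub> u = \<zero>\<^bsub>T i\<^esub>"
    and "c \<in> carrier K \<Longrightarrow> u \<in> carrier (T i) \<Longrightarrow> c \<odot>\<^bsub>T i\<^esub> u \<in> carrier (T i)"
    and "c \<in> carrier K \<Longrightarrow> c \<odot>\<^bsub>T i\<^esub> \<zero>\<^bsub>T i\<^esub> = \<zero>\<^bsub>T i\<^esub>"
    and "\<ominus>\<^bsub>T i\<^esub> \<zero>\<^bsub>T i\<^esub> = \<zero>\<^bsub>T i\<^esub>"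
proof -
  interpret Ti: module K "T i" using assms by (rule family)
  show "\<ominus>\<^bsub>T i\<^esub> \<zero>\<^bsub>T i\<^esub> = \<zero>\<^bsub>T i\<^esub>"
    by (rule Ti.minus_equality) simp_all
qed (use family [OF assms] in \<open>auto simp: module.axioms module.smult_closed module.smult_r_null
  abelian_group.a_inv_closed abelian_monoid.zero_closed
  abelian_monoid.a_closed abelian_monoid.r_zero abelian_monoid.l_zero abelian_group.l_neg
  abelian_group.axioms\<close>)

lemma family_ac:
  assumes "i \<in> I" "u \<in> carrier (T i)" "v \<in> carrier (T i)"
  shows "u \<oplus>\<^bsub>T i\<^esub> v = v \<oplus>\<^bsub>T i\<^esub> u"
    and "w \<in> carrier (T i) \<Longrightarrow> u \<oplus>\<^bsub>T i\<^esub> v \<oplus>\<^bsub>T i\<^esub> w = u \<oplus>\<^bsub>T i\<^esub> (v \<oplus>\<^bsub>T i\<^esub> w)"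
proof -
  interpret Ti: module K "T i" using assms by (intro family)
  show "u \<oplus>\<^bsub>T i\<^esub> v = v \<oplus>\<^bsub>T i\<^esub> u"
    using assms by (intro Ti.a_comm)
  show "u \<oplus>\<^bsub>T i\<^esub> v \<oplus>\<^bsub>T i\<^esub> w = u \<oplus>\<^bsub>T i\<^esub> (v \<oplus>\<^bsub>T i\<^esub> w)" if "w \<in> carrier (T i)"
    using assms that by (intro Ti.a_assoc)
qed

lemma family_smult:
  assumes "i \<in> I" "c \<in> carrier K" "u \<in> carrier (T i)"
  shows "d \<in> carrier K \<Longrightarrow> (c \<oplus>\<^bsub>K\<^esub> d) \<odot>\<^bsub>T i\<^esub> u = c \<odot>\<^bsub>T i\<^esub> u \<oplus>\<^bsub>T i\<^esub> d \<odot>\<^bsub>T i\<^esub> u"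
    and "v \<in> carrier (T i) \<Longrightarrow> c \<odot>\<^bsub>T i\<^esub> (u \<oplus>\<^bsub>T i\<^esub> v) = c \<odot>\<^bsub>T i\<^esub> u \<oplus>\<^bsub>T i\<^esub> c \<odot>\<^bsub>T i\<^esub> v"
    and "d \<in> carrier K \<Longrightarrow> (c \<otimes>\<^bsub>K\<^esub> d) \<odot>\<^bsub>T i\<^esub> u = c \<odot>\<^bsub>T i\<^esub> (d \<odot>\<^bsub>T i\<^esub> u)"
    and "\<one>\<^bsub>K\<^esub> \<odot>\<^bsub>T i\<^esub> u = u"
proof -
  interpret Ti: module K "T i" using assms by (intro family)
  show "\<one>\<^bsub>K\<^esub> \<odot>\<^bsub>T i\<^esub> u = u" using assms by simp
  show "d \<in> carrier K \<Longrightarrow> (c \<oplus>\<^bsub>K\<^esub> d) \<odot>\<^bsub>T i\<^esub> u = c \<odot>\<^bsub>T i\<^esub> u \<oplus>\<^bsub>T i\<^esub> d \<odot>\<^bsub>T i\<^esub> u"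
    "v \<in> carrier (T i) \<Longrightarrow> c \<odot>\<^bsub>T i\<^esub> (u \<oplus>\<^bsub>T i\<^esub> v) = c \<odot>\<^bsub>T i\<^esub> u \<oplus>\<^bsub>T i\<^esub> c \<odot>\<^bsub>T i\<^esub> v"
    "d \<in> carrier K \<Longrightarrow> (c \<otimes>\<^bsub>K\<^esub> d) \<odot>\<^bsub>T i\<^esub> u = c \<odot>\<^bsub>T i\<^esub> (d \<odot>\<^bsub>T i\<^esub> u)"
    using assms by (auto simp: Ti.smult_l_distr Ti.smult_r_distr Ti.smult_assoc1)
qed

lemma add_in_D:
  assumes "s \<in> carrier D" "t \<in> carrier D"
  shows "s \<oplus>\<^bsub>D\<^esub> t \<in> carrier D"
proof -
  have "{i \<in> I. s i \<oplus>\<^bsub>T i\<^esub> t i \<noteq> \<zero>\<^bsub>T i\<^esub>} \<subseteq> {i \<in> I. s i \<noteq> \<zero>\<^bsub>T i\<^esub>} \<union> {i \<in> I. t i \<noteq> \<zero>\<^bsub>T i\<^esub>}"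
    by (auto simp: family_simps)
  then have "finite {i \<in> I. s i \<oplus>\<^bsub>T i\<^esub> t i \<noteq> \<zero>\<^bsub>T i\<^esub>}"
    by (rule finite_subset) (use assms in \<open>simp add: direct_sum_carrier_iff\<close>)
  then show ?thesis
    using assms by (auto simp: direct_sum_carrier_iff family_simps cong: conj_cong)
qed

lemma D_module: "module K D"
proof (rule moduleI)
  show "abelian_group D"
  proof (rule abelian_groupI)
    show "\<zero>\<^bsub>D\<^esub> \<in> carrier D"
      by (auto simp: direct_sum_carrier_iff family_simps cong: conj_cong)
    fix t assume t: "t \<in> carrier D"
    have "{i \<in> I. \<ominus>\<^bsub>T i\<^esub> t i \<noteq> \<zero>\<^bsub>T i\<^esub>} \<subseteq> {i \<in> I. t i \<noteq> \<zero>\<^bsub>T i\<^esub>}"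
      by (auto simp: family_simps)
    then have "(\<lambda>i\<in>I. \<ominus>\<^bsub>T i\<^esub> t i) \<in> carrier D"
      using t by (auto simp: direct_sum_carrier_iff family_simps finite_subset cong: conj_cong)
    moreover have "(\<lambda>i\<in>I. \<ominus>\<^bsub>T i\<^esub> t i) \<oplus>\<^bsub>D\<^esub> t = \<zero>\<^bsub>D\<^esub>"
      using t by (auto simp: direct_sum_carrier_iff family_simps)
    ultimately show "\<exists>s\<in>carrier D. s \<oplus>\<^bsub>D\<^esub> t = \<zero>\<^bsub>D\<^esub>" by blast
    show "\<zero>\<^bsub>D\<^esub> \<oplus>\<^bsub>D\<^esub> t = t"
      using t by (auto simp: direct_sum_carrier_iff family_simps fun_eq_iff extensional_def)
  next
    fix r s t assume "r \<in> carrier D" "s \<in> carrier D" "t \<in> carrier D"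
    then show "r \<oplus>\<^bsub>D\<^esub> s \<oplus>\<^bsub>D\<^esub> t = r \<oplus>\<^bsub>D\<^esub> (s \<oplus>\<^bsub>D\<^esub> t)"
      by (auto simp: direct_sum_carrier_iff intro!: restrict_ext family_ac(2))
  next
    fix s t assume "s \<in> carrier D" "t \<in> carrier D"
    then show "s \<oplus>\<^bsub>D\<^esub> t = t \<oplus>\<^bsub>D\<^esub> s"
      by (auto simp: direct_sum_carrier_iff intro!: restrict_ext family_ac(1))
  qed (rule add_in_D)
  fix c t assume c: "c \<in> carrier K" and t: "t \<in> carrier D"
  have "{i \<in> I. c \<odot>\<^bsub>T i\<^esub> t i \<noteq> \<zero>\<^bsub>T i\<^esub>} \<subseteq> {i \<in> I. t i \<noteq> \<zero>\<^bsub>T i\<^esub>}"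
    using c by (auto simp: family_simps)
  then show "c \<odot>\<^bsub>D\<^esub> t \<in> carrier D"
    using t c by (auto simp: direct_sum_carrier_iff family_simps finite_subset cong: conj_cong)
next
  interpret K: cring K by (rule cring)
  fix t assume "t \<in> carrier D"
  then show "\<one>\<^bsub>K\<^esub> \<odot>\<^bsub>D\<^esub> t = t"
    by (auto simp: direct_sum_carrier_iff family_smult(4) [OF _ K.zero_closed] fun_eq_iff extensional_def)
next
  fix c d t assume "c \<in> carrier K" "d \<in> carrier K" "t \<in> carrier D"
  then show "(c \<oplus>\<^bsub>K\<^esub> d) \<odot>\<^bsub>D\<^esub> t = c \<odot>\<^bsub>D\<^esub> t \<oplus>\<^bsub>D\<^esub> d \<odot>\<^bsub>D\<^esub> t"
    "(c \<otimes>\<^bsub>K\<^esub> d) \<odot>\<^bsub>D\<^esub> t = c \<odot>\<^bsub>D\<^esub> (d \<odot>\<^bsub>D\<^esub> t)"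
    by (auto simp: direct_sum_carrier_iff intro!: restrict_ext family_smult)
next
  fix c s t assume "c \<in> carrier K" "s \<in> carrier D" "t \<in> carrier D"
  then show "c \<odot>\<^bsub>D\<^esub> (s \<oplus>\<^bsub>D\<^esub> t) = c \<odot>\<^bsub>D\<^esub> s \<oplus>\<^bsub>D\<^esub> c \<odot>\<^bsub>D\<^esub> t"
    by (auto simp: direct_sum_carrier_iff intro!: restrict_ext family_smult(2))
qed (rule cring)

lemma single_in_D: "z \<in> I \<Longrightarrow> u \<in> carrier (T z) \<Longrightarrow> single_at I T z u \<in> carrier D"
proof -
  assume "z \<in> I" "u \<in> carrier (T z)"
  moreover have "finite {i \<in> I. i = z \<and> u \<noteq> \<zero>\<^bsub>T z\<^esub>}"
    by (rule finite_subset [of _ "{z}"]) auto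
  ultimately show ?thesis
    by (auto simp: direct_sum_carrier_iff single_at_def family_simps if_distrib
        intro: finite_subset [of _ "{z}"] cong: conj_cong if_cong)
qed

lemma single_linear: "z \<in> I \<Longrightarrow> linear_map K (T z) D (single_at I T z)"
  by (rule linear_mapI) (auto simp: single_in_D, auto simp: single_at_def family_simps)

lemma component_linear: "z \<in> I \<Longrightarrow> linear_map K D (T z) (\<lambda>t. t z)"
  by (rule linear_mapI) (auto simp: direct_sum_carrier_iff)

text \<open>Induction on the finite support, splitting off one component at a time. The index set
  must be nonempty because the zero element is reached as a \<open>single_at\<close> with value
  zero.\<close>

lemma D_induct [consumes 2, case_names single add]:
  assumes t: "t \<in> carrier D" and "I \<noteq> {}"
    and single: "\<And>z u. z \<in> I \<Longrightarrow> u \<in> carrier (T z) \<Longrightarrow> Q (single_at I T z u)"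
    and add: "\<And>s t. s \<in> carrier D \<Longrightarrow> t \<in> carrier D \<Longrightarrow> Q s \<Longrightarrow> Q t \<Longrightarrow> Q (s \<oplus>\<^bsub>D\<^esub> t)"
  shows "Q t"
proof -
  have "finite J \<Longrightarrow> \<forall>t. t \<in> carrier D \<and> {i \<in> I. t i \<noteq> \<zero>\<^bsub>T i\<^esub>} = J \<longrightarrow> Q t" for J
  proof (induction J rule: finite_induct)
    case empty
    obtain z where z: "z \<in> I" using \<open>I \<noteq> {}\<close> by blast
    show ?case
    proof (intro allI impI)
      fix t assume "t \<in> carrier D \<and> {i \<in> I. t i \<noteq> \<zero>\<^bsub>T i\<^esub>} = {}"
      then have "t = single_at I T z \<zero>\<^bsub>T z\<^esub>"
        by (auto simp: single_at_def fun_eq_iff direct_sum_carrier_iff extensional_def)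
      then show "Q t" using single z family_simps by auto
    qed
  next
    case (insert z J)
    show ?case
    proof (intro allI impI)
      fix t assume t: "t \<in> carrier D \<and> {i \<in> I. t i \<noteq> \<zero>\<^bsub>T i\<^esub>} = insert z J"
      then have z: "z \<in> I" and tz: "t z \<in> carrier (T z)" by (auto simp: direct_sum_carrier_iff)
      define s where "s = (\<lambda>i\<in>I. if i = z then \<zero>\<^bsub>T z\<^esub> else t i)"
      have supp: "{i \<in> I. s i \<noteq> \<zero>\<^bsub>T i\<^esub>} = J"
        using t insert.hyps z by (auto simp: s_def)
      then have s: "s \<in> carrier D"
        using t insert.hyps by (auto simp: direct_sum_carrier_iff s_def family_simps)
      have "t = s \<oplus>\<^bsub>D\<^esub> single_at I T z (t z)"
        using t z by (auto simp: direct_sum_carrier_iff s_def single_at_def family_simps fun_eq_iff extensional_def)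
      moreover have "Q s" using insert.IH s supp by blast
      ultimately show "Q t"
        using add s single_in_D [OF z tz] single [OF z tz] by metis
    qed
  qed
  then show ?thesis
    using t by (auto simp: direct_sum_carrier_iff)
qed

context
  fixes X :: "('k, 'u) module" and f :: "'i \<Rightarrow> 'm \<Rightarrow> 'u"
  assumes X: "module K X" and f: "\<And>i. i \<in> I \<Longrightarrow> linear_map K (T i) X (f i)"
begin

interpretation X: module K X by (rule X)

abbreviation (input) "fsum t \<equiv> \<Oplus>\<^bsub>X\<^esub>i\<in>{i \<in> I. t i \<noteq> \<zero>\<^bsub>T i\<^esub>}. f i (t i)"

lemma f_closed: "i \<in> I \<Longrightarrow> u \<in> carrier (T i) \<Longrightarrow> f i u \<in> carrier X"
  using linear_map_closed [OF f] .

lemma f_zero: "i \<in> I \<Longrightarrow> f i \<zero>\<^bsub>T i\<^esub> = \<zero>\<^bsub>X\<^esub>"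
  using linear_map_zero [OF family X f] .

lemma fsum_superset:
  assumes "t \<in> carrier D" "finite J" "J \<subseteq> I" "{i \<in> I. t i \<noteq> \<zero>\<^bsub>T i\<^esub>} \<subseteq> J"
  shows "fsum t = (\<Oplus>\<^bsub>X\<^esub>i\<in>J. f i (t i))"
proof (rule X.add.finprod_mono_neutral_cong_left)
  show "f i (t i) = \<zero>\<^bsub>X\<^esub>" if "i \<in> J - {i \<in> I. t i \<noteq> \<zero>\<^bsub>T i\<^esub>}" for i
    using that f_zero assms by auto
  show "(\<lambda>i. f i (t i)) \<in> J \<rightarrow> carrier X"
    using assms f_closed by (auto simp: direct_sum_carrier_iff)
qed (use assms in auto)

lemma fsum_linear: "linear_map K D X fsum"
proof (rule linear_mapI)
  have fin: "finite {i \<in> I. t i \<noteq> \<zero>\<^bsub>T i\<^esub>}" and cl: "(\<lambda>i. f i (t i)) \<in> I \<rightarrow> carrier X"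
    and mem: "\<And>i. i \<in> I \<Longrightarrow> t i \<in> carrier (T i)" if "t \<in> carrier D" for t
    using that f_closed by (auto simp: direct_sum_carrier_iff)
  show "fsum t \<in> carrier X" if "t \<in> carrier D" for t
    using cl [OF that] by (intro X.finsum_closed) auto
  show "fsum (s \<oplus>\<^bsub>D\<^esub> t) = fsum s \<oplus>\<^bsub>X\<^esub> fsum t" if s: "s \<in> carrier D" and t: "t \<in> carrier D" for s t
  proof -
    let ?J = "{i \<in> I. s i \<noteq> \<zero>\<^bsub>T i\<^esub>} \<union> {i \<in> I. t i \<noteq> \<zero>\<^bsub>T i\<^esub>}"
    have J: "finite ?J" "?J \<subseteq> I" using fin s t by auto
    have "fsum (s \<oplus>\<^bsub>D\<^esub> t) = (\<Oplus>\<^bsub>X\<^esub>i\<in>?J. f i ((s \<oplus>\<^bsub>D\<^esub> t) i))"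
      using s t J by (intro fsum_superset add_in_D) (auto simp: family_simps)
    also have "\<dots> = (\<Oplus>\<^bsub>X\<^esub>i\<in>?J. f i (s i) \<oplus>\<^bsub>X\<^esub> f i (t i))"
      using cl [OF s] cl [OF t] mem [OF s] mem [OF t]
      by (intro X.add.finprod_cong') (auto simp: linear_map_add [OF f])
    also have "\<dots> = (\<Oplus>\<^bsub>X\<^esub>i\<in>?J. f i (s i)) \<oplus>\<^bsub>X\<^esub> (\<Oplus>\<^bsub>X\<^esub>i\<in>?J. f i (t i))"
      using cl [OF s] cl [OF t] J by (intro X.finsum_addf) auto
    also have "\<dots> = fsum s \<oplus>\<^bsub>X\<^esub> fsum t"
      using fsum_superset [OF s J] fsum_superset [OF t J] by auto
    finally show ?thesis .
  qed
  show "fsum (c \<odot>\<^bsub>D\<^esub> t) = c \<odot>\<^bsub>X\<^esub> fsum t" if c: "c \<in> carrier K" and t: "t \<in> carrier D" for c t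
  proof -
    let ?J = "{i \<in> I. t i \<noteq> \<zero>\<^bsub>T i\<^esub>}"
    have J: "finite ?J" "?J \<subseteq> I" using fin t by auto
    have "fsum (c \<odot>\<^bsub>D\<^esub> t) = (\<Oplus>\<^bsub>X\<^esub>i\<in>?J. f i ((c \<odot>\<^bsub>D\<^esub> t) i))"
      using t J c by (intro fsum_superset module.smult_closed [OF D_module]) (auto simp: family_simps)
    also have "\<dots> = (\<Oplus>\<^bsub>X\<^esub>i\<in>?J. c \<odot>\<^bsub>X\<^esub> f i (t i))"
      using cl [OF t] mem [OF t] c
      by (intro X.add.finprod_cong') (auto simp: linear_map_smult [OF f])
    also have "\<dots> = c \<odot>\<^bsub>X\<^esub> fsum t"
      using cl [OF t] c J by (subst X.finsum_smult_ldistr) auto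
    finally show ?thesis .
  qed
qed

lemma fsum_single:
  assumes z: "z \<in> I" and u: "u \<in> carrier (T z)"
  shows "fsum (single_at I T z u) = f z u"
proof -
  have "fsum (single_at I T z u) = (\<Oplus>\<^bsub>X\<^esub>i\<in>{z}. f i (single_at I T z u i))"
    using z u by (intro fsum_superset single_in_D) (auto simp: single_at_def)
  also have "\<dots> = f z u"
    using z f_closed [OF z u] by (simp add: single_at_def)
  finally show ?thesis .
qed

end

end

section \<open>Tensor products of bimodules\<close>

context base_category
begin

abbreviation "bim M \<equiv> bimodule K A M"

lemma K_cring: "cring K"
  by (rule cring)

lemma Hom_is_module [simp]: "x \<in> Ob A \<Longrightarrow> y \<in> Ob A \<Longrightarrow> module K (Hom A x y)"
  by (rule Hom_module)

lemma bhom_is_module [simp]: "bim M \<Longrightarrow> x \<in> Ob A \<Longrightarrow> y \<in> Ob A \<Longrightarrow> module K (bhom M x y)"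
  by (rule bimodule.bhom_module)

lemma idn_in [simp]: "x \<in> Ob A \<Longrightarrow> idn A x \<in> carrier (Hom A x x)"
  by (rule idn_closed)

lemma lact_in [simp]:
  "bim M \<Longrightarrow> x \<in> Ob A \<Longrightarrow> y \<in> Ob A \<Longrightarrow> a \<in> carrier (Hom A y y) \<Longrightarrow> m \<in> carrier (bhom M x y)
    \<Longrightarrow> lact M x y a m \<in> carrier (bhom M x y)"
  using linear_map_closed [OF bimodule.lact_linear] .

lemma ract_in [simp]:
  "bim M \<Longrightarrow> x \<in> Ob A \<Longrightarrow> y \<in> Ob A \<Longrightarrow> a \<in> carrier (Hom A x x) \<Longrightarrow> m \<in> carrier (bhom M x y)
    \<Longrightarrow> ract M x y m a \<in> carrier (bhom M x y)"
  using linear_map_closed [OF bimodule.ract_linear] .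

lemma bhom_zero_in [simp]:
  "bim M \<Longrightarrow> x \<in> Ob A \<Longrightarrow> y \<in> Ob A \<Longrightarrow> \<zero>\<^bsub>bhom M x y\<^esub> \<in> carrier (bhom M x y)"
  by (meson bhom_is_module module_abelian_group abelian_group.axioms(1) abelian_monoid.zero_closed)

text \<open>A scalar c is realised on both sides by c times the identity of \<open>z\<close>, since
  the actions are linear in the argument from \<open>A\<close>.\<close>

lemma bimodule_tensor_factors:
  assumes M: "bim M" and N: "bim N" and x: "x \<in> Ob A" "y \<in> Ob A" "z \<in> Ob A"
  shows "tensor_factors K (carrier (Hom A z z)) (bhom M z y) (bhom N x z) (ract M z y) (lact N x z)"
proof (rule tensor_factors.intro)
  fix c assume c: "c \<in> carrier K"
  interpret Z: module K "Hom A z z" using x by simp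
  show "\<exists>a\<in>carrier (Hom A z z). (\<forall>m\<in>carrier (bhom M z y). ract M z y m a = c \<odot>\<^bsub>bhom M z y\<^esub> m) \<and>
      (\<forall>n\<in>carrier (bhom N x z). lact N x z a n = c \<odot>\<^bsub>bhom N x z\<^esub> n)"
    using x c linear_map_smult [OF bimodule.ract_linear_scalar [OF M]]
      linear_map_smult [OF bimodule.lact_linear_scalar [OF N]]
    by (intro bexI [of _ "c \<odot>\<^bsub>Hom A z z\<^esub> idn A z"])
       (auto simp: bimodule.ract_idn [OF M] bimodule.lact_idn [OF N])
qed (use assms in \<open>auto intro: bimodule.ract_linear bimodule.lact_linear bimodule.bhom_module\<close>)

lemma tensor_hom_family:
  assumes "bim M" "bim N" "x \<in> Ob A" "y \<in> Ob A"
  shows "module_family K (Ob A) (tensor_at A M N x y)"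
  by (rule module_family.intro)
     (use assms K_cring in \<open>auto simp: tensor_at_def intro!: tensor_factors.tensor_module bimodule_tensor_factors\<close>)

lemma tensor_hom_module [simp]:
  "bim M \<Longrightarrow> bim N \<Longrightarrow> x \<in> Ob A \<Longrightarrow> y \<in> Ob A \<Longrightarrow> module K (tensor_hom A M N x y)"
  unfolding tensor_hom_def by (rule module_family.D_module [OF tensor_hom_family])

lemma pure_eq_single_at:
  "pure A M N x y z m n = single_at (Ob A) (tensor_at A M N x y) z
    (tensor_class (carrier (Hom A z z)) (bhom M z y) (bhom N x z) (ract M z y) (lact N x z) (frag_of (m, n)))"
  by (simp add: pure_def single_at_def)

lemma pure_linear_left:
  assumes "bim M" "bim N" "x \<in> Ob A" "y \<in> Ob A" "z \<in> Ob A" "n \<in> carrier (bhom N x z)"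
    and f: "linear_map K X (bhom M z y) f"
  shows "linear_map K X (tensor_hom A M N x y) (\<lambda>u. pure A M N x y z (f u) n)"
proof -
  interpret tensor_factors K "carrier (Hom A z z)" "bhom M z y" "bhom N x z" "ract M z y" "lact N x z"
    using assms by (intro bimodule_tensor_factors)
  have "linear_map K (bhom M z y) (tensor_at A M N x y z) (\<lambda>m. pr m n)"
    using pr_balanced_map assms(6) by (simp add: balanced_def tensor_at_def)
  from linear_map_compose [OF linear_map_compose [OF f this]
      module_family.single_linear [OF tensor_hom_family [OF assms(1-4)] assms(5)]]
  show ?thesis
    unfolding pure_eq_single_at tensor_hom_def .
qed

lemma pure_linear_right:
  assumes "bim M" "bim N" "x \<in> Ob A" "y \<in> Ob A" "z \<in> Ob A" "m \<in> carrier (bhom M z y)"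
    and f: "linear_map K X (bhom N x z) f"
  shows "linear_map K X (tensor_hom A M N x y) (\<lambda>u. pure A M N x y z m (f u))"
proof -
  interpret tensor_factors K "carrier (Hom A z z)" "bhom M z y" "bhom N x z" "ract M z y" "lact N x z"
    using assms by (intro bimodule_tensor_factors)
  have "linear_map K (bhom N x z) (tensor_at A M N x y z) (\<lambda>n. pr m n)"
    using pr_balanced_map assms(6) by (simp add: balanced_def tensor_at_def)
  from linear_map_compose [OF linear_map_compose [OF f this]
      module_family.single_linear [OF tensor_hom_family [OF assms(1-4)] assms(5)]]
  show ?thesis
    unfolding pure_eq_single_at tensor_hom_def .
qed

lemma pure_in [simp]:
  assumes "bim M" "bim N" "x \<in> Ob A" "y \<in> Ob A" "z \<in> Ob A" "m \<in> carrier (bhom M z y)" "n \<in> carrier (bhom N x z)"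
  shows "pure A M N x y z m n \<in> carrier (tensor_hom A M N x y)"
  using linear_map_closed [OF pure_linear_left [OF assms(1-5,7) linear_map_ident]] assms by simp

lemma pure_balanced:
  assumes "bim M" "bim N" "x \<in> Ob A" "y \<in> Ob A" "z \<in> Ob A" "m \<in> carrier (bhom M z y)" "n \<in> carrier (bhom N x z)"
    "a \<in> carrier (Hom A z z)"
  shows "pure A M N x y z (ract M z y m a) n = pure A M N x y z m (lact N x z a n)"
  using tensor_factors.pr_balanced [OF bimodule_tensor_factors [OF assms(1-5)]] assms
  by (simp add: pure_def cong: if_cong)

lemma pure_zero_left [simp]:
  assumes "bim M" "bim N" "x \<in> Ob A" "y \<in> Ob A" "z \<in> Ob A" "n \<in> carrier (bhom N x z)"
  shows "pure A M N x y z \<zero>\<^bsub>bhom M z y\<^esub> n = \<zero>\<^bsub>tensor_hom A M N x y\<^esub>"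
  using assms by (intro linear_map_zero [OF _ _ pure_linear_left [OF assms linear_map_ident]]) auto

lemma pure_zero_right [simp]:
  assumes "bim M" "bim N" "x \<in> Ob A" "y \<in> Ob A" "z \<in> Ob A" "m \<in> carrier (bhom M z y)"
  shows "pure A M N x y z m \<zero>\<^bsub>bhom N x z\<^esub> = \<zero>\<^bsub>tensor_hom A M N x y\<^esub>"
  using assms by (intro linear_map_zero [OF _ _ pure_linear_right [OF assms linear_map_ident]]) auto

text \<open>The condition under which \<open>lift\<close> has its universal property. It is imposed
  on each intermediate object separately, as no relation connects different summands.\<close>

definition bal :: "('o, 'k, 'a, 'm) bimod \<Rightarrow> ('o, 'k, 'a, 'n) bimod \<Rightarrow> 'o \<Rightarrow> 'o \<Rightarrow> ('k, 'u) module
    \<Rightarrow> ('o \<Rightarrow> 'm \<Rightarrow> 'n \<Rightarrow> 'u) \<Rightarrow> bool" where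
  "bal M N x y T \<phi> \<longleftrightarrow> (\<forall>z\<in>Ob A.
     balanced K (carrier (Hom A z z)) (bhom M z y) (bhom N x z) (ract M z y) (lact N x z) T (\<phi> z))"

lemma balI:
  assumes "\<And>z m. z \<in> Ob A \<Longrightarrow> m \<in> carrier (bhom M z y) \<Longrightarrow> linear_map K (bhom N x z) T (\<phi> z m)"
    and "\<And>z n. z \<in> Ob A \<Longrightarrow> n \<in> carrier (bhom N x z) \<Longrightarrow> linear_map K (bhom M z y) T (\<lambda>m. \<phi> z m n)"
    and "\<And>z m a n. z \<in> Ob A \<Longrightarrow> m \<in> carrier (bhom M z y) \<Longrightarrow> a \<in> carrier (Hom A z z)
      \<Longrightarrow> n \<in> carrier (bhom N x z) \<Longrightarrow> \<phi> z (ract M z y m a) n = \<phi> z m (lact N x z a n)"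
  shows "bal M N x y T \<phi>"
  using assms by (auto simp: bal_def balanced_def)

lemma balD:
  assumes "bal M N x y T \<phi>" "z \<in> Ob A"
  shows "m \<in> carrier (bhom M z y) \<Longrightarrow> linear_map K (bhom N x z) T (\<phi> z m)"
    and "n \<in> carrier (bhom N x z) \<Longrightarrow> linear_map K (bhom M z y) T (\<lambda>m. \<phi> z m n)"
    and "m \<in> carrier (bhom M z y) \<Longrightarrow> a \<in> carrier (Hom A z z)
      \<Longrightarrow> n \<in> carrier (bhom N x z) \<Longrightarrow> \<phi> z (ract M z y m a) n = \<phi> z m (lact N x z a n)"
  using assms by (auto simp: bal_def balanced_def)

lemma tensor_hom_induct [consumes 5, case_names pure add]:
  assumes "t \<in> carrier (tensor_hom A M N x y)" "bim M" "bim N" "x \<in> Ob A" "y \<in> Ob A"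
    and pure: "\<And>z m n. z \<in> Ob A \<Longrightarrow> m \<in> carrier (bhom M z y) \<Longrightarrow> n \<in> carrier (bhom N x z)
       \<Longrightarrow> Q (pure A M N x y z m n)"
    and add: "\<And>s t. s \<in> carrier (tensor_hom A M N x y) \<Longrightarrow> t \<in> carrier (tensor_hom A M N x y)
      \<Longrightarrow> Q s \<Longrightarrow> Q t \<Longrightarrow> Q (s \<oplus>\<^bsub>tensor_hom A M N x y\<^esub> t)"
  shows "Q t"
proof -
  interpret fam: module_family K "Ob A" "tensor_at A M N x y"
    using assms by (intro tensor_hom_family)
  from assms(1) have "t \<in> carrier fam.D" by (simp add: tensor_hom_def)
  moreover have "Ob A \<noteq> {}" using assms by auto
  ultimately show ?thesis
  proof (induction t rule: fam.D_induct)
    case (single z u)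
    interpret tensor_factors K "carrier (Hom A z z)" "bhom M z y" "bhom N x z" "ract M z y" "lact N x z"
      using assms single by (intro bimodule_tensor_factors)
    from single have "u \<in> carrier MN" by (simp add: tensor_at_def)
    then show ?case
    proof (induction u rule: tensor_induct)
      case (pr m n)
      then show ?case using pure [of z m n] single by (simp add: pure_eq_single_at)
    next
      case (add s t)
      let ?S = "single_at (Ob A) (tensor_at A M N x y) z"
      have at: "tensor_at A M N x y z = MN"
        by (simp add: tensor_at_def)
      have "?S (s \<oplus>\<^bsub>MN\<^esub> t) = ?S s \<oplus>\<^bsub>fam.D\<^esub> ?S t"
        using linear_map_add [OF fam.single_linear [OF \<open>z \<in> Ob A\<close>], of s t] add by (simp only: at)
      moreover have "?S s \<in> carrier fam.D" "?S t \<in> carrier fam.D"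
        using fam.single_in_D [OF \<open>z \<in> Ob A\<close>] add by (simp_all only: at)
      ultimately show ?case
        using assms(7) [of "?S s" "?S t"] add.IH by (simp only: tensor_hom_def)
    qed
  next
    case (add s t)
    then show ?case using assms(7) by (simp only: tensor_hom_def)
  qed
qed

lemma lift_family_linear:
  assumes "bim M" "bim N" "x \<in> Ob A" "y \<in> Ob A" "module K T" "bal M N x y T \<phi>" "z \<in> Ob A"
  shows "linear_map K (tensor_at A M N x y z) T (tensor_lift T (\<phi> z))"
  using assms unfolding tensor_at_def bal_def
  by (intro tensor_factors.tensor_lift_linear bimodule_tensor_factors) auto

lemma lift_linear:
  assumes "bim M" "bim N" "x \<in> Ob A" "y \<in> Ob A" "module K T" "bal M N x y T \<phi>"
  shows "linear_map K (tensor_hom A M N x y) T (lift A M N x y T \<phi>)"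
  unfolding tensor_hom_def lift_def
  using module_family.fsum_linear [OF tensor_hom_family [OF assms(1-4)] assms(5), of "\<lambda>z. tensor_lift T (\<phi> z)"]
    lift_family_linear [OF assms] by simp

lemma lift_pure:
  assumes "bim M" "bim N" "x \<in> Ob A" "y \<in> Ob A" "module K T" "bal M N x y T \<phi>"
    and "z \<in> Ob A" "m \<in> carrier (bhom M z y)" "n \<in> carrier (bhom N x z)"
  shows "lift A M N x y T \<phi> (pure A M N x y z m n) = \<phi> z m n"
proof -
  interpret tensor_factors K "carrier (Hom A z z)" "bhom M z y" "bhom N x z" "ract M z y" "lact N x z"
    using assms by (intro bimodule_tensor_factors)
  have "pr m n \<in> carrier (tensor_at A M N x y z)"
    using assms by (simp add: tensor_at_def cls_closed)
  then have "lift A M N x y T \<phi> (pure A M N x y z m n) = tensor_lift T (\<phi> z) (pr m n)"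
    unfolding lift_def pure_eq_single_at
    using module_family.fsum_single [OF tensor_hom_family [OF assms(1-4)] assms(5), of "\<lambda>z. tensor_lift T (\<phi> z)" z "pr m n"]
      lift_family_linear [OF assms(1-6)] assms(7) by simp
  also have "\<dots> = \<phi> z m n"
    using assms by (intro tensor_lift_pr) (auto simp: bal_def)
  finally show ?thesis .
qed

lemma tensor_ext:
  assumes "linear_map K (tensor_hom A M N x y) T f" "linear_map K (tensor_hom A M N x y) T g"
    and "bim M" "bim N" "x \<in> Ob A" "y \<in> Ob A"
    and "\<And>z m n. z \<in> Ob A \<Longrightarrow> m \<in> carrier (bhom M z y) \<Longrightarrow> n \<in> carrier (bhom N x z)
      \<Longrightarrow> f (pure A M N x y z m n) = g (pure A M N x y z m n)"
    and "t \<in> carrier (tensor_hom A M N x y)"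
  shows "f t = g t"
  using assms(8,3-6)
  by (induction t rule: tensor_hom_induct)
     (use assms in \<open>auto simp: linear_map_add [OF assms(1)] linear_map_add [OF assms(2)]\<close>)

text \<open>Here the bilinear map varies and the tensor is fixed, so the universal property does not
  apply directly; the claim is checked on pure tensors and extended by additivity in
  \<open>t\<close>.\<close>

lemma lift_linear_param:
  assumes "bim M" "bim N" "x \<in> Ob A" "y \<in> Ob A" "module K T" "module K X"
    and bal: "\<And>u. u \<in> carrier X \<Longrightarrow> bal M N x y T (\<phi> u)"
    and lin: "\<And>z m n. z \<in> Ob A \<Longrightarrow> m \<in> carrier (bhom M z y) \<Longrightarrow> n \<in> carrier (bhom N x z)
      \<Longrightarrow> linear_map K X T (\<lambda>u. \<phi> u z m n)"
    and t: "t \<in> carrier (tensor_hom A M N x y)"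
  shows "linear_map K X T (\<lambda>u. lift A M N x y T (\<phi> u) t)"
  using t assms(1-4)
proof (induction t rule: tensor_hom_induct)
  case (pure z m n)
  then have "linear_map K X T (\<lambda>u. lift A M N x y T (\<phi> u) (pure A M N x y z m n)) \<longleftrightarrow>
    linear_map K X T (\<lambda>u. \<phi> u z m n)"
    using assms by (intro linear_map_cong) (auto simp: lift_pure)
  then show ?case using lin pure by simp
next
  case (add s t)
  have "linear_map K X T (\<lambda>u. lift A M N x y T (\<phi> u) (s \<oplus>\<^bsub>tensor_hom A M N x y\<^esub> t)) \<longleftrightarrow>
    linear_map K X T (\<lambda>u. lift A M N x y T (\<phi> u) s \<oplus>\<^bsub>T\<^esub> lift A M N x y T (\<phi> u) t)"
    using assms add by (intro linear_map_cong) (auto simp: linear_map_add [OF lift_linear])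
  then show ?case using add linear_map_sum [OF assms(5)] by simp
qed

end

section \<open>Bimodule structure on the tensor product\<close>

context base_category
begin

lemma tens_simps [simp]:
  "bhom (tens A M N) = tensor_hom A M N"
  "lact (tens A M N) x y a = lift A M N x y (tensor_hom A M N x y) (\<lambda>z m n. pure A M N x y z (lact M z y a m) n)"
  "ract (tens A M N) x y t a = lift A M N x y (tensor_hom A M N x y) (\<lambda>z m n. pure A M N x y z m (ract N x z n a)) t"
  by (simp_all add: tens_def)

text \<open>The actions on a tensor product stay folded, so that the rules evaluating them on pure
  tensors can match.\<close>

declare tens_simps(2,3) [simp del]

lemma regular_simps [simp]:
  "bhom (regular_bimod A) = Hom A"
  "lact (regular_bimod A) x y a m = Comp A x y y a m"
  "ract (regular_bimod A) x y m a = Comp A x x y m a"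
  by (simp_all add: regular_bimod_def)

lemma regular_bimodule [simp]: "bim (regular_bimod A)"
  by (rule bimodule.intro)
     (auto simp: Comp_linear_left Comp_linear_right Comp_idn_left Comp_idn_right Comp_assoc)

lemmas lact_idn [simp] = bimodule.lact_idn [where K = K and A = A]
lemmas ract_idn [simp] = bimodule.ract_idn [where K = K and A = A]
lemmas lact_Comp = bimodule.lact_Comp [where K = K and A = A]
lemmas ract_Comp = bimodule.ract_Comp [where K = K and A = A]
lemmas lact_ract = bimodule.lact_ract [where K = K and A = A]

lemma lact_lin:
  "bim M \<Longrightarrow> x \<in> Ob A \<Longrightarrow> y \<in> Ob A \<Longrightarrow> a \<in> carrier (Hom A y y) \<Longrightarrow> linear_map K X (bhom M x y) f
    \<Longrightarrow> linear_map K X (bhom M x y) (\<lambda>u. lact M x y a (f u))"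
  by (rule linear_map_compose [OF _ bimodule.lact_linear])

lemma lact_scalar_lin:
  "bim M \<Longrightarrow> x \<in> Ob A \<Longrightarrow> y \<in> Ob A \<Longrightarrow> m \<in> carrier (bhom M x y) \<Longrightarrow> linear_map K X (Hom A y y) f
    \<Longrightarrow> linear_map K X (bhom M x y) (\<lambda>u. lact M x y (f u) m)"
  by (rule linear_map_compose [OF _ bimodule.lact_linear_scalar])

lemma ract_lin:
  "bim M \<Longrightarrow> x \<in> Ob A \<Longrightarrow> y \<in> Ob A \<Longrightarrow> a \<in> carrier (Hom A x x) \<Longrightarrow> linear_map K X (bhom M x y) f
    \<Longrightarrow> linear_map K X (bhom M x y) (\<lambda>u. ract M x y (f u) a)"
  by (rule linear_map_compose [OF _ bimodule.ract_linear])

lemma ract_scalar_lin: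
  "bim M \<Longrightarrow> x \<in> Ob A \<Longrightarrow> y \<in> Ob A \<Longrightarrow> m \<in> carrier (bhom M x y) \<Longrightarrow> linear_map K X (Hom A x x) f
    \<Longrightarrow> linear_map K X (bhom M x y) (\<lambda>u. ract M x y m (f u))"
  by (rule linear_map_compose [OF _ bimodule.ract_linear_scalar])

lemmas lin = lact_lin lact_scalar_lin ract_lin ract_scalar_lin pure_linear_left pure_linear_right
  linear_map_ident

lemma lact_zero [simp]:
  "bim M \<Longrightarrow> x \<in> Ob A \<Longrightarrow> y \<in> Ob A \<Longrightarrow> a \<in> carrier (Hom A y y)
    \<Longrightarrow> lact M x y a \<zero>\<^bsub>bhom M x y\<^esub> = \<zero>\<^bsub>bhom M x y\<^esub>"
  by (rule linear_map_zero [of K]) (auto intro!: lin)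

lemma ract_zero [simp]:
  "bim M \<Longrightarrow> x \<in> Ob A \<Longrightarrow> y \<in> Ob A \<Longrightarrow> a \<in> carrier (Hom A x x)
    \<Longrightarrow> ract M x y \<zero>\<^bsub>bhom M x y\<^esub> a = \<zero>\<^bsub>bhom M x y\<^esub>"
  by (rule linear_map_zero [of K "bhom M x y" "bhom M x y" "\<lambda>m. ract M x y m a"]) (auto intro!: lin)

context
  fixes M :: "('o, 'k, 'a, 'm) bimod" and N :: "('o, 'k, 'a, 'n) bimod" and x y :: 'o
  assumes MN [simp]: "bim M" "bim N" and xy [simp]: "x \<in> Ob A" "y \<in> Ob A"
begin

lemma tens_lact_bal:
  "a \<in> carrier (Hom A y y) \<Longrightarrow>
    bal M N x y (tensor_hom A M N x y) (\<lambda>z m n. pure A M N x y z (lact M z y a m) n)"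
  by (rule balI) (auto intro!: lin simp: lact_ract [symmetric] pure_balanced)

lemma tens_ract_bal:
  "a \<in> carrier (Hom A x x) \<Longrightarrow>
    bal M N x y (tensor_hom A M N x y) (\<lambda>z m n. pure A M N x y z m (ract N x z n a))"
  by (rule balI) (auto intro!: lin simp: lact_ract pure_balanced)

lemma tens_lact_pure [simp]:
  "a \<in> carrier (Hom A y y) \<Longrightarrow> z \<in> Ob A \<Longrightarrow> m \<in> carrier (bhom M z y) \<Longrightarrow> n \<in> carrier (bhom N x z)
    \<Longrightarrow> lact (tens A M N) x y a (pure A M N x y z m n) = pure A M N x y z (lact M z y a m) n"
  by (simp add: tens_simps lift_pure tens_lact_bal)

lemma tens_ract_pure [simp]:
  "a \<in> carrier (Hom A x x) \<Longrightarrow> z \<in> Ob A \<Longrightarrow> m \<in> carrier (bhom M z y) \<Longrightarrow> n \<in> carrier (bhom N x z)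
    \<Longrightarrow> ract (tens A M N) x y (pure A M N x y z m n) a = pure A M N x y z m (ract N x z n a)"
  by (simp add: tens_simps lift_pure tens_ract_bal)

lemma tens_lact_linear:
  "a \<in> carrier (Hom A y y)
    \<Longrightarrow> linear_map K (tensor_hom A M N x y) (tensor_hom A M N x y) (lact (tens A M N) x y a)"
  by (simp add: tens_simps lift_linear tens_lact_bal)

lemma tens_ract_linear:
  "a \<in> carrier (Hom A x x)
    \<Longrightarrow> linear_map K (tensor_hom A M N x y) (tensor_hom A M N x y) (\<lambda>t. ract (tens A M N) x y t a)"
  by (simp add: tens_simps lift_linear tens_ract_bal)

lemma tens_lact_linear_scalar:
  "t \<in> carrier (tensor_hom A M N x y)
    \<Longrightarrow> linear_map K (Hom A y y) (tensor_hom A M N x y) (\<lambda>a. lact (tens A M N) x y a t)"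
  unfolding tens_simps
  by (rule lift_linear_param) (auto intro!: tens_lact_bal lin)

lemma tens_ract_linear_scalar:
  "t \<in> carrier (tensor_hom A M N x y)
    \<Longrightarrow> linear_map K (Hom A x x) (tensor_hom A M N x y) (\<lambda>a. ract (tens A M N) x y t a)"
  unfolding tens_simps
  by (rule lift_linear_param) (auto intro!: tens_ract_bal lin)

lemma tens_ext:
  "linear_map K (tensor_hom A M N x y) T f \<Longrightarrow> linear_map K (tensor_hom A M N x y) T g
    \<Longrightarrow> (\<And>z m n. z \<in> Ob A \<Longrightarrow> m \<in> carrier (bhom M z y) \<Longrightarrow> n \<in> carrier (bhom N x z)
      \<Longrightarrow> f (pure A M N x y z m n) = g (pure A M N x y z m n))
    \<Longrightarrow> t \<in> carrier (tensor_hom A M N x y) \<Longrightarrow> f t = g t"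
  by (rule tensor_ext) auto

text \<open>Both sides of each law are linear in \<open>t\<close>, so each reduces on pure tensors
  to a law of one of the factors; the last one is immediate since the two actions touch different
  factors.\<close>

lemma tens_bimodule_laws:
  assumes t: "t \<in> carrier (tensor_hom A M N x y)"
  shows "lact (tens A M N) x y (idn A y) t = t"
    and "ract (tens A M N) x y t (idn A x) = t"
    and "a \<in> carrier (Hom A y y) \<Longrightarrow> b \<in> carrier (Hom A y y)
      \<Longrightarrow> lact (tens A M N) x y (Comp A y y y a b) t = lact (tens A M N) x y a (lact (tens A M N) x y b t)"
    and "a \<in> carrier (Hom A x x) \<Longrightarrow> b \<in> carrier (Hom A x x)
      \<Longrightarrow> ract (tens A M N) x y t (Comp A x x x a b) = ract (tens A M N) x y (ract (tens A M N) x y t a) b"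
    and "a \<in> carrier (Hom A y y) \<Longrightarrow> b \<in> carrier (Hom A x x)
      \<Longrightarrow> ract (tens A M N) x y (lact (tens A M N) x y a t) b = lact (tens A M N) x y a (ract (tens A M N) x y t b)"
proof -
  let ?T = "tensor_hom A M N x y" and ?l = "lact (tens A M N) x y" and ?r = "ract (tens A M N) x y"
  have Comp_in: "Comp A w w w a b \<in> carrier (Hom A w w)"
    if "w \<in> Ob A" "a \<in> carrier (Hom A w w)" "b \<in> carrier (Hom A w w)" for w a b
    using linear_map_closed [OF Comp_linear_left] that by blast
  note L = tens_lact_linear tens_ract_linear
  show "?l (idn A y) t = t"
    by (rule tens_ext [OF _ linear_map_ident _ t]) (auto simp: L lact_idn)
  show "?r t (idn A x) = t"
    by (rule tens_ext [where f = "\<lambda>t. ?r t (idn A x)", OF _ linear_map_ident _ t]) (auto simp: L ract_idn)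
  show "?l (Comp A y y y a b) t = ?l a (?l b t)" if ab: "a \<in> carrier (Hom A y y)" "b \<in> carrier (Hom A y y)"
    by (rule tens_ext [where g = "\<lambda>t. ?l a (?l b t)", OF _ linear_map_compose [OF L(1) L(1)] _ t])
       (use ab in \<open>auto simp: L lact_Comp Comp_in\<close>)
  show "?r t (Comp A x x x a b) = ?r (?r t a) b" if ab: "a \<in> carrier (Hom A x x)" "b \<in> carrier (Hom A x x)"
    by (rule tens_ext [where f = "\<lambda>t. ?r t (Comp A x x x a b)" and g = "\<lambda>t. ?r (?r t a) b",
            OF _ linear_map_compose [OF L(2) L(2)] _ t])
       (use ab in \<open>auto simp: L ract_Comp Comp_in\<close>)
  show "?r (?l a t) b = ?l a (?r t b)" if ab: "a \<in> carrier (Hom A y y)" "b \<in> carrier (Hom A x x)"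
    by (rule tens_ext [where f = "\<lambda>t. ?r (?l a t) b" and g = "\<lambda>t. ?l a (?r t b)",
            OF linear_map_compose [OF L(1) L(2)] linear_map_compose [OF L(2) L(1)] _ t])
       (use ab in \<open>auto\<close>)
qed

end

lemma tens_bimodule [simp]:
  assumes "bim M" "bim N"
  shows "bim (tens A M N)"
  by (rule bimodule.intro)
     (use assms in \<open>auto simp: tens_lact_linear tens_ract_linear tens_lact_linear_scalar
       tens_ract_linear_scalar tens_bimodule_laws\<close>)

subsection \<open>Morphisms of bimodules\<close>

abbreviation "mor M N f \<equiv> bimod_morphism K A M N f"

lemma morI:
  assumes "bim M" "bim N"
    and "\<And>x y. x \<in> Ob A \<Longrightarrow> y \<in> Ob A \<Longrightarrow> linear_map K (bhom M x y) (bhom N x y) (f x y)"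
    and "\<And>x y m a. x \<in> Ob A \<Longrightarrow> y \<in> Ob A \<Longrightarrow> m \<in> carrier (bhom M x y) \<Longrightarrow> a \<in> carrier (Hom A y y)
      \<Longrightarrow> f x y (lact M x y a m) = lact N x y a (f x y m)"
    and "\<And>x y m a. x \<in> Ob A \<Longrightarrow> y \<in> Ob A \<Longrightarrow> m \<in> carrier (bhom M x y) \<Longrightarrow> a \<in> carrier (Hom A x x)
      \<Longrightarrow> f x y (ract M x y m a) = ract N x y (f x y m) a"
  shows "mor M N f"
  using assms by (auto simp: bimod_morphism_def)

lemma mor_bim: "mor M N f \<Longrightarrow> bim M" "mor M N f \<Longrightarrow> bim N"
  by (auto simp: bimod_morphism_def)

lemma mor_linear:
  "mor M N f \<Longrightarrow> x \<in> Ob A \<Longrightarrow> y \<in> Ob A \<Longrightarrow> linear_map K (bhom M x y) (bhom N x y) (f x y)"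
  by (auto simp: bimod_morphism_def)

lemma mor_lin:
  "mor M N f \<Longrightarrow> x \<in> Ob A \<Longrightarrow> y \<in> Ob A \<Longrightarrow> linear_map K X (bhom M x y) g
    \<Longrightarrow> linear_map K X (bhom N x y) (\<lambda>u. f x y (g u))"
  by (rule linear_map_compose [OF _ mor_linear])

lemma mor_in:
  "mor M N f \<Longrightarrow> x \<in> Ob A \<Longrightarrow> y \<in> Ob A \<Longrightarrow> m \<in> carrier (bhom M x y) \<Longrightarrow> f x y m \<in> carrier (bhom N x y)"
  by (rule linear_map_closed [OF mor_linear])

lemma mor_lact:
  "mor M N f \<Longrightarrow> x \<in> Ob A \<Longrightarrow> y \<in> Ob A \<Longrightarrow> m \<in> carrier (bhom M x y) \<Longrightarrow> a \<in> carrier (Hom A y y)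
    \<Longrightarrow> f x y (lact M x y a m) = lact N x y a (f x y m)"
  by (auto simp: bimod_morphism_def)

lemma mor_ract:
  "mor M N f \<Longrightarrow> x \<in> Ob A \<Longrightarrow> y \<in> Ob A \<Longrightarrow> m \<in> carrier (bhom M x y) \<Longrightarrow> a \<in> carrier (Hom A x x)
    \<Longrightarrow> f x y (ract M x y m a) = ract N x y (f x y m) a"
  by (auto simp: bimod_morphism_def)

lemma mor_id [simp]: "bim M \<Longrightarrow> mor M M bimod_id"
  by (rule morI) (auto simp: bimod_id_def [abs_def] linear_map_ident)

lemma mor_comp:
  assumes "mor M N f" "mor N P g"
  shows "mor M P (g \<bullet> f)"
proof (rule morI)
  show "linear_map K (bhom M x y) (bhom P x y) ((g \<bullet> f) x y)" if "x \<in> Ob A" "y \<in> Ob A" for x y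
    unfolding bimod_comp_def [abs_def]
    using assms that by (intro linear_map_compose [OF mor_linear mor_linear])
qed (use assms in \<open>auto simp: bimod_comp_def mor_bim mor_lact [OF assms(1)] mor_ract [OF assms(1)]
      mor_lact [OF assms(2)] mor_ract [OF assms(2)] mor_in [OF assms(1)]\<close>)

text \<open>Linearity propagates equivariance from pure tensors to all elements. This is the form in
  which the structural maps are recognised as morphisms.\<close>

lemma tens_morI:
  assumes "bim M" "bim N" "bim Q"
    and lin: "\<And>x y. x \<in> Ob A \<Longrightarrow> y \<in> Ob A \<Longrightarrow> linear_map K (tensor_hom A M N x y) (bhom Q x y) (f x y)"
    and l: "\<And>x y z m n a. x \<in> Ob A \<Longrightarrow> y \<in> Ob A \<Longrightarrow> z \<in> Ob A \<Longrightarrow> m \<in> carrier (bhom M z y)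
      \<Longrightarrow> n \<in> carrier (bhom N x z) \<Longrightarrow> a \<in> carrier (Hom A y y)
      \<Longrightarrow> f x y (pure A M N x y z (lact M z y a m) n) = lact Q x y a (f x y (pure A M N x y z m n))"
    and r: "\<And>x y z m n a. x \<in> Ob A \<Longrightarrow> y \<in> Ob A \<Longrightarrow> z \<in> Ob A \<Longrightarrow> m \<in> carrier (bhom M z y)
      \<Longrightarrow> n \<in> carrier (bhom N x z) \<Longrightarrow> a \<in> carrier (Hom A x x)
      \<Longrightarrow> f x y (pure A M N x y z m (ract N x z n a)) = ract Q x y (f x y (pure A M N x y z m n)) a"
  shows "mor (tens A M N) Q f"
proof (rule morI)
  fix x y t a assume xy: "x \<in> Ob A" "y \<in> Ob A" and "t \<in> carrier (bhom (tens A M N) x y)"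
  then have t: "t \<in> carrier (tensor_hom A M N x y)" by simp
  note ext = tens_ext [OF assms(1,2) xy _ _ _ t, where T = "bhom Q x y"]
  show "f x y (lact (tens A M N) x y a t) = lact Q x y a (f x y t)" if a: "a \<in> carrier (Hom A y y)"
  proof (rule ext)
    show "linear_map K (tensor_hom A M N x y) (bhom Q x y) (\<lambda>t. f x y (lact (tens A M N) x y a t))"
      by (rule linear_map_compose [OF tens_lact_linear lin]) (use assms(1,2) xy a in auto)
    show "linear_map K (tensor_hom A M N x y) (bhom Q x y) (\<lambda>t. lact Q x y a (f x y t))"
      by (rule lact_lin [OF assms(3) xy a lin [OF xy]])
  qed (simp add: assms(1,2) xy a l)
  show "f x y (ract (tens A M N) x y t a) = ract Q x y (f x y t) a" if a: "a \<in> carrier (Hom A x x)"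
  proof (rule ext)
    show "linear_map K (tensor_hom A M N x y) (bhom Q x y) (\<lambda>t. f x y (ract (tens A M N) x y t a))"
      by (rule linear_map_compose [OF tens_ract_linear lin]) (use assms(1,2) xy a in auto)
    show "linear_map K (tensor_hom A M N x y) (bhom Q x y) (\<lambda>t. ract Q x y (f x y t) a)"
      by (rule ract_lin [OF assms(3) xy a lin [OF xy]])
  qed (simp add: assms(1,2) xy a r)
qed (use assms(1-3) lin in auto)

section \<open>Tensor products of morphisms, associativity and units\<close>

context
  fixes M :: "('o, 'k, 'a, 'm) bimod" and N :: "('o, 'k, 'a, 'n) bimod"
    and P :: "('o, 'k, 'a, 'p) bimod" and Q :: "('o, 'k, 'a, 'q) bimod" and f g
  assumes f: "mor M P f" and g: "mor N Q g"
begin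

lemma fg_bim [simp]: "bim M" "bim N" "bim P" "bim Q"
  using f g mor_bim by auto

lemma tens_map_bal:
  assumes "x \<in> Ob A" "y \<in> Ob A"
  shows "bal M N x y (tensor_hom A P Q x y) (\<lambda>z m n. pure A P Q x y z (f z y m) (g x z n))"
  using assms mor_in [OF f] mor_in [OF g]
  by (intro balI)
     (auto intro!: lin mor_lin [OF f] mor_lin [OF g] simp: mor_lact [OF g] mor_ract [OF f] pure_balanced)

lemma tens_map_linear:
  "x \<in> Ob A \<Longrightarrow> y \<in> Ob A
    \<Longrightarrow> linear_map K (tensor_hom A M N x y) (tensor_hom A P Q x y) (tens_map A M N P Q f g x y)"
  unfolding tens_map_def by (rule lift_linear) (auto simp: tens_map_bal)

lemma tens_map_pure:
  "x \<in> Ob A \<Longrightarrow> y \<in> Ob A \<Longrightarrow> z \<in> Ob A \<Longrightarrow> m \<in> carrier (bhom M z y) \<Longrightarrow> n \<in> carrier (bhom N x z)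
    \<Longrightarrow> tens_map A M N P Q f g x y (pure A M N x y z m n) = pure A P Q x y z (f z y m) (g x z n)"
  unfolding tens_map_def by (simp add: lift_pure tens_map_bal)

lemma tens_map_mor: "mor (tens A M N) (tens A P Q) (tens_map A M N P Q f g)"
  using mor_in [OF f] mor_in [OF g]
  by (intro tens_morI) (auto simp: tens_map_linear tens_map_pure mor_lact [OF f] mor_ract [OF g])

end

context
  fixes M :: "('o, 'k, 'a, 'm) bimod" and N :: "('o, 'k, 'a, 'n) bimod" and P :: "('o, 'k, 'a, 'p) bimod"
  assumes MNP [simp]: "bim M" "bim N" "bim P"
begin

lemma assoc_inner_bal:
  assumes "x \<in> Ob A" "y \<in> Ob A" "z \<in> Ob A" "p \<in> carrier (bhom P x z)"
  shows "bal M N z y (tensor_hom A M (tens A N P) x y)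
    (\<lambda>w m n. pure A M (tens A N P) x y w m (pure A N P x w z n p))"
  using assms by (intro balI) (auto intro!: lin simp: pure_balanced)

text \<open>The outer relation moves a scalar between \<open>t\<close> and \<open>p\<close>. On t =
  m \<otimes> n it becomes the relation between n and \<open>p\<close> inside the inner tensor
  product.\<close>

lemma assoc_bal:
  assumes xy: "x \<in> Ob A" "y \<in> Ob A"
  shows "bal (tens A M N) P x y (tensor_hom A M (tens A N P) x y)
    (\<lambda>z t p. lift A M N z y (tensor_hom A M (tens A N P) x y)
          (\<lambda>w m n. pure A M (tens A N P) x y w m (pure A N P x w z n p)) t)"
proof (rule balI)
  fix z t a p assume z: "z \<in> Ob A" and t: "t \<in> carrier (bhom (tens A M N) z y)"
    and a: "a \<in> carrier (Hom A z z)" and p: "p \<in> carrier (bhom P x z)"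
  let ?l = "\<lambda>p. lift A M N z y (tensor_hom A M (tens A N P) x y)
          (\<lambda>w m n. pure A M (tens A N P) x y w m (pure A N P x w z n p))"
  have L: "linear_map K (tensor_hom A M N z y) (tensor_hom A M (tens A N P) x y) (?l p)"
    if "p \<in> carrier (bhom P x z)" for p
    using that xy z by (intro lift_linear assoc_inner_bal) auto
  show "?l p (ract (tens A M N) z y t a) = ?l (lact P x z a p) t"
  proof (rule tens_ext [OF MNP(1,2) z xy(2) linear_map_compose [OF tens_ract_linear L] L])
  qed (use xy z a p t in \<open>auto simp: lift_pure assoc_inner_bal pure_balanced\<close>)
next
  fix z p assume "z \<in> Ob A" "p \<in> carrier (bhom P x z)"
  then show "linear_map K (bhom (tens A M N) z y) (tensor_hom A M (tens A N P) x y)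
    (lift A M N z y (tensor_hom A M (tens A N P) x y)
          (\<lambda>w m n. pure A M (tens A N P) x y w m (pure A N P x w z n p)))"
    using xy by (auto intro!: lift_linear assoc_inner_bal)
next
  fix z t assume "z \<in> Ob A" "t \<in> carrier (bhom (tens A M N) z y)"
  then show "linear_map K (bhom P x z) (tensor_hom A M (tens A N P) x y)
    (\<lambda>p. lift A M N z y (tensor_hom A M (tens A N P) x y)
          (\<lambda>w m n. pure A M (tens A N P) x y w m (pure A N P x w z n p)) t)"
    using xy by (intro lift_linear_param) (auto intro!: assoc_inner_bal lin)
qed

lemma assoc_linear:
  "x \<in> Ob A \<Longrightarrow> y \<in> Ob A
    \<Longrightarrow> linear_map K (tensor_hom A (tens A M N) P x y) (tensor_hom A M (tens A N P) x y) (assoc A M N P x y)"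
  unfolding assoc_def by (rule lift_linear) (auto simp: assoc_bal)

lemma assoc_pure:
  assumes "x \<in> Ob A" "y \<in> Ob A" "z \<in> Ob A" "w \<in> Ob A"
    "m \<in> carrier (bhom M w y)" "n \<in> carrier (bhom N z w)" "p \<in> carrier (bhom P x z)"
  shows "assoc A M N P x y (pure A (tens A M N) P x y z (pure A M N z y w m n) p)
    = pure A M (tens A N P) x y w m (pure A N P x w z n p)"
  unfolding assoc_def using assms by (simp add: lift_pure assoc_bal assoc_inner_bal)

lemma assoc_mor: "mor (tens A (tens A M N) P) (tens A M (tens A N P)) (assoc A M N P)"
proof (rule tens_morI)
  fix x y z t p a assume xyz: "x \<in> Ob A" "y \<in> Ob A" "z \<in> Ob A" and t: "t \<in> carrier (bhom (tens A M N) z y)"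
    and p: "p \<in> carrier (bhom P x z)"
  let ?p = "pure A (tens A M N) P x y z" and ?f = "assoc A M N P x y"
  let ?T = "tensor_hom A M (tens A N P) x y"
  have L: "linear_map K (tensor_hom A M N z y) ?T (\<lambda>t. ?f (?p t p))" if "p \<in> carrier (bhom P x z)" for p
    using xyz that by (intro linear_map_compose [OF pure_linear_left assoc_linear]) (auto intro!: lin)
  show "?f (?p (lact (tens A M N) z y a t) p) = lact (tens A M (tens A N P)) x y a (?f (?p t p))"
    if a: "a \<in> carrier (Hom A y y)"
  proof (rule tens_ext [OF MNP(1,2) xyz(3,2) linear_map_compose [OF tens_lact_linear L]
        linear_map_compose [OF L tens_lact_linear]])
  qed (use xyz t p a in \<open>auto simp: assoc_pure\<close>)
  show "?f (?p t (ract P x z p a)) = ract (tens A M (tens A N P)) x y (?f (?p t p)) a"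
    if a: "a \<in> carrier (Hom A x x)"
  proof (rule tens_ext [OF MNP(1,2) xyz(3,2) L linear_map_compose [OF L tens_ract_linear]])
  qed (use xyz t p a in \<open>auto simp: assoc_pure\<close>)
qed (auto simp: assoc_linear)

lemma assoc_inv_inner_bal:
  assumes "x \<in> Ob A" "y \<in> Ob A" "w \<in> Ob A" "m \<in> carrier (bhom M w y)"
  shows "bal N P x w (tensor_hom A (tens A M N) P x y)
    (\<lambda>z n p. pure A (tens A M N) P x y z (pure A M N z y w m n) p)"
  using assms by (intro balI) (auto intro!: lin simp flip: pure_balanced)

lemma assoc_inv_bal:
  assumes xy: "x \<in> Ob A" "y \<in> Ob A"
  shows "bal M (tens A N P) x y (tensor_hom A (tens A M N) P x y)
    (\<lambda>w m. lift A N P x w (tensor_hom A (tens A M N) P x y)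
          (\<lambda>z n p. pure A (tens A M N) P x y z (pure A M N z y w m n) p))"
proof (rule balI)
  fix w m a s assume w: "w \<in> Ob A" and m: "m \<in> carrier (bhom M w y)"
    and a: "a \<in> carrier (Hom A w w)" and s: "s \<in> carrier (bhom (tens A N P) x w)"
  let ?l = "\<lambda>m. lift A N P x w (tensor_hom A (tens A M N) P x y)
          (\<lambda>z n p. pure A (tens A M N) P x y z (pure A M N z y w m n) p)"
  have L: "linear_map K (tensor_hom A N P x w) (tensor_hom A (tens A M N) P x y) (?l m)"
    if "m \<in> carrier (bhom M w y)" for m
    using that xy w by (intro lift_linear assoc_inv_inner_bal) auto
  show "?l (ract M w y m a) s = ?l m (lact (tens A N P) x w a s)"
  proof (rule tens_ext [OF MNP(2,3) xy(1) w L linear_map_compose [OF tens_lact_linear L]])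
  qed (use xy w a m s in \<open>auto simp: lift_pure assoc_inv_inner_bal pure_balanced\<close>)
next
  fix w m assume "w \<in> Ob A" "m \<in> carrier (bhom M w y)"
  then show "linear_map K (bhom (tens A N P) x w) (tensor_hom A (tens A M N) P x y)
    (lift A N P x w (tensor_hom A (tens A M N) P x y)
          (\<lambda>z n p. pure A (tens A M N) P x y z (pure A M N z y w m n) p))"
    using xy by (auto intro!: lift_linear assoc_inv_inner_bal)
next
  fix w s assume "w \<in> Ob A" "s \<in> carrier (bhom (tens A N P) x w)"
  then show "linear_map K (bhom M w y) (tensor_hom A (tens A M N) P x y)
    (\<lambda>m. lift A N P x w (tensor_hom A (tens A M N) P x y)
          (\<lambda>z n p. pure A (tens A M N) P x y z (pure A M N z y w m n) p) s)"
    using xy by (intro lift_linear_param) (auto intro!: assoc_inv_inner_bal lin)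
qed

lemma assoc_inv_linear:
  "x \<in> Ob A \<Longrightarrow> y \<in> Ob A
    \<Longrightarrow> linear_map K (tensor_hom A M (tens A N P) x y) (tensor_hom A (tens A M N) P x y) (assoc_inv A M N P x y)"
  unfolding assoc_inv_def by (rule lift_linear) (auto simp: assoc_inv_bal)

lemma assoc_inv_pure:
  assumes "x \<in> Ob A" "y \<in> Ob A" "z \<in> Ob A" "w \<in> Ob A"
    "m \<in> carrier (bhom M w y)" "n \<in> carrier (bhom N z w)" "p \<in> carrier (bhom P x z)"
  shows "assoc_inv A M N P x y (pure A M (tens A N P) x y w m (pure A N P x w z n p))
    = pure A (tens A M N) P x y z (pure A M N z y w m n) p"
  unfolding assoc_inv_def using assms by (simp add: lift_pure assoc_inv_bal assoc_inv_inner_bal)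

lemma assoc_inv_mor: "mor (tens A M (tens A N P)) (tens A (tens A M N) P) (assoc_inv A M N P)"
proof (rule tens_morI)
  fix x y w m s a assume xyz: "x \<in> Ob A" "y \<in> Ob A" "w \<in> Ob A" and m: "m \<in> carrier (bhom M w y)"
    and s: "s \<in> carrier (bhom (tens A N P) x w)"
  let ?p = "pure A M (tens A N P) x y w" and ?f = "assoc_inv A M N P x y"
  let ?T = "tensor_hom A (tens A M N) P x y"
  have L: "linear_map K (tensor_hom A N P x w) ?T (\<lambda>s. ?f (?p m s))" if "m \<in> carrier (bhom M w y)" for m
    using xyz that by (intro linear_map_compose [OF pure_linear_right assoc_inv_linear]) (auto intro!: lin)
  show "?f (?p (lact M w y a m) s) = lact (tens A (tens A M N) P) x y a (?f (?p m s))"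
    if a: "a \<in> carrier (Hom A y y)"
  proof (rule tens_ext [OF MNP(2,3) xyz(1,3) L linear_map_compose [OF L tens_lact_linear]])
  qed (use xyz m s a in \<open>auto simp: assoc_inv_pure\<close>)
  show "?f (?p m (ract (tens A N P) x w s a)) = ract (tens A (tens A M N) P) x y (?f (?p m s)) a"
    if a: "a \<in> carrier (Hom A x x)"
  proof (rule tens_ext [OF MNP(2,3) xyz(1,3) linear_map_compose [OF tens_ract_linear L]
        linear_map_compose [OF L tens_ract_linear]])
  qed (use xyz m s a in \<open>auto simp: assoc_inv_pure\<close>)
qed (auto simp: assoc_inv_linear)

end

context
  fixes M :: "('o, 'k, 'a, 'm) bimod"
  assumes M [simp]: "bim M"
begin

lemma lunit_bal:
  "x \<in> Ob A \<Longrightarrow> y \<in> Ob A \<Longrightarrow> bal (regular_bimod A) M x y (bhom M x y)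
    (\<lambda>z a m. if z = y then lact M x y a m else \<zero>\<^bsub>bhom M x y\<^esub>)"
  by (rule balI) (auto intro!: lin linear_map_if linear_map_const_zero simp: lact_Comp)

lemma lunit_linear:
  "x \<in> Ob A \<Longrightarrow> y \<in> Ob A
    \<Longrightarrow> linear_map K (tensor_hom A (regular_bimod A) M x y) (bhom M x y) (lunit A M x y)"
  unfolding lunit_def by (rule lift_linear) (auto simp: lunit_bal)

lemma lunit_pure:
  "x \<in> Ob A \<Longrightarrow> y \<in> Ob A \<Longrightarrow> z \<in> Ob A \<Longrightarrow> a \<in> carrier (Hom A z y) \<Longrightarrow> m \<in> carrier (bhom M x z)
    \<Longrightarrow> lunit A M x y (pure A (regular_bimod A) M x y z a m)
      = (if z = y then lact M x y a m else \<zero>\<^bsub>bhom M x y\<^esub>)"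
  unfolding lunit_def by (simp add: lift_pure lunit_bal)

lemma lunit_mor: "mor (tens A (regular_bimod A) M) M (lunit A M)"
proof (rule tens_morI)
  have Comp_in: "Comp A z w w a b \<in> carrier (Hom A z w)"
    if "z \<in> Ob A" "w \<in> Ob A" "a \<in> carrier (Hom A w w)" "b \<in> carrier (Hom A z w)" for z w a b
    using linear_map_closed [OF Comp_linear_left] that by blast
  fix x y z b m a assume "x \<in> Ob A" "y \<in> Ob A" "z \<in> Ob A" "b \<in> carrier (bhom (regular_bimod A) z y)"
    "m \<in> carrier (bhom M x z)"
  then show "a \<in> carrier (Hom A y y) \<Longrightarrow>
     lunit A M x y (pure A (regular_bimod A) M x y z (lact (regular_bimod A) z y a b) m)
      = lact M x y a (lunit A M x y (pure A (regular_bimod A) M x y z b m))"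
    and "a \<in> carrier (Hom A x x) \<Longrightarrow>
     lunit A M x y (pure A (regular_bimod A) M x y z b (ract M x z m a))
      = ract M x y (lunit A M x y (pure A (regular_bimod A) M x y z b m)) a"
    by (auto simp: lunit_pure lact_Comp lact_ract Comp_in)
qed (auto simp: lunit_linear)

lemma runit_bal:
  "x \<in> Ob A \<Longrightarrow> y \<in> Ob A \<Longrightarrow> bal M (regular_bimod A) x y (bhom M x y)
    (\<lambda>z m a. if z = x then ract M x y m a else \<zero>\<^bsub>bhom M x y\<^esub>)"
  by (rule balI) (auto intro!: lin linear_map_if linear_map_const_zero simp: ract_Comp)

lemma runit_linear:
  "x \<in> Ob A \<Longrightarrow> y \<in> Ob A
    \<Longrightarrow> linear_map K (tensor_hom A M (regular_bimod A) x y) (bhom M x y) (runit A M x y)"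
  unfolding runit_def by (rule lift_linear) (auto simp: runit_bal)

lemma runit_pure:
  "x \<in> Ob A \<Longrightarrow> y \<in> Ob A \<Longrightarrow> z \<in> Ob A \<Longrightarrow> m \<in> carrier (bhom M z y) \<Longrightarrow> a \<in> carrier (Hom A x z)
    \<Longrightarrow> runit A M x y (pure A M (regular_bimod A) x y z m a)
      = (if z = x then ract M x y m a else \<zero>\<^bsub>bhom M x y\<^esub>)"
  unfolding runit_def by (simp add: lift_pure runit_bal)

end

end

lemma (in base_category) mor_inv:
  assumes f: "mor M N f"
    and bij: "\<And>x y. x \<in> Ob A \<Longrightarrow> y \<in> Ob A \<Longrightarrow> bij_betw (f x y) (carrier (bhom M x y)) (carrier (bhom N x y))"
  shows "mor N M (\<lambda>x y. the_inv_into (carrier (bhom M x y)) (f x y))"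
proof -
  let ?g = "\<lambda>x y. the_inv_into (carrier (bhom M x y)) (f x y)"
  have [simp]: "bim M" "bim N" using f mor_bim by auto
  have g: "?g x y m \<in> carrier (bhom M x y)" "f x y (?g x y m) = m"
    if "x \<in> Ob A" "y \<in> Ob A" "m \<in> carrier (bhom N x y)" for x y m
    using bij [OF that(1,2)] that(3)
    by (auto simp: bij_betw_def f_the_inv_into_f intro: the_inv_into_into)
  have gf: "?g x y (f x y m) = m" if "x \<in> Ob A" "y \<in> Ob A" "m \<in> carrier (bhom M x y)" for x y m
    using bij [OF that(1,2)] that(3) by (auto simp: bij_betw_def the_inv_into_f_f)
  show ?thesis
  proof (rule morI)
    fix x y m a assume xy: "x \<in> Ob A" "y \<in> Ob A" and m: "m \<in> carrier (bhom N x y)"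
    show "?g x y (lact N x y a m) = lact M x y a (?g x y m)" if a: "a \<in> carrier (Hom A y y)"
      using gf [of x y "lact M x y a (?g x y m)"] mor_lact [OF f, of x y "?g x y m" a] g xy m a by simp
    show "?g x y (ract N x y m a) = ract M x y (?g x y m) a" if a: "a \<in> carrier (Hom A x x)"
      using gf [of x y "ract M x y (?g x y m) a"] mor_ract [OF f, of x y "?g x y m" a] g xy m a by simp
  next
    show "linear_map K (bhom N x y) (bhom M x y) (?g x y)" if "x \<in> Ob A" "y \<in> Ob A" for x y
      using that by (intro linear_map_inv_into mor_linear [OF f] bij) auto
  qed auto
qed

section \<open>Stratified categories\<close>

lemma subcat_simps [simp]:
  "bhom (subcat_bimod C S) x y = (Hom C x y)\<lparr>carrier := S x y\<rparr>"
  "lact (subcat_bimod C S) x y a f = Comp C x y y (incl C y y a) f"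
  "ract (subcat_bimod C S) x y f a = Comp C x x y f (incl C x x a)"
  by (simp_all add: subcat_bimod_def)

lemma linear_map_restrict_source:
  "linear_map K M N f \<Longrightarrow> S \<subseteq> carrier M \<Longrightarrow> linear_map K (M\<lparr>carrier := S\<rparr>) N f"
  unfolding linear_map_def by (simp add: subset_iff Pi_iff)

lemma linear_map_restrict_ident:
  "S \<subseteq> carrier M \<Longrightarrow> linear_map K (M\<lparr>carrier := S\<rparr>) M (\<lambda>u. u)"
  by (rule linear_map_restrict_source [OF linear_map_ident])

lemma linear_map_restrict_target:
  "linear_map K M N f \<Longrightarrow> (\<And>u. u \<in> carrier M \<Longrightarrow> f u \<in> S) \<Longrightarrow> linear_map K M (N\<lparr>carrier := S\<rparr>) f"
  by (auto simp: linear_map_def)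

lemma linear_map_extend_target:
  "linear_map K M (N\<lparr>carrier := S\<rparr>) f \<Longrightarrow> S \<subseteq> carrier N \<Longrightarrow> linear_map K M N f"
  by (auto simp: linear_map_def)

context stratified_category
begin

abbreviation "P \<equiv> posb C"
abbreviation "N \<equiv> negb C"
abbreviation "U \<equiv> regular_bimod A"
text \<open>All of C as an A-bimodule, obtained as the case in which every morphism is selected, so
  that composition and decomposition can be treated as bimodule morphisms.\<close>

abbreviation "homb \<equiv> subcat_bimod C (\<lambda>x y. carrier (Hom C x y))"
abbreviation "T \<equiv> tensor_hom A P N"

declare Ob_eq [simp]

lemma C_Hom_module [simp]: "x \<in> Ob A \<Longrightarrow> y \<in> Ob A \<Longrightarrow> module K (Hom C x y)"
  using Hom_module by simp

lemma Comp_lin_right: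
  "x \<in> Ob A \<Longrightarrow> y \<in> Ob A \<Longrightarrow> z \<in> Ob A \<Longrightarrow> g \<in> carrier (Hom C y z) \<Longrightarrow> linear_map K X (Hom C x y) f
    \<Longrightarrow> linear_map K X (Hom C x z) (\<lambda>u. Comp C x y z g (f u))"
  by (rule linear_map_compose [OF _ Comp_linear_right]) auto

lemma Comp_lin_left:
  "x \<in> Ob A \<Longrightarrow> y \<in> Ob A \<Longrightarrow> z \<in> Ob A \<Longrightarrow> f \<in> carrier (Hom C x y) \<Longrightarrow> linear_map K X (Hom C y z) g
    \<Longrightarrow> linear_map K X (Hom C x z) (\<lambda>u. Comp C x y z (g u) f)"
  by (rule linear_map_compose [OF _ Comp_linear_left]) auto

lemma Comp_in [simp]:
  "x \<in> Ob A \<Longrightarrow> y \<in> Ob A \<Longrightarrow> z \<in> Ob A \<Longrightarrow> g \<in> carrier (Hom C y z) \<Longrightarrow> f \<in> carrier (Hom C x y)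
    \<Longrightarrow> Comp C x y z g f \<in> carrier (Hom C x z)"
  using linear_map_closed [OF Comp_linear_right, of x y z g f] by simp

lemma Comp_zero [simp]:
  assumes "x \<in> Ob A" "y \<in> Ob A" "z \<in> Ob A"
  shows "g \<in> carrier (Hom C y z) \<Longrightarrow> Comp C x y z g \<zero>\<^bsub>Hom C x y\<^esub> = \<zero>\<^bsub>Hom C x z\<^esub>"
    and "f \<in> carrier (Hom C x y) \<Longrightarrow> Comp C x y z \<zero>\<^bsub>Hom C y z\<^esub> f = \<zero>\<^bsub>Hom C x z\<^esub>"
  using assms linear_map_zero [OF _ _ Comp_linear_right, of x y z g]
    linear_map_zero [OF _ _ Comp_linear_left, of y z x f] by auto

lemma Comp_idn [simp]:
  assumes "x \<in> Ob A" "y \<in> Ob A" "f \<in> carrier (Hom C x y)"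
  shows "Comp C x y y (idn C y) f = f" "Comp C x x y f (idn C x) = f"
  using assms Comp_idn_left Comp_idn_right by auto

lemma C_assoc:
  "w \<in> Ob A \<Longrightarrow> x \<in> Ob A \<Longrightarrow> y \<in> Ob A \<Longrightarrow> z \<in> Ob A \<Longrightarrow>
    f \<in> carrier (Hom C w x) \<Longrightarrow> g \<in> carrier (Hom C x y) \<Longrightarrow> h \<in> carrier (Hom C y z) \<Longrightarrow>
    Comp C w x z (Comp C x y z h g) f = Comp C w y z h (Comp C w x y g f)"
  using Comp_assoc by simp

lemma A_Comp_in [simp]:
  "x \<in> Ob A \<Longrightarrow> y \<in> Ob A \<Longrightarrow> z \<in> Ob A \<Longrightarrow> g \<in> carrier (Hom A y z) \<Longrightarrow> f \<in> carrier (Hom A x y)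
    \<Longrightarrow> Comp A x y z g f \<in> carrier (Hom A x z)"
  using linear_map_closed [OF base.Comp_linear_right, of x y z g f] by simp

lemma pos_wide:
  assumes "x \<in> Ob A" "y \<in> Ob A"
  shows "submodule (pos C x y) K (Hom C x y)"
  using pos_subcategory assms by (auto simp: wide_linear_subcategory_def)

lemma neg_wide:
  assumes "x \<in> Ob A" "y \<in> Ob A"
  shows "submodule (neg C x y) K (Hom C x y)"
  using neg_subcategory assms by (auto simp: wide_linear_subcategory_def)

lemma pos_subset: "x \<in> Ob A \<Longrightarrow> y \<in> Ob A \<Longrightarrow> pos C x y \<subseteq> carrier (Hom C x y)"
  using module.submoduleE(1) [OF C_Hom_module pos_wide] .

lemma neg_subset: "x \<in> Ob A \<Longrightarrow> y \<in> Ob A \<Longrightarrow> neg C x y \<subseteq> carrier (Hom C x y)"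
  using module.submoduleE(1) [OF C_Hom_module neg_wide] .

lemma pos_in [simp]: "f \<in> pos C x y \<Longrightarrow> x \<in> Ob A \<Longrightarrow> y \<in> Ob A \<Longrightarrow> f \<in> carrier (Hom C x y)"
  using pos_subset by blast

lemma neg_in [simp]: "f \<in> neg C x y \<Longrightarrow> x \<in> Ob A \<Longrightarrow> y \<in> Ob A \<Longrightarrow> f \<in> carrier (Hom C x y)"
  using neg_subset by blast

lemma pos_Comp [simp]:
  "x \<in> Ob A \<Longrightarrow> y \<in> Ob A \<Longrightarrow> z \<in> Ob A \<Longrightarrow> g \<in> pos C y z \<Longrightarrow> f \<in> pos C x y \<Longrightarrow> Comp C x y z g f \<in> pos C x z"
  using pos_subcategory by (auto simp: wide_linear_subcategory_def)

lemma neg_Comp [simp]: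
  "x \<in> Ob A \<Longrightarrow> y \<in> Ob A \<Longrightarrow> z \<in> Ob A \<Longrightarrow> g \<in> neg C y z \<Longrightarrow> f \<in> neg C x y \<Longrightarrow> Comp C x y z g f \<in> neg C x z"
  using neg_subcategory by (auto simp: wide_linear_subcategory_def)

lemma idn_pos [simp]: "x \<in> Ob A \<Longrightarrow> idn C x \<in> pos C x x"
  using pos_subcategory by (auto simp: wide_linear_subcategory_def)

lemma zero_pos [simp]: "x \<in> Ob A \<Longrightarrow> y \<in> Ob A \<Longrightarrow> \<zero>\<^bsub>Hom C x y\<^esub> \<in> pos C x y"
  using subgroup.one_closed [OF submodule.axioms(1) [OF pos_wide]] by simp

lemma zero_neg [simp]: "x \<in> Ob A \<Longrightarrow> y \<in> Ob A \<Longrightarrow> \<zero>\<^bsub>Hom C x y\<^esub> \<in> neg C x y"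
  using subgroup.one_closed [OF submodule.axioms(1) [OF neg_wide]] by simp

text \<open>Fixes a normal form: diagonal morphisms are always regarded as elements of
  \<open>pos\<close>.\<close>

lemma neg_diag [simp]: "x \<in> Ob A \<Longrightarrow> neg C x x = pos C x x"
  using pos_neg_diag by simp

lemma incl_pos [simp]: "x \<in> Ob A \<Longrightarrow> a \<in> carrier (Hom A x x) \<Longrightarrow> incl C x x a \<in> pos C x x"
  using incl_bij by (auto simp: bij_betw_def)

lemma incl_linear: "x \<in> Ob A \<Longrightarrow> linear_map K (Hom A x x) (Hom C x x) (incl C x x)"
  using linear_functor.Fm_linear [OF incl_functor] by simp

lemma incl_Comp:
  "x \<in> Ob A \<Longrightarrow> a \<in> carrier (Hom A x x) \<Longrightarrow> b \<in> carrier (Hom A x x)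
    \<Longrightarrow> incl C x x (Comp A x x x a b) = Comp C x x x (incl C x x a) (incl C x x b)"
  using linear_functor.Fm_Comp [OF incl_functor] by simp

lemma incl_idn [simp]: "x \<in> Ob A \<Longrightarrow> incl C x x (idn A x) = idn C x"
  using linear_functor.Fm_idn [OF incl_functor] by simp

lemma subcat_bimodule:
  assumes S: "wide_linear_subcategory K C S" and diag: "\<And>x. x \<in> Ob A \<Longrightarrow> pos C x x \<subseteq> S x x"
  shows "base.bim (subcat_bimod C S)"
proof -
  have sub: "S x y \<subseteq> carrier (Hom C x y)" if "x \<in> Ob A" "y \<in> Ob A" for x y
    using S that module.submoduleE(1) [OF C_Hom_module] by (auto simp: wide_linear_subcategory_def)
  have cl: "Comp C x y z g f \<in> S x z"
    if "x \<in> Ob A" "y \<in> Ob A" "z \<in> Ob A" "g \<in> S y z" "f \<in> S x y" for x y z g f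
    using S that by (auto simp: wide_linear_subcategory_def)
  have inc: "incl C x x a \<in> S x x" if "x \<in> Ob A" "a \<in> carrier (Hom A x x)" for x a
    using diag incl_pos that by blast
  have mem: "f \<in> carrier (Hom C x y)" if "f \<in> S x y" "x \<in> Ob A" "y \<in> Ob A" for f x y
    using sub that by blast
  show ?thesis
  proof (rule bimodule.intro)
    show "module K (bhom (subcat_bimod C S) x y)" if "x \<in> Ob A" "y \<in> Ob A" for x y
      using S that submodule.submodule_is_module [of "S x y" K "Hom C x y"]
      by (simp add: wide_linear_subcategory_def)
  qed (auto simp: mem cl inc sub incl_Comp C_assoc
      intro!: linear_map_restrict_source linear_map_restrict_target
        Comp_lin_right Comp_lin_left incl_linear linear_map_ident)
qed

lemma full_wide: "wide_linear_subcategory K C (\<lambda>x y. carrier (Hom C x y))"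
  by (auto simp: wide_linear_subcategory_def module.carrier_is_submodule)

lemma bims [simp]: "base.bim P" "base.bim N" "base.bim homb"
  by (auto intro!: subcat_bimodule pos_subcategory neg_subcategory full_wide)

subsection \<open>Composition and decomposition\<close>

lemma comp_map_bal:
  assumes "S \<in> {pos C, neg C}" "S' \<in> {pos C, neg C}" "x \<in> Ob A" "y \<in> Ob A"
  shows "base.bal (subcat_bimod C S) (subcat_bimod C S') x y (Hom C x y) (\<lambda>z g f. Comp C x z y g f)"
proof -
  have "S u v \<subseteq> carrier (Hom C u v)" "S' u v \<subseteq> carrier (Hom C u v)" if "u \<in> Ob A" "v \<in> Ob A" for u v
    using that assms by (auto simp: pos_in neg_in)
  then show ?thesis
    using assms(3,4)
    by (intro base.balI) (auto simp: C_assoc subset_iff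
       intro!: Comp_lin_right Comp_lin_left linear_map_restrict_ident)
qed

lemma comp_map_linear:
  assumes "S \<in> {pos C, neg C}" "S' \<in> {pos C, neg C}" "x \<in> Ob A" "y \<in> Ob A"
  shows "linear_map K (tensor_hom A (subcat_bimod C S) (subcat_bimod C S') x y) (Hom C x y) (comp_map A C S S' x y)"
  unfolding comp_map_def using assms
  by (intro base.lift_linear comp_map_bal) auto

lemma comp_map_pure:
  assumes "S \<in> {pos C, neg C}" "S' \<in> {pos C, neg C}" "x \<in> Ob A" "y \<in> Ob A" "z \<in> Ob A" "g \<in> S z y" "f \<in> S' x z"
  shows "comp_map A C S S' x y (pure A (subcat_bimod C S) (subcat_bimod C S') x y z g f) = Comp C x z y g f"
  unfolding comp_map_def using assms
  by (subst base.lift_pure [OF _ _ _ _ _ comp_map_bal]) auto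

text \<open>The target is all of C because a product of a decreasing with an increasing morphism
  need lie in neither part.\<close>

lemma comp_map_mor:
  assumes "S \<in> {pos C, neg C}" "S' \<in> {pos C, neg C}"
  shows "base.mor (tens A (subcat_bimod C S) (subcat_bimod C S')) homb (comp_map A C S S')"
proof -
  have [simp]: "base.bim (subcat_bimod C S)" "base.bim (subcat_bimod C S')"
    using assms by auto
  have S: "u \<in> Ob A \<Longrightarrow> v \<in> Ob A \<Longrightarrow> f \<in> S u v \<Longrightarrow> f \<in> carrier (Hom C u v)"
    "u \<in> Ob A \<Longrightarrow> v \<in> Ob A \<Longrightarrow> f \<in> S' u v \<Longrightarrow> f \<in> carrier (Hom C u v)"
    "u \<in> Ob A \<Longrightarrow> v \<in> Ob A \<Longrightarrow> a \<in> carrier (Hom A v v) \<Longrightarrow> f \<in> S u v \<Longrightarrow> Comp C u v v (incl C v v a) f \<in> S u v"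
    "u \<in> Ob A \<Longrightarrow> v \<in> Ob A \<Longrightarrow> a \<in> carrier (Hom A u u) \<Longrightarrow> f \<in> S' u v \<Longrightarrow> Comp C u u v f (incl C u u a) \<in> S' u v"
    for u v f a
    using assms by auto
  show ?thesis
    by (rule base.tens_morI)
       (auto simp: comp_map_linear [OF assms] comp_map_pure [OF assms] S C_assoc)
qed

abbreviation "mlt \<equiv> comp_map A C (pos C) (neg C)"

lemma mlt_linear: "x \<in> Ob A \<Longrightarrow> y \<in> Ob A \<Longrightarrow> linear_map K (T x y) (Hom C x y) (mlt x y)"
  by (rule comp_map_linear) auto

lemma mlt_pure [simp]:
  "x \<in> Ob A \<Longrightarrow> y \<in> Ob A \<Longrightarrow> z \<in> Ob A \<Longrightarrow> p \<in> pos C z y \<Longrightarrow> n \<in> neg C x z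
    \<Longrightarrow> mlt x y (pure A P N x y z p n) = Comp C x z y p n"
  by (rule comp_map_pure) auto

lemma decomp_mlt [simp]:
  "x \<in> Ob A \<Longrightarrow> y \<in> Ob A \<Longrightarrow> t \<in> carrier (T x y) \<Longrightarrow> decomp A C x y (mlt x y t) = t"
  unfolding decomp_def using comp_bij [of x y] by (auto simp: bij_betw_def the_inv_into_f_f)

lemma mlt_decomp [simp]:
  "x \<in> Ob A \<Longrightarrow> y \<in> Ob A \<Longrightarrow> h \<in> carrier (Hom C x y) \<Longrightarrow> mlt x y (decomp A C x y h) = h"
  unfolding decomp_def using comp_bij [of x y] by (auto simp: bij_betw_def f_the_inv_into_f)

lemma decomp_in [simp]:
  "x \<in> Ob A \<Longrightarrow> y \<in> Ob A \<Longrightarrow> h \<in> carrier (Hom C x y) \<Longrightarrow> decomp A C x y h \<in> carrier (T x y)"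
  unfolding decomp_def using comp_bij [of x y] by (auto simp: bij_betw_def intro: the_inv_into_into)

lemma decomp_mor: "base.mor homb (tens A P N) (decomp A C)"
  unfolding decomp_def [abs_def]
  using base.mor_inv [OF comp_map_mor, of "pos C" "neg C"] comp_bij by simp

lemma decomp_linear: "x \<in> Ob A \<Longrightarrow> y \<in> Ob A \<Longrightarrow> linear_map K (Hom C x y) (T x y) (decomp A C x y)"
  using base.mor_linear [OF decomp_mor] by simp

lemma decomp_Comp:
  "x \<in> Ob A \<Longrightarrow> y \<in> Ob A \<Longrightarrow> z \<in> Ob A \<Longrightarrow> p \<in> pos C z y \<Longrightarrow> n \<in> neg C x z
    \<Longrightarrow> decomp A C x y (Comp C x z y p n) = pure A P N x y z p n"
  using decomp_mlt [of x y "pure A P N x y z p n"] by simp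

text \<open>Every morphism of C comes from a tensor, so the composites of an increasing after a
  decreasing morphism span. This is the extensionality principle by which identities in C are
  verified.\<close>

lemma Hom_ext:
  assumes f: "linear_map K (Hom C x y) X f" and g: "linear_map K (Hom C x y) X g"
    and xy: "x \<in> Ob A" "y \<in> Ob A"
    and eq: "\<And>z p n. z \<in> Ob A \<Longrightarrow> p \<in> pos C z y \<Longrightarrow> n \<in> neg C x z \<Longrightarrow> f (Comp C x z y p n) = g (Comp C x z y p n)"
    and h: "h \<in> carrier (Hom C x y)"
  shows "f h = g h"
proof -
  have "f (mlt x y t) = g (mlt x y t)" if "t \<in> carrier (T x y)" for t
    by (rule base.tens_ext [OF _ _ _ _ linear_map_compose [OF mlt_linear f] linear_map_compose [OF mlt_linear g] _ that])
       (use xy eq in auto)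
  from this [of "decomp A C x y h"] show ?thesis
    using xy h by simp
qed

subsection \<open>Counits and projections\<close>

lemma counit_diag:
  assumes "x \<in> Ob A"
  shows "f \<in> pos C x x \<Longrightarrow> counit A C x x f \<in> carrier (Hom A x x)"
    and "f \<in> pos C x x \<Longrightarrow> incl C x x (counit A C x x f) = f"
    and "a \<in> carrier (Hom A x x) \<Longrightarrow> counit A C x x (incl C x x a) = a"
  using incl_bij [OF assms] unfolding counit_def bij_betw_def
  by (auto simp: f_the_inv_into_f the_inv_into_f_f intro: the_inv_into_into)

lemma counit_off_diag [simp]: "x \<noteq> y \<Longrightarrow> counit A C x y f = \<zero>\<^bsub>Hom A x y\<^esub>"
  by (simp add: counit_def)

lemma incl_inject:
  "x \<in> Ob A \<Longrightarrow> a \<in> carrier (Hom A x x) \<Longrightarrow> b \<in> carrier (Hom A x x) \<Longrightarrow> incl C x x a = incl C x x b \<Longrightarrow> a = b"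
  using counit_diag(3) by metis

lemma A_zero_in [simp]: "x \<in> Ob A \<Longrightarrow> y \<in> Ob A \<Longrightarrow> \<zero>\<^bsub>Hom A x y\<^esub> \<in> carrier (Hom A x y)"
  using base.bhom_zero_in [OF base.regular_bimodule] by simp

lemma counit_linear_diag:
  "x \<in> Ob A \<Longrightarrow> linear_map K ((Hom C x x)\<lparr>carrier := pos C x x\<rparr>) (Hom A x x) (counit A C x x)"
  using linear_map_inv_into [of K "Hom A x x" "(Hom C x x)\<lparr>carrier := pos C x x\<rparr>" "incl C x x"] incl_bij [of x]
    linear_map_restrict_target [OF incl_linear, of x "pos C x x"]
  by (simp add: counit_def [abs_def])

lemma counit_Comp:
  assumes "x \<in> Ob A" "f \<in> pos C x x" "g \<in> pos C x x"
  shows "counit A C x x (Comp C x x x f g) = Comp A x x x (counit A C x x f) (counit A C x x g)"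
  using assms by (intro incl_inject [of x]) (auto simp: counit_diag incl_Comp)

lemma A_Comp_zero [simp]:
  assumes "x \<in> Ob A" "y \<in> Ob A" "z \<in> Ob A"
  shows "g \<in> carrier (Hom A y z) \<Longrightarrow> Comp A x y z g \<zero>\<^bsub>Hom A x y\<^esub> = \<zero>\<^bsub>Hom A x z\<^esub>"
    and "f \<in> carrier (Hom A x y) \<Longrightarrow> Comp A x y z \<zero>\<^bsub>Hom A y z\<^esub> f = \<zero>\<^bsub>Hom A x z\<^esub>"
  using assms linear_map_zero [OF _ _ base.Comp_linear_right, of x y z g]
    linear_map_zero [OF _ _ base.Comp_linear_left, of y z x f] by auto

text \<open>Off the diagonal there is only zero; on the diagonal the counit inverts the
  multiplicative bijection \<open>incl\<close>.\<close>

lemma counit_mor: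
  assumes S: "S \<in> {pos C, neg C}"
  shows "base.mor (subcat_bimod C S) U (counit A C)"
proof -
  have SS: "S x x = pos C x x" if "x \<in> Ob A" for x
    using S that by auto
  show ?thesis
  proof (rule base.morI)
    fix x y assume xy: "x \<in> Ob A" "y \<in> Ob A"
    show "linear_map K (bhom (subcat_bimod C S) x y) (bhom U x y) (counit A C x y)"
    proof (cases "x = y")
      case True
      then show ?thesis using xy counit_linear_diag [of x] by (simp add: SS)
    next
      case False
      then have "counit A C x y = (\<lambda>f. \<zero>\<^bsub>Hom A x y\<^esub>)" by (simp add: fun_eq_iff)
      then show ?thesis using xy by (simp add: linear_map_const_zero)
    qed
    fix m a assume m: "m \<in> carrier (bhom (subcat_bimod C S) x y)"
    show "counit A C x y (lact (subcat_bimod C S) x y a m) = lact U x y a (counit A C x y m)"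
      if "a \<in> carrier (Hom A y y)"
      using xy m that by (cases "x = y") (auto simp: SS counit_Comp counit_diag)
    show "counit A C x y (ract (subcat_bimod C S) x y m a) = ract U x y (counit A C x y m) a"
      if "a \<in> carrier (Hom A x x)"
      using xy m that by (cases "x = y") (auto simp: SS counit_Comp counit_diag)
  qed (use S in auto)
qed

text \<open>The projection id \<otimes> \<epsilon> of C onto its positive factor, read inside C. Of
  the terms p n it keeps those whose intermediate object is the source, where n is a scalar absorbed
  by p. Dually \<open>rpart\<close> keeps the terms whose intermediate object is the target.\<close>

definition lpart :: "'o \<Rightarrow> 'o \<Rightarrow> 'c \<Rightarrow> 'c" where
  "lpart x y h = (runit A P \<bullet> tens_map A P N P U bimod_id (counit A C) \<bullet> decomp A C) x y h"

definition rpart :: "'o \<Rightarrow> 'o \<Rightarrow> 'c \<Rightarrow> 'c" where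
  "rpart x y h = (lunit A N \<bullet> tens_map A P N U N (counit A C) bimod_id \<bullet> decomp A C) x y h"

lemma pos_lact_eq: "pos_lact A C x y z g f = lpart x z (Comp C x y z g f)"
  by (simp add: pos_lact_def lpart_def)

lemma neg_ract_eq: "neg_ract A C x y z f g = rpart x z (Comp C x y z f g)"
  by (simp add: neg_ract_def rpart_def)

lemma lpart_linear:
  assumes "x \<in> Ob A" "y \<in> Ob A"
  shows "linear_map K (Hom C x y) (bhom P x y) (lpart x y)"
  unfolding lpart_def [abs_def] bimod_comp_def
  by (rule linear_map_compose [OF linear_map_compose [OF decomp_linear base.tens_map_linear] base.runit_linear])
     (use assms in \<open>auto intro!: base.mor_id counit_mor\<close>)

lemma rpart_linear:
  assumes "x \<in> Ob A" "y \<in> Ob A"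
  shows "linear_map K (Hom C x y) (bhom N x y) (rpart x y)"
  unfolding rpart_def [abs_def] bimod_comp_def
  by (rule linear_map_compose [OF linear_map_compose [OF decomp_linear base.tens_map_linear] base.lunit_linear])
     (use assms in \<open>auto intro!: base.mor_id counit_mor\<close>)

lemma counit_in:
  "x \<in> Ob A \<Longrightarrow> y \<in> Ob A \<Longrightarrow> f \<in> pos C x y \<Longrightarrow> counit A C x y f \<in> carrier (Hom A x y)"
  "x \<in> Ob A \<Longrightarrow> y \<in> Ob A \<Longrightarrow> f \<in> neg C x y \<Longrightarrow> counit A C x y f \<in> carrier (Hom A x y)"
  by (cases "x = y"; simp add: counit_diag)+

lemma lpart_Comp:
  assumes "x \<in> Ob A" "y \<in> Ob A" "z \<in> Ob A" "p \<in> pos C z y" "n \<in> neg C x z"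
  shows "lpart x y (Comp C x z y p n) = (if z = x then Comp C x z y p n else \<zero>\<^bsub>Hom C x y\<^esub>)"
  using assms
  by (cases "z = x") (simp_all add: lpart_def bimod_comp_def decomp_Comp base.tens_map_pure [OF base.mor_id counit_mor]
      base.runit_pure bimod_id_def counit_in counit_diag)

lemma rpart_Comp:
  assumes "x \<in> Ob A" "y \<in> Ob A" "z \<in> Ob A" "p \<in> pos C z y" "n \<in> neg C x z"
  shows "rpart x y (Comp C x z y p n) = (if z = y then Comp C x z y p n else \<zero>\<^bsub>Hom C x y\<^esub>)"
  using assms
  by (cases "z = y") (simp_all add: rpart_def bimod_comp_def decomp_Comp base.tens_map_pure [OF counit_mor base.mor_id]
      base.lunit_pure bimod_id_def counit_in counit_diag)

end

lemma (in base_category) tens_map_pure_id: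
  assumes "x \<in> Ob A" "y \<in> Ob A" "z \<in> Ob A" "m \<in> carrier (bhom M z y)" "n \<in> carrier (bhom N x z)"
  shows "mor M P f \<Longrightarrow> bim N \<Longrightarrow> tens_map A M N P N f bimod_id x y (pure A M N x y z m n) = pure A P N x y z (f z y m) n"
    and "bim M \<Longrightarrow> mor N Q g \<Longrightarrow> tens_map A M N M Q bimod_id g x y (pure A M N x y z m n) = pure A M Q x y z m (g x z n)"
  using tens_map_pure [OF _ mor_id assms] tens_map_pure [OF mor_id _ assms] by (simp_all add: bimod_id_def)

text \<open>From here on \<open>bhom\<close> of a subcategory bimodule stays folded: unfolding it
  exposes a carrier update and hides the term from the general rules on bimodules.\<close>

lemma subcat_bhom_simps [simp]:
  "carrier (bhom (subcat_bimod C S) x y) = S x y"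
  "zero (bhom (subcat_bimod C S) x y) = \<zero>\<^bsub>Hom C x y\<^esub>"
  "add (bhom (subcat_bimod C S) x y) = add (Hom C x y)"
  "smult (bhom (subcat_bimod C S) x y) = smult (Hom C x y)"
  by simp_all

declare subcat_simps [simp del]

section \<open>Calculus of the two projections of C onto its factors\<close>

context stratified_category
begin

lemma bhom_target:
  "linear_map K X (Hom C x y) f \<Longrightarrow> (\<And>u. u \<in> carrier X \<Longrightarrow> f u \<in> S x y)
    \<Longrightarrow> linear_map K X (bhom (subcat_bimod C S) x y) f"
  unfolding subcat_simps by (rule linear_map_restrict_target)

lemma bhom_P_target:
  "x \<in> Ob A \<Longrightarrow> y \<in> Ob A \<Longrightarrow> linear_map K X (bhom P x y) f \<Longrightarrow> linear_map K X (Hom C x y) f"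
  unfolding subcat_simps by (rule linear_map_extend_target) (auto simp: pos_subset)

lemma bhom_N_target:
  "x \<in> Ob A \<Longrightarrow> y \<in> Ob A \<Longrightarrow> linear_map K X (bhom N x y) f \<Longrightarrow> linear_map K X (Hom C x y) f"
  unfolding subcat_simps by (rule linear_map_extend_target) (auto simp: neg_subset)

lemma bhom_const_zero:
  assumes "x \<in> Ob A" "y \<in> Ob A"
  shows "linear_map K X (bhom P x y) (\<lambda>u. \<zero>\<^bsub>Hom C x y\<^esub>)"
    and "linear_map K X (bhom N x y) (\<lambda>u. \<zero>\<^bsub>Hom C x y\<^esub>)"
  using linear_map_const_zero [OF base.bhom_is_module [OF bims(1) assms]]
    linear_map_const_zero [OF base.bhom_is_module [OF bims(2) assms]] by simp_all

lemma lpart_in [simp]: "x \<in> Ob A \<Longrightarrow> y \<in> Ob A \<Longrightarrow> h \<in> carrier (Hom C x y) \<Longrightarrow> lpart x y h \<in> pos C x y"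
  using linear_map_closed [OF lpart_linear] by simp

lemma rpart_in [simp]: "x \<in> Ob A \<Longrightarrow> y \<in> Ob A \<Longrightarrow> h \<in> carrier (Hom C x y) \<Longrightarrow> rpart x y h \<in> neg C x y"
  using linear_map_closed [OF rpart_linear] by simp

lemma lpart_lin:
  "x \<in> Ob A \<Longrightarrow> y \<in> Ob A \<Longrightarrow> linear_map K X (Hom C x y) f \<Longrightarrow> linear_map K X (bhom P x y) (\<lambda>u. lpart x y (f u))"
  by (rule linear_map_compose [OF _ lpart_linear])

lemma rpart_lin:
  "x \<in> Ob A \<Longrightarrow> y \<in> Ob A \<Longrightarrow> linear_map K X (Hom C x y) f \<Longrightarrow> linear_map K X (bhom N x y) (\<lambda>u. rpart x y (f u))"
  by (rule linear_map_compose [OF _ rpart_linear])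

lemma lpart_lin_Hom:
  "x \<in> Ob A \<Longrightarrow> y \<in> Ob A \<Longrightarrow> linear_map K X (Hom C x y) f \<Longrightarrow> linear_map K X (Hom C x y) (\<lambda>u. lpart x y (f u))"
  by (rule bhom_P_target [OF _ _ lpart_lin])

lemma rpart_lin_Hom:
  "x \<in> Ob A \<Longrightarrow> y \<in> Ob A \<Longrightarrow> linear_map K X (Hom C x y) f \<Longrightarrow> linear_map K X (Hom C x y) (\<lambda>u. rpart x y (f u))"
  by (rule bhom_N_target [OF _ _ rpart_lin])

lemmas hlin = lpart_lin_Hom rpart_lin_Hom Comp_lin_left Comp_lin_right linear_map_ident linear_map_const_zero

lemma lpart_pos [simp]: "x \<in> Ob A \<Longrightarrow> y \<in> Ob A \<Longrightarrow> p \<in> pos C x y \<Longrightarrow> lpart x y p = p"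
  using lpart_Comp [of x y x p "idn C x"] by simp

lemma rpart_pos: "x \<in> Ob A \<Longrightarrow> y \<in> Ob A \<Longrightarrow> p \<in> pos C x y \<Longrightarrow> rpart x y p = (if x = y then p else \<zero>\<^bsub>Hom C x y\<^esub>)"
  using rpart_Comp [of x y x p "idn C x"] by (cases "x = y") auto

lemma rpart_neg [simp]: "x \<in> Ob A \<Longrightarrow> y \<in> Ob A \<Longrightarrow> n \<in> neg C x y \<Longrightarrow> rpart x y n = n"
  using rpart_Comp [of x y y "idn C y" n] by simp

lemma lpart_zero [simp]: "x \<in> Ob A \<Longrightarrow> y \<in> Ob A \<Longrightarrow> lpart x y \<zero>\<^bsub>Hom C x y\<^esub> = \<zero>\<^bsub>Hom C x y\<^esub>"
  by simp

lemma rpart_zero [simp]: "x \<in> Ob A \<Longrightarrow> y \<in> Ob A \<Longrightarrow> rpart x y \<zero>\<^bsub>Hom C x y\<^esub> = \<zero>\<^bsub>Hom C x y\<^esub>"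
  by simp

lemma le_antisym: "(x, y) \<in> le A \<Longrightarrow> (y, x) \<in> le A \<Longrightarrow> x = y"
  using base.le_order by (auto simp: partial_order_on_def antisym_def)

lemma neg_antisym:
  "x \<in> Ob A \<Longrightarrow> y \<in> Ob A \<Longrightarrow> x \<noteq> y \<Longrightarrow> n \<in> neg C x y \<Longrightarrow> n' \<in> neg C y x
    \<Longrightarrow> n = \<zero>\<^bsub>Hom C x y\<^esub> \<or> n' = \<zero>\<^bsub>Hom C y x\<^esub>"
  using neg_zero [of x y] neg_zero [of y x] le_antisym [of x y] by blast

lemma pos_antisym:
  "x \<in> Ob A \<Longrightarrow> y \<in> Ob A \<Longrightarrow> x \<noteq> y \<Longrightarrow> p \<in> pos C x y \<Longrightarrow> p' \<in> pos C y x
    \<Longrightarrow> p = \<zero>\<^bsub>Hom C x y\<^esub> \<or> p' = \<zero>\<^bsub>Hom C y x\<^esub>"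
  using pos_zero [of x y] pos_zero [of y x] le_antisym [of x y] by blast

text \<open>Write h = p n'. Then h n = p (n' n), and its projection can be nonzero only if n' ends
  at \<open>w\<close>. In that case n and n' are decreasing morphisms in opposite directions between
  distinct objects, so one of them is zero.\<close>

lemma lpart_Comp_strict:
  assumes "w \<in> Ob A" "x \<in> Ob A" "y \<in> Ob A" "w \<noteq> x" "n \<in> neg C w x" "h \<in> carrier (Hom C x y)"
  shows "lpart w y (Comp C w x y h n) = \<zero>\<^bsub>Hom C w y\<^esub>"
proof (rule Hom_ext [where f = "\<lambda>h. lpart w y (Comp C w x y h n)", OF _ _ assms(2,3) _ assms(6)])
  fix z p n' assume z: "z \<in> Ob A" "p \<in> pos C z y" "n' \<in> neg C x z"
  have "Comp C w x w n' n = \<zero>\<^bsub>Hom C w w\<^esub>" if "z = w"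
    using neg_antisym [of w x n n'] assms z that by auto
  then show "lpart w y (Comp C w x y (Comp C x z y p n') n) = \<zero>\<^bsub>Hom C w y\<^esub>"
    using assms z by (cases "z = w") (auto simp: C_assoc lpart_Comp)
qed (use assms in \<open>auto intro!: hlin\<close>)

lemma rpart_Comp_strict:
  assumes "x \<in> Ob A" "y \<in> Ob A" "w \<in> Ob A" "y \<noteq> w" "p \<in> pos C y w" "h \<in> carrier (Hom C x y)"
  shows "rpart x w (Comp C x y w p h) = \<zero>\<^bsub>Hom C x w\<^esub>"
proof (rule Hom_ext [where f = "\<lambda>h. rpart x w (Comp C x y w p h)", OF _ _ assms(1,2) _ assms(6)])
  fix z p' n assume z: "z \<in> Ob A" "p' \<in> pos C z y" "n \<in> neg C x z"
  have "Comp C w y w p p' = \<zero>\<^bsub>Hom C w w\<^esub>" if "z = w"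
    using pos_antisym [of y w p p'] assms z that by auto
  then show "rpart x w (Comp C x y w p (Comp C x z y p' n)) = \<zero>\<^bsub>Hom C x w\<^esub>"
    using assms z by (cases "z = w") (auto simp: rpart_Comp simp flip: C_assoc)
qed (use assms in \<open>auto intro!: hlin\<close>)

text \<open>The kernel of \<open>lpart\<close> is the left ideal generated by the strictly decreasing part of \<open>C\<^sup>-\<close>, which is
  why \<open>lpart (g h)\<close> depends on \<open>h\<close> only through \<open>lpart h\<close>.\<close>

lemma lpart_lpart:
  assumes "x \<in> Ob A" "y \<in> Ob A" "z \<in> Ob A" "g \<in> carrier (Hom C y z)" "h \<in> carrier (Hom C x y)"
  shows "lpart x z (Comp C x y z g (lpart x y h)) = lpart x z (Comp C x y z g h)"
proof (rule Hom_ext [where f = "\<lambda>h. lpart x z (Comp C x y z g (lpart x y h))" and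
      g = "\<lambda>h. lpart x z (Comp C x y z g h)", OF _ _ assms(1,2) _ assms(5)])
  fix w p n assume w: "w \<in> Ob A" "p \<in> pos C w y" "n \<in> neg C x w"
  show "lpart x z (Comp C x y z g (lpart x y (Comp C x w y p n))) =
      lpart x z (Comp C x y z g (Comp C x w y p n))"
  proof (cases "w = x")
    case True
    then show ?thesis using assms w by (simp add: lpart_Comp)
  next
    case False
    then have "lpart x y (Comp C x w y p n) = \<zero>\<^bsub>Hom C x y\<^esub>"
      using assms w by (simp add: lpart_Comp)
    moreover have "lpart x z (Comp C x w z (Comp C w y z g p) n) = \<zero>\<^bsub>Hom C x z\<^esub>"
      using assms w False by (intro lpart_Comp_strict) simp_all
    ultimately show ?thesis
      using assms w C_assoc [of x w y z n p g] by (simp only: Comp_zero lpart_zero pos_in neg_in)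
  qed
qed (use assms in \<open>auto intro!: hlin\<close>)

lemma rpart_rpart:
  assumes "x \<in> Ob A" "y \<in> Ob A" "z \<in> Ob A" "h \<in> carrier (Hom C x y)" "g \<in> carrier (Hom C y z)"
  shows "rpart x z (Comp C x y z (rpart y z g) h) = rpart x z (Comp C x y z g h)"
proof (rule Hom_ext [where f = "\<lambda>g. rpart x z (Comp C x y z (rpart y z g) h)" and
      g = "\<lambda>g. rpart x z (Comp C x y z g h)", OF _ _ assms(2,3) _ assms(5)])
  fix w p n assume w: "w \<in> Ob A" "p \<in> pos C w z" "n \<in> neg C y w"
  show "rpart x z (Comp C x y z (rpart y z (Comp C y w z p n)) h) =
      rpart x z (Comp C x y z (Comp C y w z p n) h)"
  proof (cases "w = z")
    case True
    then show ?thesis using assms w by (simp add: rpart_Comp)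
  next
    case False
    then have "rpart y z (Comp C y w z p n) = \<zero>\<^bsub>Hom C y z\<^esub>"
      using assms w by (simp add: rpart_Comp)
    moreover have "rpart x z (Comp C x w z p (Comp C x y w n h)) = \<zero>\<^bsub>Hom C x z\<^esub>"
      using assms w False by (intro rpart_Comp_strict) simp_all
    ultimately show ?thesis
      using assms w C_assoc [of x y w z h n p] by (simp only: Comp_zero rpart_zero pos_in neg_in)
  qed
qed (use assms in \<open>auto intro!: hlin\<close>)

lemma lpart_pos_Comp:
  assumes "x \<in> Ob A" "y \<in> Ob A" "z \<in> Ob A" "p \<in> pos C y z" "h \<in> carrier (Hom C x y)"
  shows "lpart x z (Comp C x y z p h) = Comp C x y z p (lpart x y h)"
  by (rule Hom_ext [where f = "\<lambda>h. lpart x z (Comp C x y z p h)" and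
      g = "\<lambda>h. Comp C x y z p (lpart x y h)", OF _ _ assms(1,2) _ assms(5)])
    (use assms in \<open>auto intro!: hlin simp: lpart_Comp simp flip: C_assoc\<close>)

lemma rpart_Comp_neg:
  assumes "x \<in> Ob A" "y \<in> Ob A" "z \<in> Ob A" "n \<in> neg C x y" "h \<in> carrier (Hom C y z)"
  shows "rpart x z (Comp C x y z h n) = Comp C x y z (rpart y z h) n"
  by (rule Hom_ext [where f = "\<lambda>h. rpart x z (Comp C x y z h n)" and
      g = "\<lambda>h. Comp C x y z (rpart y z h) n", OF _ _ assms(2,3) _ assms(5)])
    (use assms in \<open>auto intro!: hlin simp: rpart_Comp C_assoc\<close>)

lemma lpart_Comp_diag:
  assumes "x \<in> Ob A" "y \<in> Ob A" "a \<in> pos C x x" "h \<in> carrier (Hom C x y)"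
  shows "lpart x y (Comp C x x y h a) = Comp C x x y (lpart x y h) a"
  by (rule Hom_ext [where f = "\<lambda>h. lpart x y (Comp C x x y h a)" and
      g = "\<lambda>h. Comp C x x y (lpart x y h) a", OF _ _ assms(1,2) _ assms(4)])
    (use assms in \<open>auto intro!: hlin simp: lpart_Comp C_assoc\<close>)

lemma rpart_diag_Comp:
  assumes "x \<in> Ob A" "y \<in> Ob A" "a \<in> pos C y y" "h \<in> carrier (Hom C x y)"
  shows "rpart x y (Comp C x y y a h) = Comp C x y y a (rpart x y h)"
  by (rule Hom_ext [where f = "\<lambda>h. rpart x y (Comp C x y y a h)" and
      g = "\<lambda>h. Comp C x y y a (rpart x y h)", OF _ _ assms(1,2) _ assms(4)])
    (use assms in \<open>auto intro!: hlin simp: rpart_Comp simp flip: C_assoc\<close>)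

text \<open>For an endomorphism both projections keep the same summand, the one whose intermediate
  object is the object itself.\<close>

lemma lpart_eq_rpart:
  assumes "x \<in> Ob A" "h \<in> carrier (Hom C x x)"
  shows "lpart x x h = rpart x x h"
  by (rule Hom_ext [where f = "lpart x x" and g = "rpart x x" and X = "Hom C x x", OF _ _ assms(1,1) _ assms(2)])
    (use assms in \<open>auto intro!: hlin simp: lpart_Comp rpart_Comp\<close>)

subsection \<open>The pairing\<close>

lemma twist_mor: "base.mor (tens A N P) (tens A P N) (twist A C)"
  unfolding twist_def by (rule base.mor_comp [OF comp_map_mor decomp_mor]) auto

lemma counit_P: "base.mor P U (counit A C)" and counit_N: "base.mor N U (counit A C)"
  by (auto intro: counit_mor)

lemma pairing_mor: "base.mor (tens A N P) U (pairing A C)"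
  unfolding pairing_def
  by (rule base.mor_comp [OF base.mor_comp [OF twist_mor base.tens_map_mor [OF counit_P counit_N]] base.lunit_mor])
     simp

lemma twist_pure:
  "x \<in> Ob A \<Longrightarrow> y \<in> Ob A \<Longrightarrow> z \<in> Ob A \<Longrightarrow> n \<in> neg C z y \<Longrightarrow> p \<in> pos C x z
    \<Longrightarrow> twist A C x y (pure A N P x y z n p) = decomp A C x y (Comp C x z y n p)"
  by (simp add: twist_def bimod_comp_def comp_map_pure)

text \<open>The product of the two counits is nonzero only where source, intermediate object and
  target agree, and there it is the scalar that \<open>lpart\<close> leaves.\<close>

lemma pairing_pure:
  assumes xyz: "x \<in> Ob A" "y \<in> Ob A" "z \<in> Ob A" and n: "n \<in> neg C z y" and p: "p \<in> pos C x z"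
  shows "pairing A C x y (pure A N P x y z n p) = counit A C x y (lpart x y (Comp C x z y n p))"
proof -
  let ?e = "\<lambda>h. lunit A U x y (tens_map A P N U U (counit A C) (counit A C) x y (decomp A C x y h))"
  have lin: "linear_map K (Hom C x y) (Hom A x y) ?e"
    by (rule linear_map_compose [OF linear_map_compose [OF decomp_linear base.tens_map_linear [OF counit_P counit_N]]
          base.lunit_linear [OF base.regular_bimodule, unfolded base.regular_simps]]) (use xyz in simp_all)
  have "?e h = counit A C x y (lpart x y h)" if h: "h \<in> carrier (Hom C x y)" for h
  proof (rule Hom_ext [OF lin _ xyz(1,2) _ h])
    show "linear_map K (Hom C x y) (Hom A x y) (\<lambda>h. counit A C x y (lpart x y h))"
      by (rule linear_map_compose [OF lpart_linear base.mor_linear [OF counit_P, unfolded base.regular_simps]])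
         (use xyz in simp_all)
    fix w q m assume w: "w \<in> Ob A" "q \<in> pos C w y" "m \<in> neg C x w"
    then have "?e (Comp C x w y q m)
      = (if w = y then Comp A x y y (counit A C y y q) (counit A C x y m) else \<zero>\<^bsub>Hom A x y\<^esub>)"
      using xyz
      by (cases "w = y") (simp_all add: decomp_Comp base.tens_map_pure [OF counit_P counit_N] base.lunit_pure counit_in)
    moreover have "counit A C x y (if w = x then Comp C x w y q m else \<zero>\<^bsub>Hom C x y\<^esub>)
      = (if w = y then Comp A x y y (counit A C y y q) (counit A C x y m) else \<zero>\<^bsub>Hom A x y\<^esub>)"
    proof (cases "x = y")
      case True
      then show ?thesis
        using w xyz linear_map_zero [OF _ _ base.mor_linear [OF counit_P], of x x]
        by (cases "w = y") (simp_all add: counit_Comp)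
    next
      case False
      then show ?thesis using w xyz by (cases "w = y") (simp_all add: counit_diag)
    qed
    ultimately show "?e (Comp C x w y q m) = counit A C x y (lpart x y (Comp C x w y q m))"
      using xyz w by (simp only: lpart_Comp)
  qed
  then show ?thesis
    using assms by (simp add: pairing_def bimod_comp_def twist_pure)
qed

subsection \<open>Contractions\<close>

text \<open>This is (\<beta> \<otimes> id)(n \<otimes> t) with the unit constraint removed: p
  \<otimes> n' goes to \<beta>(n \<otimes> p) n'. The scalar \<beta>(n \<otimes> p) lies in A(z, y),
  which is zero unless z = y; hence the case distinction. Dually \<open>cR\<close> is (id \<otimes>
  \<beta>)(t \<otimes> p), and \<open>sandw\<close> is the composition of the category attached to
  \<beta>.\<close>

definition cL :: "('o \<Rightarrow> 'o \<Rightarrow> ('o, 'c, 'c) btensor \<Rightarrow> 'a) \<Rightarrow> 'o \<Rightarrow> 'o \<Rightarrow> 'o \<Rightarrow> 'c \<Rightarrow> ('o, 'c, 'c) btensor \<Rightarrow> 'c" where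
  "cL \<beta> w x y n t = lift A P N w x (bhom N w y)
     (\<lambda>z p n'. if z = y then lact N w y (\<beta> y y (pure A N P y y x n p)) n' else \<zero>\<^bsub>bhom N w y\<^esub>) t"

definition cR :: "('o \<Rightarrow> 'o \<Rightarrow> ('o, 'c, 'c) btensor \<Rightarrow> 'a) \<Rightarrow> 'o \<Rightarrow> 'o \<Rightarrow> 'o \<Rightarrow> ('o, 'c, 'c) btensor \<Rightarrow> 'c \<Rightarrow> 'c" where
  "cR \<beta> w x y t p = lift A P N x y (bhom P w y)
     (\<lambda>z p' n. if z = w then ract P w y p' (\<beta> w w (pure A N P w w x n p)) else \<zero>\<^bsub>bhom P w y\<^esub>) t"

definition sandw :: "('o \<Rightarrow> 'o \<Rightarrow> ('o, 'c, 'c) btensor \<Rightarrow> 'a) \<Rightarrow> 'o \<Rightarrow> 'o \<Rightarrow> 'o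
    \<Rightarrow> ('o, 'c, 'c) btensor \<Rightarrow> ('o, 'c, 'c) btensor \<Rightarrow> ('o, 'c, 'c) btensor" where
  "sandw \<beta> w x y s t = lift A P N x y (T w y) (\<lambda>z p n. pure A P N w y z p (cL \<beta> w x z n t)) s"

context
  fixes \<beta> :: "'o \<Rightarrow> 'o \<Rightarrow> ('o, 'c, 'c) btensor \<Rightarrow> 'a"
  assumes \<beta>: "base.mor (tens A N P) U \<beta>"
begin

lemma beta_lin:
  "x \<in> Ob A \<Longrightarrow> y \<in> Ob A \<Longrightarrow> linear_map K X (tensor_hom A N P x y) g \<Longrightarrow> linear_map K X (Hom A x y) (\<lambda>u. \<beta> x y (g u))"
  using base.mor_lin [OF \<beta>] by simp

lemma beta_in [simp]:
  "x \<in> Ob A \<Longrightarrow> y \<in> Ob A \<Longrightarrow> t \<in> carrier (tensor_hom A N P x y) \<Longrightarrow> \<beta> x y t \<in> carrier (Hom A x y)"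
  using base.mor_in [OF \<beta>] by simp

lemma beta_lact:
  "x \<in> Ob A \<Longrightarrow> y \<in> Ob A \<Longrightarrow> z \<in> Ob A \<Longrightarrow> n \<in> neg C z y \<Longrightarrow> p \<in> pos C x z \<Longrightarrow> a \<in> carrier (Hom A y y)
    \<Longrightarrow> \<beta> x y (pure A N P x y z (lact N z y a n) p) = Comp A x y y a (\<beta> x y (pure A N P x y z n p))"
  using base.mor_lact [OF \<beta>, of x y "pure A N P x y z n p" a] by simp

lemma beta_ract:
  "x \<in> Ob A \<Longrightarrow> y \<in> Ob A \<Longrightarrow> z \<in> Ob A \<Longrightarrow> n \<in> neg C z y \<Longrightarrow> p \<in> pos C x z \<Longrightarrow> a \<in> carrier (Hom A x x)
    \<Longrightarrow> \<beta> x y (pure A N P x y z n (ract P x z p a)) = Comp A x x y (\<beta> x y (pure A N P x y z n p)) a"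
  using base.mor_ract [OF \<beta>, of x y "pure A N P x y z n p" a] by simp

lemma cL_bal:
  assumes "w \<in> Ob A" "x \<in> Ob A" "y \<in> Ob A" "n \<in> neg C x y"
  shows "base.bal P N w x (bhom N w y)
     (\<lambda>z p n'. if z = y then lact N w y (\<beta> y y (pure A N P y y x n p)) n' else \<zero>\<^bsub>bhom N w y\<^esub>)"
proof (rule base.balI)
  fix z p assume "z \<in> Ob A" "p \<in> carrier (bhom P z x)"
  then show "linear_map K (bhom N w z) (bhom N w y)
       (\<lambda>n'. if z = y then lact N w y (\<beta> y y (pure A N P y y x n p)) n' else \<zero>\<^bsub>bhom N w y\<^esub>)"
    using assms by (cases "z = y") (auto intro!: base.lin bhom_const_zero)
next
  fix z n' assume "z \<in> Ob A" "n' \<in> carrier (bhom N w z)"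
  then show "linear_map K (bhom P z x) (bhom N w y)
       (\<lambda>p. if z = y then lact N w y (\<beta> y y (pure A N P y y x n p)) n' else \<zero>\<^bsub>bhom N w y\<^esub>)"
    using assms by (cases "z = y") (auto intro!: base.lin beta_lin bhom_const_zero simp del: neg_diag)
next
  fix z p a n' assume "z \<in> Ob A" "p \<in> carrier (bhom P z x)" "a \<in> carrier (Hom A z z)" "n' \<in> carrier (bhom N w z)"
  then show "(if z = y then lact N w y (\<beta> y y (pure A N P y y x n (ract P z x p a))) n' else \<zero>\<^bsub>bhom N w y\<^esub>)
    = (if z = y then lact N w y (\<beta> y y (pure A N P y y x n p)) (lact N w z a n') else \<zero>\<^bsub>bhom N w y\<^esub>)"
    using assms by (auto simp: beta_ract base.lact_Comp)
qed

lemma cL_linear: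
  assumes "w \<in> Ob A" "x \<in> Ob A" "y \<in> Ob A" "n \<in> neg C x y"
  shows "linear_map K (T w x) (bhom N w y) (cL \<beta> w x y n)"
  unfolding cL_def [abs_def] using assms by (intro base.lift_linear cL_bal) auto

lemma cL_pure:
  assumes "w \<in> Ob A" "x \<in> Ob A" "y \<in> Ob A" "n \<in> neg C x y" "z \<in> Ob A" "p \<in> pos C z x" "n' \<in> neg C w z"
  shows "cL \<beta> w x y n (pure A P N w x z p n')
    = (if z = y then lact N w y (\<beta> y y (pure A N P y y x n p)) n' else \<zero>\<^bsub>Hom C w y\<^esub>)"
  unfolding cL_def using assms by (subst base.lift_pure [OF _ _ _ _ _ cL_bal]) auto

lemma cL_linear_param:
  assumes "w \<in> Ob A" "x \<in> Ob A" "y \<in> Ob A" "t \<in> carrier (T w x)"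
  shows "linear_map K (bhom N x y) (bhom N w y) (\<lambda>n. cL \<beta> w x y n t)"
  unfolding cL_def using assms
  by (intro base.lift_linear_param) (auto intro!: cL_bal base.lin beta_lin linear_map_if bhom_const_zero)

lemma cL_in [simp]:
  assumes "w \<in> Ob A" "x \<in> Ob A" "y \<in> Ob A" "n \<in> neg C x y" "t \<in> carrier (T w x)"
  shows "cL \<beta> w x y n t \<in> neg C w y"
  using linear_map_closed [OF cL_linear assms(5)] assms by simp

lemma cL_lact:
  assumes "w \<in> Ob A" "x \<in> Ob A" "y \<in> Ob A" "n \<in> neg C x y" "t \<in> carrier (T w x)" "a \<in> carrier (Hom A y y)"
  shows "cL \<beta> w x y (lact N x y a n) t = lact N w y a (cL \<beta> w x y n t)"
proof (rule base.tens_ext [OF _ _ assms(1,2) cL_linear base.lact_lin [OF _ _ _ _ cL_linear] _ assms(5)])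
  have [simp]: "lact N x y a n \<in> neg C x y"
    using base.lact_in [of N x y a n] assms by simp
  show "cL \<beta> w x y (lact N x y a n) (pure A P N w x z p n') = lact N w y a (cL \<beta> w x y n (pure A P N w x z p n'))"
    if "z \<in> Ob A" "p \<in> carrier (bhom P z x)" "n' \<in> carrier (bhom N w z)" for z p n'
    using assms that base.lact_zero [of N w y a] by (auto simp: cL_pure beta_lact base.lact_Comp)
qed (use assms base.lact_in [of N x y a n] in auto)

lemma cR_bal:
  assumes "w \<in> Ob A" "x \<in> Ob A" "y \<in> Ob A" "p \<in> pos C w x"
  shows "base.bal P N x y (bhom P w y)
     (\<lambda>z p' n. if z = w then ract P w y p' (\<beta> w w (pure A N P w w x n p)) else \<zero>\<^bsub>bhom P w y\<^esub>)"
proof (rule base.balI)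
  fix z p' assume "z \<in> Ob A" "p' \<in> carrier (bhom P z y)"
  then show "linear_map K (bhom N x z) (bhom P w y)
     (\<lambda>n. if z = w then ract P w y p' (\<beta> w w (pure A N P w w x n p)) else \<zero>\<^bsub>bhom P w y\<^esub>)"
    using assms by (cases "z = w") (auto intro!: base.lin beta_lin bhom_const_zero)
next
  fix z n assume "z \<in> Ob A" "n \<in> carrier (bhom N x z)"
  then show "linear_map K (bhom P z y) (bhom P w y)
     (\<lambda>p'. if z = w then ract P w y p' (\<beta> w w (pure A N P w w x n p)) else \<zero>\<^bsub>bhom P w y\<^esub>)"
    using assms by (cases "z = w") (auto intro!: base.lin beta_lin bhom_const_zero)
next
  fix z p' a n assume "z \<in> Ob A" "p' \<in> carrier (bhom P z y)" "a \<in> carrier (Hom A z z)" "n \<in> carrier (bhom N x z)"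
  then show "(if z = w then ract P w y (ract P z y p' a) (\<beta> w w (pure A N P w w x n p)) else \<zero>\<^bsub>bhom P w y\<^esub>)
    = (if z = w then ract P w y p' (\<beta> w w (pure A N P w w x (lact N x z a n) p)) else \<zero>\<^bsub>bhom P w y\<^esub>)"
    using assms by (auto simp: beta_lact base.ract_Comp)
qed

lemma cR_linear:
  assumes "w \<in> Ob A" "x \<in> Ob A" "y \<in> Ob A" "p \<in> pos C w x"
  shows "linear_map K (T x y) (bhom P w y) (\<lambda>t. cR \<beta> w x y t p)"
  unfolding cR_def [abs_def] using assms by (intro base.lift_linear cR_bal) auto

lemma cR_pure:
  assumes "w \<in> Ob A" "x \<in> Ob A" "y \<in> Ob A" "p \<in> pos C w x" "z \<in> Ob A" "p' \<in> pos C z y" "n \<in> neg C x z"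
  shows "cR \<beta> w x y (pure A P N x y z p' n) p
    = (if z = w then ract P w y p' (\<beta> w w (pure A N P w w x n p)) else \<zero>\<^bsub>Hom C w y\<^esub>)"
  unfolding cR_def using assms by (subst base.lift_pure [OF _ _ _ _ _ cR_bal]) auto

lemma cR_linear_param:
  assumes "w \<in> Ob A" "x \<in> Ob A" "y \<in> Ob A" "t \<in> carrier (T x y)"
  shows "linear_map K (bhom P w x) (bhom P w y) (cR \<beta> w x y t)"
  unfolding cR_def [abs_def] using assms
  by (intro base.lift_linear_param) (auto intro!: cR_bal base.lin beta_lin linear_map_if bhom_const_zero)

lemma cR_in [simp]:
  assumes "w \<in> Ob A" "x \<in> Ob A" "y \<in> Ob A" "p \<in> pos C w x" "t \<in> carrier (T x y)"
  shows "cR \<beta> w x y t p \<in> pos C w y"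
  using linear_map_closed [OF cR_linear assms(5)] assms by simp

lemma sandw_bal:
  assumes "w \<in> Ob A" "x \<in> Ob A" "y \<in> Ob A" "t \<in> carrier (T w x)"
  shows "base.bal P N x y (T w y) (\<lambda>z p n. pure A P N w y z p (cL \<beta> w x z n t))"
  using assms
  by (intro base.balI) (auto intro!: base.lin cL_linear_param simp: base.pure_balanced cL_lact)

lemma sandw_linear:
  assumes "w \<in> Ob A" "x \<in> Ob A" "y \<in> Ob A" "t \<in> carrier (T w x)"
  shows "linear_map K (T x y) (T w y) (\<lambda>s. sandw \<beta> w x y s t)"
  unfolding sandw_def using assms by (intro base.lift_linear sandw_bal) auto

lemma sandw_linear_param:
  assumes "w \<in> Ob A" "x \<in> Ob A" "y \<in> Ob A" "s \<in> carrier (T x y)"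
  shows "linear_map K (T w x) (T w y) (sandw \<beta> w x y s)"
  unfolding sandw_def [abs_def] using assms
  by (intro base.lift_linear_param) (auto intro!: sandw_bal base.lin cL_linear)

lemma sandw_pure:
  assumes "w \<in> Ob A" "x \<in> Ob A" "y \<in> Ob A" "t \<in> carrier (T w x)" "z \<in> Ob A" "p \<in> pos C z y" "n \<in> neg C x z"
  shows "sandw \<beta> w x y (pure A P N x y z p n) t = pure A P N w y z p (cL \<beta> w x z n t)"
  unfolding sandw_def using assms by (subst base.lift_pure [OF _ _ _ _ _ sandw_bal]) auto

lemma sandw_in [simp]:
  assumes "w \<in> Ob A" "x \<in> Ob A" "y \<in> Ob A" "s \<in> carrier (T x y)" "t \<in> carrier (T w x)"
  shows "sandw \<beta> w x y s t \<in> carrier (T w y)"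
  using linear_map_closed [OF sandw_linear assms(4)] assms by simp

text \<open>By definition \<open>sandw\<close> contracts the second tensor from the left. Moving the
  resulting scalar across the tensor sign turns this into a contraction of the first tensor from the
  right.\<close>

lemma sandw_pure_right:
  assumes "w \<in> Ob A" "x \<in> Ob A" "y \<in> Ob A" "s \<in> carrier (T x y)" "z \<in> Ob A" "p \<in> pos C z x" "n \<in> neg C w z"
  shows "sandw \<beta> w x y s (pure A P N w x z p n) = pure A P N w y z (cR \<beta> z x y s p) n"
proof (rule base.tens_ext [OF _ _ assms(2,3) sandw_linear base.pure_linear_left [OF _ _ _ _ _ _ cR_linear] _ assms(4)])
  fix v p' n' assume v: "v \<in> Ob A" "p' \<in> carrier (bhom P v y)" "n' \<in> carrier (bhom N x v)"
  show "sandw \<beta> w x y (pure A P N x y v p' n') (pure A P N w x z p n)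
      = pure A P N w y z (cR \<beta> z x y (pure A P N x y v p' n') p) n"
    using assms v base.pure_zero_left [of P N w y z n] base.pure_zero_right [of P N w y v p']
    by (cases "v = z") (auto simp: sandw_pure cL_pure cR_pure base.pure_balanced)
qed (use assms in auto)

end

text \<open>Both sides are linear in \<open>t\<close>, and on a pure tensor the associator and the
  unit map just evaluate to the action of the scalar produced by \<beta>.\<close>

lemma contraction_left:
  assumes \<beta>: "base.mor (tens A N P) U \<beta>"
    and x: "w \<in> Ob A" "x \<in> Ob A" "y \<in> Ob A" and n: "n \<in> neg C x y" and t: "t \<in> carrier (T w x)"
  shows "lunit A N w y (tens_map A (tens A N P) N U N \<beta> bimod_id w y
      (assoc_inv A N P N w y (pure A N (tens A P N) w y x n t))) = cL \<beta> w x y n t" (is "?f t = _")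
proof (rule base.tens_ext [OF _ _ x(1,2) _ cL_linear [OF \<beta>] _ t])
  show "linear_map K (T w x) (bhom N w y) ?f"
    by (rule linear_map_compose [OF linear_map_compose [OF linear_map_compose [OF base.pure_linear_right
            base.assoc_inv_linear] base.tens_map_linear [OF \<beta> base.mor_id]] base.lunit_linear])
       (use x n in \<open>auto intro!: base.lin\<close>)
  fix z p n' assume z: "z \<in> Ob A" "p \<in> carrier (bhom P z x)" "n' \<in> carrier (bhom N w z)"
  show "?f (pure A P N w x z p n') = cL \<beta> w x y n (pure A P N w x z p n')"
    using x n z beta_in [OF \<beta>]
    by (auto simp: base.assoc_inv_pure base.tens_map_pure_id(1) [OF _ _ _ _ _ \<beta>] base.lunit_pure cL_pure [OF \<beta>])
qed (use x n in auto)

lemma copairing_triangle_left: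
  assumes \<beta>: "base.mor (tens A N P) U \<beta>" and \<gamma>: "base.mor U (tens A P N) \<gamma>"
    and x: "x \<in> Ob A" "y \<in> Ob A" and n: "n \<in> neg C x y"
  shows "(lunit A N \<bullet> tens_map A (tens A N P) N U N \<beta> bimod_id \<bullet> assoc_inv A N P N
         \<bullet> tens_map A N U N (tens A P N) bimod_id \<gamma> \<bullet> runit_inv A N) x y n
    = cL \<beta> x x y n (\<gamma> x x (idn A x))"
  using contraction_left [OF \<beta> x(1,1,2) n] base.mor_in [OF \<gamma>, of x x "idn A x"] x n
  by (simp add: bimod_comp_def runit_inv_def base.tens_map_pure_id(2) [OF _ _ _ _ _ _ \<gamma>])

lemma copairing_triangle_right:
  assumes \<beta>: "base.mor (tens A N P) U \<beta>" and \<gamma>: "base.mor U (tens A P N) \<gamma>"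
    and x: "x \<in> Ob A" "y \<in> Ob A" and p: "p \<in> pos C x y"
  shows "(runit A P \<bullet> tens_map A P (tens A N P) P U bimod_id \<beta> \<bullet> assoc A P N P
         \<bullet> tens_map A U P (tens A P N) P \<gamma> bimod_id \<bullet> lunit_inv A P) x y p
    = cR \<beta> x y y (\<gamma> y y (idn A y)) p"
proof -
  have \<gamma>y: "\<gamma> y y (idn A y) \<in> carrier (T y y)"
    using base.mor_in [OF \<gamma>, of y y "idn A y"] x by simp
  let ?f = "\<lambda>t. runit A P x y (tens_map A P (tens A N P) P U bimod_id \<beta> x y
      (assoc A P N P x y (pure A (tens A P N) P x y y t p)))"
  have "?f t = cR \<beta> x y y t p" if t: "t \<in> carrier (T y y)" for t
  proof (rule base.tens_ext [OF _ _ x(2,2) _ cR_linear [OF \<beta>] _ t])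
    show "linear_map K (T y y) (bhom P x y) ?f"
      by (rule linear_map_compose [OF linear_map_compose [OF linear_map_compose [OF base.pure_linear_left
              base.assoc_linear] base.tens_map_linear [OF base.mor_id \<beta>]] base.runit_linear])
         (use x p in \<open>auto intro!: base.lin\<close>)
    fix z p' n assume z: "z \<in> Ob A" "p' \<in> carrier (bhom P z y)" "n \<in> carrier (bhom N y z)"
    show "?f (pure A P N y y z p' n) = cR \<beta> x y y (pure A P N y y z p' n) p"
      using x p z beta_in [OF \<beta>]
      by (auto simp: base.assoc_pure base.tens_map_pure [OF base.mor_id \<beta>] base.runit_pure bimod_id_def cR_pure [OF \<beta>])
  qed (use x p in auto)
  with \<gamma>y x p show ?thesis
    by (simp add: bimod_comp_def lunit_inv_def base.tens_map_pure [OF \<gamma> base.mor_id] bimod_id_def)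
qed

text \<open>The inverse unit maps in the two triangle identities insert identities of A, so only the
  values of \<gamma> at identities enter them.\<close>

lemma is_copairing_iff:
  assumes \<beta>: "base.mor (tens A N P) U \<beta>"
  shows "is_copairing K A C \<beta> \<gamma> \<longleftrightarrow> base.mor U (tens A P N) \<gamma> \<and>
    (\<forall>x\<in>Ob A. \<forall>y\<in>Ob A. \<forall>n\<in>neg C x y. cL \<beta> x x y n (\<gamma> x x (idn A x)) = n) \<and>
    (\<forall>x\<in>Ob A. \<forall>y\<in>Ob A. \<forall>p\<in>pos C x y. cR \<beta> x y y (\<gamma> y y (idn A y)) p = p)"
  using copairing_triangle_left [OF \<beta>] copairing_triangle_right [OF \<beta>]
  by (auto simp: is_copairing_def Let_def bimod_eq_def bimod_id_def)

end

text \<open>Truncation of an element to selected summands; it serves to isolate the components above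
  a given object.\<close>

lemma (in module_family) restrict_linear:
  "linear_map K D D (\<lambda>t. \<lambda>i\<in>I. if S i then t i else \<zero>\<^bsub>T i\<^esub>)"
proof (rule linear_mapI)
  fix t assume t: "t \<in> carrier D"
  have "{i \<in> I. (if S i then t i else \<zero>\<^bsub>T i\<^esub>) \<noteq> \<zero>\<^bsub>T i\<^esub>} \<subseteq> {i \<in> I. t i \<noteq> \<zero>\<^bsub>T i\<^esub>}" by auto
  then have "finite {i \<in> I. (if S i then t i else \<zero>\<^bsub>T i\<^esub>) \<noteq> \<zero>\<^bsub>T i\<^esub>}"
    by (rule finite_subset) (use t in \<open>simp add: direct_sum_carrier_iff\<close>)
  then show "(\<lambda>i\<in>I. if S i then t i else \<zero>\<^bsub>T i\<^esub>) \<in> carrier D"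
    using t by (auto simp: direct_sum_carrier_iff family_simps cong: conj_cong)
qed (auto simp: family_simps intro!: restrict_ext)

context stratified_category
begin

lemma rpart_diag_in [simp]: "x \<in> Ob A \<Longrightarrow> h \<in> carrier (Hom C x x) \<Longrightarrow> rpart x x h \<in> pos C x x"
  using rpart_in [of x x h] by simp

subsection \<open>The action of \<open>C\<close> on \<open>C\<^sup>+ \<otimes> C\<^sup>-\<close>\<close>

abbreviation "tlact \<equiv> clact (pos_tens_neg A C)"
abbreviation "tract \<equiv> cract (pos_tens_neg A C)"

lemma tlact_eq: "tlact x y z g = lift A P N x y (T x z) (\<lambda>w p n. pure A P N x z w (lpart w z (Comp C w y z g p)) n)"
  by (simp add: pos_tens_neg_def Let_def pos_lact_eq)

lemma tract_eq: "tract x y z t h = lift A P N y z (T x z) (\<lambda>w p n. pure A P N x z w p (rpart x w (Comp C x y w n h))) t"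
  by (simp add: pos_tens_neg_def Let_def neg_ract_eq)

lemma chom_eq [simp]: "chom (pos_tens_neg A C) = T"
  by (simp add: pos_tens_neg_def Let_def)

lemma P_ident_lin: "x \<in> Ob A \<Longrightarrow> y \<in> Ob A \<Longrightarrow> linear_map K (bhom P x y) (Hom C x y) (\<lambda>u. u)"
  by (rule bhom_P_target [OF _ _ linear_map_ident])

lemma N_ident_lin: "x \<in> Ob A \<Longrightarrow> y \<in> Ob A \<Longrightarrow> linear_map K (bhom N x y) (Hom C x y) (\<lambda>u. u)"
  by (rule bhom_N_target [OF _ _ linear_map_ident])

lemma ract_P: "ract P x y p a = Comp C x x y p (incl C x x a)"
  and lact_N: "lact N x y a n = Comp C x y y (incl C y y a) n"
  and lact_P: "lact P x y a p = Comp C x y y (incl C y y a) p"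
  and ract_N: "ract N x y n a = Comp C x x y n (incl C x x a)"
  by (simp_all add: subcat_simps)

text \<open>Right multiplication by a diagonal element commutes with \<open>lpart\<close>, so the
  scalar comes out of the projection and can be moved to the other factor.\<close>

lemma tlact_bal:
  assumes "x \<in> Ob A" "y \<in> Ob A" "z \<in> Ob A" "g \<in> carrier (Hom C y z)"
  shows "base.bal P N x y (T x z) (\<lambda>w p n. pure A P N x z w (lpart w z (Comp C w y z g p)) n)"
proof (rule base.balI)
  fix w p a n assume w: "w \<in> Ob A" "p \<in> carrier (bhom P w y)" "a \<in> carrier (Hom A w w)" "n \<in> carrier (bhom N x w)"
  then have "lpart w z (Comp C w y z g (ract P w y p a)) = ract P w z (lpart w z (Comp C w y z g p)) a"
    using assms by (simp add: ract_P lpart_Comp_diag flip: C_assoc)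
  then show "pure A P N x z w (lpart w z (Comp C w y z g (ract P w y p a))) n
      = pure A P N x z w (lpart w z (Comp C w y z g p)) (lact N x w a n)"
    using assms w by (simp add: base.pure_balanced)
qed (use assms in \<open>auto intro!: base.pure_linear_left base.pure_linear_right lpart_lin Comp_lin_right P_ident_lin linear_map_ident\<close>)

lemma tract_bal:
  assumes "x \<in> Ob A" "y \<in> Ob A" "z \<in> Ob A" "h \<in> carrier (Hom C x y)"
  shows "base.bal P N y z (T x z) (\<lambda>w p n. pure A P N x z w p (rpart x w (Comp C x y w n h)))"
proof (rule base.balI)
  fix w p a n assume w: "w \<in> Ob A" "p \<in> carrier (bhom P w z)" "a \<in> carrier (Hom A w w)" "n \<in> carrier (bhom N y w)"
  then have "rpart x w (Comp C x y w (lact N y w a n) h) = lact N x w a (rpart x w (Comp C x y w n h))"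
    using assms by (simp add: lact_N rpart_diag_Comp C_assoc)
  then show "pure A P N x z w (ract P w z p a) (rpart x w (Comp C x y w n h))
      = pure A P N x z w p (rpart x w (Comp C x y w (lact N y w a n) h))"
    using assms w by (simp add: base.pure_balanced)
qed (use assms in \<open>auto intro!: base.pure_linear_left base.pure_linear_right rpart_lin Comp_lin_left N_ident_lin linear_map_ident\<close>)

lemma tlact_linear:
  assumes "x \<in> Ob A" "y \<in> Ob A" "z \<in> Ob A" "g \<in> carrier (Hom C y z)"
  shows "linear_map K (T x y) (T x z) (tlact x y z g)"
  unfolding tlact_eq using assms by (intro base.lift_linear tlact_bal) auto

lemma tract_linear:
  assumes "x \<in> Ob A" "y \<in> Ob A" "z \<in> Ob A" "h \<in> carrier (Hom C x y)"
  shows "linear_map K (T y z) (T x z) (\<lambda>t. tract x y z t h)"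
  unfolding tract_eq using assms by (intro base.lift_linear tract_bal) auto

lemma tlact_pure [simp]:
  assumes "x \<in> Ob A" "y \<in> Ob A" "z \<in> Ob A" "g \<in> carrier (Hom C y z)" "w \<in> Ob A" "p \<in> pos C w y" "n \<in> neg C x w"
  shows "tlact x y z g (pure A P N x y w p n) = pure A P N x z w (lpart w z (Comp C w y z g p)) n"
  unfolding tlact_eq using assms by (subst base.lift_pure [OF _ _ _ _ _ tlact_bal]) auto

lemma tract_pure [simp]:
  assumes "x \<in> Ob A" "y \<in> Ob A" "z \<in> Ob A" "h \<in> carrier (Hom C x y)" "w \<in> Ob A" "p \<in> pos C w z" "n \<in> neg C y w"
  shows "tract x y z (pure A P N y z w p n) h = pure A P N x z w p (rpart x w (Comp C x y w n h))"
  unfolding tract_eq using assms by (subst base.lift_pure [OF _ _ _ _ _ tract_bal]) auto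

lemma tlact_in [simp]:
  "x \<in> Ob A \<Longrightarrow> y \<in> Ob A \<Longrightarrow> z \<in> Ob A \<Longrightarrow> g \<in> carrier (Hom C y z) \<Longrightarrow> t \<in> carrier (T x y) \<Longrightarrow> tlact x y z g t \<in> carrier (T x z)"
  by (rule linear_map_closed [OF tlact_linear])

lemma tract_in [simp]:
  assumes "x \<in> Ob A" "y \<in> Ob A" "z \<in> Ob A" "h \<in> carrier (Hom C x y)" "t \<in> carrier (T y z)"
  shows "tract x y z t h \<in> carrier (T x z)"
  using linear_map_closed [OF tract_linear [OF assms(1-4)] assms(5)] .

lemma tlact_linear_param:
  assumes "x \<in> Ob A" "y \<in> Ob A" "z \<in> Ob A" "t \<in> carrier (T x y)"
  shows "linear_map K (Hom C y z) (T x z) (\<lambda>g. tlact x y z g t)"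
  unfolding tlact_eq using assms
  by (intro base.lift_linear_param)
     (auto intro!: tlact_bal base.pure_linear_left lpart_lin Comp_lin_left linear_map_ident)

lemma tract_linear_param:
  assumes "x \<in> Ob A" "y \<in> Ob A" "z \<in> Ob A" "t \<in> carrier (T y z)"
  shows "linear_map K (Hom C x y) (T x z) (tract x y z t)"
  unfolding tract_eq using assms
  by (intro base.lift_linear_param)
     (auto intro!: tract_bal base.pure_linear_right rpart_lin Comp_lin_right linear_map_ident)

lemma T_ext:
  "x \<in> Ob A \<Longrightarrow> y \<in> Ob A \<Longrightarrow> linear_map K (T x y) X f \<Longrightarrow> linear_map K (T x y) X g
    \<Longrightarrow> (\<And>z m n. z \<in> Ob A \<Longrightarrow> m \<in> pos C z y \<Longrightarrow> n \<in> neg C x z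
      \<Longrightarrow> f (pure A P N x y z m n) = g (pure A P N x y z m n))
    \<Longrightarrow> t \<in> carrier (T x y) \<Longrightarrow> f t = g t"
  by (rule base.tens_ext [OF bims(1,2)]) simp_all

lemma tlact_idn:
  assumes "x \<in> Ob A" "y \<in> Ob A" "t \<in> carrier (T x y)"
  shows "tlact x y y (idn C y) t = t"
  by (rule T_ext [OF assms(1,2) tlact_linear linear_map_ident _ assms(3)]) (use assms in auto)

lemma tract_idn:
  assumes "x \<in> Ob A" "y \<in> Ob A" "t \<in> carrier (T x y)"
  shows "tract x x y t (idn C x) = t"
  by (rule T_ext [OF assms(1,2) tract_linear linear_map_ident _ assms(3)]) (use assms in auto)

text \<open>Projecting after the first factor loses nothing for the next one, by
  \<open>lpart_lpart\<close>.\<close>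

lemma tlact_Comp:
  assumes "w \<in> Ob A" "x \<in> Ob A" "y \<in> Ob A" "z \<in> Ob A" "t \<in> carrier (T w x)"
    "g \<in> carrier (Hom C x y)" "h \<in> carrier (Hom C y z)"
  shows "tlact w x z (Comp C x y z h g) t = tlact w y z h (tlact w x y g t)"
  by (rule T_ext [OF assms(1,2) tlact_linear linear_map_compose [OF tlact_linear tlact_linear] _ assms(5)])
     (use assms in \<open>auto simp: lpart_lpart C_assoc\<close>)

lemma tract_Comp:
  assumes "w \<in> Ob A" "x \<in> Ob A" "y \<in> Ob A" "z \<in> Ob A" "t \<in> carrier (T y z)"
    "g \<in> carrier (Hom C x y)" "h \<in> carrier (Hom C w x)"
  shows "tract w y z t (Comp C w x y g h) = tract w x z (tract x y z t g) h"
  by (rule T_ext [OF assms(3,4) tract_linear linear_map_compose [OF tract_linear tract_linear] _ assms(5)])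
     (use assms in \<open>auto simp: rpart_rpart C_assoc\<close>)

lemma tlact_tract:
  assumes "w \<in> Ob A" "x \<in> Ob A" "y \<in> Ob A" "z \<in> Ob A" "t \<in> carrier (T x y)"
    "g \<in> carrier (Hom C y z)" "h \<in> carrier (Hom C w x)"
  shows "tract w x z (tlact x y z g t) h = tlact w y z g (tract w x y t h)"
  by (rule T_ext [OF assms(2,3) linear_map_compose [OF tlact_linear tract_linear] linear_map_compose [OF tract_linear tlact_linear] _ assms(5)])
     (use assms in auto)

lemma pos_tens_neg_bimodule: "category_bimodule K C (pos_tens_neg A C)"
  by (rule category_bimodule.intro)
     (auto simp: tlact_linear tlact_linear_param tract_linear tract_linear_param tlact_idn tract_idn tlact_Comp tract_Comp tlact_tract)

lemma regular_cbimodule: "category_bimodule K C (regular_cbimod C)"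
  by (rule category_bimodule.intro)
     (auto simp: regular_cbimod_def C_assoc intro!: Comp_lin_left Comp_lin_right linear_map_ident)

text \<open>Multiplying an increasing morphism by a diagonal one stays increasing, so the projection
  in the action of C does nothing.\<close>

lemma tlact_incl:
  assumes "x \<in> Ob A" "y \<in> Ob A" "t \<in> carrier (T x y)" "a \<in> carrier (Hom A y y)"
  shows "tlact x y y (incl C y y a) t = lact (tens A P N) x y a t"
  by (rule T_ext [OF assms(1,2) tlact_linear base.tens_lact_linear _ assms(3)])
     (use assms in \<open>auto simp: lact_P\<close>)

lemma tract_incl:
  assumes "x \<in> Ob A" "y \<in> Ob A" "t \<in> carrier (T x y)" "a \<in> carrier (Hom A x x)"
  shows "tract x x y t (incl C x x a) = ract (tens A P N) x y t a"
proof (rule T_ext [OF assms(1,2) tract_linear base.tens_ract_linear _ assms(3)])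
  fix z m n assume z: "z \<in> Ob A" "m \<in> pos C z y" "n \<in> neg C x z"
  have "Comp C x x z n (incl C x x a) \<in> neg C x z"
    using assms z by (intro neg_Comp) auto
  then show "tract x x y (pure A P N x y z m n) (incl C x x a) = ract (tens A P N) x y (pure A P N x y z m n) a"
    using assms z by (simp add: ract_N)
qed (use assms in auto)

text \<open>The action of h touches only the last factor, and the contraction multiplies that factor
  on the left by a diagonal scalar, which passes through \<open>rpart\<close>.\<close>

lemma cL_tract:
  assumes \<beta>: "base.mor (tens A N P) U \<beta>" and w: "w \<in> Ob A" "v \<in> Ob A" "x \<in> Ob A" "y \<in> Ob A"
    and n: "n \<in> neg C x y" and t: "t \<in> carrier (T v x)" and h: "h \<in> carrier (Hom C w v)"
  shows "cL \<beta> w x y n (tract w v x t h) = rpart w y (Comp C w v y (cL \<beta> v x y n t) h)"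
proof (rule T_ext [where f = "\<lambda>t. cL \<beta> w x y n (tract w v x t h)"
      and g = "\<lambda>t. rpart w y (Comp C w v y (cL \<beta> v x y n t) h)", OF w(2,3) _ _ _ t])
  show "linear_map K (T v x) (bhom N w y) (\<lambda>t. cL \<beta> w x y n (tract w v x t h))"
    by (rule linear_map_compose [OF tract_linear [OF w(1-3) h] cL_linear [OF \<beta> w(1,3,4) n]])
  show "linear_map K (T v x) (bhom N w y) (\<lambda>t. rpart w y (Comp C w v y (cL \<beta> v x y n t) h))"
    by (rule rpart_lin [OF w(1,4) Comp_lin_left [OF w(1,2,4) h bhom_N_target [OF w(2,4) cL_linear [OF \<beta> w(2-4) n]]]])
  fix z p n' assume z: "z \<in> Ob A" "p \<in> pos C z x" "n' \<in> neg C v z"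
  show "cL \<beta> w x y n (tract w v x (pure A P N v x z p n') h)
      = rpart w y (Comp C w v y (cL \<beta> v x y n (pure A P N v x z p n')) h)"
  proof (cases "z = y")
    case True
    define a where "a = incl C y y (\<beta> y y (pure A N P y y x n p))"
    have a: "a \<in> pos C y y"
      using True z w n beta_in [OF \<beta>] by (simp add: a_def)
    have "cL \<beta> w x y n (tract w v x (pure A P N v x z p n') h) = Comp C w y y a (rpart w y (Comp C w v y n' h))"
      using True z w n h by (simp add: cL_pure [OF \<beta>] lact_N a_def)
    moreover have "cL \<beta> v x y n (pure A P N v x z p n') = Comp C v y y a n'"
      using True z w n by (simp add: cL_pure [OF \<beta>] lact_N a_def)
    ultimately show ?thesis
      using True z w h a by (simp add: C_assoc rpart_diag_Comp)
  next
    case False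
    then show ?thesis using z w n h by (simp add: cL_pure [OF \<beta>])
  qed
qed

lemma cL_sandw:
  assumes \<beta>: "base.mor (tens A N P) U \<beta>" and \<beta>': "base.mor (tens A N P) U \<beta>'"
    and "w \<in> Ob A" "v \<in> Ob A" "x \<in> Ob A" "y \<in> Ob A"
    "n \<in> neg C x y" "s \<in> carrier (T v x)" "t \<in> carrier (T w v)"
  shows "cL \<beta> w x y n (sandw \<beta>' w v x s t) = cL \<beta>' w v y (cL \<beta> v x y n s) t"
proof (rule T_ext [OF assms(4,5) linear_map_compose [OF sandw_linear [OF \<beta>'] cL_linear [OF \<beta>]]
      linear_map_compose [OF cL_linear [OF \<beta>] cL_linear_param [OF \<beta>']] _ assms(8)])
  fix z p n' assume "z \<in> Ob A" "p \<in> pos C z x" "n' \<in> neg C v z"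
  then show "cL \<beta> w x y n (sandw \<beta>' w v x (pure A P N v x z p n') t)
      = cL \<beta>' w v y (cL \<beta> v x y n (pure A P N v x z p n')) t"
    using assms linear_map_zero [OF _ _ cL_linear_param [OF \<beta>'], of v y w t]
    by (cases "z = y") (simp_all add: sandw_pure [OF \<beta>'] cL_pure [OF \<beta>] cL_in [OF \<beta>'] cL_lact [OF \<beta>'] beta_in [OF \<beta>])
qed (use assms in auto)

text \<open>The two contractions happen at different tensor signs and hence commute. Two pairings
  are allowed because the comparison of the pairing of C with a second one mixes them.\<close>

lemma sandw_assoc:
  assumes \<beta>: "base.mor (tens A N P) U \<beta>" and \<beta>': "base.mor (tens A N P) U \<beta>'"
    and "w \<in> Ob A" "x \<in> Ob A" "y \<in> Ob A" "z \<in> Ob A"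
    "r \<in> carrier (T y z)" "s \<in> carrier (T x y)" "t \<in> carrier (T w x)"
  shows "sandw \<beta> w x z (sandw \<beta>' x y z r s) t = sandw \<beta>' w y z r (sandw \<beta> w x y s t)"
  by (rule T_ext [OF assms(5,6) linear_map_compose [OF sandw_linear [OF \<beta>'] sandw_linear [OF \<beta>]] sandw_linear [OF \<beta>'] _ assms(7)])
     (use assms in \<open>auto simp: sandw_pure [OF \<beta>] sandw_pure [OF \<beta>'] cL_in [OF \<beta>'] sandw_in [OF \<beta>] cL_sandw [OF \<beta>' \<beta>]\<close>)

lemma sandw_tract:
  assumes \<beta>: "base.mor (tens A N P) U \<beta>"
    and "w \<in> Ob A" "v \<in> Ob A" "x \<in> Ob A" "y \<in> Ob A"
    "s \<in> carrier (T x y)" "t \<in> carrier (T v x)" "h \<in> carrier (Hom C w v)"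
  shows "sandw \<beta> w x y s (tract w v x t h) = tract w v y (sandw \<beta> v x y s t) h"
  by (rule T_ext [OF assms(4,5) sandw_linear [OF \<beta>] linear_map_compose [OF sandw_linear [OF \<beta>] tract_linear] _ assms(6)])
     (use assms in \<open>auto simp: sandw_pure [OF \<beta>] cL_in [OF \<beta>] cL_tract [OF \<beta>]\<close>)

text \<open>The triangle identities for a family of elements standing for the values \<gamma>(1); in
  this form the pairing of C and any second pairing are treated alike.\<close>

definition copairing_at where
  "copairing_at \<beta> g \<longleftrightarrow> (\<forall>x\<in>Ob A. g x \<in> carrier (T x x)) \<and>
    (\<forall>x\<in>Ob A. \<forall>y\<in>Ob A. \<forall>n\<in>neg C x y. cL \<beta> x x y n (g x) = n) \<and>
    (\<forall>x\<in>Ob A. \<forall>y\<in>Ob A. \<forall>p\<in>pos C x y. cR \<beta> x y y (g y) p = p)"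

lemma is_copairing_at:
  assumes "base.mor (tens A N P) U \<beta>" "is_copairing K A C \<beta> \<gamma>"
  shows "copairing_at \<beta> (\<lambda>x. \<gamma> x x (idn A x))"
  using assms base.mor_in [of U "tens A P N" \<gamma>]
  by (auto simp: is_copairing_iff copairing_at_def)

text \<open>The triangle identities are the unit laws of \<open>sandw\<close>: on a pure tensor the
  contraction with g affects only the adjacent factor and restores it.\<close>

lemma sandw_copairing:
  assumes \<beta>: "base.mor (tens A N P) U \<beta>" and g: "copairing_at \<beta> g" and xy: "x \<in> Ob A" "y \<in> Ob A"
    and t: "t \<in> carrier (T x y)"
  shows "sandw \<beta> x y y (g y) t = t" and "sandw \<beta> x x y t (g x) = t"
proof -
  have gx: "g x \<in> carrier (T x x)" "g y \<in> carrier (T y y)" using g xy by (auto simp: copairing_at_def)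
  show "sandw \<beta> x y y (g y) t = t"
    by (rule T_ext [OF xy sandw_linear_param [OF \<beta>] linear_map_ident _ t])
       (use xy g gx in \<open>auto simp: sandw_pure_right [OF \<beta>] copairing_at_def\<close>)
  show "sandw \<beta> x x y t (g x) = t"
    by (rule T_ext [OF xy sandw_linear [OF \<beta>] linear_map_ident _ t])
       (use xy g gx in \<open>auto simp: sandw_pure [OF \<beta>] copairing_at_def\<close>)
qed

subsection \<open>Projections of the actions\<close>

lemma rpart_mlt_lin: "x \<in> Ob A \<Longrightarrow> y \<in> Ob A \<Longrightarrow> linear_map K (T x y) (bhom N x y) (\<lambda>t. rpart x y (mlt x y t))"
  by (rule rpart_lin [OF _ _ mlt_linear])

lemma lpart_mlt_lin: "x \<in> Ob A \<Longrightarrow> y \<in> Ob A \<Longrightarrow> linear_map K (T x y) (bhom P x y) (\<lambda>t. lpart x y (mlt x y t))"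
  by (rule lpart_lin [OF _ _ mlt_linear])

lemma mlt_in [simp]: "x \<in> Ob A \<Longrightarrow> y \<in> Ob A \<Longrightarrow> t \<in> carrier (T x y) \<Longrightarrow> mlt x y t \<in> carrier (Hom C x y)"
  by (rule linear_map_closed [OF mlt_linear])

lemma incl_pairing:
  "x \<in> Ob A \<Longrightarrow> y \<in> Ob A \<Longrightarrow> n \<in> neg C x y \<Longrightarrow> p \<in> pos C y x
    \<Longrightarrow> incl C y y (pairing A C y y (pure A N P y y x n p)) = lpart y y (Comp C y x y n p)"
  by (simp add: pairing_pure counit_diag)

text \<open>The bridge between the actions of C and the pairing. On p \<otimes> n both sides vanish
  unless p starts at \<open>z\<close>. Then h p is an endomorphism, so its two projections agree,
  depend on h only through \<open>rpart\<close>, and equal the scalar obtained by pairing the right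
  projection of h with p.\<close>

lemma rpart_mlt_tlact:
  assumes "x \<in> Ob A" "y \<in> Ob A" "z \<in> Ob A" "h \<in> carrier (Hom C y z)" "t \<in> carrier (T x y)"
  shows "rpart x z (mlt x z (tlact x y z h t)) = cL (pairing A C) x y z (rpart y z h) t"
proof (rule T_ext [OF assms(1,2) linear_map_compose [OF tlact_linear rpart_mlt_lin] cL_linear [OF pairing_mor] _ assms(5)])
  fix w p n assume w: "w \<in> Ob A" "p \<in> pos C w y" "n \<in> neg C x w"
  have "lpart w w (Comp C w y w (rpart y w h) p) = lpart w w (Comp C w y w h p)" if "w = z"
    using assms w that by (simp add: lpart_eq_rpart rpart_rpart)
  then show "rpart x z (mlt x z (tlact x y z h (pure A P N x y w p n)))
      = cL (pairing A C) x y z (rpart y z h) (pure A P N x y w p n)"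
    using assms w by (cases "w = z") (simp_all add: cL_pure [OF pairing_mor] rpart_Comp lact_N incl_pairing)
qed (use assms in auto)

lemma lpart_mlt_tract:
  assumes "x \<in> Ob A" "y \<in> Ob A" "z \<in> Ob A" "h \<in> carrier (Hom C x y)" "t \<in> carrier (T y z)"
  shows "lpart x z (mlt x z (tract x y z t h)) = cR (pairing A C) x y z t (lpart x y h)"
proof (rule T_ext [OF assms(2,3) linear_map_compose [OF tract_linear lpart_mlt_lin] cR_linear [OF pairing_mor] _ assms(5)])
  fix w p n assume w: "w \<in> Ob A" "p \<in> pos C w z" "n \<in> neg C y w"
  have "lpart w w (Comp C w y w n (lpart w y h)) = rpart w w (Comp C w y w n h)" if "w = x"
    using assms w that by (simp add: lpart_lpart flip: lpart_eq_rpart)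
  then show "lpart x z (mlt x z (tract x y z (pure A P N y z w p n) h))
      = cR (pairing A C) x y z (pure A P N y z w p n) (lpart x y h)"
    using assms w by (cases "w = x") (simp_all add: cR_pure [OF pairing_mor] lpart_Comp ract_P incl_pairing)
qed (use assms in auto)

lemma rpart_mlt_tract:
  assumes "x \<in> Ob A" "y \<in> Ob A" "z \<in> Ob A" "h \<in> carrier (Hom C x y)" "t \<in> carrier (T y z)"
  shows "rpart x z (mlt x z (tract x y z t h)) = rpart x z (Comp C x y z (rpart y z (mlt y z t)) h)"
proof (rule T_ext [OF assms(2,3) linear_map_compose [OF tract_linear rpart_mlt_lin]
      rpart_lin [OF _ _ Comp_lin_left [OF _ _ _ _ bhom_N_target [OF _ _ rpart_mlt_lin]]] _ assms(5)])
  fix w p n assume w: "w \<in> Ob A" "p \<in> pos C w z" "n \<in> neg C y w"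
  show "rpart x z (mlt x z (tract x y z (pure A P N y z w p n) h))
      = rpart x z (Comp C x y z (rpart y z (mlt y z (pure A P N y z w p n))) h)"
  proof (cases "w = z")
    case True
    then show ?thesis using assms w by (simp add: C_assoc rpart_diag_Comp)
  next
    case False
    then show ?thesis using assms w by (simp add: rpart_Comp)
  qed
qed (use assms in auto)

lemma lpart_mlt_tlact:
  assumes "x \<in> Ob A" "y \<in> Ob A" "z \<in> Ob A" "h \<in> carrier (Hom C y z)" "t \<in> carrier (T x y)"
  shows "lpart x z (mlt x z (tlact x y z h t)) = lpart x z (Comp C x y z h (lpart x y (mlt x y t)))"
proof (rule T_ext [OF assms(1,2) linear_map_compose [OF tlact_linear lpart_mlt_lin]
      lpart_lin [OF _ _ Comp_lin_right [OF _ _ _ _ bhom_P_target [OF _ _ lpart_mlt_lin]]] _ assms(5)])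
  fix w p n assume w: "w \<in> Ob A" "p \<in> pos C w y" "n \<in> neg C x w"
  show "lpart x z (mlt x z (tlact x y z h (pure A P N x y w p n)))
      = lpart x z (Comp C x y z h (lpart x y (mlt x y (pure A P N x y w p n))))"
  proof (cases "w = x")
    case True
    then show ?thesis using assms w lpart_Comp_diag [of x z n "Comp C x y z h p"] by (simp add: C_assoc)
  next
    case False
    then show ?thesis using assms w by (simp add: lpart_Comp)
  qed
qed (use assms in auto)

text \<open>Both sides are the right projection of the product n g t, computed with the bracketings
  n (g t) and (n g) t. This is the balancedness of the pairing over C.\<close>

lemma cL_pairing_tlact:
  assumes "v \<in> Ob A" "x \<in> Ob A" "y \<in> Ob A" "z \<in> Ob A" "n \<in> neg C y z" "g \<in> carrier (Hom C x y)" "t \<in> carrier (T v x)"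
  shows "cL (pairing A C) v y z n (tlact v x y g t) = cL (pairing A C) v x z (rpart x z (Comp C x y z n g)) t"
  using assms rpart_mlt_tlact [of v y z n "tlact v x y g t"] rpart_mlt_tlact [of v x z "Comp C x y z n g" t]
  by (simp add: tlact_Comp)

end

context stratified_category
begin

subsection \<open>Perfect implies Morita\<close>

text \<open>Contracting with n from the left turns either side into the right projection of n c: on
  the left by balancedness and the triangle identity, on the right because the contraction commutes
  with the right action. Sandwiching with \<open>g y\<close>, a left unit, then recovers the
  elements from these contractions.\<close>

lemma copairing_central:
  assumes g: "copairing_at (pairing A C) g" and x: "x \<in> Ob A" and y: "y \<in> Ob A" and c: "c \<in> carrier (Hom C x y)"
  shows "tlact x x y c (g x) = tract x y y (g y) c"
proof -
  let ?b = "pairing A C"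
  have gx: "g x \<in> carrier (T x x)" and gy: "g y \<in> carrier (T y y)"
    using g x y by (auto simp: copairing_at_def)
  have l: "tlact x x y c (g x) \<in> carrier (T x y)" and r: "tract x y y (g y) c \<in> carrier (T x y)"
    using x y c gx gy by auto
  have "sandw ?b x y y s (tlact x x y c (g x)) = sandw ?b x y y s (tract x y y (g y) c)"
    if s: "s \<in> carrier (T y y)" for s
  proof (rule T_ext [OF y y sandw_linear [OF pairing_mor x y y l] sandw_linear [OF pairing_mor x y y r] _ s])
    fix z p n assume z: "z \<in> Ob A" and p: "p \<in> pos C z y" and n: "n \<in> neg C y z"
    have "cL ?b x y z n (tlact x x y c (g x)) = cL ?b x x z (rpart x z (Comp C x y z n c)) (g x)"
      using x y z n c gx by (simp add: cL_pairing_tlact)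
    also have "\<dots> = rpart x z (Comp C x y z (cL ?b y y z n (g y)) c)"
      using g x y z n c by (simp add: copairing_at_def)
    also have "\<dots> = cL ?b x y z n (tract x y y (g y) c)"
      using cL_tract [OF pairing_mor x y y z n gy c] by simp
    finally show "sandw ?b x y y (pure A P N y y z p n) (tlact x x y c (g x))
        = sandw ?b x y y (pure A P N y y z p n) (tract x y y (g y) c)"
      by (simp only: sandw_pure [OF pairing_mor x y y l z p n] sandw_pure [OF pairing_mor x y y r z p n])
  qed
  from this [OF gy] show ?thesis
    using sandw_copairing(1) [OF pairing_mor g x y l] sandw_copairing(1) [OF pairing_mor g x y r] by simp
qed

lemma pure_diag:
  assumes "x \<in> Ob A" "z \<in> Ob A" "p \<in> pos C z z" "n \<in> neg C x z"
  shows "pure A P N x z z p n = pure A P N x z z (idn C z) (Comp C x z z p n)"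
  using base.pure_balanced [of P N x z z "idn C z" n "counit A C z z p"] assms
  by (simp add: ract_P lact_N counit_diag)

lemma leading_term:
  assumes z: "z \<in> Ob A" and s: "s \<in> carrier (T z z)" and X: "module K X" and F: "linear_map K (T z z) X F"
    and zero: "\<zero>\<^bsub>X\<^esub> \<in> Q" and add: "\<And>q q'. q \<in> Q \<Longrightarrow> q' \<in> Q \<Longrightarrow> q \<oplus>\<^bsub>X\<^esub> q' \<in> Q" and sub: "Q \<subseteq> carrier X"
    and lower: "\<And>w p n. w \<in> Ob A \<Longrightarrow> (w, z) \<in> le A \<Longrightarrow> w \<noteq> z \<Longrightarrow> p \<in> pos C w z \<Longrightarrow> n \<in> neg C z w
      \<Longrightarrow> F (pure A P N z z w p n) \<in> Q"
  shows "\<exists>q\<in>Q. F s = F (pure A P N z z z (idn C z) (rpart z z (mlt z z s))) \<oplus>\<^bsub>X\<^esub> q"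
  using s bims(1,2) z z
proof (induction s rule: base.tensor_hom_induct)
  interpret X: module K X by (rule X)
  have F0: "F \<zero>\<^bsub>T z z\<^esub> = \<zero>\<^bsub>X\<^esub>"
    using linear_map_zero [OF _ X F] z by simp
  {
    case (pure w p n)
    let ?t = "pure A P N z z w p n"
    have t: "?t \<in> carrier (T z z)" using pure z by simp
    consider "w = z" | "w \<noteq> z" "(w, z) \<in> le A" | "w \<noteq> z" "(w, z) \<notin> le A" by blast
    then show ?case
    proof cases
      case 1
      then have "pure A P N z z z (idn C z) (rpart z z (mlt z z ?t)) = ?t"
        using pure z pure_diag [of z z p n] by simp
      then show ?thesis
        using zero linear_map_closed [OF F t] by (intro bexI [of _ "\<zero>\<^bsub>X\<^esub>"]) simp_all
    next
      case 2
      then have "rpart z z (mlt z z ?t) = \<zero>\<^bsub>Hom C z z\<^esub>"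
        using pure z by (simp add: rpart_Comp)
      then have "F (pure A P N z z z (idn C z) (rpart z z (mlt z z ?t))) = \<zero>\<^bsub>X\<^esub>"
        using F0 z base.pure_zero_right [of P N z z z "idn C z"] by simp
      moreover have "F ?t \<in> Q"
        using lower [of w p n] 2 pure by simp
      ultimately show ?thesis
        using sub by (intro bexI [of _ "F ?t"]) auto
    next
      case 3
      then have "p = \<zero>\<^bsub>Hom C w z\<^esub>" using pos_zero [of w z] pure z by auto
      then have "?t = \<zero>\<^bsub>T z z\<^esub>"
        using pure z base.pure_zero_left [of P N z z w n] by simp
      moreover have "mlt z z \<zero>\<^bsub>T z z\<^esub> = \<zero>\<^bsub>Hom C z z\<^esub>"
        using linear_map_zero [OF _ _ mlt_linear [OF z z]] z by simp
      ultimately show ?thesis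
        using zero z F0 base.pure_zero_right [of P N z z z "idn C z"] by (intro bexI [of _ "\<zero>\<^bsub>X\<^esub>"]) simp_all
    qed
  next
    case (add s t)
    let ?d = "\<lambda>s. F (pure A P N z z z (idn C z) (rpart z z (mlt z z s)))"
    have d: "linear_map K (T z z) X ?d"
      by (rule linear_map_compose [OF base.pure_linear_right [OF bims(1,2) _ _ _ _ rpart_mlt_lin] F]) (use z in auto)
    obtain q q' where q: "q \<in> Q" "q' \<in> Q" "F s = ?d s \<oplus>\<^bsub>X\<^esub> q" "F t = ?d t \<oplus>\<^bsub>X\<^esub> q'"
      using add.IH by blast
    have "F (s \<oplus>\<^bsub>T z z\<^esub> t) = (?d s \<oplus>\<^bsub>X\<^esub> q) \<oplus>\<^bsub>X\<^esub> (?d t \<oplus>\<^bsub>X\<^esub> q')"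
      using linear_map_add [OF F] add.hyps q by simp
    also have "\<dots> = (?d s \<oplus>\<^bsub>X\<^esub> ?d t) \<oplus>\<^bsub>X\<^esub> (q \<oplus>\<^bsub>X\<^esub> q')"
      using linear_map_closed [OF d] add.hyps q sub by (simp add: X.a_ac subset_iff)
    also have "?d s \<oplus>\<^bsub>X\<^esub> ?d t = ?d (s \<oplus>\<^bsub>T z z\<^esub> t)"
      using linear_map_add [OF d] add.hyps by simp
    finally show ?case
      using assms(6) [OF q(1,2)] by blast
  }
qed

text \<open>The map \<open>c \<mapsto> c \<gamma>\<^sub>x\<close> sends \<open>p n\<close>, where \<open>p\<close> starts at \<open>z\<close>, to \<open>p \<otimes> n\<close> plus terms at objects below \<open>z\<close>.
  This unipotent triangular map is surjective by well-founded induction on \<open>z\<close>, and injective by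
  looking at a maximal object in a support.\<close>

context
  fixes g :: "'o \<Rightarrow> ('o, 'c, 'c) btensor"
  assumes g_in: "\<And>x. x \<in> Ob A \<Longrightarrow> g x \<in> carrier (T x x)"
    and g_top: "\<And>x. x \<in> Ob A \<Longrightarrow> rpart x x (mlt x x (g x)) = idn C x"
    and central: "\<And>x y c. x \<in> Ob A \<Longrightarrow> y \<in> Ob A \<Longrightarrow> c \<in> carrier (Hom C x y)
      \<Longrightarrow> tlact x x y c (g x) = tract x y y (g y) c"
begin

abbreviation (input) "act x y c \<equiv> tlact x x y c (g x)"

lemma act_linear: "x \<in> Ob A \<Longrightarrow> y \<in> Ob A \<Longrightarrow> linear_map K (Hom C x y) (T x y) (act x y)"
  by (rule tlact_linear_param) (auto simp: g_in)

text \<open>Centrality gives p n \<gamma> = p \<gamma> n. The leading term 1 \<otimes> 1 of \<gamma>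
  contributes p \<otimes> n, and a term of \<gamma> at w contributes a term at the same w.\<close>

lemma act_Comp:
  assumes x: "x \<in> Ob A" "y \<in> Ob A" and z: "z \<in> Ob A" and p: "p \<in> pos C z y" and n: "n \<in> neg C x z"
    and zero: "\<zero>\<^bsub>T x y\<^esub> \<in> Q" and add: "\<And>q q'. q \<in> Q \<Longrightarrow> q' \<in> Q \<Longrightarrow> q \<oplus>\<^bsub>T x y\<^esub> q' \<in> Q" and sub: "Q \<subseteq> carrier (T x y)"
    and lower: "\<And>w p n. w \<in> Ob A \<Longrightarrow> (w, z) \<in> le A \<Longrightarrow> w \<noteq> z \<Longrightarrow> p \<in> pos C w y \<Longrightarrow> n \<in> neg C x w
      \<Longrightarrow> pure A P N x y w p n \<in> Q"
  shows "\<exists>q\<in>Q. act x y (Comp C x z y p n) = pure A P N x y z p n \<oplus>\<^bsub>T x y\<^esub> q"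
proof -
  let ?F = "\<lambda>s. tlact x z y p (tract x z z s n)"
  have F: "linear_map K (T z z) (T x y) ?F"
    by (rule linear_map_compose [OF tract_linear tlact_linear]) (use x z p n in auto)
  have F_pure: "?F (pure A P N z z w p' n') = pure A P N x y w (Comp C w z y p p') (Comp C x z w n' n)"
    if "w \<in> Ob A" "p' \<in> pos C w z" "n' \<in> neg C z w" for w p' n'
    using x z p n that by simp
  have "\<exists>q\<in>Q. ?F (g z) = ?F (pure A P N z z z (idn C z) (rpart z z (mlt z z (g z)))) \<oplus>\<^bsub>T x y\<^esub> q"
  proof (rule leading_term [OF z g_in [OF z] _ F zero add sub])
    show "?F (pure A P N z z w p' n') \<in> Q"
      if "w \<in> Ob A" "(w, z) \<in> le A" "w \<noteq> z" "p' \<in> pos C w z" "n' \<in> neg C z w" for w p' n'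
      using that x z p n lower [of w "Comp C w z y p p'" "Comp C x z w n' n"] by (simp add: F_pure)
  qed (use x in auto)
  moreover have "?F (pure A P N z z z (idn C z) (rpart z z (mlt z z (g z)))) = pure A P N x y z p n"
    using F_pure [of z "idn C z" "idn C z"] x z p n by (simp add: g_top)
  moreover have "?F (g z) = act x y (Comp C x z y p n)"
    using x z p n g_in central [of x z n] by (simp add: tlact_Comp)
  ultimately show ?thesis by simp
qed

lemma act_surj:
  assumes x: "x \<in> Ob A" "y \<in> Ob A" and t: "t \<in> carrier (T x y)"
  shows "t \<in> act x y ` carrier (Hom C x y)" (is "_ \<in> ?Q")
proof -
  interpret X: module K "T x y" using x by simp
  interpret H: module K "Hom C x y" using x by simp
  note lin = act_linear [OF x]
  have zero: "\<zero>\<^bsub>T x y\<^esub> \<in> ?Q"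
    using linear_map_zero [OF H.module_axioms X.module_axioms lin] by (metis H.zero_closed image_eqI)
  have add: "q \<oplus>\<^bsub>T x y\<^esub> q' \<in> ?Q" if "q \<in> ?Q" "q' \<in> ?Q" for q q'
  proof -
    from that obtain h h' where "h \<in> carrier (Hom C x y)" "h' \<in> carrier (Hom C x y)" "q = act x y h" "q' = act x y h'"
      by blast
    then show ?thesis
      using linear_map_add [OF lin, of h h'] by (metis H.a_closed image_eqI)
  qed
  have minus: "\<ominus>\<^bsub>T x y\<^esub> q \<in> ?Q" if "q \<in> ?Q" for q
  proof -
    from that obtain h where "h \<in> carrier (Hom C x y)" "q = act x y h" by blast
    then show ?thesis
      using linear_map_minus [OF H.module_axioms X.module_axioms lin, of h] by (metis H.a_inv_closed image_eqI)
  qed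
  have sub: "?Q \<subseteq> carrier (T x y)"
    using linear_map_closed [OF lin] by auto
  have pure: "\<forall>p n. z \<in> Ob A \<longrightarrow> p \<in> pos C z y \<longrightarrow> n \<in> neg C x z \<longrightarrow> pure A P N x y z p n \<in> ?Q" for z
  proof (induction z rule: wf_induct_rule [OF base.le_dcc])
    case (1 z)
    show ?case
    proof (intro allI impI)
      fix p n assume z: "z \<in> Ob A" and p: "p \<in> pos C z y" and n: "n \<in> neg C x z"
      obtain q where q: "q \<in> ?Q" and eq: "act x y (Comp C x z y p n) = pure A P N x y z p n \<oplus>\<^bsub>T x y\<^esub> q"
        using act_Comp [OF x z p n zero add sub] 1 by auto
      have "pure A P N x y z p n = act x y (Comp C x z y p n) \<oplus>\<^bsub>T x y\<^esub> (\<ominus>\<^bsub>T x y\<^esub> q)"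
        using q sub x z p n by (subst eq) (auto simp: X.a_assoc X.r_neg)
      also have "\<dots> \<in> ?Q"
        using q x z p n by (intro add minus imageI) auto
      finally show "pure A P N x y z p n \<in> ?Q" .
    qed
  qed
  show ?thesis
    using t bims(1,2) x
  proof (induction t rule: base.tensor_hom_induct)
    case (pure z m n)
    then show ?case using \<open>\<And>z. \<forall>p n. z \<in> Ob A \<longrightarrow> _\<close> by simp
  qed (rule add)
qed

lemma pure_component:
  "w \<in> Ob A \<Longrightarrow> w \<noteq> z \<Longrightarrow> pure A P N x y z p n w = \<zero>\<^bsub>tensor_at A P N x y w\<^esub>"
  by (simp add: pure_def)

lemma act_inj:
  assumes x: "x \<in> Ob A" "y \<in> Ob A" and h: "h \<in> carrier (Hom C x y)" and 0: "act x y h = \<zero>\<^bsub>T x y\<^esub>"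
  shows "h = \<zero>\<^bsub>Hom C x y\<^esub>"
proof -
  interpret fam: module_family K "Ob A" "tensor_at A P N x y"
    using base.tensor_hom_family [OF bims(1,2) x] .
  have T: "T x y = fam.D" by (simp add: tensor_hom_def)
  interpret X: module K "T x y" using x by simp
  define \<Psi> where "\<Psi> t = act x y (mlt x y t)" for t
  have \<Psi>: "linear_map K (T x y) (T x y) \<Psi>"
    unfolding \<Psi>_def by (rule linear_map_compose [OF mlt_linear [OF x] act_linear [OF x]])
  \<comment> \<open>\<open>up z\<close> keeps the components strictly above \<open>z\<close>. Since
    the map only adds terms at lower objects, its component at \<open>z\<close> depends on t z and
    on these components alone.\<close>
  define up where "up z t = (\<lambda>w\<in>Ob A. if (z, w) \<in> le A \<and> w \<noteq> z then t w else \<zero>\<^bsub>tensor_at A P N x y w\<^esub>)" for z t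
  have up: "linear_map K (T x y) (T x y) (up z)" for z
    unfolding up_def T by (rule fam.restrict_linear)
  have comp: "linear_map K (T x y) (tensor_at A P N x y z) (\<lambda>t. t z)" if "z \<in> Ob A" for z
    unfolding T by (rule fam.component_linear [OF that])
  have zero_z: "\<zero>\<^bsub>T x y\<^esub> z = \<zero>\<^bsub>tensor_at A P N x y z\<^esub>" if "z \<in> Ob A" for z
    using that by (simp add: T)
  have triangular: "\<Psi> t z = t z \<oplus>\<^bsub>tensor_at A P N x y z\<^esub> \<Psi> (up z t) z"
    if z: "z \<in> Ob A" and t: "t \<in> carrier (T x y)" for z t
  proof (rule T_ext [OF x _ _ _ t])
    interpret Z: module K "tensor_at A P N x y z" using z by (rule fam.family)
    show "linear_map K (T x y) (tensor_at A P N x y z) (\<lambda>t. \<Psi> t z)"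
      by (rule linear_map_compose [OF \<Psi> comp [OF z]])
    show "linear_map K (T x y) (tensor_at A P N x y z) (\<lambda>t. t z \<oplus>\<^bsub>tensor_at A P N x y z\<^esub> \<Psi> (up z t) z)"
      by (rule linear_map_sum [OF Z.module_axioms comp [OF z]
            linear_map_compose [OF linear_map_compose [OF up \<Psi>] comp [OF z]]])
    fix w p n assume w: "w \<in> Ob A" and p: "p \<in> pos C w y" and n: "n \<in> neg C x w"
    let ?t = "pure A P N x y w p n"
    have t: "?t \<in> carrier (T x y)" using x w p n by simp
    have ext: "\<And>i. i \<notin> Ob A \<Longrightarrow> ?t i = undefined" by (simp add: pure_def)
    have tz: "?t z \<in> carrier (tensor_at A P N x y z)" using linear_map_closed [OF comp [OF z] t] .
    show "\<Psi> ?t z = ?t z \<oplus>\<^bsub>tensor_at A P N x y z\<^esub> \<Psi> (up z ?t) z"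
    proof (cases "(z, w) \<in> le A \<and> w \<noteq> z")
      case True
      then have "up z ?t = ?t"
        using pure_component [of _ w x y p n] ext by (auto simp: up_def fun_eq_iff)
      moreover have "\<Psi> ?t z \<in> carrier (tensor_at A P N x y z)"
        using linear_map_closed [OF comp [OF z] linear_map_closed [OF \<Psi> t]] .
      moreover have "?t z = \<zero>\<^bsub>tensor_at A P N x y z\<^esub>"
        using True pure_component [of z w x y p n] z by blast
      ultimately show ?thesis by simp
    next
      case False
      \<comment> \<open>Elements without component at \<open>z\<close>. The lower terms of a tensor
        at \<open>w\<close> sit strictly below \<open>w\<close>, hence not at \<open>z\<close>,
        which is not strictly below \<open>w\<close> in this case.\<close>
      let ?Q = "{q \<in> carrier (T x y). q z = \<zero>\<^bsub>tensor_at A P N x y z\<^esub>}"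
      have "\<exists>q\<in>?Q. act x y (Comp C x w y p n) = ?t \<oplus>\<^bsub>T x y\<^esub> q"
      proof (rule act_Comp [OF x w p n])
        show "\<zero>\<^bsub>T x y\<^esub> \<in> ?Q" using zero_z [OF z] X.zero_closed by blast
        show "q \<oplus>\<^bsub>T x y\<^esub> q' \<in> ?Q" if "q \<in> ?Q" "q' \<in> ?Q" for q q'
          using that linear_map_add [OF comp [OF z], of q q'] by simp
        fix w' p' n' assume w': "w' \<in> Ob A" "(w', w) \<in> le A" "w' \<noteq> w" "p' \<in> pos C w' y" "n' \<in> neg C x w'"
        then have "z \<noteq> w'" using False by auto
        then show "pure A P N x y w' p' n' \<in> ?Q"
          using w' x z pure_component [of z w' x y p' n'] by simp
      qed auto
      then obtain q where q: "q \<in> carrier (T x y)" "q z = \<zero>\<^bsub>tensor_at A P N x y z\<^esub>" "\<Psi> ?t = ?t \<oplus>\<^bsub>T x y\<^esub> q"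
        unfolding \<Psi>_def using x w p n by auto
      have "up z ?t = \<zero>\<^bsub>T x y\<^esub>"
        using False pure_component [of _ w x y p n] by (auto simp: up_def T fun_eq_iff)
      then have "\<Psi> (up z ?t) z = \<zero>\<^bsub>tensor_at A P N x y z\<^esub>"
        using linear_map_zero [OF X.module_axioms X.module_axioms \<Psi>] zero_z [OF z] by simp
      then show ?thesis
        using q linear_map_add [OF comp [OF z] t q(1)] tz by simp
    qed
  qed
  define t where "t = decomp A C x y h"
  have t: "t \<in> carrier (T x y)" and ht: "h = mlt x y t"
    using x h by (auto simp: t_def)
  have \<Psi>t: "\<Psi> t = \<zero>\<^bsub>T x y\<^esub>" using 0 by (simp add: \<Psi>_def ht)
  let ?S = "{i \<in> Ob A. t i \<noteq> \<zero>\<^bsub>tensor_at A P N x y i\<^esub>}"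
  have "?S = {}"
  proof (rule ccontr)
    assume "?S \<noteq> {}"
    moreover have "finite ?S" using t by (simp add: T direct_sum_carrier_iff)
    moreover have "asymp_on ?S (\<lambda>i j. (i, j) \<in> le A \<and> i \<noteq> j)"
      using le_antisym by (auto simp: asymp_on_def)
    moreover have "transp_on ?S (\<lambda>i j. (i, j) \<in> le A \<and> i \<noteq> j)"
      using base.le_order le_antisym
      unfolding partial_order_on_def preorder_on_def transp_on_def trans_def by blast
    ultimately obtain z where z: "z \<in> ?S" and max: "\<And>w. w \<in> ?S \<Longrightarrow> w \<noteq> z \<Longrightarrow> \<not> ((z, w) \<in> le A \<and> z \<noteq> w)"
      using Finite_Set.bex_max_element [of ?S "\<lambda>i j. (i, j) \<in> le A \<and> i \<noteq> j"] by blast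
    interpret Z: module K "tensor_at A P N x y z" using z by (intro fam.family) auto
    \<comment> \<open>Nothing in the support lies above the maximal object \<open>z\<close>, so
      \<open>triangular\<close> degenerates there to the equation 0 = t z.\<close>
    have "up z t = \<zero>\<^bsub>T x y\<^esub>"
      using max by (auto simp: up_def T fun_eq_iff)
    then have "\<Psi> (up z t) z = \<zero>\<^bsub>tensor_at A P N x y z\<^esub>"
      using linear_map_zero [OF X.module_axioms X.module_axioms \<Psi>] zero_z [of z] z by simp
    then have "t z = \<zero>\<^bsub>tensor_at A P N x y z\<^esub>"
      using triangular [of z t] z t \<Psi>t zero_z [of z] linear_map_closed [OF comp [of z] t] by simp
    then show False using z by simp
  qed
  then have "t = \<zero>\<^bsub>T x y\<^esub>"
    using t by (auto simp: T direct_sum_carrier_iff fun_eq_iff extensional_def)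
  then show ?thesis
    using ht linear_map_zero [OF _ _ mlt_linear [OF x]] x by simp
qed

lemma act_bij:
  assumes x: "x \<in> Ob A" "y \<in> Ob A"
  shows "bij_betw (act x y) (carrier (Hom C x y)) (carrier (T x y))"
proof -
  interpret H: module K "Hom C x y" using x by simp
  interpret X: module K "T x y" using x by simp
  note lin = act_linear [OF x]
  have "inj_on (act x y) (carrier (Hom C x y))"
  proof (rule inj_onI)
    fix h h' assume h: "h \<in> carrier (Hom C x y)" "h' \<in> carrier (Hom C x y)" and eq: "act x y h = act x y h'"
    have "act x y (h \<ominus>\<^bsub>Hom C x y\<^esub> h') = \<zero>\<^bsub>T x y\<^esub>"
      using linear_map_diff [OF H.module_axioms X.module_axioms lin h] eq linear_map_closed [OF lin h(2)]
      by (simp add: X.minus_eq X.r_neg)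
    then have "h \<ominus>\<^bsub>Hom C x y\<^esub> h' = \<zero>\<^bsub>Hom C x y\<^esub>"
      using act_inj [OF x] h by simp
    then show "h = h'" using h by (simp add: H.minus_eq H.minus_equality H.add.inv_solve_right')
  qed
  moreover have "act x y ` carrier (Hom C x y) = carrier (T x y)"
    using act_surj [OF x] linear_map_closed [OF lin] by auto
  ultimately show ?thesis by (simp add: bij_betw_def)
qed

end

text \<open>The triangle identity at n = 1, read through \<open>rpart_mlt_tlact\<close>: contracting
  1 with \<gamma> is the same as multiplying \<gamma> out and projecting.\<close>

lemma copairing_top:
  assumes g: "copairing_at (pairing A C) g" and x: "x \<in> Ob A"
  shows "rpart x x (mlt x x (g x)) = idn C x"
proof -
  have gx: "g x \<in> carrier (T x x)" using g x by (auto simp: copairing_at_def)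
  have "cL (pairing A C) x x x (idn C x) (g x) = idn C x"
    using g x by (simp add: copairing_at_def)
  then show ?thesis
    using rpart_mlt_tlact [of x x x "idn C x" "g x"] x gx by (simp add: tlact_idn)
qed

lemma regular_cbimod_simps [simp]:
  "chom (regular_cbimod C) = Hom C" "clact (regular_cbimod C) = Comp C" "cract (regular_cbimod C) = Comp C"
  by (simp_all add: regular_cbimod_def)

text \<open>The isomorphism is the inverse of c \<mapsto> c \<gamma>. Compatibility with the left
  action is associativity; with the right action it follows from c \<gamma> = \<gamma> c.\<close>

lemma perfect_imp_isomorphic:
  assumes "perfect K A C"
  shows "cbimod_isomorphic K C (pos_tens_neg A C) (regular_cbimod C)"
proof -
  obtain \<gamma> where \<gamma>: "is_copairing K A C (pairing A C) \<gamma>"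
    using assms by (auto simp: perfect_def perfect_pairing_def)
  define g where "g x = \<gamma> x x (idn A x)" for x
  have g: "copairing_at (pairing A C) g"
    unfolding g_def by (rule is_copairing_at [OF pairing_mor \<gamma>])
  have g_in: "g x \<in> carrier (T x x)" if "x \<in> Ob A" for x
    using g that by (auto simp: copairing_at_def)
  let ?act = "\<lambda>x y c. tlact x x y c (g x)"
  define f where "f x y = the_inv_into (carrier (Hom C x y)) (?act x y)" for x y
  have lin: "linear_map K (Hom C x y) (T x y) (?act x y)" if "x \<in> Ob A" "y \<in> Ob A" for x y
    by (rule act_linear [OF g_in copairing_top [OF g] copairing_central [OF g] that])
  have bij: "bij_betw (?act x y) (carrier (Hom C x y)) (carrier (T x y))" if "x \<in> Ob A" "y \<in> Ob A" for x y
    by (rule act_bij [OF g_in copairing_top [OF g] copairing_central [OF g] that])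
  have f_in: "f x y t \<in> carrier (Hom C x y)" and act_f: "?act x y (f x y t) = t"
    if "x \<in> Ob A" "y \<in> Ob A" "t \<in> carrier (T x y)" for x y t
    using bij [OF that(1,2)] that(3) f_the_inv_into_f [of "?act x y" "carrier (Hom C x y)" t] unfolding f_def bij_betw_def
    by (auto intro: the_inv_into_into)
  have f_act: "f x y (?act x y h) = h" if "x \<in> Ob A" "y \<in> Ob A" "h \<in> carrier (Hom C x y)" for x y h
    using bij [OF that(1,2)] that(3) the_inv_into_f_f [of "?act x y" "carrier (Hom C x y)" h] unfolding f_def bij_betw_def by auto
  have "f x z (tlact x y z c t) = Comp C x y z c (f x y t)"
    if "x \<in> Ob A" "y \<in> Ob A" "z \<in> Ob A" "t \<in> carrier (T x y)" "c \<in> carrier (Hom C y z)" for x y z t c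
    using f_act [of x z "Comp C x y z c (f x y t)"] that f_in act_f g_in by (simp add: tlact_Comp)
  moreover have "f x z (tract x y z t c) = Comp C x y z (f y z t) c"
    if x: "x \<in> Ob A" "y \<in> Ob A" "z \<in> Ob A" and t: "t \<in> carrier (T y z)" and c: "c \<in> carrier (Hom C x y)" for x y z t c
  proof -
    have "?act x z (Comp C x y z (f y z t) c) = tlact x y z (f y z t) (tract x y y (g y) c)"
      using x t c f_in g_in copairing_central [OF g x(1,2) c] by (simp add: tlact_Comp)
    also have "\<dots> = tract x y z t c"
      using x t c f_in g_in act_f by (simp flip: tlact_tract)
    finally show ?thesis
      using f_act [of x z "Comp C x y z (f y z t) c"] x t c f_in by simp
  qed
  moreover have "linear_map K (T x y) (Hom C x y) (f x y)" "bij_betw (f x y) (carrier (T x y)) (carrier (Hom C x y))"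
    if "x \<in> Ob A" "y \<in> Ob A" for x y
    unfolding f_def using that lin bij by (auto intro!: linear_map_inv_into bij_betw_the_inv_into)
  ultimately show ?thesis
    unfolding cbimod_isomorphic_def
    by (auto simp: pos_tens_neg_bimodule regular_cbimodule intro!: exI [of _ f])
qed

subsection \<open>Morita implies perfect\<close>

text \<open>A central element at each object extends to a bimodule morphism out of A by a \<mapsto>
  a g; off the diagonal, where A is zero, the value is zero.\<close>

lemma central_mor:
  assumes g_in: "\<And>x. x \<in> Ob A \<Longrightarrow> g x \<in> carrier (T x x)"
    and central: "\<And>x a. x \<in> Ob A \<Longrightarrow> a \<in> carrier (Hom A x x)
      \<Longrightarrow> lact (tens A P N) x x a (g x) = ract (tens A P N) x x (g x) a"
  shows "base.mor U (tens A P N) (\<lambda>x y a. if x = y then lact (tens A P N) x x a (g x) else \<zero>\<^bsub>T x y\<^esub>)"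
proof (rule base.morI)
  fix x y assume xy: "x \<in> Ob A" "y \<in> Ob A"
  show "linear_map K (bhom U x y) (bhom (tens A P N) x y)
      (\<lambda>a. if x = y then lact (tens A P N) x x a (g x) else \<zero>\<^bsub>T x y\<^esub>)"
    using xy g_in by (cases "x = y") (auto intro!: base.tens_lact_linear_scalar linear_map_const_zero)
  fix m a assume m: "m \<in> carrier (bhom U x y)"
  note laws = base.tens_bimodule_laws [OF bims(1,2)]
  show "(if x = y then lact (tens A P N) x x (lact U x y a m) (g x) else \<zero>\<^bsub>T x y\<^esub>)
      = lact (tens A P N) x y a (if x = y then lact (tens A P N) x x m (g x) else \<zero>\<^bsub>T x y\<^esub>)"
    if "a \<in> carrier (Hom A y y)"
    using that xy m g_in base.lact_zero [of "tens A P N" x y a] by (cases "x = y") (simp_all add: laws)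
  show "(if x = y then lact (tens A P N) x x (ract U x y m a) (g x) else \<zero>\<^bsub>T x y\<^esub>)
      = ract (tens A P N) x y (if x = y then lact (tens A P N) x x m (g x) else \<zero>\<^bsub>T x y\<^esub>) a"
    if "a \<in> carrier (Hom A x x)"
    using that xy m g_in central base.ract_zero [of "tens A P N" x y a] by (cases "x = y") (simp_all add: laws)
qed auto

lemma perfectI:
  assumes "base.mor U (tens A P N) \<gamma>"
    and "\<And>x y n. x \<in> Ob A \<Longrightarrow> y \<in> Ob A \<Longrightarrow> n \<in> neg C x y \<Longrightarrow> cL (pairing A C) x x y n (\<gamma> x x (idn A x)) = n"
    and "\<And>x y p. x \<in> Ob A \<Longrightarrow> y \<in> Ob A \<Longrightarrow> p \<in> pos C x y \<Longrightarrow> cR (pairing A C) x y y (\<gamma> y y (idn A y)) p = p"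
  shows "perfect K A C"
  using assms is_copairing_iff [OF pairing_mor] pairing_mor
  by (auto simp: perfect_def perfect_pairing_def)

text \<open>The elements g sent to identities by the isomorphism are central for C, but the
  isomorphism may be rescaled, so their top coefficient u need not be 1. Contraction with g
  multiplies by u instead of being the identity; once u is known to be a central unit, its inverse v
  corrects g.\<close>

lemma isomorphic_imp_perfect:
  assumes "cbimod_isomorphic K C (pos_tens_neg A C) (regular_cbimod C)"
  shows "perfect K A C"
proof -
  let ?b = "pairing A C"
  obtain f where f: "\<forall>x\<in>Ob A. \<forall>y\<in>Ob A. linear_map K (T x y) (Hom C x y) (f x y) \<and>
        bij_betw (f x y) (carrier (T x y)) (carrier (Hom C x y))"
      "\<forall>x\<in>Ob A. \<forall>y\<in>Ob A. \<forall>z\<in>Ob A. \<forall>t\<in>carrier (T x y). \<forall>c\<in>carrier (Hom C y z).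
        f x z (tlact x y z c t) = Comp C x y z c (f x y t)"
      "\<forall>x\<in>Ob A. \<forall>y\<in>Ob A. \<forall>z\<in>Ob A. \<forall>t\<in>carrier (T y z). \<forall>c\<in>carrier (Hom C x y).
        f x z (tract x y z t c) = Comp C x y z (f y z t) c"
    using assms unfolding cbimod_isomorphic_def by simp blast
  have f_bij: "bij_betw (f x y) (carrier (T x y)) (carrier (Hom C x y))" if "x \<in> Ob A" "y \<in> Ob A" for x y
    using f(1) that by blast
  have f_left: "f x z (tlact x y z c t) = Comp C x y z c (f x y t)"
    if "x \<in> Ob A" "y \<in> Ob A" "z \<in> Ob A" "t \<in> carrier (T x y)" "c \<in> carrier (Hom C y z)" for x y z t c
    using f(2) that by blast
  have f_right: "f x z (tract x y z t c) = Comp C x y z (f y z t) c"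
    if "x \<in> Ob A" "y \<in> Ob A" "z \<in> Ob A" "t \<in> carrier (T y z)" "c \<in> carrier (Hom C x y)" for x y z t c
    using f(3) that by blast
  have f_in: "f x y t \<in> carrier (Hom C x y)" if "x \<in> Ob A" "y \<in> Ob A" "t \<in> carrier (T x y)" for x y t
    using f_bij [OF that(1,2)] that(3) by (auto simp: bij_betw_def)
  have f_inj: "t = t'" if "x \<in> Ob A" "y \<in> Ob A" "t \<in> carrier (T x y)" "t' \<in> carrier (T x y)" "f x y t = f x y t'" for x y t t'
    using f_bij [OF that(1,2)] that(3-5) by (auto simp: bij_betw_def inj_on_def)
  have "\<forall>x\<in>Ob A. \<exists>t\<in>carrier (T x x). f x x t = idn C x"
  proof
    fix x assume x: "x \<in> Ob A"
    then have "idn C x \<in> f x x ` carrier (T x x)" using f_bij [OF x x] by (simp add: bij_betw_def)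
    then show "\<exists>t\<in>carrier (T x x). f x x t = idn C x" by (auto simp: image_iff)
  qed
  then obtain g where g_in [simp]: "\<And>x. x \<in> Ob A \<Longrightarrow> g x \<in> carrier (T x x)" and f_g: "\<And>x. x \<in> Ob A \<Longrightarrow> f x x (g x) = idn C x"
    by metis
  have central: "tlact x x y c (g x) = tract x y y (g y) c"
    if "x \<in> Ob A" "y \<in> Ob A" "c \<in> carrier (Hom C x y)" for x y c
    using that by (intro f_inj [of x y]) (auto simp: f_left f_right f_g)
  have act_f: "tlact x x y (f x y t) (g x) = t" if "x \<in> Ob A" "y \<in> Ob A" "t \<in> carrier (T x y)" for x y t
    using that f_in by (intro f_inj [of x y]) (auto simp: f_left f_g)
  define u where "u x = rpart x x (mlt x x (g x))" for x
  have u_in [simp]: "u x \<in> pos C x x" if "x \<in> Ob A" for x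
    using that by (simp add: u_def)
  have u_lpart: "lpart x x (mlt x x (g x)) = u x" if "x \<in> Ob A" for x
    using that by (simp add: u_def lpart_eq_rpart)
  \<comment> \<open>Centrality allows n g to be computed as g n, whose right projection is u
    n.\<close>
  have cL_u: "cL ?b x x y n (g x) = Comp C x y y (u y) n" if "x \<in> Ob A" "y \<in> Ob A" "n \<in> neg C x y" for x y n
  proof -
    have "cL ?b x x y n (g x) = rpart x y (mlt x y (tract x y y (g y) n))"
      using rpart_mlt_tlact [of x x y n "g x"] that by (simp add: central)
    also have "\<dots> = rpart x y (Comp C x y y (u y) n)"
      using that by (simp add: rpart_mlt_tract u_def)
    finally show ?thesis using that by (simp add: rpart_diag_Comp)
  qed
  have cR_u: "cR ?b x y y (g y) p = Comp C x x y p (u x)" if "x \<in> Ob A" "y \<in> Ob A" "p \<in> pos C x y" for x y p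
  proof -
    have "cR ?b x y y (g y) p = lpart x y (mlt x y (tlact x x y p (g x)))"
      using lpart_mlt_tract [of x y y p "g y"] that by (simp add: central)
    also have "\<dots> = lpart x y (Comp C x x y p (u x))"
      using that by (simp add: lpart_mlt_tlact u_lpart)
    finally show ?thesis using that by simp
  qed
  \<comment> \<open>\<open>f x x\<close> applied to 1 \<otimes> 1 is the element c with c g = 1
    \<otimes> 1. Projecting this equation, and the same one with g on the left, gives inverses of
    \<open>u\<close> on both sides.\<close>
  define v where "v x = rpart x x (f x x (pure A P N x x x (idn C x) (idn C x)))" for x
  have v_in [simp]: "v x \<in> pos C x x" if "x \<in> Ob A" for x
    using that f_in by (simp add: v_def)
  have uv: "Comp C x x x (u x) (v x) = idn C x" and vu: "Comp C x x x (v x) (u x) = idn C x" if x: "x \<in> Ob A" for x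
  proof -
    let ?t = "pure A P N x x x (idn C x) (idn C x)"
    have t: "?t \<in> carrier (T x x)" and ft: "f x x ?t \<in> carrier (Hom C x x)" using x f_in by auto
    have "rpart x x (mlt x x (tlact x x x (f x x ?t) (g x))) = Comp C x x x (u x) (v x)"
      using rpart_mlt_tlact [OF x x x ft g_in [OF x]] cL_u [of x x "v x"] x ft by (simp add: v_def)
    then show "Comp C x x x (u x) (v x) = idn C x"
      using act_f [OF x x t] x by simp
    have "lpart x x (mlt x x (tract x x x (g x) (f x x ?t))) = Comp C x x x (v x) (u x)"
      using lpart_mlt_tract [OF x x x ft g_in [OF x]] cR_u [of x x "v x"] x ft by (simp add: v_def lpart_eq_rpart)
    then show "Comp C x x x (v x) (u x) = idn C x"
      using act_f [OF x x t] x central [OF x x ft] by simp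
  qed
  \<comment> \<open>The contraction of g with a diagonal element is computed twice, by
    \<open>cR_u\<close> and through the other projection, which agrees on endomorphisms.\<close>
  have u_central: "Comp C x x x a (u x) = Comp C x x x (u x) a" if x: "x \<in> Ob A" and a: "a \<in> pos C x x" for x a
  proof -
    have "cR ?b x x x (g x) a = lpart x x (mlt x x (tract x x x (g x) a))"
      using lpart_mlt_tract [of x x x a "g x"] x a by simp
    also have "\<dots> = rpart x x (mlt x x (tract x x x (g x) a))"
      using x a by (simp add: lpart_eq_rpart)
    also have "\<dots> = Comp C x x x (u x) a"
      using x a by (simp add: rpart_mlt_tract u_def)
    finally show ?thesis using cR_u [OF x x a] by simp
  qed
  have v_central: "Comp C x x x a (v x) = Comp C x x x (v x) a" if x: "x \<in> Ob A" and a: "a \<in> pos C x x" for x a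
  proof -
    have "Comp C x x x a (v x) = Comp C x x x (Comp C x x x (v x) (u x)) (Comp C x x x a (v x))"
      using x a by (simp add: vu)
    also have "\<dots> = Comp C x x x (v x) (Comp C x x x (Comp C x x x (u x) a) (v x))"
      using x a by (simp add: C_assoc)
    also have "\<dots> = Comp C x x x (v x) (Comp C x x x a (Comp C x x x (u x) (v x)))"
      using x a by (simp add: u_central [symmetric] C_assoc)
    finally show ?thesis using x a by (simp add: uv)
  qed
  \<comment> \<open>Right multiplication by the inverse unit on the positive factor; centrality of
    \<open>v\<close> makes it compatible with the right action of A.\<close>
  define m where "m x y p = Comp C x x y p (v x)" for x y p
  have m: "base.mor P P m"
  proof (rule base.morI)
    fix x y assume xy: "x \<in> Ob A" "y \<in> Ob A"
    then show "linear_map K (bhom P x y) (bhom P x y) (m x y)"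
      unfolding m_def [abs_def] by (auto intro!: bhom_target Comp_lin_left P_ident_lin)
    fix p a assume p: "p \<in> carrier (bhom P x y)"
    show "m x y (lact P x y a p) = lact P x y a (m x y p)" if "a \<in> carrier (Hom A y y)"
      using that xy p by (simp add: m_def lact_P C_assoc)
    show "m x y (ract P x y p a) = ract P x y (m x y p) a" if "a \<in> carrier (Hom A x x)"
      using that xy p v_central [of x "incl C x x a"] by (simp add: m_def ract_P C_assoc)
  qed auto
  let ?\<gamma> = "tens_map A P N P N m bimod_id \<bullet> (\<lambda>x y a. if x = y then lact (tens A P N) x x a (g x) else \<zero>\<^bsub>T x y\<^esub>)"
  have mid: "base.mor (tens A P N) (tens A P N) (tens_map A P N P N m bimod_id)"
    by (rule base.tens_map_mor [OF m base.mor_id]) auto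
  note ml = base.tens_map_linear [OF m base.mor_id [OF bims(2)]]
  note mp = base.tens_map_pure [OF m base.mor_id [OF bims(2)]]
  have m_pos: "m x y p \<in> pos C x y" if "x \<in> Ob A" "y \<in> Ob A" "p \<in> pos C x y" for x y p
    using that by (simp add: m_def)
  have cL_m: "cL ?b x x y n (tens_map A P N P N m bimod_id x x t) = Comp C x y y (v y) (cL ?b x x y n t)"
    if x: "x \<in> Ob A" "y \<in> Ob A" and n: "n \<in> neg C x y" and t: "t \<in> carrier (T x x)" for x y n t
  proof (rule T_ext [OF x(1,1) _ _ _ t])
    show "linear_map K (T x x) (Hom C x y) (\<lambda>t. cL ?b x x y n (tens_map A P N P N m bimod_id x x t))"
      by (rule bhom_N_target [OF x linear_map_compose [OF ml [OF x(1,1)] cL_linear [OF pairing_mor x(1,1,2) n]]])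
    show "linear_map K (T x x) (Hom C x y) (\<lambda>t. Comp C x y y (v y) (cL ?b x x y n t))"
      by (rule Comp_lin_right [OF x(1,2,2) _ bhom_N_target [OF x cL_linear [OF pairing_mor x(1,1,2) n]]])
         (use x in auto)
    fix z p n' assume z: "z \<in> Ob A" "p \<in> pos C z x" "n' \<in> neg C x z"
    have "lpart y y (Comp C y x y n (m y x p)) = Comp C y y y (v y) (lpart y y (Comp C y x y n p))" if "z = y"
    proof -
      have "lpart y y (Comp C y x y n (m y x p)) = Comp C y y y (lpart y y (Comp C y x y n p)) (v y)"
        using x n z that lpart_Comp_diag [of y y "v y" "Comp C y x y n p"] by (simp add: m_def C_assoc)
      then show ?thesis using v_central [of y "lpart y y (Comp C y x y n p)"] x n z that by simp
    qed
    then show "cL ?b x x y n (tens_map A P N P N m bimod_id x x (pure A P N x x z p n'))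
        = Comp C x y y (v y) (cL ?b x x y n (pure A P N x x z p n'))"
      using x n z m_pos by (cases "z = y") (simp_all add: mp bimod_id_def cL_pure [OF pairing_mor] lact_N incl_pairing C_assoc)
  qed
  have cR_m: "cR ?b x y y (tens_map A P N P N m bimod_id y y t) p = Comp C x x y (cR ?b x y y t p) (v x)"
    if x: "x \<in> Ob A" "y \<in> Ob A" and p: "p \<in> pos C x y" and t: "t \<in> carrier (T y y)" for x y p t
  proof (rule T_ext [OF x(2,2) _ _ _ t])
    show "linear_map K (T y y) (Hom C x y) (\<lambda>t. cR ?b x y y (tens_map A P N P N m bimod_id y y t) p)"
      by (rule bhom_P_target [OF x linear_map_compose [OF ml [OF x(2,2)] cR_linear [OF pairing_mor x(1,2,2) p]]])
    show "linear_map K (T y y) (Hom C x y) (\<lambda>t. Comp C x x y (cR ?b x y y t p) (v x))"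
      by (rule Comp_lin_left [OF x(1,1,2) _ bhom_P_target [OF x cR_linear [OF pairing_mor x(1,2,2) p]]])
         (use x in auto)
    fix z p' n assume z: "z \<in> Ob A" "p' \<in> pos C z y" "n \<in> neg C y z"
    then show "cR ?b x y y (tens_map A P N P N m bimod_id y y (pure A P N y y z p' n)) p
        = Comp C x x y (cR ?b x y y (pure A P N y y z p' n) p) (v x)"
      using x p m_pos v_central [of x "lpart x x (Comp C x y x n p)"]
      by (cases "z = x") (simp_all add: mp bimod_id_def cR_pure [OF pairing_mor] ract_P incl_pairing C_assoc m_def)
  qed
  show ?thesis
  proof (rule perfectI)
    show "base.mor U (tens A P N) ?\<gamma>"
      by (rule base.mor_comp [OF central_mor mid]) (auto simp: central simp flip: tlact_incl tract_incl)
    fix x y assume x: "x \<in> Ob A" "y \<in> Ob A"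
    show "cL ?b x x y n (?\<gamma> x x (idn A x)) = n" if n: "n \<in> neg C x y" for n
    proof -
      have "Comp C x y y (v y) (Comp C x y y (u y) n) = n"
        using x n vu [of y] by (simp flip: C_assoc)
      then show ?thesis using x n by (simp add: bimod_comp_def base.tens_bimodule_laws cL_m cL_u)
    qed
    show "cR ?b x y y (?\<gamma> y y (idn A y)) p = p" if p: "p \<in> pos C x y" for p
    proof -
      have "Comp C x x y (Comp C x x y p (u x)) (v x) = p"
        using x p uv [of x] by (simp add: C_assoc)
      then show ?thesis using x p by (simp add: bimod_comp_def base.tens_bimodule_laws cR_m cR_u)
    qed
  qed
qed

end

section \<open>Quotients of bimodules\<close>

lemma linear_map_hom: "linear_map K M N f \<Longrightarrow> f \<in> hom (add_monoid M) (add_monoid N)"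
  by (auto simp: linear_map_def hom_def)

text \<open>Applied to the actions of A, this turns the additive group generated by the relations
  into a sub-bimodule.\<close>

lemma linear_map_generate:
  assumes M: "module K M" and f: "linear_map K M M f" and S: "S \<subseteq> carrier M"
    and fS: "\<And>s. s \<in> S \<Longrightarrow> f s \<in> S" and h: "h \<in> generate (add_monoid M) S"
  shows "f h \<in> generate (add_monoid M) S"
proof -
  interpret M: module K M by (rule M)
  have G: "group (add_monoid M)" by (rule M.a_group)
  have mem: "g \<in> carrier M" if "g \<in> generate (add_monoid M) S" for g
    using group.generate_in_carrier [OF G _ that] S by simp
  have minus: "f (\<ominus>\<^bsub>M\<^esub> u) = \<ominus>\<^bsub>M\<^esub> f u" if "u \<in> carrier M" for u
    using linear_map_minus [OF M M f that] .
  show ?thesis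
    using h
  proof (induction h rule: generate.induct)
    case one
    then show ?case
      using linear_map_zero [OF M M f] generate.one [of "add_monoid M" S] by simp
  next
    case (incl s)
    then show ?case using fS by (auto intro: generate.incl)
  next
    case (inv s)
    then show ?case
      using minus [of s] S generate.inv [OF fS [of s], of "add_monoid M"] by (auto simp: a_inv_def)
  next
    case (eng s t)
    then show ?case
      using linear_map_add [OF f, of s t] mem generate.eng [of "f s" "add_monoid M" S "f t"] by simp
  qed
qed

context base_category
begin

text \<open>Scalars act through multiples of identities of A, so stability under the left action
  already implies stability under scalars.\<close>

lemma smult_eq_lact:
  assumes "bim M" "x \<in> Ob A" "y \<in> Ob A" "c \<in> carrier K" "m \<in> carrier (bhom M x y)"
  shows "c \<odot>\<^bsub>bhom M x y\<^esub> m = lact M x y (c \<odot>\<^bsub>Hom A y y\<^esub> idn A y) m"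
  using linear_map_smult [OF bimodule.lact_linear_scalar [OF assms(1-3,5)] assms(4), of "idn A y"] assms
  by simp

lemma smult_idn_in: "y \<in> Ob A \<Longrightarrow> c \<in> carrier K \<Longrightarrow> c \<odot>\<^bsub>Hom A y y\<^esub> idn A y \<in> carrier (Hom A y y)"
  by (rule module.smult_closed) auto

context
  fixes M :: "('o, 'k, 'a, 'm) bimod" and H :: "'o \<Rightarrow> 'o \<Rightarrow> 'm set"
  assumes M [simp]: "bim M"
    and H: "\<And>x y. x \<in> Ob A \<Longrightarrow> y \<in> Ob A \<Longrightarrow> subgroup (H x y) (add_monoid (bhom M x y))"
    and H_lact: "\<And>x y a h. x \<in> Ob A \<Longrightarrow> y \<in> Ob A \<Longrightarrow> a \<in> carrier (Hom A y y) \<Longrightarrow> h \<in> H x y \<Longrightarrow> lact M x y a h \<in> H x y"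
    and H_ract: "\<And>x y a h. x \<in> Ob A \<Longrightarrow> y \<in> Ob A \<Longrightarrow> a \<in> carrier (Hom A x x) \<Longrightarrow> h \<in> H x y \<Longrightarrow> ract M x y h a \<in> H x y"
begin

abbreviation "qc x y m \<equiv> H x y #>\<^bsub>add_monoid (bhom M x y)\<^esub> m"
abbreviation "Q \<equiv> quotient_bimod M H"

lemma bhom_comm_group: "x \<in> Ob A \<Longrightarrow> y \<in> Ob A \<Longrightarrow> comm_group (add_monoid (bhom M x y))"
  using abelian_group.a_comm_group [OF module_abelian_group [OF bhom_is_module [OF M]]] by simp

lemma H_in: "x \<in> Ob A \<Longrightarrow> y \<in> Ob A \<Longrightarrow> h \<in> H x y \<Longrightarrow> h \<in> carrier (bhom M x y)"
  using subgroup.mem_carrier [OF H] by fastforce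

lemma H_smult:
  "x \<in> Ob A \<Longrightarrow> y \<in> Ob A \<Longrightarrow> c \<in> carrier K \<Longrightarrow> h \<in> H x y \<Longrightarrow> c \<odot>\<^bsub>bhom M x y\<^esub> h \<in> H x y"
  using smult_eq_lact [OF M, of x y c h] H_lact [OF _ _ smult_idn_in] H_in by simp

lemma qc_linear_op:
  assumes x: "x \<in> Ob A" "y \<in> Ob A" and f: "linear_map K (bhom M x y) (bhom M x y) f"
    and fH: "\<And>h. h \<in> H x y \<Longrightarrow> f h \<in> H x y" and u: "u \<in> carrier (bhom M x y)"
  shows "(\<Union>m\<in>qc x y u. qc x y (f m)) = qc x y (f u)"
  using coset_UN [OF bhom_comm_group [OF x] bhom_comm_group [OF x] H [OF x] H [OF x] linear_map_hom [OF f] fH] u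
  by simp

lemma smult_lin: "x \<in> Ob A \<Longrightarrow> y \<in> Ob A \<Longrightarrow> c \<in> carrier K \<Longrightarrow> linear_map K (bhom M x y) (bhom M x y) (\<lambda>m. c \<odot>\<^bsub>bhom M x y\<^esub> m)"
proof -
  assume x: "x \<in> Ob A" "y \<in> Ob A" and c: "c \<in> carrier K"
  interpret X: module K "bhom M x y" using x by simp
  show ?thesis
    using c by (intro linear_mapI) (auto simp: X.smult_r_distr X.smult_assoc1 [symmetric] X.R.m_comm)
qed

lemma Q_module: "x \<in> Ob A \<Longrightarrow> y \<in> Ob A \<Longrightarrow> module K (bhom Q x y)"
proof -
  assume x: "x \<in> Ob A" "y \<in> Ob A"
  interpret X: module K "bhom M x y" using x by simp
  show ?thesis
    unfolding quotient_bimod_def bimod.simps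
    by (rule module_of_quotient [OF K_cring bhom_comm_group [OF x] H [OF x]])
       (use x H_smult in \<open>auto simp: X.smult_l_distr X.smult_assoc1 intro!: linear_map_hom smult_lin\<close>)
qed

lemma Q_carrier: "x \<in> Ob A \<Longrightarrow> y \<in> Ob A \<Longrightarrow> carrier (bhom Q x y) = qc x y ` carrier (bhom M x y)"
  by (simp add: quotient_bimod_def carrier_FactGroup)

lemma qc_linear:
  assumes x: "x \<in> Ob A" "y \<in> Ob A"
  shows "linear_map K (bhom M x y) (bhom Q x y) (qc x y)"
proof (rule linear_mapI)
  interpret G: comm_group "add_monoid (bhom M x y)" by (rule bhom_comm_group [OF x])
  have n: "normal (H x y) (add_monoid (bhom M x y))"
    using G.subgroup_imp_normal H [OF x] by blast
  show "qc x y (u \<oplus>\<^bsub>bhom M x y\<^esub> v) = qc x y u \<oplus>\<^bsub>bhom Q x y\<^esub> qc x y v"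
    if "u \<in> carrier (bhom M x y)" "v \<in> carrier (bhom M x y)" for u v
    using normal.rcos_sum [OF n, of u v] that by (simp add: quotient_bimod_def)
  show "qc x y (c \<odot>\<^bsub>bhom M x y\<^esub> u) = c \<odot>\<^bsub>bhom Q x y\<^esub> qc x y u" if "c \<in> carrier K" "u \<in> carrier (bhom M x y)" for c u
    using qc_linear_op [OF x smult_lin [OF x that(1)] H_smult [OF x that(1)] that(2)] by (simp add: quotient_bimod_def)
qed (use x Q_carrier in auto)

text \<open>\<open>F\<close> is known only by its values on cosets, so this covers operations
  defined by unions as well as maps defined by a choice of representative.\<close>

lemma Q_map_linear:
  assumes x: "x \<in> Ob A" "y \<in> Ob A" and f: "linear_map K (bhom M x y) Y f"
    and F: "\<And>u. u \<in> carrier (bhom M x y) \<Longrightarrow> F (qc x y u) = f u"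
  shows "linear_map K (bhom Q x y) Y F"
proof (rule linear_mapI)
  interpret X: module K "bhom M x y" using x by simp
  note q = qc_linear [OF x]
  show "F X \<in> carrier Y" if "X \<in> carrier (bhom Q x y)" for X
    using that F linear_map_closed [OF f] by (auto simp: Q_carrier [OF x])
  show "F (X \<oplus>\<^bsub>bhom Q x y\<^esub> X') = F X \<oplus>\<^bsub>Y\<^esub> F X'"
    if "X \<in> carrier (bhom Q x y)" "X' \<in> carrier (bhom Q x y)" for X X'
  proof -
    from that obtain u v where u: "u \<in> carrier (bhom M x y)" "v \<in> carrier (bhom M x y)" and X: "X = qc x y u" "X' = qc x y v"
      by (auto simp: Q_carrier [OF x])
    have "F (X \<oplus>\<^bsub>bhom Q x y\<^esub> X') = F (qc x y (u \<oplus>\<^bsub>bhom M x y\<^esub> v))"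
      unfolding X by (simp only: linear_map_add [OF q u])
    then show ?thesis
      unfolding X using u by (simp only: F X.a_closed linear_map_add [OF f])
  qed
  show "F (c \<odot>\<^bsub>bhom Q x y\<^esub> X) = c \<odot>\<^bsub>Y\<^esub> F X" if c: "c \<in> carrier K" and "X \<in> carrier (bhom Q x y)" for c X
  proof -
    from that obtain u where u: "u \<in> carrier (bhom M x y)" and X: "X = qc x y u"
      by (auto simp: Q_carrier [OF x])
    have "F (c \<odot>\<^bsub>bhom Q x y\<^esub> X) = F (qc x y (c \<odot>\<^bsub>bhom M x y\<^esub> u))"
      unfolding X by (simp only: linear_map_smult [OF q c u])
    then show ?thesis
      unfolding X using u c by (simp only: F X.smult_closed linear_map_smult [OF f])
  qed
qed

lemma Q_lact:
  "x \<in> Ob A \<Longrightarrow> y \<in> Ob A \<Longrightarrow> a \<in> carrier (Hom A y y) \<Longrightarrow> u \<in> carrier (bhom M x y)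
    \<Longrightarrow> lact Q x y a (qc x y u) = qc x y (lact M x y a u)"
  using qc_linear_op [of x y "lact M x y a" u] H_lact bimodule.lact_linear [OF M, of x y a]
  by (simp add: quotient_bimod_def)

lemma Q_ract:
  "x \<in> Ob A \<Longrightarrow> y \<in> Ob A \<Longrightarrow> a \<in> carrier (Hom A x x) \<Longrightarrow> u \<in> carrier (bhom M x y)
    \<Longrightarrow> ract Q x y (qc x y u) a = qc x y (ract M x y u a)"
  using qc_linear_op [of x y "\<lambda>u. ract M x y u a" u] H_ract bimodule.ract_linear [OF M, of x y a]
  by (simp add: quotient_bimod_def)

lemma Q_bimodule: "bim Q"
proof (rule bimodule.intro)
  fix x y assume x: "x \<in> Ob A" "y \<in> Ob A"
  note q = qc_linear [OF x]
  show "module K (bhom Q x y)" by (rule Q_module [OF x])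
  show "linear_map K (bhom Q x y) (bhom Q x y) (lact Q x y a)" if a: "a \<in> carrier (Hom A y y)" for a
    by (rule Q_map_linear [OF x linear_map_compose [OF bimodule.lact_linear [OF M x a] q]]) (simp add: Q_lact x a)
  show "linear_map K (bhom Q x y) (bhom Q x y) (\<lambda>X. ract Q x y X a)" if a: "a \<in> carrier (Hom A x x)" for a
    by (rule Q_map_linear [OF x linear_map_compose [OF bimodule.ract_linear [OF M x a] q]]) (simp add: Q_ract x a)
  fix X assume "X \<in> carrier (bhom Q x y)"
  then obtain u where u: "u \<in> carrier (bhom M x y)" and X: "X = qc x y u"
    by (auto simp: Q_carrier [OF x])
  show "linear_map K (Hom A y y) (bhom Q x y) (\<lambda>a. lact Q x y a X)"
    using linear_map_compose [OF bimodule.lact_linear_scalar [OF M x u] q] x u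
    by (subst linear_map_cong [of K _ _ "\<lambda>a. qc x y (lact M x y a u)"]) (auto simp: X Q_lact)
  show "linear_map K (Hom A x x) (bhom Q x y) (\<lambda>a. ract Q x y X a)"
    using linear_map_compose [OF bimodule.ract_linear_scalar [OF M x u] q] x u
    by (subst linear_map_cong [of K _ _ "\<lambda>a. qc x y (ract M x y u a)"]) (auto simp: X Q_ract)
  have Comp_in: "Comp A w w w a b \<in> carrier (Hom A w w)"
    if "w \<in> Ob A" "a \<in> carrier (Hom A w w)" "b \<in> carrier (Hom A w w)" for w a b
    using linear_map_closed [OF Comp_linear_left] that by blast
  show "lact Q x y (idn A y) X = X" "ract Q x y X (idn A x) = X"
    using x u by (simp_all add: X Q_lact Q_ract)
  show "lact Q x y (Comp A y y y a b) X = lact Q x y a (lact Q x y b X)"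
    if "a \<in> carrier (Hom A y y)" "b \<in> carrier (Hom A y y)" for a b
    using x u that by (simp add: X Q_lact lact_Comp Comp_in)
  show "ract Q x y X (Comp A x x x a b) = ract Q x y (ract Q x y X a) b"
    if "a \<in> carrier (Hom A x x)" "b \<in> carrier (Hom A x x)" for a b
    using x u that by (simp add: X Q_ract ract_Comp Comp_in)
  show "ract Q x y (lact Q x y a X) b = lact Q x y a (ract Q x y X b)"
    if "a \<in> carrier (Hom A y y)" "b \<in> carrier (Hom A x x)" for a b
    using x u that by (simp add: X Q_lact Q_ract lact_ract)
qed

text \<open>The first isomorphism theorem: the condition on kernels makes the induced map both well
  defined and injective.\<close>

lemma quotient_isomorphic:
  assumes f: "mor M N f"
    and ker: "\<And>x y m. x \<in> Ob A \<Longrightarrow> y \<in> Ob A \<Longrightarrow> m \<in> carrier (bhom M x y) \<Longrightarrow> f x y m = \<zero>\<^bsub>bhom N x y\<^esub> \<longleftrightarrow> m \<in> H x y"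
    and surj: "\<And>x y n. x \<in> Ob A \<Longrightarrow> y \<in> Ob A \<Longrightarrow> n \<in> carrier (bhom N x y) \<Longrightarrow> n \<in> f x y ` carrier (bhom M x y)"
  shows "bimod_isomorphic K A Q N"
proof -
  have N: "bim N" using f mor_bim by blast
  have coset: "qc x y u = qc x y v \<longleftrightarrow> f x y u = f x y v"
    if x: "x \<in> Ob A" "y \<in> Ob A" and u: "u \<in> carrier (bhom M x y)" "v \<in> carrier (bhom M x y)" for x y u v
  proof -
    interpret X: module K "bhom M x y" using x by simp
    interpret Y: module K "bhom N x y" using x N by simp
    have fu: "f x y u \<in> carrier (bhom N x y)" "f x y v \<in> carrier (bhom N x y)" using mor_in [OF f x] u by auto
    have "qc x y u = qc x y v \<longleftrightarrow> u \<ominus>\<^bsub>bhom M x y\<^esub> v \<in> H x y"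
      using coset_eq_iff [OF bhom_comm_group [OF x] H [OF x], of u v] u by (simp add: a_minus_def a_inv_def)
    also have "\<dots> \<longleftrightarrow> f x y u \<ominus>\<^bsub>bhom N x y\<^esub> f x y v = \<zero>\<^bsub>bhom N x y\<^esub>"
      using ker [OF x, of "u \<ominus>\<^bsub>bhom M x y\<^esub> v"] u
        linear_map_diff [OF X.module_axioms Y.module_axioms mor_linear [OF f x] u] by simp
    also have "\<dots> \<longleftrightarrow> f x y u = f x y v"
    proof
      assume 0: "f x y u \<ominus>\<^bsub>bhom N x y\<^esub> f x y v = \<zero>\<^bsub>bhom N x y\<^esub>"
      have "f x y u = (f x y u \<ominus>\<^bsub>bhom N x y\<^esub> f x y v) \<oplus>\<^bsub>bhom N x y\<^esub> f x y v"
        using fu by (simp add: Y.minus_eq Y.a_assoc Y.l_neg)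
      then show "f x y u = f x y v" using 0 fu by simp
    qed (use fu in \<open>simp add: Y.minus_eq Y.r_neg\<close>)
    finally show ?thesis .
  qed
  \<comment> \<open>An arbitrary representative is chosen; by \<open>coset\<close> the value does
    not depend on it.\<close>
  define F where "F x y X = f x y (SOME u. u \<in> carrier (bhom M x y) \<and> X = qc x y u)" for x y X
  have F: "F x y (qc x y u) = f x y u" if x: "x \<in> Ob A" "y \<in> Ob A" and u: "u \<in> carrier (bhom M x y)" for x y u
  proof -
    define v where "v = (SOME v. v \<in> carrier (bhom M x y) \<and> qc x y u = qc x y v)"
    have "v \<in> carrier (bhom M x y) \<and> qc x y u = qc x y v"
      unfolding v_def by (rule someI [of _ u]) (use u in simp)
    then have "f x y u = f x y v" using coset [OF x u] by blast
    then show ?thesis by (simp add: F_def v_def)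
  qed
  have "mor Q N F"
  proof (rule morI)
    fix x y assume x: "x \<in> Ob A" "y \<in> Ob A"
    show "linear_map K (bhom Q x y) (bhom N x y) (F x y)"
      by (rule Q_map_linear [OF x mor_linear [OF f x] F [OF x]])
    fix X a assume "X \<in> carrier (bhom Q x y)"
    then obtain u where u: "u \<in> carrier (bhom M x y)" and X: "X = qc x y u"
      by (auto simp: Q_carrier [OF x])
    show "F x y (lact Q x y a X) = lact N x y a (F x y X)" if "a \<in> carrier (Hom A y y)"
      using that x u by (simp add: X Q_lact F mor_lact [OF f])
    show "F x y (ract Q x y X a) = ract N x y (F x y X) a" if "a \<in> carrier (Hom A x x)"
      using that x u by (simp add: X Q_ract F mor_ract [OF f])
  qed (use N Q_bimodule in auto)
  moreover have "bij_betw (F x y) (carrier (bhom Q x y)) (carrier (bhom N x y))" if x: "x \<in> Ob A" "y \<in> Ob A" for x y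
  proof -
    have "inj_on (F x y) (carrier (bhom Q x y))"
    proof (rule inj_onI)
      fix X X' assume "X \<in> carrier (bhom Q x y)" "X' \<in> carrier (bhom Q x y)" and eq: "F x y X = F x y X'"
      then obtain u v where u: "u \<in> carrier (bhom M x y)" "v \<in> carrier (bhom M x y)" and X: "X = qc x y u" "X' = qc x y v"
        by (auto simp: Q_carrier [OF x])
      then show "X = X'"
        using coset [OF x u] eq by (simp only: F [OF x])
    qed
    moreover have "F x y ` carrier (bhom Q x y) = f x y ` carrier (bhom M x y)"
      unfolding Q_carrier [OF x] image_image by (rule image_cong [OF refl F [OF x]])
    moreover have "f x y ` carrier (bhom M x y) = carrier (bhom N x y)"
      using surj [OF x] mor_in [OF f x] by auto
    ultimately show ?thesis by (simp add: bij_betw_def)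
  qed
  ultimately show ?thesis by (auto simp: bimod_isomorphic_def)
qed

end

end

section \<open>The quotient of the tensor product of the negative and positive parts by the action
  of C\<close>

context stratified_category
begin

abbreviation "NP \<equiv> tensor_hom A N P"

lemma neg_tens_pos_rels_eq:
  "neg_tens_pos_rels A C x y =
     {pure A N P x y u (rpart u y (Comp C u v y f g)) h \<ominus>\<^bsub>NP x y\<^esub> pure A N P x y v f (lpart x v (Comp C x u v g h)) | u v f g h.
        u \<in> Ob A \<and> v \<in> Ob A \<and> f \<in> neg C v y \<and> g \<in> carrier (Hom C u v) \<and> h \<in> pos C x u}"
  by (simp add: neg_tens_pos_rels_def pos_lact_eq neg_ract_eq)

lemma neg_tens_pos_relsI:
  "u \<in> Ob A \<Longrightarrow> v \<in> Ob A \<Longrightarrow> f \<in> neg C v y \<Longrightarrow> g \<in> carrier (Hom C u v) \<Longrightarrow> h \<in> pos C x u \<Longrightarrow>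
    pure A N P x y u (rpart u y (Comp C u v y f g)) h \<ominus>\<^bsub>NP x y\<^esub> pure A N P x y v f (lpart x v (Comp C x u v g h))
      \<in> neg_tens_pos_rels A C x y"
  unfolding neg_tens_pos_rels_eq by blast

lemma neg_tens_pos_rels_cases:
  assumes "r \<in> neg_tens_pos_rels A C x y"
  obtains u v f g h where "u \<in> Ob A" "v \<in> Ob A" "f \<in> neg C v y" "g \<in> carrier (Hom C u v)" "h \<in> pos C x u"
    "r = pure A N P x y u (rpart u y (Comp C u v y f g)) h \<ominus>\<^bsub>NP x y\<^esub> pure A N P x y v f (lpart x v (Comp C x u v g h))"
  using assms unfolding neg_tens_pos_rels_eq by blast

lemma NP_diff_in: "x \<in> Ob A \<Longrightarrow> y \<in> Ob A \<Longrightarrow> s \<in> carrier (NP x y) \<Longrightarrow> t \<in> carrier (NP x y) \<Longrightarrow> s \<ominus>\<^bsub>NP x y\<^esub> t \<in> carrier (NP x y)"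
  using abelian_group.minus_closed [OF module_abelian_group [OF base.tensor_hom_module [OF bims(2,1)]]] .

lemma neg_tens_pos_rels_subset:
  assumes "x \<in> Ob A" "y \<in> Ob A"
  shows "neg_tens_pos_rels A C x y \<subseteq> carrier (NP x y)"
  using assms by (auto elim!: neg_tens_pos_rels_cases intro!: NP_diff_in)

text \<open>The scalar is absorbed into \<open>f\<close>, so a generating relation becomes another
  generating relation.\<close>

lemma neg_tens_pos_rels_lact:
  assumes x: "x \<in> Ob A" "y \<in> Ob A" and a: "a \<in> carrier (Hom A y y)" and r: "r \<in> neg_tens_pos_rels A C x y"
  shows "lact (tens A N P) x y a r \<in> neg_tens_pos_rels A C x y"
  using r
proof (rule neg_tens_pos_rels_cases)
  fix u v f g h assume u: "u \<in> Ob A" "v \<in> Ob A" "f \<in> neg C v y" "g \<in> carrier (Hom C u v)" "h \<in> pos C x u"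
    and r: "r = pure A N P x y u (rpart u y (Comp C u v y f g)) h \<ominus>\<^bsub>NP x y\<^esub> pure A N P x y v f (lpart x v (Comp C x u v g h))"
  have af: "Comp C v y y (incl C y y a) f \<in> neg C v y" using u x a by (intro neg_Comp) auto
  have "lact (tens A N P) x y a r = pure A N P x y u (lact N u y a (rpart u y (Comp C u v y f g))) h
      \<ominus>\<^bsub>NP x y\<^esub> pure A N P x y v (lact N v y a f) (lpart x v (Comp C x u v g h))"
    using x u a by (simp add: r linear_map_diff [OF _ _ base.tens_lact_linear])
  also have "lact N u y a (rpart u y (Comp C u v y f g)) = rpart u y (Comp C u v y (Comp C v y y (incl C y y a) f) g)"
    using x u a by (simp add: lact_N rpart_diag_Comp C_assoc)
  finally show ?thesis
    using neg_tens_pos_relsI [OF u(1,2) af u(4,5)] by (simp add: lact_N)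
qed

lemma neg_tens_pos_rels_ract:
  assumes x: "x \<in> Ob A" "y \<in> Ob A" and a: "a \<in> carrier (Hom A x x)" and r: "r \<in> neg_tens_pos_rels A C x y"
  shows "ract (tens A N P) x y r a \<in> neg_tens_pos_rels A C x y"
  using r
proof (rule neg_tens_pos_rels_cases)
  fix u v f g h assume u: "u \<in> Ob A" "v \<in> Ob A" "f \<in> neg C v y" "g \<in> carrier (Hom C u v)" "h \<in> pos C x u"
    and r: "r = pure A N P x y u (rpart u y (Comp C u v y f g)) h \<ominus>\<^bsub>NP x y\<^esub> pure A N P x y v f (lpart x v (Comp C x u v g h))"
  have ha: "Comp C x x u h (incl C x x a) \<in> pos C x u" using u x a by (intro pos_Comp) auto
  have "ract (tens A N P) x y r a = pure A N P x y u (rpart u y (Comp C u v y f g)) (ract P x u h a)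
      \<ominus>\<^bsub>NP x y\<^esub> pure A N P x y v f (ract P x v (lpart x v (Comp C x u v g h)) a)"
    using x u a by (simp add: r linear_map_diff [OF _ _ base.tens_ract_linear])
  also have "ract P x v (lpart x v (Comp C x u v g h)) a = lpart x v (Comp C x u v g (Comp C x x u h (incl C x x a)))"
    using x u a by (simp add: ract_P lpart_Comp_diag flip: C_assoc)
  finally show ?thesis
    using neg_tens_pos_relsI [OF u(1-4) ha] by (simp add: ract_P)
qed

text \<open>For endomorphisms both sides project the triple product f g h. Passing between
  \<open>lpart\<close> and \<open>rpart\<close>, which agree there, allows the inner projection to
  be dropped on either side. For distinct objects both values are zero.\<close>

lemma pairing_C_balanced:
  assumes x: "x \<in> Ob A" "y \<in> Ob A"
    and u: "u \<in> Ob A" "v \<in> Ob A" "f \<in> neg C v y" "g \<in> carrier (Hom C u v)" "h \<in> pos C x u"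
  shows "pairing A C x y (pure A N P x y u (rpart u y (Comp C u v y f g)) h)
    = pairing A C x y (pure A N P x y v f (lpart x v (Comp C x u v g h)))"
proof (cases "x = y")
  case True
  have h: "h \<in> pos C y u" and mem: "h \<in> carrier (Hom C y u)" "f \<in> carrier (Hom C v y)"
    "Comp C u v y f g \<in> carrier (Hom C u y)" "rpart u y (Comp C u v y f g) \<in> carrier (Hom C u y)"
    "Comp C y u v g h \<in> carrier (Hom C y v)"
    using True x u by auto
  have "lpart y y (Comp C y u y (rpart u y (Comp C u v y f g)) h) = rpart y y (Comp C y u y (rpart u y (Comp C u v y f g)) h)"
    by (rule lpart_eq_rpart [OF x(2) Comp_in [OF x(2) u(1) x(2) mem(4,1)]])
  also have "\<dots> = rpart y y (Comp C y u y (Comp C u v y f g) h)"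
    by (rule rpart_rpart [OF x(2) u(1) x(2) mem(1,3)])
  also have "\<dots> = lpart y y (Comp C y u y (Comp C u v y f g) h)"
    by (rule lpart_eq_rpart [OF x(2) Comp_in [OF x(2) u(1) x(2) mem(3,1)], symmetric])
  also have "\<dots> = lpart y y (Comp C y v y f (Comp C y u v g h))"
    by (simp only: C_assoc [OF x(2) u(1,2) x(2) mem(1) u(4) mem(2)])
  also have "\<dots> = lpart y y (Comp C y v y f (lpart y v (Comp C y u v g h)))"
    by (rule lpart_lpart [OF x(2) u(2) x(2) mem(2,5), symmetric])
  finally have eq: "lpart y y (Comp C y u y (rpart u y (Comp C u v y f g)) h)
      = lpart y y (Comp C y v y f (lpart y v (Comp C y u v g h)))" .
  show ?thesis
    unfolding True pairing_pure [OF x(2,2) u(1) rpart_in [OF u(1) x(2) mem(3)] h]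
      pairing_pure [OF x(2,2) u(2,3) lpart_in [OF x(2) u(2) mem(5)]] eq ..
next
  case False
  then show ?thesis using x u by (simp add: pairing_pure)
qed

text \<open>Reduces an arbitrary tensor to its pairing modulo the relations; an element with zero
  pairing then lies in the subgroup they generate.\<close>

lemma pairing_mod_rels:
  assumes x: "x \<in> Ob A" "y \<in> Ob A" and t: "t \<in> carrier (NP x y)"
  shows "\<exists>h\<in>generate (add_monoid (NP x y)) (neg_tens_pos_rels A C x y).
    t = (if x = y then pure A N P x y x (incl C x x (pairing A C x y t)) (idn C x) else \<zero>\<^bsub>NP x y\<^esub>) \<oplus>\<^bsub>NP x y\<^esub> h"
proof -
  let ?G = "generate (add_monoid (NP x y)) (neg_tens_pos_rels A C x y)"
  let ?i = "\<lambda>t. if x = y then pure A N P x y x (incl C x x (pairing A C x y t)) (idn C x) else \<zero>\<^bsub>NP x y\<^esub>"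
  have modX: "module K (NP x y)" using x by simp
  interpret X: module K "NP x y" by (rule modX)
  have G_in: "h \<in> carrier (NP x y)" if "h \<in> ?G" for h
    using group.generate_in_carrier [OF X.a_group _ that] neg_tens_pos_rels_subset [OF x] by simp
  have G_add: "h \<oplus>\<^bsub>NP x y\<^esub> h' \<in> ?G" if "h \<in> ?G" "h' \<in> ?G" for h h'
    using generate.eng [OF that] by simp
  have G_minus: "\<ominus>\<^bsub>NP x y\<^esub> h \<in> ?G" if "h \<in> ?G" for h
    using group.generate_m_inv_closed [OF X.a_group _ that] neg_tens_pos_rels_subset [OF x] by (simp add: a_inv_def)
  have i_lin: "linear_map K (NP x y) (NP x y) ?i"
  proof (cases "x = y")
    case True
    have "linear_map K (NP x x) (NP x x) (\<lambda>t. pure A N P x x x (incl C x x (pairing A C x x t)) (idn C x))"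
      by (rule base.pure_linear_left [OF bims(2,1) x(1,1,1) _ bhom_target
            [OF linear_map_compose [OF _ incl_linear [OF x(1)]]]])
         (use x beta_in [OF pairing_mor] beta_lin [OF pairing_mor x(1,1) linear_map_ident] in auto)
    then show ?thesis using True by simp
  qed (simp add: linear_map_const_zero [OF modX])
  show ?thesis
    using t bims(2,1) x
  proof (induction t rule: base.tensor_hom_induct)
    case (pure z n p)
    define p' where "p' = lpart x y (Comp C x z y n p)"
    have p': "p' \<in> pos C x y" using pure x by (simp add: p'_def)
    \<comment> \<open>The relations for (f, g, h) = (1, n, p) and (1, p', 1). The first replaces n
      \<otimes> p by 1 \<otimes> p'; the second moves p' to the left factor, where
      \<open>rpart\<close> leaves only its diagonal part.\<close>
    let ?r1 = "pure A N P x y z n p \<ominus>\<^bsub>NP x y\<^esub> pure A N P x y y (idn C y) p'"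
    let ?r2 = "pure A N P x y x (rpart x y p') (idn C x) \<ominus>\<^bsub>NP x y\<^esub> pure A N P x y y (idn C y) p'"
    have r1: "?r1 \<in> ?G"
      using neg_tens_pos_relsI [of z y "idn C y" y n p x] pure x by (auto simp: p'_def intro: generate.incl)
    have r2: "?r2 \<in> ?G"
      using neg_tens_pos_relsI [of x y "idn C y" y p' "idn C x" x] p' x by (auto intro: generate.incl)
    have i: "?i (pure A N P x y z n p) = pure A N P x y x (rpart x y p') (idn C x)"
    proof (cases "x = y")
      case True
      then show ?thesis
        using pure x p' by (simp add: pairing_pure rpart_pos counit_diag p'_def)
    next
      case False
      then show ?thesis
        using x p' base.pure_zero_left [of N P x y x "idn C x"] by (simp add: rpart_pos)
    qed
    have in_X: "pure A N P x y z n p \<in> carrier (NP x y)" "pure A N P x y y (idn C y) p' \<in> carrier (NP x y)"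
      "pure A N P x y x (rpart x y p') (idn C x) \<in> carrier (NP x y)"
      using pure x p' by auto
    have arith: "t = s \<oplus>\<^bsub>NP x y\<^esub> (\<ominus>\<^bsub>NP x y\<^esub> (s \<ominus>\<^bsub>NP x y\<^esub> r) \<oplus>\<^bsub>NP x y\<^esub> (t \<ominus>\<^bsub>NP x y\<^esub> r))"
      if "t \<in> carrier (NP x y)" "r \<in> carrier (NP x y)" "s \<in> carrier (NP x y)" for t r s
    proof -
      have "\<ominus>\<^bsub>NP x y\<^esub> (s \<ominus>\<^bsub>NP x y\<^esub> r) \<oplus>\<^bsub>NP x y\<^esub> (t \<ominus>\<^bsub>NP x y\<^esub> r)
          = \<ominus>\<^bsub>NP x y\<^esub> s \<oplus>\<^bsub>NP x y\<^esub> (t \<oplus>\<^bsub>NP x y\<^esub> (r \<oplus>\<^bsub>NP x y\<^esub> (\<ominus>\<^bsub>NP x y\<^esub> r)))"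
        using that by (simp add: X.minus_eq X.minus_add X.a_ac del: X.r_neg)
      then show ?thesis using that by (simp add: X.r_neg X.r_neg1 X.a_assoc [symmetric] X.a_comm)
    qed
    show ?case
      unfolding i
      by (rule rev_bexI [OF G_add [OF G_minus [OF r2] r1]]) (rule arith [OF in_X])
  next
    case (add s t)
    obtain h h' where h: "h \<in> ?G" "h' \<in> ?G" "s = ?i s \<oplus>\<^bsub>NP x y\<^esub> h" "t = ?i t \<oplus>\<^bsub>NP x y\<^esub> h'"
      using add.IH by blast
    have "s \<oplus>\<^bsub>NP x y\<^esub> t = (?i s \<oplus>\<^bsub>NP x y\<^esub> h) \<oplus>\<^bsub>NP x y\<^esub> (?i t \<oplus>\<^bsub>NP x y\<^esub> h')"
      using h(3,4) by argo
    also have "\<dots> = (?i s \<oplus>\<^bsub>NP x y\<^esub> ?i t) \<oplus>\<^bsub>NP x y\<^esub> (h \<oplus>\<^bsub>NP x y\<^esub> h')"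
      using linear_map_closed [OF i_lin add.hyps(1)] linear_map_closed [OF i_lin add.hyps(2)] G_in h(1,2)
      by (simp only: X.a_ac X.a_closed)
    also have "?i s \<oplus>\<^bsub>NP x y\<^esub> ?i t = ?i (s \<oplus>\<^bsub>NP x y\<^esub> t)"
      using linear_map_add [OF i_lin add.hyps] by simp
    finally show ?case using G_add [OF h(1,2)] by (rule bexI)
  qed
qed

text \<open>In \<open>C\<^sup>- \<otimes>\<^sub>C C\<^sup>+\<close> one has \<open>n \<otimes> p = 1 \<otimes> n p = \<epsilon>(n p) \<otimes> 1\<close>, so this half of the Morita condition always holds.\<close>

lemma neg_tens_pos_isomorphic: "bimod_isomorphic K A (neg_tens_pos A C) (regular_bimod A)"
  unfolding neg_tens_pos_def
proof (rule base.quotient_isomorphic [OF _ _ _ _ pairing_mor])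
  let ?G = "\<lambda>x y. generate (add_monoid (NP x y)) (neg_tens_pos_rels A C x y)"
  show "base.bim (tens A N P)" by simp
  fix x y assume x: "x \<in> Ob A" "y \<in> Ob A"
  have modX: "module K (NP x y)" using x by simp
  interpret X: module K "NP x y" by (rule modX)
  interpret Y: module K "Hom A x y" using x by simp
  note b_lin = base.mor_linear [OF pairing_mor x, unfolded base.tens_simps base.regular_simps]
  have sub: "neg_tens_pos_rels A C x y \<subseteq> carrier (NP x y)" by (rule neg_tens_pos_rels_subset [OF x])
  show "subgroup (?G x y) (add_monoid (bhom (tens A N P) x y))"
    using group.generate_is_subgroup [OF X.a_group, of "neg_tens_pos_rels A C x y"] sub by simp
  have G_in: "h \<in> carrier (NP x y)" if "h \<in> ?G x y" for h
    using group.generate_in_carrier [OF X.a_group _ that] sub by simp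
  show "lact (tens A N P) x y a h \<in> ?G x y" if "a \<in> carrier (Hom A y y)" "h \<in> ?G x y" for a h
    by (rule linear_map_generate [OF modX base.tens_lact_linear [OF bims(2,1) x that(1)] sub
          neg_tens_pos_rels_lact [OF x that(1)] that(2)])
  show "ract (tens A N P) x y h a \<in> ?G x y" if "a \<in> carrier (Hom A x x)" "h \<in> ?G x y" for a h
    by (rule linear_map_generate [OF modX base.tens_ract_linear [OF bims(2,1) x that(1)] sub
          neg_tens_pos_rels_ract [OF x that(1)] that(2)])
  have ker: "pairing A C x y h = \<zero>\<^bsub>Hom A x y\<^esub>" if "h \<in> ?G x y" for h
    using that
  proof (induction h rule: generate.induct)
    case one
    then show ?case using linear_map_zero [OF modX Y.module_axioms b_lin] by simp
  next
    case (incl r)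
    then obtain u v f g h where u: "u \<in> Ob A" "v \<in> Ob A" "f \<in> neg C v y" "g \<in> carrier (Hom C u v)" "h \<in> pos C x u"
      and r: "r = pure A N P x y u (rpart u y (Comp C u v y f g)) h \<ominus>\<^bsub>NP x y\<^esub> pure A N P x y v f (lpart x v (Comp C x u v g h))"
      by (rule neg_tens_pos_rels_cases)
    then show ?case
      using x linear_map_diff [OF modX Y.module_axioms b_lin] pairing_C_balanced [OF x u]
        linear_map_closed [OF b_lin, of "pure A N P x y v f (lpart x v (Comp C x u v g h))"]
      by (simp add: Y.minus_eq Y.r_neg)
  next
    case (inv r)
    then obtain u v f g h where u: "u \<in> Ob A" "v \<in> Ob A" "f \<in> neg C v y" "g \<in> carrier (Hom C u v)" "h \<in> pos C x u"
      and r: "r = pure A N P x y u (rpart u y (Comp C u v y f g)) h \<ominus>\<^bsub>NP x y\<^esub> pure A N P x y v f (lpart x v (Comp C x u v g h))"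
      by (rule neg_tens_pos_rels_cases)
    then have "pairing A C x y r = \<zero>\<^bsub>Hom A x y\<^esub>"
      using x linear_map_diff [OF modX Y.module_axioms b_lin] pairing_C_balanced [OF x u]
        linear_map_closed [OF b_lin, of "pure A N P x y v f (lpart x v (Comp C x u v g h))"]
      by (simp add: Y.minus_eq Y.r_neg)
    moreover have "\<ominus>\<^bsub>Hom A x y\<^esub> \<zero>\<^bsub>Hom A x y\<^esub> = \<zero>\<^bsub>Hom A x y\<^esub>"
      by (rule Y.minus_equality) simp_all
    moreover have "r \<in> carrier (NP x y)" using inv sub by blast
    ultimately show ?case
      using linear_map_minus [OF modX Y.module_axioms b_lin, of r] by (simp add: a_inv_def)
  next
    case (eng h h')
    then show ?case using linear_map_add [OF b_lin G_in G_in, of h h'] by simp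
  qed
  show "pairing A C x y t = \<zero>\<^bsub>bhom U x y\<^esub> \<longleftrightarrow> t \<in> ?G x y" if t: "t \<in> carrier (bhom (tens A N P) x y)" for t
  proof
    assume 0: "pairing A C x y t = \<zero>\<^bsub>bhom U x y\<^esub>"
    obtain h where h: "h \<in> ?G x y" and
      eq: "t = (if x = y then pure A N P x y x (incl C x x (pairing A C x y t)) (idn C x) else \<zero>\<^bsub>NP x y\<^esub>) \<oplus>\<^bsub>NP x y\<^esub> h"
      using pairing_mod_rels [OF x, of t] t by auto
    have "(if x = y then pure A N P x y x (incl C x x (pairing A C x y t)) (idn C x) else \<zero>\<^bsub>NP x y\<^esub>) = \<zero>\<^bsub>NP x y\<^esub>"
      using 0 x linear_map_zero [OF _ _ incl_linear [OF x(1)]] base.pure_zero_left [of N P x x x "idn C x"] by auto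
    then have "t = h" using eq G_in [OF h] by simp
    then show "t \<in> ?G x y" using h by simp
  qed (use ker in auto)
  show "a \<in> pairing A C x y ` carrier (bhom (tens A N P) x y)" if a: "a \<in> carrier (bhom U x y)" for a
  proof (cases "x = y")
    case True
    then have "pairing A C x y (pure A N P x y x (incl C x x a) (idn C x)) = a"
      using x a by (simp add: pairing_pure counit_diag)
    then show ?thesis using True x a by (intro image_eqI [where x = "pure A N P x y x (incl C x x a) (idn C x)"]) auto
  next
    case False
    then have "a = \<zero>\<^bsub>Hom A x y\<^esub>" using base.Hom_zero [OF x] a by simp
    then show ?thesis
      using linear_map_zero [OF modX Y.module_axioms b_lin] by (intro image_eqI [where x = "\<zero>\<^bsub>NP x y\<^esub>"]) auto
  qed
qed

lemma perfect_iff_morita: "perfect K A C \<longleftrightarrow> gives_morita_equivalence K A C"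
  using perfect_imp_isomorphic isomorphic_imp_perfect neg_tens_pos_isomorphic
  by (auto simp: gives_morita_equivalence_def)

end

section \<open>Isomorphisms of linear categories\<close>

text \<open>Inverses of bijective linear maps that respect composition and identities respect them
  too, so on identical objects no further data has to be found.\<close>

lemma linear_category_iso_iff:
  assumes F: "linear_functor K C D (\<lambda>x. x) F" and Ob: "Ob D = Ob C"
  shows "linear_category_iso K C D (\<lambda>x. x) F \<longleftrightarrow>
    (\<forall>x\<in>Ob C. \<forall>y\<in>Ob C. bij_betw (F x y) (carrier (Hom C x y)) (carrier (Hom D x y)))"
    (is "_ \<longleftrightarrow> ?bij")
proof
  interpret F: linear_functor K C D "\<lambda>x. x" F by (rule F)
  assume "linear_category_iso K C D (\<lambda>x. x) F"
  then obtain Go Gm where G: "linear_functor K D C Go Gm" and Go: "\<forall>x\<in>Ob D. Go x = x"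
    and GF: "\<forall>x\<in>Ob C. \<forall>y\<in>Ob C. \<forall>f\<in>carrier (Hom C x y). Gm x y (F x y f) = f"
    and FG: "\<forall>x\<in>Ob D. \<forall>y\<in>Ob D. \<forall>f\<in>carrier (Hom D x y). F (Go x) (Go y) (Gm x y f) = f"
    unfolding linear_category_iso_def by blast
  interpret G: linear_functor K D C Go Gm by (rule G)
  show ?bij
  proof (intro ballI)
    fix x y assume x: "x \<in> Ob C" "y \<in> Ob C"
    show "bij_betw (F x y) (carrier (Hom C x y)) (carrier (Hom D x y))"
    proof (rule bij_betwI [where g = "Gm x y"])
      show "F x y \<in> carrier (Hom C x y) \<rightarrow> carrier (Hom D x y)"
        using F.Fm_linear [OF x] by (simp add: linear_map_def)
      show "Gm x y \<in> carrier (Hom D x y) \<rightarrow> carrier (Hom C x y)"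
        using G.Fm_linear [of x y] x Go Ob by (simp add: linear_map_def)
    qed (use x GF FG Go Ob in auto)
  qed
next
  interpret F: linear_functor K C D "\<lambda>x. x" F by (rule F)
  assume bij: ?bij
  define G where "G x y = the_inv_into (carrier (Hom C x y)) (F x y)" for x y
  have G_in: "G x y f \<in> carrier (Hom C x y)" and FG: "F x y (G x y f) = f"
    if "x \<in> Ob C" "y \<in> Ob C" "f \<in> carrier (Hom D x y)" for x y f
    using bij that f_the_inv_into_f [of "F x y" "carrier (Hom C x y)" f]
      the_inv_into_into [of "F x y" "carrier (Hom C x y)" f "carrier (Hom C x y)"]
    by (auto simp: bij_betw_def G_def)
  have GF: "G x y (F x y f) = f" if "x \<in> Ob C" "y \<in> Ob C" "f \<in> carrier (Hom C x y)" for x y f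
    using bij that the_inv_into_f_f [of "F x y" "carrier (Hom C x y)" f] by (auto simp: bij_betw_def G_def)
  have "linear_functor K D C (\<lambda>x. x) G"
  proof (intro linear_functor.intro linear_functor_axioms.intro)
    fix x y assume x: "x \<in> Ob D" "y \<in> Ob D"
    show "linear_map K (Hom D x y) (Hom C x y) (G x y)"
      unfolding G_def using x Ob bij F.Fm_linear F.source.Hom_module by (intro linear_map_inv_into) auto
    fix z f g assume z: "z \<in> Ob D" and f: "f \<in> carrier (Hom D x y)" and g: "g \<in> carrier (Hom D y z)"
    have gf: "Comp C x y z (G y z g) (G x y f) \<in> carrier (Hom C x z)"
      using linear_map_closed [OF F.source.Comp_linear_right, of x y z "G y z g" "G x y f"] x z f g G_in Ob by simp
    have "F x z (Comp C x y z (G y z g) (G x y f)) = Comp D x y z g f"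
      using F.Fm_Comp [of x y z "G x y f" "G y z g"] x z f g G_in FG Ob by simp
    then show "G x z (Comp D x y z g f) = Comp C x y z (G y z g) (G x y f)"
      using GF [of x z "Comp C x y z (G y z g) (G x y f)"] gf x z Ob by simp
  next
    fix x assume "x \<in> Ob D"
    then show "G x x (idn D x) = idn C x"
      using GF [of x x "idn C x"] F.Fm_idn [of x] F.source.idn_closed [of x] Ob by simp
  qed (use Ob F.source.linear_category_axioms F.target.linear_category_axioms in auto)
  then show "linear_category_iso K C D (\<lambda>x. x) F"
    unfolding linear_category_iso_def using F GF FG Ob
    by (intro conjI exI [of _ "\<lambda>x. x"] exI [of _ G]) auto
qed

section \<open>The category of a perfect pairing\<close>

context stratified_category
begin

text \<open>With the first factor reduced to p \<otimes> n, the outer associator sets p aside and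
  the remaining maps are those of \<open>contraction_left\<close> on n \<otimes> t.\<close>

lemma sandwich_pure:
  assumes \<beta>: "base.mor (tens A N P) U \<beta>" and x: "x \<in> Ob A" "y \<in> Ob A" "z \<in> Ob A"
    and s: "s \<in> carrier (T y z)" and t: "t \<in> carrier (T x y)"
  shows "sandwich A C \<beta> x z (pure A (tens A P N) (tens A P N) x z y s t) = sandw \<beta> x y z s t"
proof -
  note id = base.mor_id [OF bims(1)]
  have b2: "base.mor (tens A (tens A N P) N) (tens A U N) (tens_map A (tens A N P) N U N \<beta> bimod_id)"
    by (rule base.tens_map_mor [OF \<beta> base.mor_id]) simp
  have "base.mor (tens A (tens A P N) (tens A P N)) (tens A P N) (sandwich A C \<beta>)"
    unfolding sandwich_def Let_def
    by (rule base.mor_comp [OF base.mor_comp [OF base.mor_comp [OF base.assoc_mor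
            base.tens_map_mor [OF id base.assoc_inv_mor]] base.tens_map_mor [OF id b2]]
          base.tens_map_mor [OF id base.lunit_mor]]) simp_all
  then have lin: "linear_map K (tensor_hom A (tens A P N) (tens A P N) x z) (T x z) (sandwich A C \<beta> x z)"
    using base.mor_linear [of _ _ "sandwich A C \<beta>" x z] x by fastforce
  show ?thesis
  proof (rule T_ext [OF x(2,3) linear_map_compose [OF base.pure_linear_left lin] sandw_linear [OF \<beta> x t] _ s])
    fix w p n assume w: "w \<in> Ob A" "p \<in> pos C w z" "n \<in> neg C y w"
    \<comment> \<open>The intermediate values are named for their membership facts, without which
      the rules for \<open>tens_map\<close> on pure tensors do not apply.\<close>
    let ?s1 = "pure A N (tens A P N) x w y n t"
    have s1: "?s1 \<in> carrier (tensor_hom A N (tens A P N) x w)" using x w t by simp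
    let ?s2 = "assoc_inv A N P N x w ?s1"
    have s2: "?s2 \<in> carrier (tensor_hom A (tens A N P) N x w)"
      using base.mor_in [OF base.assoc_inv_mor [OF bims(2,1,2)], of x w ?s1] x w s1 by simp
    let ?s3 = "tens_map A (tens A N P) N U N \<beta> bimod_id x w ?s2"
    have s3: "?s3 \<in> carrier (tensor_hom A U N x w)"
      using base.mor_in [OF b2, of x w ?s2] x w s2 by simp
    have "assoc A P N (tens A P N) x z (pure A (tens A P N) (tens A P N) x z y (pure A P N y z w p n) t)
      = pure A P (tens A N (tens A P N)) x z w p ?s1"
      using x w t by (simp add: base.assoc_pure)
    then show "sandwich A C \<beta> x z (pure A (tens A P N) (tens A P N) x z y (pure A P N y z w p n) t)
      = sandw \<beta> x y z (pure A P N y z w p n) t"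
      using x w t s1 s2 s3 contraction_left [OF \<beta> x(1,2) w(1,3) t]
      by (simp add: sandwich_def Let_def bimod_comp_def base.tens_map_pure_id(2) [OF _ _ _ _ _ bims(1) base.assoc_inv_mor]
          base.tens_map_pure_id(2) [OF _ _ _ _ _ bims(1) b2] base.tens_map_pure_id(2) [OF _ _ _ _ _ bims(1) base.lunit_mor]
          sandw_pure [OF \<beta>])
  qed (use x t in \<open>auto simp: linear_map_ident\<close>)
qed

lemma pairing_category_simps [simp]:
  "Ob (pairing_category A C \<beta> \<gamma>) = Ob A"
  "Hom (pairing_category A C \<beta> \<gamma>) = T"
  "idn (pairing_category A C \<beta> \<gamma>) x = \<gamma> x x (idn A x)"
  by (simp_all add: pairing_category_def Let_def)

lemma pairing_category_Comp:
  assumes "base.mor (tens A N P) U \<beta>" "x \<in> Ob A" "y \<in> Ob A" "z \<in> Ob A" "s \<in> carrier (T y z)" "t \<in> carrier (T x y)"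
  shows "Comp (pairing_category A C \<beta> \<gamma>) x y z s t = sandw \<beta> x y z s t"
  using sandwich_pure [OF assms] by (simp add: pairing_category_def Let_def)

lemma pairing_linear_category:
  assumes \<beta>: "base.mor (tens A N P) U \<beta>" and \<gamma>: "copairing_at \<beta> (\<lambda>x. \<gamma> x x (idn A x))"
  shows "linear_category K (pairing_category A C \<beta> \<gamma>)"
proof (rule linear_category.intro)
  let ?D = "pairing_category A C \<beta> \<gamma>"
  note Comp = pairing_category_Comp [OF \<beta>]
  have \<gamma>_in: "\<gamma> x x (idn A x) \<in> carrier (T x x)" if "x \<in> Ob A" for x
    using \<gamma> that by (auto simp: copairing_at_def)
  note S = sandw_in [OF \<beta>]
  show "linear_map K (Hom ?D x y) (Hom ?D x z) (\<lambda>f. Comp ?D x y z g f)"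
    if "x \<in> Ob ?D" "y \<in> Ob ?D" "z \<in> Ob ?D" "g \<in> carrier (Hom ?D y z)" for x y z g
    using that sandw_linear_param [OF \<beta>, of x y z g] by (subst linear_map_cong [where g = "sandw \<beta> x y z g"]) (auto simp: Comp)
  show "linear_map K (Hom ?D y z) (Hom ?D x z) (\<lambda>g. Comp ?D x y z g f)"
    if "x \<in> Ob ?D" "y \<in> Ob ?D" "z \<in> Ob ?D" "f \<in> carrier (Hom ?D x y)" for x y z f
    using that sandw_linear [OF \<beta>, of x y z f]
    by (subst linear_map_cong [where g = "\<lambda>g. sandw \<beta> x y z g f"]) (auto simp: Comp)
  show "Comp ?D w x z (Comp ?D x y z h g) f = Comp ?D w y z h (Comp ?D w x y g f)"
    if "w \<in> Ob ?D" "x \<in> Ob ?D" "y \<in> Ob ?D" "z \<in> Ob ?D" "f \<in> carrier (Hom ?D w x)"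
      "g \<in> carrier (Hom ?D x y)" "h \<in> carrier (Hom ?D y z)" for w x y z f g h
    using that sandw_assoc [OF \<beta> \<beta>, of w x y z h g f] by (simp add: Comp S)
  show "Comp ?D x y y (idn ?D y) f = f" "Comp ?D x x y f (idn ?D x) = f"
    if "x \<in> Ob ?D" "y \<in> Ob ?D" "f \<in> carrier (Hom ?D x y)" for x y f
    using that sandw_copairing [OF \<beta> \<gamma>, of x y f] by (simp_all add: Comp \<gamma>_in)
qed (use base.K_cring \<gamma> in \<open>auto simp: copairing_at_def\<close>)

subsection \<open>The functor \<open>L\<close>\<close>

lemma neg_add:
  "x \<in> Ob A \<Longrightarrow> y \<in> Ob A \<Longrightarrow> n \<in> neg C x y \<Longrightarrow> n' \<in> neg C x y \<Longrightarrow> n \<oplus>\<^bsub>Hom C x y\<^esub> n' \<in> neg C x y"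
  using subgroup.m_closed [OF submodule.axioms(1) [OF neg_wide]] by simp

text \<open>The general result lands in all of C; closure of \<open>neg\<close> under composition
  and addition restricts the target.\<close>

lemma mu_mor: "base.mor (tens A N N) N (comp_map A C (neg C) (neg C))"
proof -
  have m: "base.mor (tens A N N) homb (comp_map A C (neg C) (neg C))"
    by (rule comp_map_mor) auto
  have lin: "linear_map K (tensor_hom A N N x y) (Hom C x y) (comp_map A C (neg C) (neg C) x y)"
    if "x \<in> Ob A" "y \<in> Ob A" for x y
    using that by (intro comp_map_linear) auto
  have mem: "comp_map A C (neg C) (neg C) x y t \<in> neg C x y"
    if x: "x \<in> Ob A" "y \<in> Ob A" and t: "t \<in> carrier (tensor_hom A N N x y)" for x y t
    using t bims(2,2) x
  proof (induction t rule: base.tensor_hom_induct)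
    case (pure z m n)
    then show ?case using x by (simp add: comp_map_pure)
  next
    case (add s t)
    then show ?case using linear_map_add [OF lin [OF x]] neg_add [OF x] by simp
  qed
  show ?thesis
  proof (rule base.morI)
    fix x y assume x: "x \<in> Ob A" "y \<in> Ob A"
    show "linear_map K (bhom (tens A N N) x y) (bhom N x y) (comp_map A C (neg C) (neg C) x y)"
      by (rule bhom_target) (use x lin mem in auto)
    fix t a assume t: "t \<in> carrier (bhom (tens A N N) x y)"
    show "comp_map A C (neg C) (neg C) x y (lact (tens A N N) x y a t) = lact N x y a (comp_map A C (neg C) (neg C) x y t)"
      if "a \<in> carrier (Hom A y y)"
      using base.mor_lact [OF m x t that] by (simp add: subcat_simps)
    show "comp_map A C (neg C) (neg C) x y (ract (tens A N N) x y t a) = ract N x y (comp_map A C (neg C) (neg C) x y t) a"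
      if "a \<in> carrier (Hom A x x)"
      using base.mor_ract [OF m x t that] by (simp add: subcat_simps)
  qed auto
qed

abbreviation (input) "mu \<equiv> comp_map A C (neg C) (neg C)"

text \<open>The counit on the positive factor of q, followed by the product of the negative factors,
  is the right projection of the product of q, multiplied by n.\<close>

lemma L_inner:
  assumes x: "x \<in> Ob A" "z \<in> Ob A" "w \<in> Ob A" and n: "n \<in> neg C x z" and q: "q \<in> carrier (T z w)"
  shows "lunit A N x w (tens_map A P (tens A N N) U N (counit A C) mu x w
      (assoc A P N N x w (pure A (tens A P N) N x w z q n))) = Comp C x z w (rpart z w (mlt z w q)) n"
    (is "?f q = _")
proof (rule T_ext [OF x(2,3) _ _ _ q])
  show "linear_map K (T z w) (Hom C x w) ?f"
    by (rule bhom_N_target [OF _ _ linear_map_compose [OF linear_map_compose [OF linear_map_compose [OF base.pure_linear_left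
            base.assoc_linear] base.tens_map_linear [OF counit_P mu_mor]] base.lunit_linear]])
       (use x n in \<open>auto intro!: linear_map_ident\<close>)
  show "linear_map K (T z w) (Hom C x w) (\<lambda>q. Comp C x z w (rpart z w (mlt z w q)) n)"
    by (rule Comp_lin_left [OF _ _ _ _ bhom_N_target [OF _ _ rpart_mlt_lin]]) (use x n in auto)
  fix v p n' assume v: "v \<in> Ob A" "p \<in> pos C v w" "n' \<in> neg C z v"
  have "?f (pure A P N z w v p n') = (if v = w then lact N x w (counit A C w w p) (Comp C x z w n' n) else \<zero>\<^bsub>Hom C x w\<^esub>)"
    using x n v
    by (simp add: base.assoc_pure base.tens_map_pure [OF counit_P mu_mor] comp_map_pure base.lunit_pure counit_in)
  also have "\<dots> = Comp C x z w (rpart z w (mlt z w (pure A P N z w v p n'))) n"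
  proof (cases "v = w")
    case True
    then show ?thesis using x n v by (simp add: lact_N counit_diag C_assoc)
  next
    case False
    then show ?thesis using x n v by (simp add: rpart_Comp)
  qed
  finally show "?f (pure A P N z w v p n') = Comp C x z w (rpart z w (mlt z w (pure A P N z w v p n'))) n" .
qed

text \<open>The twist decomposes the product n p, so \<open>L_inner\<close> yields the right
  projection of n p times n'. The factor n' can then be taken inside the projection.\<close>

lemma L_middle:
  assumes x: "x \<in> Ob A" "y \<in> Ob A" "w \<in> Ob A" and n: "n \<in> neg C y w" and t: "t \<in> carrier (T x y)"
  shows "lunit A N x w (tens_map A P (tens A N N) U N (counit A C) mu x w
      (assoc A P N N x w (tens_map A (tens A N P) N (tens A P N) N (twist A C) bimod_id x w
        (assoc_inv A N P N x w (pure A N (tens A P N) x w y n t))))) = rpart x w (Comp C x y w n (mlt x y t))"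
    (is "?f t = _")
proof (rule T_ext [OF x(1,2) _ _ _ t])
  show "linear_map K (T x y) (bhom N x w) ?f"
    by (rule linear_map_compose [OF linear_map_compose [OF linear_map_compose [OF linear_map_compose [OF linear_map_compose
         [OF base.pure_linear_right base.assoc_inv_linear] base.tens_map_linear [OF twist_mor base.mor_id]]
         base.assoc_linear] base.tens_map_linear [OF counit_P mu_mor]] base.lunit_linear])
       (use x n in \<open>auto intro!: linear_map_ident\<close>)
  show "linear_map K (T x y) (bhom N x w) (\<lambda>t. rpart x w (Comp C x y w n (mlt x y t)))"
    by (rule rpart_lin [OF _ _ Comp_lin_right [OF _ _ _ _ mlt_linear]]) (use x n in auto)
  fix z p n' assume z: "z \<in> Ob A" "p \<in> pos C z y" "n' \<in> neg C x z"
  let ?q = "decomp A C z w (Comp C z y w n p)"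
  have "?f (pure A P N x y z p n') = lunit A N x w (tens_map A P (tens A N N) U N (counit A C) mu x w
      (assoc A P N N x w (pure A (tens A P N) N x w z ?q n')))"
    using x n z by (simp add: base.assoc_inv_pure base.tens_map_pure_id(1) [OF _ _ _ _ _ twist_mor] twist_pure)
  also have "\<dots> = Comp C x z w (rpart z w (Comp C z y w n p)) n'"
    using L_inner [OF x(1) z(1) x(3) z(3), of ?q] x n z by simp
  also have "\<dots> = rpart x w (Comp C x y w n (mlt x y (pure A P N x y z p n')))"
    using x n z by (simp add: rpart_Comp_neg flip: C_assoc)
  finally show "?f (pure A P N x y z p n') = rpart x w (Comp C x y w n (mlt x y (pure A P N x y z p n')))" .
qed

text \<open>The part \<open>G\<close> that follows the insertion of the copairing sends s \<otimes>
  t to s acted on from the right by the product of t. Here s is \<gamma>(1) and t decomposes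
  h.\<close>

lemma L_map_eq:
  assumes \<gamma>: "base.mor U (tens A P N) \<gamma>" and x: "x \<in> Ob A" "y \<in> Ob A" and h: "h \<in> carrier (Hom C x y)"
  shows "L_map A C \<gamma> x y h = tract x y y (\<gamma> y y (idn A y)) h"
proof -
  let ?PN = "tens A P N"
  note id = base.mor_id [OF bims(1)]
  have twm: "base.mor (tens A (tens A N P) N) (tens A (tens A P N) N) (tens_map A (tens A N P) N (tens A P N) N (twist A C) bimod_id)"
    by (rule base.tens_map_mor [OF twist_mor base.mor_id]) simp
  have cm: "base.mor (tens A P (tens A N N)) (tens A U N) (tens_map A P (tens A N N) U N (counit A C) mu)"
    by (rule base.tens_map_mor [OF counit_P mu_mor])
  define G where "G = tens_map A P (tens A U N) P N bimod_id (lunit A N)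
      \<bullet> tens_map A P (tens A P (tens A N N)) P (tens A U N) bimod_id
          (tens_map A P (tens A N N) U N (counit A C) mu)
      \<bullet> tens_map A P (tens A (tens A P N) N) P (tens A P (tens A N N)) bimod_id (assoc A P N N)
      \<bullet> tens_map A P (tens A (tens A N P) N) P (tens A (tens A P N) N) bimod_id
          (tens_map A (tens A N P) N (tens A P N) N (twist A C) bimod_id)
      \<bullet> tens_map A P (tens A N (tens A P N)) P (tens A (tens A N P) N) bimod_id (assoc_inv A N P N)
      \<bullet> assoc A P N (tens A P N)"
  have "base.mor (tens A ?PN ?PN) ?PN G"
    unfolding G_def
    by (rule base.mor_comp [OF base.mor_comp [OF base.mor_comp [OF base.mor_comp [OF base.mor_comp [OF base.assoc_mor
            base.tens_map_mor [OF id base.assoc_inv_mor]] base.tens_map_mor [OF id twm]]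
            base.tens_map_mor [OF id base.assoc_mor]] base.tens_map_mor [OF id cm]]
          base.tens_map_mor [OF id base.lunit_mor]]) simp_all
  then have G_lin: "linear_map K (tensor_hom A ?PN ?PN x y) (T x y) (G x y)"
    using base.mor_linear [of _ _ G x y] x by fastforce
  have G_pure: "G x y (pure A ?PN ?PN x y y s t) = tract x y y s (mlt x y t)"
    if s: "s \<in> carrier (T y y)" and t: "t \<in> carrier (T x y)" for s t
  proof (rule T_ext [OF x(2,2) linear_map_compose [OF base.pure_linear_left G_lin] tract_linear [OF x(1,2,2)] _ s])
    fix w p n assume w: "w \<in> Ob A" "p \<in> pos C w y" "n \<in> neg C y w"
    let ?s1 = "pure A N ?PN x w y n t"
    have s1: "?s1 \<in> carrier (tensor_hom A N ?PN x w)" using x w t by simp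
    let ?s2 = "assoc_inv A N P N x w ?s1"
    have s2: "?s2 \<in> carrier (tensor_hom A (tens A N P) N x w)"
      using base.mor_in [OF base.assoc_inv_mor [OF bims(2,1,2)], of x w ?s1] x w s1 by simp
    let ?s3 = "tens_map A (tens A N P) N (tens A P N) N (twist A C) bimod_id x w ?s2"
    have s3: "?s3 \<in> carrier (tensor_hom A (tens A P N) N x w)"
      using base.mor_in [OF twm, of x w ?s2] x w s2 by simp
    let ?s4 = "assoc A P N N x w ?s3"
    have s4: "?s4 \<in> carrier (tensor_hom A P (tens A N N) x w)"
      using base.mor_in [OF base.assoc_mor [OF bims(1,2,2)], of x w ?s3] x w s3 by simp
    let ?s5 = "tens_map A P (tens A N N) U N (counit A C) mu x w ?s4"
    have s5: "?s5 \<in> carrier (tensor_hom A U N x w)"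
      using base.mor_in [OF cm, of x w ?s4] x w s4 by simp
    have "assoc A P N ?PN x y (pure A ?PN ?PN x y y (pure A P N y y w p n) t) = pure A P (tens A N ?PN) x y w p ?s1"
      using x w t by (simp add: base.assoc_pure)
    then have "G x y (pure A ?PN ?PN x y y (pure A P N y y w p n) t) = pure A P N x y w p (lunit A N x w ?s5)"
      using x w s1 s2 s3 s4 s5
      by (simp add: G_def bimod_comp_def base.tens_map_pure_id(2) [OF _ _ _ _ _ bims(1) base.assoc_inv_mor]
          base.tens_map_pure_id(2) [OF _ _ _ _ _ bims(1) twm] base.tens_map_pure_id(2) [OF _ _ _ _ _ bims(1) base.assoc_mor]
          base.tens_map_pure_id(2) [OF _ _ _ _ _ bims(1) cm] base.tens_map_pure_id(2) [OF _ _ _ _ _ bims(1) base.lunit_mor])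
    also have "\<dots> = tract x y y (pure A P N y y w p n) (mlt x y t)"
      using x w t L_middle [OF x w(1,3) t] by simp
    finally show "G x y (pure A ?PN ?PN x y y (pure A P N y y w p n) t) = tract x y y (pure A P N y y w p n) (mlt x y t)" .
  qed (use x t in \<open>auto simp: linear_map_ident\<close>)
  have "L_map A C \<gamma> x y h = G x y (tens_map A U ?PN ?PN ?PN \<gamma> bimod_id x y (pure A U ?PN x y y (idn A y) (decomp A C x y h)))"
    by (simp add: L_map_def Let_def G_def bimod_comp_def lunit_inv_def)
  also have "\<dots> = G x y (pure A ?PN ?PN x y y (\<gamma> y y (idn A y)) (decomp A C x y h))"
    using x h by (simp add: base.tens_map_pure_id(1) [OF _ _ _ _ _ \<gamma>])
  also have "\<dots> = tract x y y (\<gamma> y y (idn A y)) h"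
    using x h base.mor_in [OF \<gamma>, of y y "idn A y"] by (simp add: G_pure)
  finally show ?thesis .
qed

lemma incl_mor: "base.mor U P (incl C)"
proof -
  have lin: "linear_map K (Hom A x y) (Hom C x y) (incl C x y)" if "x \<in> Ob A" "y \<in> Ob A" for x y
    using linear_functor.Fm_linear [OF incl_functor that] .
  have mem: "incl C x y a \<in> pos C x y" if x: "x \<in> Ob A" "y \<in> Ob A" and a: "a \<in> carrier (Hom A x y)" for x y a
  proof (cases "x = y")
    case False
    then have "a = \<zero>\<^bsub>Hom A x y\<^esub>" using base.Hom_zero [OF x] a by simp
    then show ?thesis using linear_map_zero [OF _ _ lin [OF x]] x by simp
  qed (use x a in simp)
  show ?thesis
  proof (rule base.morI)
    fix x y assume x: "x \<in> Ob A" "y \<in> Ob A"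
    show "linear_map K (bhom U x y) (bhom P x y) (incl C x y)"
      by (rule bhom_target) (use x lin mem in auto)
    fix m a assume m: "m \<in> carrier (bhom U x y)"
    show "incl C x y (lact U x y a m) = lact P x y a (incl C x y m)" if "a \<in> carrier (Hom A y y)"
      using linear_functor.Fm_Comp [OF incl_functor x x(2), of m a] m that by (simp add: lact_P)
    show "incl C x y (ract U x y m a) = ract P x y (incl C x y m) a" if "a \<in> carrier (Hom A x x)"
      using linear_functor.Fm_Comp [OF incl_functor x(1,1,2), of a m] m that by (simp add: ract_P)
  qed auto
qed

end

section \<open>Quasi-cellular categories\<close>

context quasi_cellular_category
begin

abbreviation "dd x \<equiv> d x x (idn A x)"

lemma d_mor: "base.mor U (tens A P N) d"
  using d_copairing by (simp add: is_copairing_iff [OF b_morphism])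

lemma d_at: "copairing_at b dd"
  by (rule is_copairing_at [OF b_morphism d_copairing])

lemma dd_in [simp]: "x \<in> Ob A \<Longrightarrow> dd x \<in> carrier (T x x)"
  using d_at by (auto simp: copairing_at_def)

lemma L_eq: "x \<in> Ob A \<Longrightarrow> y \<in> Ob A \<Longrightarrow> h \<in> carrier (Hom C x y) \<Longrightarrow> L_map A C d x y h = tract x y y (dd y) h"
  by (rule L_map_eq [OF d_mor])

lemma L_in [simp]: "x \<in> Ob A \<Longrightarrow> y \<in> Ob A \<Longrightarrow> h \<in> carrier (Hom C x y) \<Longrightarrow> L_map A C d x y h \<in> carrier (T x y)"
  by (simp add: L_eq)

text \<open>The right action of f leaves the sandwich product, and d is a right unit for it: (d g)(d
  f) = ((d g) d) f = (d g) f = d (g f).\<close>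

lemma L_Comp:
  assumes x: "x \<in> Ob A" "y \<in> Ob A" "z \<in> Ob A" and f: "f \<in> carrier (Hom C x y)" and g: "g \<in> carrier (Hom C y z)"
  shows "L_map A C d x z (Comp C x y z g f) = sandw b x y z (L_map A C d y z g) (L_map A C d x y f)"
proof -
  have "sandw b x y z (tract y z z (dd z) g) (tract x y y (dd y) f)
      = tract x y z (sandw b y y z (tract y z z (dd z) g) (dd y)) f"
    using x f g by (simp add: sandw_tract [OF b_morphism])
  also have "\<dots> = tract x y z (tract y z z (dd z) g) f"
    using x g by (simp add: sandw_copairing(2) [OF b_morphism d_at])
  finally show ?thesis
    using x f g by (simp add: L_eq tract_Comp)
qed

lemma L_functor: "linear_functor K C (pairing_category A C b d) (\<lambda>x. x) (L_map A C d)"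
proof (intro linear_functor.intro linear_functor_axioms.intro)
  show "linear_category K C" by (rule linear_category_axioms)
  show "linear_category K (pairing_category A C b d)" by (rule pairing_linear_category [where \<gamma> = d, OF b_morphism d_at])
  fix x y assume x: "x \<in> Ob C" "y \<in> Ob C"
  show "linear_map K (Hom C x y) (Hom (pairing_category A C b d) x y) (L_map A C d x y)"
    using x tract_linear_param [of x y y "dd y"]
    by (subst linear_map_cong [where g = "tract x y y (dd y)"]) (auto simp: L_eq)
  fix z f g assume "z \<in> Ob C" "f \<in> carrier (Hom C x y)" "g \<in> carrier (Hom C y z)"
  then show "L_map A C d x z (Comp C x y z g f)
      = Comp (pairing_category A C b d) x y z (L_map A C d y z g) (L_map A C d x y f)"
    using x by (simp add: L_Comp pairing_category_Comp [OF b_morphism])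
next
  fix x assume "x \<in> Ob C"
  then show "L_map A C d x x (idn C x) = idn (pairing_category A C b d) x"
    by (simp add: L_eq tract_idn)
qed simp

lemma L_is_isomorphism_iff:
  "L_is_isomorphism K A C b d \<longleftrightarrow>
    (\<forall>x\<in>Ob A. \<forall>y\<in>Ob A. bij_betw (L_map A C d x y) (carrier (Hom C x y)) (carrier (T x y)))"
  unfolding L_is_isomorphism_def by (subst linear_category_iso_iff [OF L_functor]) auto

text \<open>Two perfect pairings differ by the mutually inverse maps \<open>(id \<otimes> \<beta> \<otimes> id)(d \<otimes> -)\<close> and
  \<open>(id \<otimes> b \<otimes> id)(\<gamma> \<otimes> -)\<close>, and these relate \<open>L c = d c\<close> to the isomorphism \<open>c \<mapsto> \<gamma> c\<close>.\<close>

lemma perfect_imp_L: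
  assumes "perfect K A C"
  shows "L_is_isomorphism K A C b d"
  unfolding L_is_isomorphism_iff
proof (intro ballI)
  fix x y assume x: "x \<in> Ob A" "y \<in> Ob A"
  let ?\<beta> = "pairing A C"
  obtain \<gamma> where \<gamma>: "is_copairing K A C ?\<beta> \<gamma>"
    using assms by (auto simp: perfect_def perfect_pairing_def)
  define g where "g x = \<gamma> x x (idn A x)" for x
  have g: "copairing_at ?\<beta> g"
    unfolding g_def by (rule is_copairing_at [OF pairing_mor \<gamma>])
  have g_in: "g x \<in> carrier (T x x)" if "x \<in> Ob A" for x
    using g that by (auto simp: copairing_at_def)
  let ?S = "sandw ?\<beta> x y y (dd y)" and ?R = "sandw b x y y (g y)"
  have SR: "?S (?R t) = t" if t: "t \<in> carrier (T x y)" for t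
  proof -
    \<comment> \<open>Associativity with mixed pairings brings \<open>g y\<close> next to
      \<open>dd y\<close>, where it is a right unit for the pairing of C; what remains is the left
      unit \<open>dd y\<close> for \<open>b\<close>.\<close>
    have "?S (?R t) = sandw b x y y (sandw ?\<beta> y y y (dd y) (g y)) t"
      using sandw_assoc [OF b_morphism pairing_mor x(1,2,2,2) dd_in [OF x(2)] g_in [OF x(2)] t] by simp
    then show ?thesis
      using x t by (simp add: sandw_copairing(2) [OF pairing_mor g] sandw_copairing(1) [OF b_morphism d_at])
  qed
  have RS: "?R (?S t) = t" if t: "t \<in> carrier (T x y)" for t
  proof -
    have "?R (?S t) = sandw ?\<beta> x y y (sandw b y y y (g y) (dd y)) t"
      using sandw_assoc [OF pairing_mor b_morphism x(1,2,2,2) g_in [OF x(2)] dd_in [OF x(2)] t] by simp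
    then show ?thesis
      using x t g_in by (simp add: sandw_copairing(2) [OF b_morphism d_at] sandw_copairing(1) [OF pairing_mor g])
  qed
  have S: "bij_betw ?S (carrier (T x y)) (carrier (T x y))"
    by (rule bij_betwI [where g = ?R])
       (use x g_in SR RS sandw_in [OF pairing_mor] sandw_in [OF b_morphism] in auto)
  have act: "bij_betw (\<lambda>c. tlact x x y c (g x)) (carrier (Hom C x y)) (carrier (T x y))"
    by (rule act_bij [OF g_in copairing_top [OF g] copairing_central [OF g] x])
  \<comment> \<open>Centrality moves c to the right of g, where its action commutes with the
    sandwich by \<open>dd y\<close>; g then disappears as a right unit.\<close>
  have "L_map A C d x y c = ?S (tlact x x y c (g x))" if c: "c \<in> carrier (Hom C x y)" for c
  proof -
    have "?S (tlact x x y c (g x)) = tract x y y (sandw ?\<beta> y y y (dd y) (g y)) c"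
      using copairing_central [OF g x c] sandw_tract [OF pairing_mor x(1,2,2,2) dd_in [OF x(2)] g_in [OF x(2)] c] by simp
    then show ?thesis
      using x c by (simp add: sandw_copairing(2) [OF pairing_mor g] L_eq)
  qed
  then show "bij_betw (L_map A C d x y) (carrier (Hom C x y)) (carrier (T x y))"
    using bij_betw_trans [OF act S] by (subst bij_betw_cong [of _ _ "?S \<circ> (\<lambda>c. tlact x x y c (g x))"]) auto
qed

lemma b_idn:
  assumes x: "x \<in> Ob A" "y \<in> Ob A" and n: "n \<in> neg C x y"
  shows "b x y (pure A N P x y x n (idn C x)) = counit A C x y n"
  using b_unit_right x n
  by (simp add: bimod_eq_def bimod_comp_def runit_inv_def base.tens_map_pure_id(2) [OF _ _ _ _ _ bims(2) incl_mor])

text \<open>The unit axiom makes b(n \<otimes> 1) the counit of n, so contracting with 1 applies the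
  counit to the negative factor, and this is \<open>lpart\<close> of the product.\<close>

lemma cR_idn:
  assumes x: "x \<in> Ob A" "y \<in> Ob A" and t: "t \<in> carrier (T x y)"
  shows "cR b x x y t (idn C x) = lpart x y (mlt x y t)"
proof (rule T_ext [OF x cR_linear [OF b_morphism x(1,1,2)] lpart_mlt_lin [OF x] _ t])
  fix z p n assume z: "z \<in> Ob A" "p \<in> pos C z y" "n \<in> neg C x z"
  show "cR b x x y (pure A P N x y z p n) (idn C x) = lpart x y (mlt x y (pure A P N x y z p n))"
    using x z by (cases "z = x") (simp_all add: cR_pure [OF b_morphism] b_idn ract_P lpart_Comp counit_diag)
qed (use x in simp)

text \<open>The map \<open>\<sigma> p = (id \<otimes> \<beta>)(d \<otimes> p)\<close> satisfies \<open>\<beta> = b (id \<otimes> \<sigma>)\<close>, so \<open>\<beta>\<close> is perfect once \<open>\<sigma>\<close> is bijective.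
  For \<open>e = L\<^sup>-\<^sup>1(1 \<otimes> 1)\<close> one gets \<open>L(p e) = \<sigma> p \<otimes> 1\<close>, while \<open>p e\<close> projects to \<open>p\<close>: this inverts \<open>\<sigma>\<close>.\<close>

lemma L_imp_perfect:
  assumes "L_is_isomorphism K A C b d"
  shows "perfect K A C"
proof -
  let ?\<beta> = "pairing A C"
  have bij: "bij_betw (L_map A C d x y) (carrier (Hom C x y)) (carrier (T x y))" if "x \<in> Ob A" "y \<in> Ob A" for x y
    using assms that by (simp add: L_is_isomorphism_iff)
  define \<sigma> where "\<sigma> x y p = cR ?\<beta> x y y (dd y) p" for x y p
  have \<sigma>_in [simp]: "\<sigma> x y p \<in> pos C x y" if "x \<in> Ob A" "y \<in> Ob A" "p \<in> pos C x y" for x y p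
    using that by (simp add: \<sigma>_def cR_in [OF pairing_mor])
  \<comment> \<open>This expresses \<open>\<sigma>\<close> through L, and is the way in which
    bijectivity of L reaches \<open>\<sigma>\<close>.\<close>
  have \<sigma>_lpart: "\<sigma> x y (lpart x y h) = lpart x y (mlt x y (L_map A C d x y h))"
    if "x \<in> Ob A" "y \<in> Ob A" "h \<in> carrier (Hom C x y)" for x y h
    using that by (simp add: \<sigma>_def L_eq lpart_mlt_tract)
  have \<sigma>_eq: "\<sigma> x y p = lpart x y (mlt x y (tract x y y (dd y) p))" if "x \<in> Ob A" "y \<in> Ob A" "p \<in> pos C x y" for x y p
    using \<sigma>_lpart [of x y p] that by (simp add: L_eq)
  have d_central: "tlact x x x (incl C x x a) (dd x) = tract x x x (dd x) (incl C x x a)"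
    if x: "x \<in> Ob A" and a: "a \<in> carrier (Hom A x x)" for x a
    using base.mor_lact [OF d_mor x x, of "idn A x" a] base.mor_ract [OF d_mor x x, of "idn A x" a] x a
    by (simp add: tlact_incl tract_incl base.Comp_idn_left base.Comp_idn_right)
  \<comment> \<open>Multiplication of a decreasing morphism by a diagonal one stays decreasing, so
    the projection in the action disappears and multiplying out commutes with it.\<close>
  have mlt_ract: "mlt x y (tract x x y t a) = Comp C x x y (mlt x y t) a"
    if x: "x \<in> Ob A" "y \<in> Ob A" and t: "t \<in> carrier (T x y)" and a: "a \<in> pos C x x" for x y t a
  proof (rule T_ext [OF x linear_map_compose [OF tract_linear mlt_linear] Comp_lin_left [OF _ _ _ _ mlt_linear] _ t])
    fix z p n assume z: "z \<in> Ob A" "p \<in> pos C z y" "n \<in> neg C x z"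
    have "Comp C x x z n a \<in> neg C x z" using x z a by (intro neg_Comp) auto
    then show "mlt x y (tract x x y (pure A P N x y z p n) a) = Comp C x x y (mlt x y (pure A P N x y z p n)) a"
      using x z a by (simp add: C_assoc)
  qed (use x a in auto)
  have \<sigma>: "base.mor P P \<sigma>"
  proof (rule base.morI)
    fix x y assume x: "x \<in> Ob A" "y \<in> Ob A"
    show "linear_map K (bhom P x y) (bhom P x y) (\<sigma> x y)"
      unfolding \<sigma>_def [abs_def] by (rule cR_linear_param [OF pairing_mor x(1,2,2)]) (use x in simp)
    fix p a assume p: "p \<in> carrier (bhom P x y)"
    then have p': "p \<in> pos C x y" by simp
    show "\<sigma> x y (lact P x y a p) = lact P x y a (\<sigma> x y p)" if a: "a \<in> carrier (Hom A y y)"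
    proof -
      have "\<sigma> x y (lact P x y a p) = lpart x y (mlt x y (tract x y y (dd y) (Comp C x y y (incl C y y a) p)))"
        using x p' a by (simp add: lact_P \<sigma>_eq)
      also have "\<dots> = lpart x y (mlt x y (tlact x y y (incl C y y a) (tract x y y (dd y) p)))"
        using x p' a by (simp add: tract_Comp d_central [symmetric] tlact_tract)
      also have "\<dots> = lact P x y a (\<sigma> x y p)"
        using x p' a by (simp add: lpart_mlt_tlact \<sigma>_eq lact_P)
      finally show ?thesis .
    qed
    show "\<sigma> x y (ract P x y p a) = ract P x y (\<sigma> x y p) a" if a: "a \<in> carrier (Hom A x x)"
    proof -
      have "\<sigma> x y (ract P x y p a) = lpart x y (mlt x y (tract x x y (tract x y y (dd y) p) (incl C x x a)))"
        using x p' a by (simp add: ract_P \<sigma>_eq tract_Comp)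
      then show ?thesis
        using x p' a by (simp add: mlt_ract lpart_Comp_diag \<sigma>_eq ract_P)
    qed
  qed auto
  have \<sigma>_bij: "bij_betw (\<sigma> x y) (pos C x y) (pos C x y)" if x: "x \<in> Ob A" "y \<in> Ob A" for x y
  proof -
    \<comment> \<open>The candidate inverse of \<open>\<sigma>\<close>: solve L h = q \<otimes> 1
      and project h.\<close>
    define s where "s q = lpart x y (the_inv_into (carrier (Hom C x y)) (L_map A C d x y) (pure A P N x y x q (idn C x)))" for q
    let ?inv = "\<lambda>q. the_inv_into (carrier (Hom C x y)) (L_map A C d x y) (pure A P N x y x q (idn C x))"
    have q_in: "pure A P N x y x q (idn C x) \<in> carrier (T x y)" if "q \<in> pos C x y" for q
      using that x by simp
    have inv_in: "?inv q \<in> carrier (Hom C x y)" and L_inv: "L_map A C d x y (?inv q) = pure A P N x y x q (idn C x)"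
      if "q \<in> pos C x y" for q
      using bij [OF x] q_in [OF that] f_the_inv_into_f [of "L_map A C d x y" "carrier (Hom C x y)"]
        the_inv_into_into [of "L_map A C d x y" "carrier (Hom C x y)" _ "carrier (Hom C x y)"]
      by (auto simp: bij_betw_def)
    have \<sigma>s: "\<sigma> x y (s q) = q" if "q \<in> pos C x y" for q
      using \<sigma>_lpart [OF x inv_in [OF that]] L_inv [OF that] that x by (simp add: s_def)
    obtain e where e: "e \<in> carrier (Hom C x x)" and Le: "L_map A C d x x e = pure A P N x x x (idn C x) (idn C x)"
    proof -
      have "pure A P N x x x (idn C x) (idn C x) \<in> L_map A C d x x ` carrier (Hom C x x)"
        using bij [OF x(1,1)] x by (simp add: bij_betw_def)
      then show thesis using that by (auto simp: image_iff)
    qed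
    \<comment> \<open>The triangle identity of \<open>d\<close> at 1, where by \<open>cR_idn\<close>
      the contraction with \<open>b\<close> is a projection of the product.\<close>
    have dd_top: "lpart x x (mlt x x (dd x)) = idn C x"
      using cR_idn [OF x(1,1) dd_in [OF x(1)]] d_at x by (simp add: copairing_at_def)
    have "\<sigma> x x (lpart x x e) = idn C x"
      using \<sigma>_lpart [OF x(1,1) e] Le x by simp
    \<comment> \<open>Diagonal elements are fixed by \<open>\<sigma>\<close>, because
      \<open>dd x\<close> multiplies out to 1 up to terms that the projection kills.\<close>
    moreover have "\<sigma> x x (lpart x x e) = lpart x x e"
      using \<sigma>_eq [OF x(1,1), of "lpart x x e"] x e dd_top by (simp add: mlt_ract lpart_Comp_diag)
    ultimately have e1: "lpart x x e = idn C x" by simp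
    have s\<sigma>: "s (\<sigma> x y p) = p" if p: "p \<in> pos C x y" for p
    proof -
      have pe: "Comp C x x y p e \<in> carrier (Hom C x y)" using x p e by simp
      \<comment> \<open>Functoriality writes L(p e) as L(p) composed with 1 \<otimes> 1, and this
        composition contracts the negative factor of L(p) with 1.\<close>
      have "L_map A C d x y (Comp C x x y p e) = pure A P N x y x (cR b x x y (L_map A C d x y p) (idn C x)) (idn C x)"
        using x p e Le by (simp add: L_Comp sandw_pure_right [OF b_morphism])
      also have "cR b x x y (L_map A C d x y p) (idn C x) = \<sigma> x y p"
        using \<sigma>_lpart [OF x, of p] x p by (simp add: cR_idn)
      finally have "?inv (\<sigma> x y p) = Comp C x x y p e"
        using the_inv_into_f_f [of "L_map A C d x y" "carrier (Hom C x y)", OF _ pe] bij [OF x] by (simp add: bij_betw_def)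
      then show ?thesis
        using x p e e1 by (simp add: s_def lpart_pos_Comp)
    qed
    show ?thesis
      by (rule bij_betwI [where g = s]) (use x inv_in \<sigma>s s\<sigma> in \<open>auto simp: s_def\<close>)
  qed
  define \<tau> where "\<tau> x y = the_inv_into (pos C x y) (\<sigma> x y)" for x y
  have \<tau>: "base.mor P P \<tau>"
    using base.mor_inv [OF \<sigma>] \<sigma>_bij unfolding \<tau>_def by simp
  have \<tau>_in [simp]: "\<tau> x y p \<in> pos C x y" if "x \<in> Ob A" "y \<in> Ob A" "p \<in> pos C x y" for x y p
    using base.mor_in [OF \<tau> that(1,2), of p] that by simp
  have \<sigma>\<tau>: "\<sigma> x y (\<tau> x y p) = p" if "x \<in> Ob A" "y \<in> Ob A" "p \<in> pos C x y" for x y p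
    using \<sigma>_bij [OF that(1,2)] f_the_inv_into_f [of "\<sigma> x y" "pos C x y" p] that by (simp add: bij_betw_def \<tau>_def)
  have \<tau>\<sigma>: "\<tau> x y (\<sigma> x y p) = p" if "x \<in> Ob A" "y \<in> Ob A" "p \<in> pos C x y" for x y p
    using \<sigma>_bij [OF that(1,2)] the_inv_into_f_f [of "\<sigma> x y" "pos C x y" p] that by (simp add: bij_betw_def \<tau>_def)
  \<comment> \<open>For t = q \<otimes> m both sides are the product b(n \<otimes> q) \<beta>(m
    \<otimes> p), or zero. For t = d the contraction of n is n itself and that of p is
    \<open>\<sigma>\<close> applied to p.\<close>
  have adj: "b y y (pure A N P y y x n (cR ?\<beta> y x x t p)) = ?\<beta> y y (pure A N P y y x (cL b x x y n t) p)"
    if x: "x \<in> Ob A" "y \<in> Ob A" and n: "n \<in> neg C x y" and p: "p \<in> pos C y x" and t: "t \<in> carrier (T x x)" for x y n p t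
  proof (rule T_ext [OF x(1,1) _ _ _ t])
    show "linear_map K (T x x) (Hom A y y) (\<lambda>t. b y y (pure A N P y y x n (cR ?\<beta> y x x t p)))"
      by (rule beta_lin [OF b_morphism x(2,2) base.pure_linear_right [OF bims(2,1) x(2,2,1) _ cR_linear [OF pairing_mor x(2,1,1) p]]])
         (use n in simp)
    show "linear_map K (T x x) (Hom A y y) (\<lambda>t. ?\<beta> y y (pure A N P y y x (cL b x x y n t) p))"
      by (rule beta_lin [OF pairing_mor x(2,2) base.pure_linear_left [OF bims(2,1) x(2,2,1) _ cL_linear [OF b_morphism x(1,1,2) n]]])
         (use p in simp)
    fix z q m assume z: "z \<in> Ob A" "q \<in> pos C z x" "m \<in> neg C x z"
    show "b y y (pure A N P y y x n (cR ?\<beta> y x x (pure A P N x x z q m) p))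
        = ?\<beta> y y (pure A N P y y x (cL b x x y n (pure A P N x x z q m)) p)"
    proof (cases "z = y")
      case True
      then show ?thesis
        using x n p z beta_in [OF pairing_mor] beta_in [OF b_morphism]
        by (simp add: cR_pure [OF pairing_mor] cL_pure [OF b_morphism] beta_ract [OF b_morphism] beta_lact [OF pairing_mor])
    next
      case False
      have "b y y \<zero>\<^bsub>NP y y\<^esub> = \<zero>\<^bsub>Hom A y y\<^esub>" "?\<beta> y y \<zero>\<^bsub>NP y y\<^esub> = \<zero>\<^bsub>Hom A y y\<^esub>"
        using linear_map_zero [OF _ _ base.mor_linear [OF b_morphism x(2,2)]]
          linear_map_zero [OF _ _ base.mor_linear [OF pairing_mor x(2,2)]] x by simp_all
      then show ?thesis
        using False x n p z base.pure_zero_right [of N P y y x n] base.pure_zero_left [of N P y y x p]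
        by (simp add: cR_pure [OF pairing_mor] cL_pure [OF b_morphism])
    qed
  qed
  have b_\<sigma>: "?\<beta> y y (pure A N P y y x n p) = b y y (pure A N P y y x n (\<sigma> y x p))"
    if x: "x \<in> Ob A" "y \<in> Ob A" and n: "n \<in> neg C x y" and p: "p \<in> pos C y x" for x y n p
    using adj [OF x n p dd_in [OF x(1)]] d_at x n by (simp add: copairing_at_def \<sigma>_def)
  \<comment> \<open>Twisting the positive factor of \<open>d\<close> by the inverse of
    \<open>\<sigma>\<close> turns the copairing of \<open>b\<close> into one for the pairing of
    C.\<close>
  let ?m = "tens_map A P N P N \<tau> bimod_id"
  note ml = base.tens_map_linear [OF \<tau> base.mor_id [OF bims(2)]]
  note mp = base.tens_map_pure_id(1) [OF _ _ _ _ _ \<tau> bims(2)]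
  have cL_m: "cL ?\<beta> x x y n (?m x x t) = cL b x x y n t"
    if x: "x \<in> Ob A" "y \<in> Ob A" and n: "n \<in> neg C x y" and t: "t \<in> carrier (T x x)" for x y n t
  proof (rule T_ext [OF x(1,1) linear_map_compose [OF ml [OF x(1,1)] cL_linear [OF pairing_mor x(1,1,2) n]]
        cL_linear [OF b_morphism x(1,1,2) n] _ t])
    fix z p n' assume z: "z \<in> Ob A" "p \<in> pos C z x" "n' \<in> neg C x z"
    show "cL ?\<beta> x x y n (?m x x (pure A P N x x z p n')) = cL b x x y n (pure A P N x x z p n')"
      using x n z by (cases "z = y") (simp_all add: mp cL_pure [OF pairing_mor] cL_pure [OF b_morphism] b_\<sigma> \<sigma>\<tau>)
  qed
  \<comment> \<open>The contraction multiplies the positive factor of t by a right scalar, which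
    \<open>\<tau>\<close> respects, so \<open>\<tau>\<close> comes out; at t = d it cancels
    \<open>\<sigma>\<close>.\<close>
  have cR_m: "cR ?\<beta> x y y (?m y y t) p = \<tau> x y (cR ?\<beta> x y y t p)"
    if x: "x \<in> Ob A" "y \<in> Ob A" and p: "p \<in> pos C x y" and t: "t \<in> carrier (T y y)" for x y p t
  proof (rule T_ext [OF x(2,2) linear_map_compose [OF ml [OF x(2,2)] cR_linear [OF pairing_mor x(1,2,2) p]]
        linear_map_compose [OF cR_linear [OF pairing_mor x(1,2,2) p] base.mor_linear [OF \<tau> x]] _ t])
    fix z p' n assume z: "z \<in> Ob A" "p' \<in> pos C z y" "n \<in> neg C y z"
    show "cR ?\<beta> x y y (?m y y (pure A P N y y z p' n)) p = \<tau> x y (cR ?\<beta> x y y (pure A P N y y z p' n) p)"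
      using x p z base.mor_ract [OF \<tau> x] beta_in [OF pairing_mor] linear_map_zero [OF _ _ base.mor_linear [OF \<tau> x]]
      by (cases "z = x") (simp_all add: mp cR_pure [OF pairing_mor])
  qed
  show ?thesis
  proof (rule perfectI)
    show "base.mor U (tens A P N) (?m \<bullet> d)"
      by (rule base.mor_comp [OF d_mor base.tens_map_mor [OF \<tau> base.mor_id]]) simp
    fix x y assume x: "x \<in> Ob A" "y \<in> Ob A"
    show "cL ?\<beta> x x y n ((?m \<bullet> d) x x (idn A x)) = n" if "n \<in> neg C x y" for n
      using that x d_at by (simp add: bimod_comp_def cL_m copairing_at_def)
    show "cR ?\<beta> x y y ((?m \<bullet> d) y y (idn A y)) p = p" if "p \<in> pos C x y" for p
      using that x \<tau>\<sigma> [OF x that] by (simp add: bimod_comp_def cR_m \<sigma>_def)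
  qed
qed

lemma L_iff_perfect: "L_is_isomorphism K A C b d \<longleftrightarrow> perfect K A C"
  using L_imp_perfect perfect_imp_L by blast

end

theorem theorem1:
  fixes K :: "'k ring" and A :: "('o, 'k, 'a) basecat" and C :: "('o, 'k, 'a, 'c) stratcat"
  assumes "cring K" and "base_category K A" and "stratified_category K A C"
  shows "(perfect K A C \<longleftrightarrow> gives_morita_equivalence K A C) \<and>
    (\<forall>b d. quasi_cellular_category K A C b d \<longrightarrow>
       (perfect K A C \<and> gives_morita_equivalence K A C \<longrightarrow> L_is_isomorphism K A C b d) \<and>
       (admits_action K A C b \<longrightarrow>
          (L_is_isomorphism K A C b d \<longleftrightarrow> perfect K A C) \<and>
          (L_is_isomorphism K A C b d \<longleftrightarrow> gives_morita_equivalence K A C)))"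
  using stratified_category.perfect_iff_morita [OF assms(3)] quasi_cellular_category.L_iff_perfect
  by blast

end
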